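(* Let $k$ be a commutative artinian ring and let $\mathcal{C}$ be a skeletally small $k$-linear exact category which is Hom-finite and Krull-Schmidt. With $\tau\colon\underline{\mathcal{C}_r}\to\overline{\mathcal{C}_l}$, $\tau^-\colon\overline{\mathcal{C}_l}\to\underline{\mathcal{C}_r}$, and the natural transformations $\underline{\epsilon}\colon\tau^-\tau\to\operatorname{Id}_{\underline{\mathcal{C}_r}}$ and $\overline{\eta}\colon\operatorname{Id}_{\overline{\mathcal{C}_l}}\to\tau\tau^-$ as defined in the context, both $\underline{\epsilon}$ and $\overline{\eta}$ are isomorphisms. Hence the functors $\tau$ and $\tau^-$ are quasi-inverse to each other (mutually quasi-inverse equivalences between $\underline{\mathcal{C}_r}$ and $\overline{\mathcal{C}_l}$).
   Context: $k$ is a commutative artinian ring, $\check{k}$ is the minimal injective cogenerator of $k$-modules, $D=\operatorname{Hom}_k(-,\check{k})$ is the Matlis duality, and $k$-mod is the category of finitely generated $k$-modules. An exact category is an additive category $\mathcal{C}$ with a class $\mathcal{E}$ of kernel-cokernel pairs (called conflations) satisfying the Quillen/Keller axioms. $\operatorname{Ext}^1_{\mathcal{E}}(X,Y)$ is the $k$-module of equivalence classes of conflations $Y\to E\to X$; it is functorial via pullback in $X$ and pushout in $Y$. Hom-finite means all Hom $k$-modules are finitely generated. A morphism $f$ is projectively trivial if $\operatorname{Ext}^1_{\mathcal{E}}(f,Z)=0$ for every object $Z$, and injectively trivial if $\operatorname{Ext}^1_{\mathcal{E}}(Z,f)=0$ for every object $Z$. These form ideals $\mathcal{P}$ and $\mathcal{I}$;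 put $\underline{\mathcal{C}}=\mathcal{C}/\mathcal{P}$ and $\overline{\mathcal{C}}=\mathcal{C}/\mathcal{I}$, with Hom modules $\underline{\operatorname{Hom}}_{\mathcal{C}}$ and $\overline{\operatorname{Hom}}_{\mathcal{C}}$, and write $\underline{f}$, $\overline{f}$ for the images of a morphism $f$. Then $\operatorname{Ext}^1_{\mathcal{E}}(-,Z)$ is a contravariant functor on $\underline{\mathcal{C}}$ and $\operatorname{Ext}^1_{\mathcal{E}}(Z,-)$ a covariant functor on $\overline{\mathcal{C}}$. $\mathcal{C}_r$ is the full subcategory of those $X\in\mathcal{C}$ for which $D\operatorname{Ext}^1_{\mathcal{E}}(X,-)\colon\overline{\mathcal{C}}\to k$-mod is representable (isomorphic to $\overline{\operatorname{Hom}}_{\mathcal{C}}(-,X')$ for some $X'$), and $\mathcal{C}_l$ the full subcategory of those $X$ for which $D\operatorname{Ext}^1_{\mathcal{E}}(-,X)\colon\underline{\mathcal{C}}\to k$-mod is representable (isomorphic to $\underline{\operatorname{Hom}}_{\mathcal{C}}(X',-)$ for some $X'$). $\underline{\mathcal{C}_r}$ is the image of $\mathcal{C}_r$ in $\underline{\mathcal{C}}$ and $\overline{\mathcal{C}_l}$ is the image of $\mathcal{C}_l$ in $\overline{\mathcal{C}}$ (full subcategories). For each $Y\in\mathcal{C}_r$ fix an object $\tau Y$ and an isomorphism of functors $\phi_Y\colon\overline{\operatorname{Hom}}_{\mathcal{C}}(-,\tau Y)\to D\operatorname{Ext}^1_{\mathcal{E}}(Y,-)$, with components $\phi_{Y,M}$.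 For each $X\in\mathcal{C}_l$ fix an object $\tau^-X$ and an isomorphism of functors $\psi_X\colon\underline{\operatorname{Hom}}_{\mathcal{C}}(\tau^-X,-)\to D\operatorname{Ext}^1_{\mathcal{E}}(-,X)$, with components $\psi_{X,M}$. It is known that $\tau Y\in\mathcal{C}_l$ for $Y\in\mathcal{C}_r$ and $\tau^-X\in\mathcal{C}_r$ for $X\in\mathcal{C}_l$. By Yoneda's lemma $\tau$ becomes a functor $\underline{\mathcal{C}_r}\to\overline{\mathcal{C}_l}$: for $\underline{f}\colon Y\to Y'$, $\tau(\underline{f})$ is the unique morphism $\tau Y\to\tau Y'$ in $\overline{\mathcal{C}_l}$ with $\phi_{Y'}\circ\overline{\operatorname{Hom}}_{\mathcal{C}}(-,\tau(\underline{f}))=D\operatorname{Ext}^1_{\mathcal{E}}(f,-)\circ\phi_Y$. Similarly $\tau^-\colon\overline{\mathcal{C}_l}\to\underline{\mathcal{C}_r}$: for $\overline{g}\colon X\to X'$, $\tau^-(\overline{g})\colon\tau^-X\to\tau^-X'$ is the unique morphism with $\psi_X\circ\underline{\operatorname{Hom}}_{\mathcal{C}}(\tau^-(\overline{g}),-)=D\operatorname{Ext}^1_{\mathcal{E}}(-,g)\circ\psi_{X'}$. For $Y\in\underline{\mathcal{C}_r}$ set $\underline{\epsilon_Y}=(\psi_{\tau Y,Y}^{-1}\circ\phi_{Y,\tau Y})(\overline{\operatorname{Id}_{\tau Y}})\colon\tau^-\tau Y\to Y$ in $\underline{\mathcal{C}_r}$. For $X\in\overline{\mathcal{C}_l}$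 set $\overline{\eta_X}=(\phi_{\tau^-X,X}^{-1}\circ\psi_{X,\tau^-X})(\underline{\operatorname{Id}_{\tau^-X}})\colon X\to\tau\tau^-X$ in $\overline{\mathcal{C}_l}$. These are the components of natural transformations $\underline{\epsilon}\colon\tau^-\tau\to\operatorname{Id}_{\underline{\mathcal{C}_r}}$ and $\overline{\eta}\colon\operatorname{Id}_{\overline{\mathcal{C}_l}}\to\tau\tau^-$. *)

theory Defs
  imports "HOL-Algebra.Module" "HOL-Algebra.Ideal" "HOL-Library.FuncSet"
begin

section \<open>Rings and modules\<close>

definition artinian_ring :: "'r ring \<Rightarrow> bool" where
  "artinian_ring k \<longleftrightarrow> cring k \<and>
     (\<forall>I :: nat \<Rightarrow> 'r set. (\<forall>n. ideal (I n) k) \<and> (\<forall>n. I (Suc n) \<subseteq> I n)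
        \<longrightarrow> (\<exists>n. \<forall>m\<ge>n. I m = I n))"

definition local_ring :: "('m, 'z) ring_scheme \<Rightarrow> bool" where
  "local_ring R \<longleftrightarrow> ring R \<and> \<one>\<^bsub>R\<^esub> \<noteq> \<zero>\<^bsub>R\<^esub> \<and>
     (\<forall>a\<in>carrier R. \<forall>b\<in>carrier R. a \<notin> Units R \<and> b \<notin> Units R \<longrightarrow> a \<oplus>\<^bsub>R\<^esub> b \<notin> Units R)"

definition linear_map :: "'r ring \<Rightarrow> ('r, 'a) module \<Rightarrow> ('r, 'b) module \<Rightarrow> ('a \<Rightarrow> 'b) \<Rightarrow> bool" where
  "linear_map k M N f \<longleftrightarrow> f \<in> carrier M \<rightarrow> carrier N \<and>
     (\<forall>x\<in>carrier M. \<forall>y\<in>carrier M. f (x \<oplus>\<^bsub>M\<^esub> y) = f x \<oplus>\<^bsub>N\<^esub> f y) \<and>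
     (\<forall>a\<in>carrier k. \<forall>x\<in>carrier M. f (a \<odot>\<^bsub>M\<^esub> x) = a \<odot>\<^bsub>N\<^esub> f x)"

definition linear_iso :: "'r ring \<Rightarrow> ('r, 'a) module \<Rightarrow> ('r, 'b) module \<Rightarrow> ('a \<Rightarrow> 'b) \<Rightarrow> bool" where
  "linear_iso k M N f \<longleftrightarrow> linear_map k M N f \<and> bij_betw f (carrier M) (carrier N)"

definition finitely_generated :: "'r ring \<Rightarrow> ('r, 'a) module \<Rightarrow> bool" where
  "finitely_generated k M \<longleftrightarrow>
     (\<exists>S. finite S \<and> S \<subseteq> carrier M \<and> (\<forall>N. submodule N k M \<and> S \<subseteq> N \<longrightarrow> N = carrier M))"

text \<open>The fields \<open>mult\<close> and \<open>one\<close> inherited by the record of modules from rings carry no meaning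
  for modules; they are left undefined in the modules constructed below.\<close>

definition quot_module :: "('r, 'a) module \<Rightarrow> 'a set \<Rightarrow> ('r, 'a set) module" where
  "quot_module M N =
     \<lparr>carrier = a_rcosets\<^bsub>M\<^esub> N, mult = undefined, one = undefined,
      zero = N, add = (<+>\<^bsub>M\<^esub>), smult = (\<lambda>a U. \<Union>u\<in>U. N +>\<^bsub>M\<^esub> (a \<odot>\<^bsub>M\<^esub> u))\<rparr>"

text \<open>A definition in HOL cannot quantify over types, so the test modules in the next two
  definitions have to live on a fixed type. Cosets in the module of sequences over \<open>k\<close> have the type
  chosen here, so that every countably generated \<open>k\<close>-module, in particular every
  cyclic one, and every ideal of \<open>k\<close> is isomorphic to a module on this type. By Baer's criterion injectivity with
  respect to these test modules gives the lifting property for modules on all types; since cyclic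
  modules are among them, an injective module separating the points of the test modules separates
  the points of all modules.\<close>

type_synonym 'r test_module = "('r, (nat \<Rightarrow> 'r) set) module"

definition injective_module :: "'r ring \<Rightarrow> ('r, 'q) module \<Rightarrow> bool" where
  "injective_module k Q \<longleftrightarrow> module k Q \<and>
     (\<forall>(A :: 'r test_module) (B :: 'r test_module) f g.
        module k A \<and> module k B \<and> linear_map k A B f \<and> inj_on f (carrier A) \<and> linear_map k A Q g
        \<longrightarrow> (\<exists>h. linear_map k B Q h \<and> (\<forall>x\<in>carrier A. h (f x) = g x)))"

definition cogenerator :: "'r ring \<Rightarrow> ('r, 'q) module \<Rightarrow> bool" where
  "cogenerator k Q \<longleftrightarrow> module k Q \<and>
     (\<forall>A :: 'r test_module. module k A \<longrightarrow>
        (\<forall>x\<in>carrier A. x \<noteq> \<zero>\<^bsub>A\<^esub> \<longrightarrow> (\<exists>f. linear_map k A Q f \<and> f x \<noteq> \<zero>\<^bsub>Q\<^esub>)))"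

definition minimal_injective_cogenerator :: "'r ring \<Rightarrow> ('r, 'q) module \<Rightarrow> bool" where
  "minimal_injective_cogenerator k Q \<longleftrightarrow> injective_module k Q \<and> cogenerator k Q \<and>
     (\<forall>N. submodule N k Q \<and> injective_module k (Q\<lparr>carrier := N\<rparr>)
            \<and> cogenerator k (Q\<lparr>carrier := N\<rparr>) \<longrightarrow> N = carrier Q)"

text \<open>The Matlis dual \<open>D M\<close>; linear forms are restricted to the carrier (extensional), so that
  equality of elements of \<open>D M\<close> is equality in HOL.\<close>

definition dual :: "'r ring \<Rightarrow> ('r, 'q) module \<Rightarrow> ('r, 'a) module \<Rightarrow> ('r, 'a \<Rightarrow> 'q) module" where
  "dual k Q M =
     \<lparr>carrier = {\<theta> \<in> extensional (carrier M). linear_map k M Q \<theta>},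
      mult = undefined, one = undefined,
      zero = (\<lambda>x\<in>carrier M. \<zero>\<^bsub>Q\<^esub>),
      add = (\<lambda>\<theta> \<kappa>. \<lambda>x\<in>carrier M. \<theta> x \<oplus>\<^bsub>Q\<^esub> \<kappa> x),
      smult = (\<lambda>a \<theta>. \<lambda>x\<in>carrier M. a \<odot>\<^bsub>Q\<^esub> \<theta> x)\<rparr>"

text \<open>\<open>dual_map M f\<close> is \<open>D f\<close>, for \<open>f\<close> with source \<open>M\<close>.\<close>

definition dual_map :: "('r, 'a) module \<Rightarrow> ('a \<Rightarrow> 'b) \<Rightarrow> ('b \<Rightarrow> 'q) \<Rightarrow> 'a \<Rightarrow> 'q" where
  "dual_map M f \<theta> = (\<lambda>x\<in>carrier M. \<theta> (f x))"


section \<open>Linear categories\<close>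

text \<open>Composition takes no objects as arguments because Hom modules belonging to different pairs of
  objects are required to be disjoint. Only the values of \<open>Hom\<close> and \<open>Idt\<close> at objects matter.\<close>

record ('r, 'o, 'm) lcat =
  Obj :: "'o set"
  Hom :: "'o \<Rightarrow> 'o \<Rightarrow> ('r, 'm) module"
  Comp :: "'m \<Rightarrow> 'm \<Rightarrow> 'm"  (infixl "\<cdot>\<index>" 75)
  Idt :: "'o \<Rightarrow> 'm"

abbreviation Mor :: "('r, 'o, 'm) lcat \<Rightarrow> 'o \<Rightarrow> 'o \<Rightarrow> 'm set" where
  "Mor C X Y \<equiv> carrier (Hom C X Y)"

definition linear_category :: "'r ring \<Rightarrow> ('r, 'o, 'm) lcat \<Rightarrow> bool" where
  "linear_category k C \<longleftrightarrow>
     (\<forall>X\<in>Obj C. \<forall>Y\<in>Obj C. module k (Hom C X Y)) \<and>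
     (\<forall>X\<in>Obj C. \<forall>Y\<in>Obj C. \<forall>X'\<in>Obj C. \<forall>Y'\<in>Obj C.
        Mor C X Y \<inter> Mor C X' Y' \<noteq> {} \<longrightarrow> X = X' \<and> Y = Y') \<and>
     (\<forall>X\<in>Obj C. Idt C X \<in> Mor C X X) \<and>
     (\<forall>X\<in>Obj C. \<forall>Y\<in>Obj C. \<forall>f\<in>Mor C X Y.
        f \<cdot>\<^bsub>C\<^esub> Idt C X = f \<and> Idt C Y \<cdot>\<^bsub>C\<^esub> f = f) \<and>
     (\<forall>W\<in>Obj C. \<forall>X\<in>Obj C. \<forall>Y\<in>Obj C. \<forall>Z\<in>Obj C.
        \<forall>f\<in>Mor C W X. \<forall>g\<in>Mor C X Y. \<forall>h\<in>Mor C Y Z.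
        h \<cdot>\<^bsub>C\<^esub> (g \<cdot>\<^bsub>C\<^esub> f) = (h \<cdot>\<^bsub>C\<^esub> g) \<cdot>\<^bsub>C\<^esub> f) \<and>
     (\<forall>X\<in>Obj C. \<forall>Y\<in>Obj C. \<forall>Z\<in>Obj C.
        (\<forall>g\<in>Mor C Y Z. linear_map k (Hom C X Y) (Hom C X Z) (\<lambda>f. g \<cdot>\<^bsub>C\<^esub> f)) \<and>
        (\<forall>f\<in>Mor C X Y. linear_map k (Hom C Y Z) (Hom C X Z) (\<lambda>g. g \<cdot>\<^bsub>C\<^esub> f)))"

definition is_iso :: "('r, 'o, 'm) lcat \<Rightarrow> 'o \<Rightarrow> 'o \<Rightarrow> 'm \<Rightarrow> bool" where
  "is_iso C X Y f \<longleftrightarrow> f \<in> Mor C X Y \<and>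
     (\<exists>g\<in>Mor C Y X. g \<cdot>\<^bsub>C\<^esub> f = Idt C X \<and> f \<cdot>\<^bsub>C\<^esub> g = Idt C Y)"

definition zero_object :: "('r, 'o, 'm) lcat \<Rightarrow> 'o \<Rightarrow> bool" where
  "zero_object C Z \<longleftrightarrow> Z \<in> Obj C \<and>
     (\<forall>X\<in>Obj C. (\<exists>!f. f \<in> Mor C Z X) \<and> (\<exists>!f. f \<in> Mor C X Z))"

record ('o, 'm) biprod =
  Bob :: 'o
  in1 :: 'm
  in2 :: 'm
  pr1 :: 'm
  pr2 :: 'm

definition is_biprod :: "('r, 'o, 'm) lcat \<Rightarrow> 'o \<Rightarrow> 'o \<Rightarrow> ('o, 'm) biprod \<Rightarrow> bool" where
  "is_biprod C A B S \<longleftrightarrow> Bob S \<in> Obj C \<and>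
     in1 S \<in> Mor C A (Bob S) \<and> in2 S \<in> Mor C B (Bob S) \<and>
     pr1 S \<in> Mor C (Bob S) A \<and> pr2 S \<in> Mor C (Bob S) B \<and>
     pr1 S \<cdot>\<^bsub>C\<^esub> in1 S = Idt C A \<and> pr2 S \<cdot>\<^bsub>C\<^esub> in2 S = Idt C B \<and>
     pr1 S \<cdot>\<^bsub>C\<^esub> in2 S = \<zero>\<^bsub>Hom C B A\<^esub> \<and> pr2 S \<cdot>\<^bsub>C\<^esub> in1 S = \<zero>\<^bsub>Hom C A B\<^esub> \<and>
     (in1 S \<cdot>\<^bsub>C\<^esub> pr1 S) \<oplus>\<^bsub>Hom C (Bob S) (Bob S)\<^esub> (in2 S \<cdot>\<^bsub>C\<^esub> pr2 S) = Idt C (Bob S)"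

text \<open>\<open>biprod_map C S T f g\<close> is the morphism \<open>f \<oplus> g\<close> from the biproduct \<open>S\<close> to the biproduct \<open>T\<close>.\<close>

definition biprod_map ::
    "('r, 'o, 'm) lcat \<Rightarrow> ('o, 'm) biprod \<Rightarrow> ('o, 'm) biprod \<Rightarrow> 'm \<Rightarrow> 'm \<Rightarrow> 'm" where
  "biprod_map C S T f g =
     (in1 T \<cdot>\<^bsub>C\<^esub> f \<cdot>\<^bsub>C\<^esub> pr1 S) \<oplus>\<^bsub>Hom C (Bob S) (Bob T)\<^esub> (in2 T \<cdot>\<^bsub>C\<^esub> g \<cdot>\<^bsub>C\<^esub> pr2 S)"

definition additive_category :: "'r ring \<Rightarrow> ('r, 'o, 'm) lcat \<Rightarrow> bool" where
  "additive_category k C \<longleftrightarrow> linear_category k C \<and>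
     (\<exists>Z. zero_object C Z) \<and> (\<forall>A\<in>Obj C. \<forall>B\<in>Obj C. \<exists>S. is_biprod C A B S)"

definition hom_finite :: "'r ring \<Rightarrow> ('r, 'o, 'm) lcat \<Rightarrow> bool" where
  "hom_finite k C \<longleftrightarrow> (\<forall>X\<in>Obj C. \<forall>Y\<in>Obj C. finitely_generated k (Hom C X Y))"

definition End_ring :: "('r, 'o, 'm) lcat \<Rightarrow> 'o \<Rightarrow> ('r, 'm) module" where
  "End_ring C X = (Hom C X X)\<lparr>mult := Comp C, one := Idt C X\<rparr>"

definition is_direct_sum ::
    "('r, 'o, 'm) lcat \<Rightarrow> 'o \<Rightarrow> nat \<Rightarrow> (nat \<Rightarrow> 'o) \<Rightarrow> (nat \<Rightarrow> 'm) \<Rightarrow> (nat \<Rightarrow> 'm) \<Rightarrow> bool" where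
  "is_direct_sum C X n Xs s p \<longleftrightarrow>
     (\<forall>i<n. Xs i \<in> Obj C \<and> s i \<in> Mor C (Xs i) X \<and> p i \<in> Mor C X (Xs i)) \<and>
     (\<forall>i<n. \<forall>j<n. p i \<cdot>\<^bsub>C\<^esub> s j = (if i = j then Idt C (Xs i) else \<zero>\<^bsub>Hom C (Xs j) (Xs i)\<^esub>)) \<and>
     finsum (Hom C X X) (\<lambda>i. s i \<cdot>\<^bsub>C\<^esub> p i) {..<n} = Idt C X"

definition krull_schmidt :: "('r, 'o, 'm) lcat \<Rightarrow> bool" where
  "krull_schmidt C \<longleftrightarrow>
     (\<forall>X\<in>Obj C. \<exists>n Xs s p. is_direct_sum C X n Xs s p \<and> (\<forall>i<n. local_ring (End_ring C (Xs i))))"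


section \<open>Exact categories\<close>

definition is_kernel :: "('r, 'o, 'm) lcat \<Rightarrow> 'o \<Rightarrow> 'o \<Rightarrow> 'o \<Rightarrow> 'm \<Rightarrow> 'm \<Rightarrow> bool" where
  "is_kernel C A B X i p \<longleftrightarrow> i \<in> Mor C A B \<and> p \<in> Mor C B X \<and> p \<cdot>\<^bsub>C\<^esub> i = \<zero>\<^bsub>Hom C A X\<^esub> \<and>
     (\<forall>T\<in>Obj C. \<forall>f\<in>Mor C T B. p \<cdot>\<^bsub>C\<^esub> f = \<zero>\<^bsub>Hom C T X\<^esub> \<longrightarrow> (\<exists>!g. g \<in> Mor C T A \<and> i \<cdot>\<^bsub>C\<^esub> g = f))"

definition is_cokernel :: "('r, 'o, 'm) lcat \<Rightarrow> 'o \<Rightarrow> 'o \<Rightarrow> 'o \<Rightarrow> 'm \<Rightarrow> 'm \<Rightarrow> bool" where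
  "is_cokernel C A B X i p \<longleftrightarrow> i \<in> Mor C A B \<and> p \<in> Mor C B X \<and> p \<cdot>\<^bsub>C\<^esub> i = \<zero>\<^bsub>Hom C A X\<^esub> \<and>
     (\<forall>T\<in>Obj C. \<forall>f\<in>Mor C B T. f \<cdot>\<^bsub>C\<^esub> i = \<zero>\<^bsub>Hom C A T\<^esub> \<longrightarrow> (\<exists>!g. g \<in> Mor C X T \<and> g \<cdot>\<^bsub>C\<^esub> p = f))"

text \<open>The square with \<open>p : P \<rightarrow> A\<close>, \<open>q : P \<rightarrow> B\<close>, \<open>f : A \<rightarrow> X\<close>, \<open>g : B \<rightarrow> X\<close>.\<close>

definition is_pullback ::
    "('r, 'o, 'm) lcat \<Rightarrow> 'o \<Rightarrow> 'o \<Rightarrow> 'o \<Rightarrow> 'o \<Rightarrow> 'm \<Rightarrow> 'm \<Rightarrow> 'm \<Rightarrow> 'm \<Rightarrow> bool" where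
  "is_pullback C P A B X p q f g \<longleftrightarrow>
     p \<in> Mor C P A \<and> q \<in> Mor C P B \<and> f \<in> Mor C A X \<and> g \<in> Mor C B X \<and> f \<cdot>\<^bsub>C\<^esub> p = g \<cdot>\<^bsub>C\<^esub> q \<and>
     (\<forall>T\<in>Obj C. \<forall>a\<in>Mor C T A. \<forall>b\<in>Mor C T B. f \<cdot>\<^bsub>C\<^esub> a = g \<cdot>\<^bsub>C\<^esub> b \<longrightarrow>
        (\<exists>!u. u \<in> Mor C T P \<and> p \<cdot>\<^bsub>C\<^esub> u = a \<and> q \<cdot>\<^bsub>C\<^esub> u = b))"

text \<open>The square with \<open>f : X \<rightarrow> A\<close>, \<open>g : X \<rightarrow> B\<close>, \<open>i : A \<rightarrow> P\<close>, \<open>j : B \<rightarrow> P\<close>.\<close>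

definition is_pushout ::
    "('r, 'o, 'm) lcat \<Rightarrow> 'o \<Rightarrow> 'o \<Rightarrow> 'o \<Rightarrow> 'o \<Rightarrow> 'm \<Rightarrow> 'm \<Rightarrow> 'm \<Rightarrow> 'm \<Rightarrow> bool" where
  "is_pushout C X A B P f g i j \<longleftrightarrow>
     f \<in> Mor C X A \<and> g \<in> Mor C X B \<and> i \<in> Mor C A P \<and> j \<in> Mor C B P \<and> i \<cdot>\<^bsub>C\<^esub> f = j \<cdot>\<^bsub>C\<^esub> g \<and>
     (\<forall>T\<in>Obj C. \<forall>a\<in>Mor C A T. \<forall>b\<in>Mor C B T. a \<cdot>\<^bsub>C\<^esub> f = b \<cdot>\<^bsub>C\<^esub> g \<longrightarrow>
        (\<exists>!u. u \<in> Mor C P T \<and> u \<cdot>\<^bsub>C\<^esub> i = a \<and> u \<cdot>\<^bsub>C\<^esub> j = b))"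

text \<open>The exact structure is a set of composable pairs; \<open>conflation C E A B X i p\<close> says that
  \<open>A \<rightarrow> B \<rightarrow> X\<close> belongs to it.\<close>

definition conflation ::
    "('r, 'o, 'm) lcat \<Rightarrow> ('m \<times> 'm) set \<Rightarrow> 'o \<Rightarrow> 'o \<Rightarrow> 'o \<Rightarrow> 'm \<Rightarrow> 'm \<Rightarrow> bool" where
  "conflation C E A B X i p \<longleftrightarrow> A \<in> Obj C \<and> B \<in> Obj C \<and> X \<in> Obj C \<and>
     i \<in> Mor C A B \<and> p \<in> Mor C B X \<and> (i, p) \<in> E"

definition inflation :: "('r, 'o, 'm) lcat \<Rightarrow> ('m \<times> 'm) set \<Rightarrow> 'o \<Rightarrow> 'o \<Rightarrow> 'm \<Rightarrow> bool" where
  "inflation C E A B i \<longleftrightarrow> (\<exists>X p. conflation C E A B X i p)"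

definition deflation :: "('r, 'o, 'm) lcat \<Rightarrow> ('m \<times> 'm) set \<Rightarrow> 'o \<Rightarrow> 'o \<Rightarrow> 'm \<Rightarrow> bool" where
  "deflation C E B X p \<longleftrightarrow> (\<exists>A i. conflation C E A B X i p)"

text \<open>Quillen's axioms as simplified by Keller, in their self-dual form (Buehler, Exact categories,
  Definition 2.1).\<close>

definition exact_category :: "'r ring \<Rightarrow> ('r, 'o, 'm) lcat \<Rightarrow> ('m \<times> 'm) set \<Rightarrow> bool" where
  "exact_category k C E \<longleftrightarrow> additive_category k C \<and>
     (\<forall>(i, p)\<in>E. \<exists>A\<in>Obj C. \<exists>B\<in>Obj C. \<exists>X\<in>Obj C.
        is_kernel C A B X i p \<and> is_cokernel C A B X i p) \<and>
     (\<forall>A B X i p A' B' X' i' p' a b x.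
        conflation C E A B X i p \<and> A' \<in> Obj C \<and> B' \<in> Obj C \<and> X' \<in> Obj C \<and>
        i' \<in> Mor C A' B' \<and> p' \<in> Mor C B' X' \<and>
        is_iso C A A' a \<and> is_iso C B B' b \<and> is_iso C X X' x \<and>
        i' \<cdot>\<^bsub>C\<^esub> a = b \<cdot>\<^bsub>C\<^esub> i \<and> p' \<cdot>\<^bsub>C\<^esub> b = x \<cdot>\<^bsub>C\<^esub> p
        \<longrightarrow> conflation C E A' B' X' i' p') \<and>
     (\<forall>A\<in>Obj C. inflation C E A A (Idt C A)) \<and>
     (\<forall>A\<in>Obj C. deflation C E A A (Idt C A)) \<and>
     (\<forall>A B X i j. inflation C E A B i \<and> inflation C E B X j \<longrightarrow> inflation C E A X (j \<cdot>\<^bsub>C\<^esub> i)) \<and>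
     (\<forall>A B X p q. deflation C E A B p \<and> deflation C E B X q \<longrightarrow> deflation C E A X (q \<cdot>\<^bsub>C\<^esub> p)) \<and>
     (\<forall>A B A' i f. inflation C E A B i \<and> A' \<in> Obj C \<and> f \<in> Mor C A A' \<longrightarrow>
        (\<exists>B'\<in>Obj C. \<exists>f' i'. is_pushout C A B A' B' i f f' i' \<and> inflation C E A' B' i')) \<and>
     (\<forall>B X X' p f. deflation C E B X p \<and> X' \<in> Obj C \<and> f \<in> Mor C X' X \<longrightarrow>
        (\<exists>B'\<in>Obj C. \<exists>f' p'. is_pullback C B' B X' X f' p' p f \<and> deflation C E B' X' p'))"


section \<open>The functor Ext\<close>

definition ext_class ::
    "('r, 'o, 'm) lcat \<Rightarrow> ('m \<times> 'm) set \<Rightarrow> 'o \<Rightarrow> 'o \<Rightarrow> 'm \<times> 'm \<Rightarrow> ('m \<times> 'm) set" where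
  "ext_class C E X Y c = {(i', p'). \<exists>A A' h.
     conflation C E Y A X (fst c) (snd c) \<and> conflation C E Y A' X i' p' \<and>
     is_iso C A A' h \<and> h \<cdot>\<^bsub>C\<^esub> fst c = i' \<and> p' \<cdot>\<^bsub>C\<^esub> h = snd c}"

text \<open>\<open>ext_pb C E f \<xi>\<close> and \<open>ext_po C E g \<xi>\<close> are \<open>Ext(f, Y) \<xi>\<close> and \<open>Ext(X, g) \<xi>\<close>: the set of all
  conflations arising from a representative of \<open>\<xi>\<close> by some choice of a pullback along \<open>f\<close>,
  respectively of a pushout along \<open>g\<close>.\<close>

definition ext_pb ::
    "('r, 'o, 'm) lcat \<Rightarrow> ('m \<times> 'm) set \<Rightarrow> 'm \<Rightarrow> ('m \<times> 'm) set \<Rightarrow> ('m \<times> 'm) set" where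
  "ext_pb C E f \<xi> = {(i', p'). \<exists>(i, p)\<in>\<xi>. \<exists>Y A A' X X' h.
     conflation C E Y A X i p \<and> conflation C E Y A' X' i' p' \<and>
     is_pullback C A' X' A X p' h f p \<and> h \<cdot>\<^bsub>C\<^esub> i' = i}"

definition ext_po ::
    "('r, 'o, 'm) lcat \<Rightarrow> ('m \<times> 'm) set \<Rightarrow> 'm \<Rightarrow> ('m \<times> 'm) set \<Rightarrow> ('m \<times> 'm) set" where
  "ext_po C E g \<xi> = {(i', p'). \<exists>(i, p)\<in>\<xi>. \<exists>Y Y' A A' X h.
     conflation C E Y A X i p \<and> conflation C E Y' A' X i' p' \<and>
     is_pushout C Y Y' A A' g i i' h \<and> p' \<cdot>\<^bsub>C\<^esub> h = p}"

text \<open>The Baer sum \<open>\<nabla>\<^sub>* \<Delta>\<^sup>* (\<xi> \<oplus> \<zeta>)\<close>; the biproducts \<open>SX\<close> of \<open>X, X\<close>, \<open>SY\<close> of \<open>Y, Y\<close> and \<open>SA\<close> of the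
  two middle terms range over all choices.\<close>

definition ext_add :: "('r, 'o, 'm) lcat \<Rightarrow> ('m \<times> 'm) set \<Rightarrow> 'o \<Rightarrow> 'o
    \<Rightarrow> ('m \<times> 'm) set \<Rightarrow> ('m \<times> 'm) set \<Rightarrow> ('m \<times> 'm) set" where
  "ext_add C E X Y \<xi> \<zeta> = {c. \<exists>(i, p)\<in>\<xi>. \<exists>(j, q)\<in>\<zeta>. \<exists>A B SX SY SA.
     conflation C E Y A X i p \<and> conflation C E Y B X j q \<and>
     is_biprod C X X SX \<and> is_biprod C Y Y SY \<and> is_biprod C A B SA \<and>
     c \<in> ext_po C E (pr1 SY \<oplus>\<^bsub>Hom C (Bob SY) Y\<^esub> pr2 SY)
           (ext_pb C E (in1 SX \<oplus>\<^bsub>Hom C X (Bob SX)\<^esub> in2 SX)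
             (ext_class C E (Bob SX) (Bob SY)
               (biprod_map C SY SA i j, biprod_map C SA SX p q)))}"

definition split_conflations ::
    "('r, 'o, 'm) lcat \<Rightarrow> ('m \<times> 'm) set \<Rightarrow> 'o \<Rightarrow> 'o \<Rightarrow> ('m \<times> 'm) set" where
  "split_conflations C E X Y =
     {(i, p). \<exists>A. conflation C E Y A X i p \<and> (\<exists>s\<in>Mor C X A. p \<cdot>\<^bsub>C\<^esub> s = Idt C X)}"

text \<open>\<open>Ext C E X Y\<close> consists of classes of conflations \<open>Y \<rightarrow> A \<rightarrow> X\<close>.\<close>

definition Ext ::
    "('r, 'o, 'm) lcat \<Rightarrow> ('m \<times> 'm) set \<Rightarrow> 'o \<Rightarrow> 'o \<Rightarrow> ('r, ('m \<times> 'm) set) module" where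
  "Ext C E X Y =
     \<lparr>carrier = {ext_class C E X Y (i, p) | i p. \<exists>A. conflation C E Y A X i p},
      mult = undefined, one = undefined,
      zero = split_conflations C E X Y,
      add = ext_add C E X Y,
      smult = (\<lambda>a. ext_po C E (a \<odot>\<^bsub>Hom C Y Y\<^esub> Idt C Y))\<rparr>"

definition proj_trivial :: "('r, 'o, 'm) lcat \<Rightarrow> ('m \<times> 'm) set \<Rightarrow> 'o \<Rightarrow> 'o \<Rightarrow> 'm set" where
  "proj_trivial C E X Y = {f \<in> Mor C X Y.
     \<forall>Z\<in>Obj C. \<forall>\<xi>\<in>carrier (Ext C E Y Z). ext_pb C E f \<xi> = \<zero>\<^bsub>Ext C E X Z\<^esub>}"

definition inj_trivial :: "('r, 'o, 'm) lcat \<Rightarrow> ('m \<times> 'm) set \<Rightarrow> 'o \<Rightarrow> 'o \<Rightarrow> 'm set" where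
  "inj_trivial C E X Y = {f \<in> Mor C X Y.
     \<forall>Z\<in>Obj C. \<forall>\<xi>\<in>carrier (Ext C E Z X). ext_po C E f \<xi> = \<zero>\<^bsub>Ext C E Z Y\<^esub>}"


section \<open>Quotient categories, functors and natural isomorphisms\<close>

text \<open>The image of a morphism \<open>f\<close> in the quotient by \<open>J\<close>.\<close>

definition quot_class :: "('r, 'o, 'm) lcat \<Rightarrow> ('o \<Rightarrow> 'o \<Rightarrow> 'm set) \<Rightarrow> 'm \<Rightarrow> 'm set" where
  "quot_class C J f =
     {h. \<exists>X\<in>Obj C. \<exists>Y\<in>Obj C. f \<in> Mor C X Y \<and> h \<in> J X Y +>\<^bsub>Hom C X Y\<^esub> f}"

definition quot_cat ::
    "('r, 'o, 'm) lcat \<Rightarrow> ('o \<Rightarrow> 'o \<Rightarrow> 'm set) \<Rightarrow> ('r, 'o, 'm set) lcat" where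
  "quot_cat C J =
     \<lparr>Obj = Obj C,
      Hom = (\<lambda>X Y. quot_module (Hom C X Y) (J X Y)),
      Comp = (\<lambda>G F. \<Union>g\<in>G. \<Union>f\<in>F. quot_class C J (g \<cdot>\<^bsub>C\<^esub> f)),
      Idt = (\<lambda>X. quot_class C J (Idt C X))\<rparr>"

definition full_subcat :: "('r, 'o, 'm) lcat \<Rightarrow> 'o set \<Rightarrow> ('r, 'o, 'm) lcat" where
  "full_subcat C S = C\<lparr>Obj := S\<rparr>"

record ('o, 'm, 'p, 'n) fctr =
  Fob :: "'o \<Rightarrow> 'p"
  Fmor :: "'o \<Rightarrow> 'o \<Rightarrow> 'm \<Rightarrow> 'n"

definition is_functor ::
    "('r, 'o, 'm) lcat \<Rightarrow> ('s, 'p, 'n) lcat \<Rightarrow> ('o, 'm, 'p, 'n) fctr \<Rightarrow> bool" where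
  "is_functor A B F \<longleftrightarrow>
     (\<forall>X\<in>Obj A. Fob F X \<in> Obj B) \<and>
     (\<forall>X\<in>Obj A. \<forall>Y\<in>Obj A. \<forall>f\<in>Mor A X Y. Fmor F X Y f \<in> Mor B (Fob F X) (Fob F Y)) \<and>
     (\<forall>X\<in>Obj A. Fmor F X X (Idt A X) = Idt B (Fob F X)) \<and>
     (\<forall>X\<in>Obj A. \<forall>Y\<in>Obj A. \<forall>Z\<in>Obj A. \<forall>f\<in>Mor A X Y. \<forall>g\<in>Mor A Y Z.
        Fmor F X Z (g \<cdot>\<^bsub>A\<^esub> f) = Fmor F Y Z g \<cdot>\<^bsub>B\<^esub> Fmor F X Y f)"

definition id_functor :: "('o, 'm, 'o, 'm) fctr" where
  "id_functor = \<lparr>Fob = (\<lambda>X. X), Fmor = (\<lambda>X Y f. f)\<rparr>"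

definition comp_functor ::
    "('p, 'n, 'u, 'v) fctr \<Rightarrow> ('o, 'm, 'p, 'n) fctr \<Rightarrow> ('o, 'm, 'u, 'v) fctr" where
  "comp_functor G F =
     \<lparr>Fob = (\<lambda>X. Fob G (Fob F X)),
      Fmor = (\<lambda>X Y f. Fmor G (Fob F X) (Fob F Y) (Fmor F X Y f))\<rparr>"

definition natural_iso :: "('r, 'o, 'm) lcat \<Rightarrow> ('s, 'p, 'n) lcat
    \<Rightarrow> ('o, 'm, 'p, 'n) fctr \<Rightarrow> ('o, 'm, 'p, 'n) fctr \<Rightarrow> ('o \<Rightarrow> 'n) \<Rightarrow> bool" where
  "natural_iso A B F G \<alpha> \<longleftrightarrow> is_functor A B F \<and> is_functor A B G \<and>
     (\<forall>X\<in>Obj A. is_iso B (Fob F X) (Fob G X) (\<alpha> X)) \<and>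
     (\<forall>X\<in>Obj A. \<forall>Y\<in>Obj A. \<forall>f\<in>Mor A X Y.
        \<alpha> Y \<cdot>\<^bsub>B\<^esub> Fmor F X Y f = Fmor G X Y f \<cdot>\<^bsub>B\<^esub> \<alpha> X)"

definition mutually_quasi_inverse :: "('r, 'o, 'm) lcat \<Rightarrow> ('s, 'p, 'n) lcat
    \<Rightarrow> ('o, 'm, 'p, 'n) fctr \<Rightarrow> ('p, 'n, 'o, 'm) fctr \<Rightarrow> bool" where
  "mutually_quasi_inverse A B F G \<longleftrightarrow> is_functor A B F \<and> is_functor B A G \<and>
     (\<exists>\<alpha>. natural_iso A A (comp_functor G F) id_functor \<alpha>) \<and>
     (\<exists>\<beta>. natural_iso B B id_functor (comp_functor F G) \<beta>)"


section \<open>The generalized Auslander-Reiten translations\<close>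

definition proj_stable :: "('r, 'o, 'm) lcat \<Rightarrow> ('m \<times> 'm) set \<Rightarrow> ('r, 'o, 'm set) lcat" where
  "proj_stable C E = quot_cat C (proj_trivial C E)"

definition inj_stable :: "('r, 'o, 'm) lcat \<Rightarrow> ('m \<times> 'm) set \<Rightarrow> ('r, 'o, 'm set) lcat" where
  "inj_stable C E = quot_cat C (inj_trivial C E)"

text \<open>\<open>represents_r k Q C E Y T \<phi>\<close>: the family \<open>\<phi>\<close> is an isomorphism of functors from the functor
  represented by \<open>T\<close> on the injectively stable category to \<open>D Ext(Y, -)\<close>. Every morphism of the
  stable category being the class of some \<open>g\<close>, naturality is stated for these classes.\<close>

definition represents_r :: "'r ring \<Rightarrow> ('r, 'q) module \<Rightarrow> ('r, 'o, 'm) lcat \<Rightarrow> ('m \<times> 'm) set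
    \<Rightarrow> 'o \<Rightarrow> 'o \<Rightarrow> ('o \<Rightarrow> 'm set \<Rightarrow> (('m \<times> 'm) set \<Rightarrow> 'q)) \<Rightarrow> bool" where
  "represents_r k Q C E Y T \<phi> \<longleftrightarrow> T \<in> Obj C \<and>
     (\<forall>M\<in>Obj C. linear_iso k (Hom (inj_stable C E) M T) (dual k Q (Ext C E Y M)) (\<phi> M)) \<and>
     (\<forall>M\<in>Obj C. \<forall>N\<in>Obj C. \<forall>g\<in>Mor C M N. \<forall>U\<in>Mor (inj_stable C E) N T.
        \<phi> M (U \<cdot>\<^bsub>inj_stable C E\<^esub> quot_class C (inj_trivial C E) g)
          = dual_map (Ext C E Y M) (ext_po C E g) (\<phi> N U))"

text \<open>\<open>represents_l k Q C E X T \<psi>\<close>: the family \<open>\<psi>\<close> is an isomorphism of functors from the functor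
  corepresented by \<open>T\<close> on the projectively stable category to \<open>D Ext(-, X)\<close>.\<close>

definition represents_l :: "'r ring \<Rightarrow> ('r, 'q) module \<Rightarrow> ('r, 'o, 'm) lcat \<Rightarrow> ('m \<times> 'm) set
    \<Rightarrow> 'o \<Rightarrow> 'o \<Rightarrow> ('o \<Rightarrow> 'm set \<Rightarrow> (('m \<times> 'm) set \<Rightarrow> 'q)) \<Rightarrow> bool" where
  "represents_l k Q C E X T \<psi> \<longleftrightarrow> T \<in> Obj C \<and>
     (\<forall>M\<in>Obj C. linear_iso k (Hom (proj_stable C E) T M) (dual k Q (Ext C E M X)) (\<psi> M)) \<and>
     (\<forall>M\<in>Obj C. \<forall>N\<in>Obj C. \<forall>g\<in>Mor C M N. \<forall>U\<in>Mor (proj_stable C E) T M.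
        \<psi> N (quot_class C (proj_trivial C E) g \<cdot>\<^bsub>proj_stable C E\<^esub> U)
          = dual_map (Ext C E N X) (ext_pb C E g) (\<psi> M U))"

definition Obj_r :: "'r ring \<Rightarrow> ('r, 'q) module \<Rightarrow> ('r, 'o, 'm) lcat \<Rightarrow> ('m \<times> 'm) set \<Rightarrow> 'o set" where
  "Obj_r k Q C E = {Y \<in> Obj C. \<exists>T \<phi>. represents_r k Q C E Y T \<phi>}"

definition Obj_l :: "'r ring \<Rightarrow> ('r, 'q) module \<Rightarrow> ('r, 'o, 'm) lcat \<Rightarrow> ('m \<times> 'm) set \<Rightarrow> 'o set" where
  "Obj_l k Q C E = {X \<in> Obj C. \<exists>T \<psi>. represents_l k Q C E X T \<psi>}"

definition stable_r :: "'r ring \<Rightarrow> ('r, 'q) module \<Rightarrow> ('r, 'o, 'm) lcat \<Rightarrow> ('m \<times> 'm) set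
    \<Rightarrow> ('r, 'o, 'm set) lcat" where
  "stable_r k Q C E = full_subcat (proj_stable C E) (Obj_r k Q C E)"

definition stable_l :: "'r ring \<Rightarrow> ('r, 'q) module \<Rightarrow> ('r, 'o, 'm) lcat \<Rightarrow> ('m \<times> 'm) set
    \<Rightarrow> ('r, 'o, 'm set) lcat" where
  "stable_l k Q C E = full_subcat (inj_stable C E) (Obj_l k Q C E)"

text \<open>The functor \<open>\<tau>\<close> determined by the chosen objects \<open>t Y\<close> and isomorphisms \<open>\<phi> Y\<close>. On morphisms
  it is given by Yoneda's lemma: the image \<open>T\<close> of the class \<open>F\<close> of \<open>f : Y \<rightarrow> Y'\<close> satisfies
  \<open>\<phi>\<^sub>Y\<^sub>' \<circ> Hom(-, T) = D Ext(f, -) \<circ> \<phi>\<^sub>Y\<close>.\<close>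

definition tau :: "('r, 'o, 'm) lcat \<Rightarrow> ('m \<times> 'm) set
    \<Rightarrow> ('o \<Rightarrow> 'o) \<Rightarrow> ('o \<Rightarrow> 'o \<Rightarrow> 'm set \<Rightarrow> (('m \<times> 'm) set \<Rightarrow> 'q))
    \<Rightarrow> ('o, 'm set, 'o, 'm set) fctr" where
  "tau C E t \<phi> =
     \<lparr>Fob = t,
      Fmor = (\<lambda>Y Y' F. THE T. T \<in> Mor (inj_stable C E) (t Y) (t Y') \<and>
        (\<forall>f\<in>F. \<forall>M\<in>Obj C. \<forall>U\<in>Mor (inj_stable C E) M (t Y).
           \<phi> Y' M (T \<cdot>\<^bsub>inj_stable C E\<^esub> U)
             = dual_map (Ext C E Y' M) (ext_pb C E f) (\<phi> Y M U)))\<rparr>"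

text \<open>The functor \<open>\<tau>\<^sup>-\<close>: the image \<open>T\<close> of the class \<open>G\<close> of \<open>g : X \<rightarrow> X'\<close> satisfies
  \<open>\<psi>\<^sub>X \<circ> Hom(T, -) = D Ext(-, g) \<circ> \<psi>\<^sub>X\<^sub>'\<close>.\<close>

definition tau_minus :: "('r, 'o, 'm) lcat \<Rightarrow> ('m \<times> 'm) set
    \<Rightarrow> ('o \<Rightarrow> 'o) \<Rightarrow> ('o \<Rightarrow> 'o \<Rightarrow> 'm set \<Rightarrow> (('m \<times> 'm) set \<Rightarrow> 'q))
    \<Rightarrow> ('o, 'm set, 'o, 'm set) fctr" where
  "tau_minus C E s \<psi> =
     \<lparr>Fob = s,
      Fmor = (\<lambda>X X' G. THE T. T \<in> Mor (proj_stable C E) (s X) (s X') \<and>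
        (\<forall>g\<in>G. \<forall>M\<in>Obj C. \<forall>U\<in>Mor (proj_stable C E) (s X') M.
           \<psi> X M (U \<cdot>\<^bsub>proj_stable C E\<^esub> T)
             = dual_map (Ext C E M X) (ext_po C E g) (\<psi> X' M U)))\<rparr>"

definition epsilon :: "('r, 'o, 'm) lcat \<Rightarrow> ('m \<times> 'm) set
    \<Rightarrow> ('o \<Rightarrow> 'o) \<Rightarrow> ('o \<Rightarrow> 'o \<Rightarrow> 'm set \<Rightarrow> (('m \<times> 'm) set \<Rightarrow> 'q))
    \<Rightarrow> ('o \<Rightarrow> 'o) \<Rightarrow> ('o \<Rightarrow> 'o \<Rightarrow> 'm set \<Rightarrow> (('m \<times> 'm) set \<Rightarrow> 'q)) \<Rightarrow> 'o \<Rightarrow> 'm set" where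
  "epsilon C E t \<phi> s \<psi> Y =
     inv_into (Mor (proj_stable C E) (s (t Y)) Y) (\<psi> (t Y) Y)
       (\<phi> Y (t Y) (Idt (inj_stable C E) (t Y)))"

definition eta :: "('r, 'o, 'm) lcat \<Rightarrow> ('m \<times> 'm) set
    \<Rightarrow> ('o \<Rightarrow> 'o) \<Rightarrow> ('o \<Rightarrow> 'o \<Rightarrow> 'm set \<Rightarrow> (('m \<times> 'm) set \<Rightarrow> 'q))
    \<Rightarrow> ('o \<Rightarrow> 'o) \<Rightarrow> ('o \<Rightarrow> 'o \<Rightarrow> 'm set \<Rightarrow> (('m \<times> 'm) set \<Rightarrow> 'q)) \<Rightarrow> 'o \<Rightarrow> 'm set" where
  "eta C E t \<phi> s \<psi> X =
     inv_into (Mor (inj_stable C E) X (t (s X))) (\<phi> (s X) X)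
       (\<psi> X (s X) (Idt (proj_stable C E) (s X)))"

end

theory Submission
  imports Defs
begin

text \<open>Write \<open>\<theta>\<close> for the functional on \<open>Ext(Y, \<tau>Y)\<close> corresponding to the identity of \<open>\<tau>Y\<close>. By
  Yoneda, \<open>g \<mapsto> \<theta> \<circ> Ext(Y, g)\<close> identifies the injectively stable morphisms \<open>M \<rightarrow> \<tau>Y\<close> with
  \<open>D Ext(Y, M)\<close>. The point is that \<open>\<theta>\<close> is then universal on the other side as well: \<open>f \<mapsto> \<theta> \<circ> Ext(f, \<tau>Y)\<close>
  identifies the projectively stable morphisms \<open>Y \<rightarrow> M\<close> with \<open>D Ext(M, \<tau>Y)\<close>. Thus \<open>\<tau>Y\<close> lies in \<open>C\<^sub>l\<close>
  and is represented by \<open>Y\<close>, so that uniqueness of representing objects makes the counit invertible;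
  the unit is dual.

  The two-sided universality rests on Matlis duality over the artinian ring \<open>k\<close>: every endomorphism of
  the minimal injective cogenerator \<open>Q\<close> is a scalar, hence for a bilinear pairing of a finitely
  generated module \<open>H\<close> with a module \<open>M\<close> the elements of \<open>H\<close> induce all functionals on \<open>M\<close> that vanish
  on the orthogonal of \<open>H\<close>.\<close>

section \<open>Matlis duality\<close>

text \<open>Finite generation is assumed for Hom modules only, so Ext cannot be compared with its
  double dual; duality is used through pairings in which the finitely generated side is a Hom
  module. Moreover injectivity and the cogenerator property are tested on modules over one fixed
  type, while Ext consists of sets of pairs of morphisms; functionals on Ext come from Baer's
  criterion and Zorn's lemma. That endomorphisms of \<open>Q\<close> are scalars is where minimality
  and the chain condition meet: minimality lets each simple module occur in \<open>Q\<close> only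
  once, and the chain condition lets a scalar be corrected one simple layer at a time. The exchange
  of sides is proved in an abstract bimodule whose axioms are invariant under swapping the two
  arguments, so one argument serves counit and unit. Identities between stable morphisms are then
  checked on single functionals: \<open>\<tau>\<close> sends the class of \<open>f\<close> to that
  of the \<open>u\<close> with \<open>\<theta>' (po u \<xi>) = \<theta> (pb f \<xi>)\<close>, where
  \<theta> and \<theta>' belong to source and target of \<open>f\<close>.\<close>

lemma linear_mapI:
  assumes "\<And>x. x \<in> carrier M \<Longrightarrow> f x \<in> carrier N"
    and "\<And>x y. x \<in> carrier M \<Longrightarrow> y \<in> carrier M \<Longrightarrow> f (x \<oplus>\<^bsub>M\<^esub> y) = f x \<oplus>\<^bsub>N\<^esub> f y"
    and "\<And>a x. a \<in> carrier k \<Longrightarrow> x \<in> carrier M \<Longrightarrow> f (a \<odot>\<^bsub>M\<^esub> x) = a \<odot>\<^bsub>N\<^esub> f x"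
  shows "linear_map k M N f"
  using assms by (auto simp: linear_map_def)

lemma
  assumes "linear_map k M N f"
  shows linear_map_closed: "x \<in> carrier M \<Longrightarrow> f x \<in> carrier N"
    and linear_map_add: "x \<in> carrier M \<Longrightarrow> y \<in> carrier M \<Longrightarrow> f (x \<oplus>\<^bsub>M\<^esub> y) = f x \<oplus>\<^bsub>N\<^esub> f y"
    and linear_map_smult: "a \<in> carrier k \<Longrightarrow> x \<in> carrier M \<Longrightarrow> f (a \<odot>\<^bsub>M\<^esub> x) = a \<odot>\<^bsub>N\<^esub> f x"
  using assms by (auto simp: linear_map_def)

lemma linear_map_zero:
  assumes "module k M" "module k N" "linear_map k M N f"
  shows "f \<zero>\<^bsub>M\<^esub> = \<zero>\<^bsub>N\<^esub>"
proof -
  interpret M: module k M by fact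
  interpret N: module k N by fact
  have "f (\<zero>\<^bsub>k\<^esub> \<odot>\<^bsub>M\<^esub> \<zero>\<^bsub>M\<^esub>) = \<zero>\<^bsub>k\<^esub> \<odot>\<^bsub>N\<^esub> f \<zero>\<^bsub>M\<^esub>"
    using assms(3) by (rule linear_map_smult) auto
  then show ?thesis
    using linear_map_closed[OF assms(3)] by simp
qed

lemma (in module) smult_minus_one: "x \<in> carrier M \<Longrightarrow> (\<ominus> \<one>) \<odot>\<^bsub>M\<^esub> x = \<ominus>\<^bsub>M\<^esub> x"
  by (simp add: smult_l_minus)

lemma linear_map_neg:
  assumes "module k M" "module k N" "linear_map k M N f" "x \<in> carrier M"
  shows "f (\<ominus>\<^bsub>M\<^esub> x) = \<ominus>\<^bsub>N\<^esub> f x"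
proof -
  interpret M: module k M by fact
  interpret N: module k N by fact
  show ?thesis
    using linear_map_smult[OF assms(3), of "\<ominus>\<^bsub>k\<^esub> \<one>\<^bsub>k\<^esub>" x] linear_map_closed[OF assms(3)] assms(4)
    by (simp add: M.smult_minus_one N.smult_minus_one)
qed

lemma linear_map_comp:
  "linear_map k M N f \<Longrightarrow> linear_map k N P g \<Longrightarrow> linear_map k M P (\<lambda>x. g (f x))"
  by (rule linear_mapI) (simp_all add: linear_map_closed linear_map_add linear_map_smult)

lemma linear_map_cong:
  "module k M \<Longrightarrow> linear_map k M N f \<Longrightarrow> (\<And>x. x \<in> carrier M \<Longrightarrow> g x = f x) \<Longrightarrow> linear_map k M N g"
  by (rule linear_mapI)
    (auto simp: linear_map_closed linear_map_add linear_map_smult module.smult_closed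
      abelian_groupE(1)[OF module.axioms(2)])

lemma (in module) submodule_memD:
  assumes "submodule H R M"
  shows "x \<in> H \<Longrightarrow> x \<in> carrier M" "\<zero>\<^bsub>M\<^esub> \<in> H"
    "x \<in> H \<Longrightarrow> y \<in> H \<Longrightarrow> x \<oplus>\<^bsub>M\<^esub> y \<in> H"
    "a \<in> carrier R \<Longrightarrow> x \<in> H \<Longrightarrow> a \<odot>\<^bsub>M\<^esub> x \<in> H"
    "x \<in> H \<Longrightarrow> \<ominus>\<^bsub>M\<^esub> x \<in> H"
proof -
  note E = submoduleE[OF assms]
  show "x \<in> H \<Longrightarrow> x \<in> carrier M" "x \<in> H \<Longrightarrow> y \<in> H \<Longrightarrow> x \<oplus>\<^bsub>M\<^esub> y \<in> H"
    "a \<in> carrier R \<Longrightarrow> x \<in> H \<Longrightarrow> a \<odot>\<^bsub>M\<^esub> x \<in> H" "x \<in> H \<Longrightarrow> \<ominus>\<^bsub>M\<^esub> x \<in> H"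
    using E by auto
  obtain z where z: "z \<in> H" using E(2) by blast
  then have "\<zero> \<odot>\<^bsub>M\<^esub> z \<in> H" using E(4) by blast
  then show "\<zero>\<^bsub>M\<^esub> \<in> H" using z E(1) by auto
qed

lemma (in module) submoduleI':
  assumes "H \<subseteq> carrier M" "\<zero>\<^bsub>M\<^esub> \<in> H"
    and "\<And>x y. x \<in> H \<Longrightarrow> y \<in> H \<Longrightarrow> x \<oplus>\<^bsub>M\<^esub> y \<in> H"
    and "\<And>a x. a \<in> carrier R \<Longrightarrow> x \<in> H \<Longrightarrow> a \<odot>\<^bsub>M\<^esub> x \<in> H"
  shows "submodule H R M"
proof (rule submoduleI)
  fix x assume x: "x \<in> H"
  then have "(\<ominus> \<one>) \<odot>\<^bsub>M\<^esub> x \<in> H" by (rule assms(4)[rotated]) simp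
  then show "\<ominus>\<^bsub>M\<^esub> x \<in> H" using x assms(1) by (auto simp: smult_minus_one)
qed (use assms in auto)

definition cyclic :: "'r ring \<Rightarrow> ('r, 'a) module \<Rightarrow> 'a \<Rightarrow> 'a set" where
  "cyclic k M z = (\<lambda>a. a \<odot>\<^bsub>M\<^esub> z) ` carrier k"

definition sum_sub :: "('r, 'a) module \<Rightarrow> 'a set \<Rightarrow> 'a set \<Rightarrow> 'a set" where
  "sum_sub M A B = {x \<oplus>\<^bsub>M\<^esub> y | x y. x \<in> A \<and> y \<in> B}"

lemma submodule_cyclic:
  assumes "module k M" "z \<in> carrier M"
  shows "submodule (cyclic k M z) k M" "z \<in> cyclic k M z"
proof -
  interpret module k M by fact
  show "submodule (cyclic k M z) k M"
  proof (rule submoduleI')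
    show "\<zero>\<^bsub>M\<^esub> \<in> cyclic k M z"
      using assms(2) by (auto simp: cyclic_def image_iff intro!: bexI[of _ "\<zero>\<^bsub>k\<^esub>"])
    show "x \<oplus>\<^bsub>M\<^esub> y \<in> cyclic k M z" if "x \<in> cyclic k M z" "y \<in> cyclic k M z" for x y
      using that assms(2) by (auto simp: cyclic_def image_iff smult_l_distr[symmetric])
    show "a \<odot>\<^bsub>M\<^esub> x \<in> cyclic k M z" if "a \<in> carrier k" "x \<in> cyclic k M z" for a x
      using that assms(2) by (auto simp: cyclic_def image_iff smult_assoc1[symmetric])
  qed (use assms(2) in \<open>auto simp: cyclic_def\<close>)
  show "z \<in> cyclic k M z"
    using assms(2) by (auto simp: cyclic_def image_iff intro!: bexI[of _ "\<one>\<^bsub>k\<^esub>"])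
qed

lemma submodule_sum_sub:
  assumes "module k M" "submodule A k M" "submodule B k M"
  shows "submodule (sum_sub M A B) k M" "A \<subseteq> sum_sub M A B" "B \<subseteq> sum_sub M A B"
proof -
  interpret module k M by fact
  note A = submodule_memD[OF assms(2)] and B = submodule_memD[OF assms(3)]
  show "submodule (sum_sub M A B) k M"
  proof (rule submoduleI')
    show "sum_sub M A B \<subseteq> carrier M" using A(1) B(1) by (auto simp: sum_sub_def)
    show "\<zero>\<^bsub>M\<^esub> \<in> sum_sub M A B"
      unfolding sum_sub_def using A(2) B(2) by (force intro: exI[of _ "\<zero>\<^bsub>M\<^esub>"])
    fix x y assume "x \<in> sum_sub M A B" "y \<in> sum_sub M A B"
    then obtain a b c d where *: "x = a \<oplus>\<^bsub>M\<^esub> b" "y = c \<oplus>\<^bsub>M\<^esub> d" "a \<in> A" "c \<in> A" "b \<in> B" "d \<in> B"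
      by (auto simp: sum_sub_def)
    then have "x \<oplus>\<^bsub>M\<^esub> y = (a \<oplus>\<^bsub>M\<^esub> c) \<oplus>\<^bsub>M\<^esub> (b \<oplus>\<^bsub>M\<^esub> d)"
      using A(1) B(1) by (simp add: M.add.m_ac)
    then show "x \<oplus>\<^bsub>M\<^esub> y \<in> sum_sub M A B"
      unfolding sum_sub_def using * A(3) B(3) by blast
  next
    fix r x assume r: "r \<in> carrier k" "x \<in> sum_sub M A B"
    then obtain a b where *: "x = a \<oplus>\<^bsub>M\<^esub> b" "a \<in> A" "b \<in> B" by (auto simp: sum_sub_def)
    then have "r \<odot>\<^bsub>M\<^esub> x = r \<odot>\<^bsub>M\<^esub> a \<oplus>\<^bsub>M\<^esub> r \<odot>\<^bsub>M\<^esub> b"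
      using A(1) B(1) r by (simp add: smult_r_distr)
    then show "r \<odot>\<^bsub>M\<^esub> x \<in> sum_sub M A B"
      unfolding sum_sub_def using * r A(4) B(4) by blast
  qed
  show "A \<subseteq> sum_sub M A B"
  proof
    fix x assume "x \<in> A"
    then have "x = x \<oplus>\<^bsub>M\<^esub> \<zero>\<^bsub>M\<^esub>" "x \<in> A" using A(1) by auto
    then show "x \<in> sum_sub M A B" unfolding sum_sub_def using B(2) by blast
  qed
  show "B \<subseteq> sum_sub M A B"
  proof
    fix x assume "x \<in> B"
    then have "x = \<zero>\<^bsub>M\<^esub> \<oplus>\<^bsub>M\<^esub> x" "x \<in> B" using B(1) by auto
    then show "x \<in> sum_sub M A B" unfolding sum_sub_def using A(2) by blast
  qed
qed

section \<open>The ring as a module over itself, ideals as its submodules\<close>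

definition regular_module :: "'r ring \<Rightarrow> ('r, 'r) module" where
  "regular_module k = \<lparr>carrier = carrier k, mult = mult k, one = one k, zero = zero k, add = add k,
     smult = mult k\<rparr>"

lemma regular_module_sel [simp]:
  "carrier (regular_module k) = carrier k" "add (regular_module k) = add k"
  "zero (regular_module k) = zero k" "smult (regular_module k) = mult k"
  by (simp_all add: regular_module_def)

lemma module_regular:
  assumes "cring k"
  shows "module k (regular_module k)"
proof -
  interpret cring k by fact
  show ?thesis
  proof (rule moduleI)
    show "abelian_group (regular_module k)"
    proof (rule abelian_groupI)
      fix x assume "x \<in> carrier (regular_module k)"
      then show "\<exists>y\<in>carrier (regular_module k). y \<oplus>\<^bsub>regular_module k\<^esub> x = \<zero>\<^bsub>regular_module k\<^esub>"
        using l_neg by auto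
    next
      fix x y assume "x \<in> carrier (regular_module k)" "y \<in> carrier (regular_module k)"
      then show "x \<oplus>\<^bsub>regular_module k\<^esub> y = y \<oplus>\<^bsub>regular_module k\<^esub> x"
        by (simp add: a_comm)
    qed (simp_all add: a_assoc)
  qed (simp_all add: l_distr r_distr m_assoc assms)
qed

lemma ideal_iff_submodule:
  fixes k :: "'r ring"
  assumes "cring k"
  shows "ideal I k \<longleftrightarrow> submodule I k (regular_module k)"
proof -
  interpret cring k by fact
  interpret K: module k "regular_module k" using assms by (rule module_regular)
  show ?thesis
  proof
    assume "ideal I k"
    then interpret I: ideal I k .
    show "submodule I k (regular_module k)"
      by (rule K.submoduleI') (auto simp: I.I_l_closed I.a_closed I.zero_closed I.Icarr)
  next
    assume I: "submodule I k (regular_module k)"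
    show "ideal I k"
    proof (rule idealI)
      show "subgroup I (add_monoid k)"
        using I by (simp add: submodule_def subgroup_def regular_module_def m_inv_def)
      show "x \<otimes>\<^bsub>k\<^esub> a \<in> I" "a \<otimes>\<^bsub>k\<^esub> x \<in> I" if "a \<in> I" "x \<in> carrier k" for a x
        using K.submodule_memD(4)[OF I that(2,1)] K.submodule_memD(1)[OF I that(1)] that(2)
        by (simp_all add: m_comm)
    qed (rule ring_axioms)
  qed
qed

lemma idealI_cring:
  fixes k :: "'r ring"
  assumes "cring k" "I \<subseteq> carrier k" "\<zero>\<^bsub>k\<^esub> \<in> I"
    and "\<And>x y. x \<in> I \<Longrightarrow> y \<in> I \<Longrightarrow> x \<oplus>\<^bsub>k\<^esub> y \<in> I"
    and "\<And>a x. a \<in> carrier k \<Longrightarrow> x \<in> I \<Longrightarrow> a \<otimes>\<^bsub>k\<^esub> x \<in> I"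
  shows "ideal I k"
  unfolding ideal_iff_submodule[OF assms(1)]
  by (rule module.submoduleI'[OF module_regular[OF assms(1)]]) (use assms in auto)


subsection \<open>Transport of modules and quotients\<close>

text \<open>Injectivity and the cogenerator property quantify over modules on one fixed type; an
  injection \<open>e\<close> into that type carries a module there. The operations are pulled back
  through \<open>inv_into\<close>, so they are meaningful only on the image of
  \<open>e\<close>.\<close>

definition transport_module :: "('a \<Rightarrow> 'b) \<Rightarrow> ('r, 'a) module \<Rightarrow> ('r, 'b) module" where
  "transport_module e M = \<lparr>carrier = e ` carrier M, mult = undefined, one = undefined,
     zero = e \<zero>\<^bsub>M\<^esub>,
     add = (\<lambda>u v. e (inv_into (carrier M) e u \<oplus>\<^bsub>M\<^esub> inv_into (carrier M) e v)),
     smult = (\<lambda>a u. e (a \<odot>\<^bsub>M\<^esub> inv_into (carrier M) e u))\<rparr>"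

lemma transport_module:
  assumes "module k M" "inj_on e (carrier M)"
  shows "module k (transport_module e M)" "linear_map k M (transport_module e M) e"
    "linear_map k (transport_module e M) M (inv_into (carrier M) e)"
proof -
  interpret module k M by fact
  have [simp]: "inv_into (carrier M) e (e x) = x" if "x \<in> carrier M" for x
    using that assms(2) by simp
  show "module k (transport_module e M)"
  proof (rule moduleI)
    show "abelian_group (transport_module e M)"
    proof (rule abelian_groupI)
      fix x assume "x \<in> carrier (transport_module e M)"
      then obtain a where "a \<in> carrier M" "x = e a" by (auto simp: transport_module_def)
      then show "\<exists>y\<in>carrier (transport_module e M).
          y \<oplus>\<^bsub>transport_module e M\<^esub> x = \<zero>\<^bsub>transport_module e M\<^esub>"
        by (auto simp: transport_module_def M.l_neg intro!: bexI[of _ "\<ominus>\<^bsub>M\<^esub> a"])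
    next
      fix x y assume "x \<in> carrier (transport_module e M)" "y \<in> carrier (transport_module e M)"
      then show "x \<oplus>\<^bsub>transport_module e M\<^esub> y = y \<oplus>\<^bsub>transport_module e M\<^esub> x"
        by (auto simp: transport_module_def M.a_comm)
    qed (auto simp: transport_module_def M.a_assoc)
  qed (auto simp: transport_module_def smult_l_distr smult_r_distr smult_assoc1 R.cring_axioms)
  show "linear_map k M (transport_module e M) e"
    "linear_map k (transport_module e M) M (inv_into (carrier M) e)"
    by (auto simp: linear_map_def transport_module_def)
qed

text \<open>Serves two purposes: the cyclic module \<open>k/I\<close> in the cogenerator argument,
  and the Hom modules of both stable categories.\<close>

locale quotient_module = module k M for k :: "'r ring" and M :: "('r, 'a) module" and N +
  assumes sub: "submodule N k M"
begin

lemma abelian_subgroup: "abelian_subgroup N M"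
proof (rule abelian_subgroupI3)
  show "additive_subgroup N M"
    using sub by (simp add: additive_subgroup_def submodule_def)
qed (rule M.abelian_group_axioms)

lemma mem_coset_iff:
  assumes "x \<in> carrier M"
  shows "y \<in> N +>\<^bsub>M\<^esub> x \<longleftrightarrow> y \<in> carrier M \<and> y \<oplus>\<^bsub>M\<^esub> \<ominus>\<^bsub>M\<^esub> x \<in> N"
proof
  assume "y \<in> N +>\<^bsub>M\<^esub> x"
  then obtain n where "n \<in> N" "y = n \<oplus>\<^bsub>M\<^esub> x" by (auto simp: a_r_coset_def' )
  then show "y \<in> carrier M \<and> y \<oplus>\<^bsub>M\<^esub> \<ominus>\<^bsub>M\<^esub> x \<in> N"
    using assms submodule_memD(1)[OF sub] by (auto simp: M.a_assoc M.r_neg)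
next
  assume y: "y \<in> carrier M \<and> y \<oplus>\<^bsub>M\<^esub> \<ominus>\<^bsub>M\<^esub> x \<in> N"
  then have "y = (y \<oplus>\<^bsub>M\<^esub> \<ominus>\<^bsub>M\<^esub> x) \<oplus>\<^bsub>M\<^esub> x" using assms by (auto simp: M.a_assoc M.l_neg)
  then show "y \<in> N +>\<^bsub>M\<^esub> x" using y by (auto simp: a_r_coset_def')
qed

lemma coset_self: "x \<in> carrier M \<Longrightarrow> x \<in> N +>\<^bsub>M\<^esub> x"
  by (simp add: mem_coset_iff M.r_neg submodule_memD(2)[OF sub])

lemma coset_eq_iff:
  assumes "x \<in> carrier M" "y \<in> carrier M"
  shows "N +>\<^bsub>M\<^esub> x = N +>\<^bsub>M\<^esub> y \<longleftrightarrow> x \<oplus>\<^bsub>M\<^esub> \<ominus>\<^bsub>M\<^esub> y \<in> N"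
proof
  assume "N +>\<^bsub>M\<^esub> x = N +>\<^bsub>M\<^esub> y"
  then show "x \<oplus>\<^bsub>M\<^esub> \<ominus>\<^bsub>M\<^esub> y \<in> N"
    using coset_self[OF assms(1)] mem_coset_iff[OF assms(2)] by blast
next
  assume "x \<oplus>\<^bsub>M\<^esub> \<ominus>\<^bsub>M\<^esub> y \<in> N"
  then have "x \<in> N +>\<^bsub>M\<^esub> y" using mem_coset_iff[OF assms(2)] assms(1) by blast
  then show "N +>\<^bsub>M\<^esub> x = N +>\<^bsub>M\<^esub> y"
    using M.a_repr_independence'[of x N y] assms sub
    by (simp add: submodule_def a_r_coset_def)
qed

lemma carrier_quot: "carrier (quot_module M N) = (\<lambda>x. N +>\<^bsub>M\<^esub> x) ` carrier M"
  by (auto simp: quot_module_def A_RCOSETS_def')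

lemma add_quot:
  assumes "x \<in> carrier M" "y \<in> carrier M"
  shows "(N +>\<^bsub>M\<^esub> x) \<oplus>\<^bsub>quot_module M N\<^esub> (N +>\<^bsub>M\<^esub> y) = N +>\<^bsub>M\<^esub> (x \<oplus>\<^bsub>M\<^esub> y)"
  using abelian_subgroup.a_rcos_sum[OF abelian_subgroup assms] by (simp add: quot_module_def)

text \<open>\<open>quot_module\<close> forms a union over all representatives; here it turns out to
  be a union of equal cosets over a nonempty index set.\<close>

lemma smult_quot:
  assumes "a \<in> carrier k" "x \<in> carrier M"
  shows "a \<odot>\<^bsub>quot_module M N\<^esub> (N +>\<^bsub>M\<^esub> x) = N +>\<^bsub>M\<^esub> (a \<odot>\<^bsub>M\<^esub> x)"
proof -
  have "N +>\<^bsub>M\<^esub> (a \<odot>\<^bsub>M\<^esub> u) = N +>\<^bsub>M\<^esub> (a \<odot>\<^bsub>M\<^esub> x)" if "u \<in> N +>\<^bsub>M\<^esub> x" for u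
  proof -
    have u: "u \<in> carrier M" "u \<oplus>\<^bsub>M\<^esub> \<ominus>\<^bsub>M\<^esub> x \<in> N" using that assms(2) by (auto simp: mem_coset_iff)
    have "a \<odot>\<^bsub>M\<^esub> u \<oplus>\<^bsub>M\<^esub> \<ominus>\<^bsub>M\<^esub> (a \<odot>\<^bsub>M\<^esub> x) = a \<odot>\<^bsub>M\<^esub> (u \<oplus>\<^bsub>M\<^esub> \<ominus>\<^bsub>M\<^esub> x)"
      using u assms by (simp add: smult_r_distr smult_r_minus)
    then show ?thesis
      using submodule_memD(4)[OF sub assms(1) u(2)] u assms by (simp add: coset_eq_iff)
  qed
  then have "(\<Union>u\<in>N +>\<^bsub>M\<^esub> x. N +>\<^bsub>M\<^esub> (a \<odot>\<^bsub>M\<^esub> u)) = (\<Union>u\<in>N +>\<^bsub>M\<^esub> x. N +>\<^bsub>M\<^esub> (a \<odot>\<^bsub>M\<^esub> x))"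
    by (rule SUP_cong[OF refl])
  also have "\<dots> = N +>\<^bsub>M\<^esub> (a \<odot>\<^bsub>M\<^esub> x)"
    using coset_self[OF assms(2)] by blast
  finally show ?thesis by (simp add: quot_module_def)
qed

lemma zero_quot: "\<zero>\<^bsub>quot_module M N\<^esub> = N +>\<^bsub>M\<^esub> \<zero>\<^bsub>M\<^esub>"
  using submodule_memD(1)[OF sub] by (auto simp: quot_module_def a_r_coset_def')

lemma module_quot: "module k (quot_module M N)"
proof (rule moduleI)
  show "abelian_group (quot_module M N)"
  proof (rule abelian_groupI)
    fix x assume "x \<in> carrier (quot_module M N)"
    then obtain a where "a \<in> carrier M" "x = N +>\<^bsub>M\<^esub> a" by (auto simp: carrier_quot)
    then show "\<exists>y\<in>carrier (quot_module M N). y \<oplus>\<^bsub>quot_module M N\<^esub> x = \<zero>\<^bsub>quot_module M N\<^esub>"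
      by (auto simp: carrier_quot add_quot zero_quot M.l_neg intro!: bexI[of _ "\<ominus>\<^bsub>M\<^esub> a"])
  next
    fix x y assume "x \<in> carrier (quot_module M N)" "y \<in> carrier (quot_module M N)"
    then show "x \<oplus>\<^bsub>quot_module M N\<^esub> y = y \<oplus>\<^bsub>quot_module M N\<^esub> x"
      by (auto simp: carrier_quot add_quot M.a_comm)
  qed (auto simp: carrier_quot add_quot zero_quot M.a_assoc)
qed (auto simp: carrier_quot add_quot smult_quot smult_l_distr smult_r_distr smult_assoc1
      R.cring_axioms)

lemma linear_map_coset: "linear_map k M (quot_module M N) (\<lambda>x. N +>\<^bsub>M\<^esub> x)"
  by (rule linear_mapI) (simp_all add: carrier_quot add_quot smult_quot)

end

section \<open>Injective cogenerators: Baer's criterion and annihilators\<close>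

locale injective_cogenerator = Q: module k Q
  for k :: "'r ring" and Q :: "('r, 'q) module" +
  assumes injective: "injective_module k Q" and cogen: "cogenerator k Q"
begin

text \<open>Singletons of constant sequences embed \<open>I\<close> and \<open>k\<close> into the
  type of test modules, where \<open>injective_module\<close> applies; \<open>q\<close> is the value
  at 1 of the extension to \<open>k\<close>.\<close>

lemma baer:
  assumes "ideal I k" "linear_map k ((regular_module k)\<lparr>carrier := I\<rparr>) Q g"
  shows "\<exists>q\<in>carrier Q. \<forall>a\<in>I. g a = a \<odot>\<^bsub>Q\<^esub> q"
proof -
  let ?K = "regular_module k"
  let ?I = "?K\<lparr>carrier := I\<rparr>"
  interpret I: ideal I k by fact
  interpret K: module k ?K by (rule module_regular) (rule Q.R.cring_axioms)
  define e :: "'r \<Rightarrow> (nat \<Rightarrow> 'r) set" where "e a = {\<lambda>_. a}" for a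
  have e: "inj_on e S" for S by (rule inj_onI) (auto simp: e_def fun_eq_iff)
  have I: "module k ?I"
    using assms(1) ideal_iff_submodule[OF Q.R.cring_axioms] K.module_axioms
    by (simp add: submodule.submodule_is_module)
  let ?A = "transport_module e ?I" and ?B = "transport_module e ?K"
  note A = transport_module[OF I e] and B = transport_module[OF K.module_axioms e]
  let ?f = "\<lambda>u. e (inv_into (carrier ?I) e u)"
  have inc: "linear_map k ?I ?K (\<lambda>x. x)"
    by (rule linear_mapI) (auto simp: I.Icarr)
  have fid: "?f u = u" if "u \<in> carrier ?A" for u
    using that by (auto simp: transport_module_def f_inv_into_f)
  have "linear_map k ?A ?B ?f"
    using linear_map_comp[OF linear_map_comp[OF A(3) inc] B(2)] .
  moreover have "inj_on ?f (carrier ?A)" by (rule inj_onI) (metis fid)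
  moreover have "linear_map k ?A Q (\<lambda>u. g (inv_into (carrier ?I) e u))"
    by (rule linear_map_comp[OF A(3) assms(2)])
  ultimately obtain h where h: "linear_map k ?B Q h"
    "\<forall>x\<in>carrier ?A. h (?f x) = g (inv_into (carrier ?I) e x)"
    using injective A(1) B(1) unfolding injective_module_def by blast
  have he: "linear_map k ?K Q (\<lambda>x. h (e x))" by (rule linear_map_comp[OF B(2) h(1)])
  show ?thesis
  proof (intro bexI[of _ "h (e \<one>\<^bsub>k\<^esub>)"] ballI)
    show "h (e \<one>\<^bsub>k\<^esub>) \<in> carrier Q" using linear_map_closed[OF he, of "\<one>\<^bsub>k\<^esub>"] by simp
    fix a assume a: "a \<in> I"
    then have "e a \<in> carrier ?A" by (simp add: transport_module_def)
    then have "g (inv_into I e (e a)) = h (e a)" using h(2) fid by simp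
    moreover have "inv_into I e (e a) = a" using a e by simp
    moreover have "h (e (a \<otimes>\<^bsub>k\<^esub> \<one>\<^bsub>k\<^esub>)) = a \<odot>\<^bsub>Q\<^esub> h (e \<one>\<^bsub>k\<^esub>)"
      using linear_map_smult[OF he, of a "\<one>\<^bsub>k\<^esub>"] a I.Icarr by simp
    ultimately show "g a = a \<odot>\<^bsub>Q\<^esub> h (e \<one>\<^bsub>k\<^esub>)" using a I.Icarr by simp
  qed
qed

text \<open>The quotient of \<open>k\<close> by \<open>I\<close> is a nonzero cyclic module, so some
  functional into \<open>Q\<close> does not kill the class of 1; its value there is
  \<open>q\<close>.\<close>

lemma annihilated_by_proper_ideal:
  assumes "ideal I k" "\<one>\<^bsub>k\<^esub> \<notin> I"
  shows "\<exists>q\<in>carrier Q. q \<noteq> \<zero>\<^bsub>Q\<^esub> \<and> (\<forall>a\<in>I. a \<odot>\<^bsub>Q\<^esub> q = \<zero>\<^bsub>Q\<^esub>)"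
proof -
  let ?K = "regular_module k"
  interpret I: ideal I k by fact
  interpret K: module k ?K by (rule module_regular) (rule Q.R.cring_axioms)
  interpret N: quotient_module k ?K I
    using assms(1) ideal_iff_submodule[OF Q.R.cring_axioms]
    by (intro quotient_module.intro quotient_module_axioms.intro K.module_axioms) simp
  \<comment> \<open>A coset becomes the set of constant sequences with values in it; evaluation at 0
    recovers the coset, so \<open>e\<close> is injective.\<close>
  define e :: "'r set \<Rightarrow> (nat \<Rightarrow> 'r) set" where "e U = (\<lambda>a _. a) ` U" for U
  have "inj e"
  proof (rule injI)
    fix U V assume "e U = e V"
    then have "(\<lambda>f. f 0) ` e U = (\<lambda>f. f 0) ` e V" by simp
    then show "U = V" by (simp add: e_def image_image)
  qed
  then have e: "inj_on e S" for S by (rule inj_on_subset) simp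
  note A = transport_module[OF N.module_quot e]
  let ?A = "transport_module e (quot_module ?K I)"
  define c where "c a = e (I +>\<^bsub>?K\<^esub> a)" for a
  have c: "linear_map k ?K ?A c"
    unfolding c_def by (rule linear_map_comp[OF N.linear_map_coset A(2)])
  have n0: "\<ominus>\<^bsub>?K\<^esub> \<zero>\<^bsub>k\<^esub> = \<zero>\<^bsub>k\<^esub>"
    using K.M.r_neg[OF K.M.zero_closed] K.M.l_zero[OF K.M.a_inv_closed[OF K.M.zero_closed]] by simp
  have "\<not> \<one>\<^bsub>k\<^esub> \<oplus>\<^bsub>?K\<^esub> \<ominus>\<^bsub>?K\<^esub> \<zero>\<^bsub>?K\<^esub> \<in> I"
    using assms(2) n0 by simp
  then have "c \<one>\<^bsub>k\<^esub> \<noteq> c \<zero>\<^bsub>k\<^esub>"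
    using N.coset_eq_iff[of "\<one>\<^bsub>k\<^esub>" "\<zero>\<^bsub>k\<^esub>"] injD[OF \<open>inj e\<close>] by (auto simp: c_def)
  moreover have "\<zero>\<^bsub>?A\<^esub> = c \<zero>\<^bsub>k\<^esub>" by (simp add: transport_module_def c_def N.zero_quot)
  ultimately have "c \<one>\<^bsub>k\<^esub> \<noteq> \<zero>\<^bsub>?A\<^esub>" by simp
  moreover have "c \<one>\<^bsub>k\<^esub> \<in> carrier ?A" using linear_map_closed[OF c, of "\<one>\<^bsub>k\<^esub>"] by simp
  ultimately obtain f where f: "linear_map k ?A Q f" "f (c \<one>\<^bsub>k\<^esub>) \<noteq> \<zero>\<^bsub>Q\<^esub>"
    using cogen A(1) unfolding cogenerator_def by blast
  have fc: "linear_map k ?K Q (\<lambda>a. f (c a))" by (rule linear_map_comp[OF c f(1)])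
  have "a \<odot>\<^bsub>Q\<^esub> f (c \<one>\<^bsub>k\<^esub>) = \<zero>\<^bsub>Q\<^esub>" if a: "a \<in> I" for a
  proof -
    have "a \<oplus>\<^bsub>?K\<^esub> \<ominus>\<^bsub>?K\<^esub> \<zero>\<^bsub>?K\<^esub> \<in> I"
      using a n0 by (simp add: I.Icarr)
    then have "c a = c \<zero>\<^bsub>k\<^esub>"
      using N.coset_eq_iff[of a "\<zero>\<^bsub>k\<^esub>"] a by (auto simp: c_def I.Icarr)
    then show ?thesis
      using linear_map_smult[OF fc, of a "\<one>\<^bsub>k\<^esub>"] a
        linear_map_zero[OF K.module_axioms Q.module_axioms fc] by (simp add: I.Icarr)
  qed
  then show ?thesis using f(2) linear_map_closed[OF fc, of "\<one>\<^bsub>k\<^esub>"] by auto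
qed

end

section \<open>Partial linear maps, their extension by Zorn's lemma, separating functionals\<close>

definition linear_graph :: "'r ring \<Rightarrow> ('r, 'a) module \<Rightarrow> ('r, 'q) module \<Rightarrow> ('a \<times> 'q) set \<Rightarrow> bool" where
  "linear_graph k M Q G \<longleftrightarrow> G \<subseteq> carrier M \<times> carrier Q \<and> (\<zero>\<^bsub>M\<^esub>, \<zero>\<^bsub>Q\<^esub>) \<in> G \<and>
     (\<forall>x y u v. (x, u) \<in> G \<longrightarrow> (y, v) \<in> G \<longrightarrow> (x \<oplus>\<^bsub>M\<^esub> y, u \<oplus>\<^bsub>Q\<^esub> v) \<in> G) \<and>
     (\<forall>a\<in>carrier k. \<forall>x u. (x, u) \<in> G \<longrightarrow> (a \<odot>\<^bsub>M\<^esub> x, a \<odot>\<^bsub>Q\<^esub> u) \<in> G) \<and>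
     (\<forall>u. (\<zero>\<^bsub>M\<^esub>, u) \<in> G \<longrightarrow> u = \<zero>\<^bsub>Q\<^esub>)"

lemma linear_graphD:
  assumes "linear_graph k M Q G"
  shows "(x, u) \<in> G \<Longrightarrow> x \<in> carrier M" "(x, u) \<in> G \<Longrightarrow> u \<in> carrier Q"
    "(\<zero>\<^bsub>M\<^esub>, \<zero>\<^bsub>Q\<^esub>) \<in> G"
    "(x, u) \<in> G \<Longrightarrow> (y, v) \<in> G \<Longrightarrow> (x \<oplus>\<^bsub>M\<^esub> y, u \<oplus>\<^bsub>Q\<^esub> v) \<in> G"
    "a \<in> carrier k \<Longrightarrow> (x, u) \<in> G \<Longrightarrow> (a \<odot>\<^bsub>M\<^esub> x, a \<odot>\<^bsub>Q\<^esub> u) \<in> G"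
    "(\<zero>\<^bsub>M\<^esub>, u) \<in> G \<Longrightarrow> u = \<zero>\<^bsub>Q\<^esub>"
  using assms unfolding linear_graph_def by (blast+)

lemma linear_graph_neg:
  assumes "module k M" "module k Q" "linear_graph k M Q G" "(x, u) \<in> G"
  shows "(\<ominus>\<^bsub>M\<^esub> x, \<ominus>\<^bsub>Q\<^esub> u) \<in> G"
proof -
  interpret M: module k M by fact
  interpret Q: module k Q by fact
  have "((\<ominus>\<^bsub>k\<^esub> \<one>\<^bsub>k\<^esub>) \<odot>\<^bsub>M\<^esub> x, (\<ominus>\<^bsub>k\<^esub> \<one>\<^bsub>k\<^esub>) \<odot>\<^bsub>Q\<^esub> u) \<in> G"
    by (rule linear_graphD(5)[OF assms(3) _ assms(4)]) simp
  then show ?thesis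
    using linear_graphD(1,2)[OF assms(3,4)] by (simp add: M.smult_minus_one Q.smult_minus_one)
qed

lemma linear_graph_unique:
  assumes "module k M" "module k Q" "linear_graph k M Q G" "(x, u) \<in> G" "(x, v) \<in> G"
  shows "u = v"
proof -
  interpret M: module k M by fact
  interpret Q: module k Q by fact
  note G = linear_graphD[OF assms(3)]
  have "(x \<oplus>\<^bsub>M\<^esub> \<ominus>\<^bsub>M\<^esub> x, u \<oplus>\<^bsub>Q\<^esub> \<ominus>\<^bsub>Q\<^esub> v) \<in> G"
    using G(4) assms(4) linear_graph_neg[OF assms(1-3,5)] by blast
  then have "u \<oplus>\<^bsub>Q\<^esub> \<ominus>\<^bsub>Q\<^esub> v = \<zero>\<^bsub>Q\<^esub>"
    using G(6) G(1)[OF assms(4)] by (simp add: M.r_neg)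
  then show ?thesis using G(2)[OF assms(4)] G(2)[OF assms(5)]
    by (metis Q.M.add.inv_closed Q.M.minus_equality Q.M.minus_minus)
qed

text \<open>Partial linear maps are represented by their graphs, so that extension is inclusion and
  the union of a chain is an upper bound. A maximal graph is total: at any point \<open>x\<close>,
  Baer's criterion supplies a value that can be adjoined.\<close>

lemma (in injective_cogenerator) extend_graph:
  fixes M :: "('r, 'a) module"
  assumes M: "module k M" and lgF: "linear_graph k M Q F"
  shows "\<exists>h. linear_map k M Q h \<and> (\<forall>x u. (x, u) \<in> F \<longrightarrow> h x = u)"
proof -
  interpret M: module k M by fact
  define S where "S = {G. linear_graph k M Q G \<and> F \<subseteq> G}"
  have "S \<noteq> {}" using lgF by (auto simp: S_def)
  moreover have "\<Union>\<C> \<in> S" if "\<C> \<noteq> {}" "subset.chain S \<C>" for \<C>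
  proof -
    have lg: "linear_graph k M Q G" "F \<subseteq> G" if "G \<in> \<C>" for G
      using that \<open>subset.chain S \<C>\<close> by (auto simp: subset.chain_def S_def)
    \<comment> \<open>Two elements of the union lie in one member of the chain, which is what
      closure under addition requires.\<close>
    have two: "\<exists>G\<in>\<C>. p \<in> G \<and> r \<in> G" if pr: "p \<in> \<Union>\<C>" "r \<in> \<Union>\<C>" for p r
    proof -
      obtain G1 G2 where G: "G1 \<in> \<C>" "G2 \<in> \<C>" "p \<in> G1" "r \<in> G2" using pr by blast
      then have "G1 \<subseteq> G2 \<or> G2 \<subseteq> G1"
        using \<open>subset.chain S \<C>\<close> by (auto simp: subset.chain_def)
      then show ?thesis using G by blast
    qed
    have "linear_graph k M Q (\<Union>\<C>)"
      unfolding linear_graph_def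
    proof (intro conjI allI impI ballI)
      show "\<Union>\<C> \<subseteq> carrier M \<times> carrier Q" using linear_graphD(1,2)[OF lg(1)] by auto
      show "(\<zero>\<^bsub>M\<^esub>, \<zero>\<^bsub>Q\<^esub>) \<in> \<Union>\<C>" using linear_graphD(3)[OF lg(1)] \<open>\<C> \<noteq> {}\<close> by blast
      show "u = \<zero>\<^bsub>Q\<^esub>" if "(\<zero>\<^bsub>M\<^esub>, u) \<in> \<Union>\<C>" for u using linear_graphD(6)[OF lg(1)] that by blast
      show "(a \<odot>\<^bsub>M\<^esub> x, a \<odot>\<^bsub>Q\<^esub> u) \<in> \<Union>\<C>" if "a \<in> carrier k" "(x, u) \<in> \<Union>\<C>" for a x u
        using linear_graphD(5)[OF lg(1)] that by blast
      show "(x \<oplus>\<^bsub>M\<^esub> y, u \<oplus>\<^bsub>Q\<^esub> v) \<in> \<Union>\<C>" if "(x, u) \<in> \<Union>\<C>" "(y, v) \<in> \<Union>\<C>" for x y u v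
        using two[OF that] linear_graphD(4)[OF lg(1)] by blast
    qed
    then show ?thesis using lg(2) \<open>\<C> \<noteq> {}\<close> by (auto simp: S_def)
  qed
  ultimately obtain G where "G \<in> S" and max: "\<And>G'. G' \<in> S \<Longrightarrow> G \<subseteq> G' \<Longrightarrow> G' = G"
    using subset_Zorn_nonempty[of S] by metis
  then have lg: "linear_graph k M Q G" and FG: "F \<subseteq> G" by (auto simp: S_def)
  note G = linear_graphD[OF lg] and uniq = linear_graph_unique[OF M Q.module_axioms lg]
    and neg = linear_graph_neg[OF M Q.module_axioms lg]
  have total: "\<exists>u. (x, u) \<in> G" if x: "x \<in> carrier M" for x
  proof -
    \<comment> \<open>The ideal of scalars that move \<open>x\<close> into the domain of
      \<open>G\<close>. On it, \<open>a\<close> goes to the value of \<open>G\<close> at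
      \<open>a x\<close>; Baer's criterion makes this map multiplication on some \<open>q\<close>,
      which becomes the value at \<open>x\<close>.\<close>
    define I where "I = {a \<in> carrier k. \<exists>u. (a \<odot>\<^bsub>M\<^esub> x, u) \<in> G}"
    define l where "l a = (THE u. (a \<odot>\<^bsub>M\<^esub> x, u) \<in> G)" for a
    have l: "l a = u" if "(a \<odot>\<^bsub>M\<^esub> x, u) \<in> G" for a u
      unfolding l_def using that uniq by blast
    have lI: "(a \<odot>\<^bsub>M\<^esub> x, l a) \<in> G" "a \<in> carrier k" if "a \<in> I" for a
      using that l by (auto simp: I_def)
    have add: "((a \<oplus>\<^bsub>k\<^esub> b) \<odot>\<^bsub>M\<^esub> x, l a \<oplus>\<^bsub>Q\<^esub> l b) \<in> G" if "a \<in> I" "b \<in> I" for a b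
      using G(4)[OF lI(1)[OF that(1)] lI(1)[OF that(2)]] lI(2) that x by (simp add: M.smult_l_distr)
    have mul: "((a \<otimes>\<^bsub>k\<^esub> b) \<odot>\<^bsub>M\<^esub> x, a \<odot>\<^bsub>Q\<^esub> l b) \<in> G" if "a \<in> carrier k" "b \<in> I" for a b
      using G(5)[OF that(1) lI(1)[OF that(2)]] lI(2) that x by (simp add: M.smult_assoc1)
    have "ideal I k"
    proof (rule idealI_cring[OF Q.R.cring_axioms])
      show "\<zero>\<^bsub>k\<^esub> \<in> I" using G(3) x by (auto simp: I_def)
      show "a \<oplus>\<^bsub>k\<^esub> b \<in> I" if "a \<in> I" "b \<in> I" for a b
        using add[OF that] lI(2)[OF that(1)] lI(2)[OF that(2)] by (auto simp: I_def)
      show "a \<otimes>\<^bsub>k\<^esub> b \<in> I" if "a \<in> carrier k" "b \<in> I" for a b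
        using mul[OF that] lI(2)[OF that(2)] that(1) by (auto simp: I_def)
    qed (auto simp: I_def)
    moreover have "linear_map k ((regular_module k)\<lparr>carrier := I\<rparr>) Q l"
      by (rule linear_mapI) (auto simp: l[OF add] l[OF mul] G(2)[OF lI(1)])
    ultimately obtain q where q: "q \<in> carrier Q" "\<And>a. a \<in> I \<Longrightarrow> l a = a \<odot>\<^bsub>Q\<^esub> q"
      using baer by blast
    define G' where "G' = {(y \<oplus>\<^bsub>M\<^esub> a \<odot>\<^bsub>M\<^esub> x, u \<oplus>\<^bsub>Q\<^esub> a \<odot>\<^bsub>Q\<^esub> q) | y u a. (y, u) \<in> G \<and> a \<in> carrier k}"
    have G'I: "(y', u') \<in> G'" if "(y, u) \<in> G" "a \<in> carrier k" "y' = y \<oplus>\<^bsub>M\<^esub> a \<odot>\<^bsub>M\<^esub> x"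
      "u' = u \<oplus>\<^bsub>Q\<^esub> a \<odot>\<^bsub>Q\<^esub> q" for y u a y' u'
      using that unfolding G'_def by blast
    have GG': "G \<subseteq> G'"
    proof clarify
      fix y u assume "(y, u) \<in> G"
      then show "(y, u) \<in> G'"
        using G(1,2) x q(1) by (intro G'I[of y u "\<zero>\<^bsub>k\<^esub>"]) auto
    qed
    have "linear_graph k M Q G'"
      unfolding linear_graph_def
    proof (intro conjI allI impI ballI)
      show "G' \<subseteq> carrier M \<times> carrier Q" using G(1,2) x q(1) by (auto simp: G'_def)
      show "(\<zero>\<^bsub>M\<^esub>, \<zero>\<^bsub>Q\<^esub>) \<in> G'" using GG' G(3) by blast
      fix y y' u u'
      assume "(y, u) \<in> G'"
      then obtain z v a where 1: "(z, v) \<in> G" "a \<in> carrier k" "y = z \<oplus>\<^bsub>M\<^esub> a \<odot>\<^bsub>M\<^esub> x" "u = v \<oplus>\<^bsub>Q\<^esub> a \<odot>\<^bsub>Q\<^esub> q"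
        unfolding G'_def by blast
      note c1 = G(1,2)[OF 1(1)]
      {
        assume "(y', u') \<in> G'"
        then obtain z' v' a' where 2: "(z', v') \<in> G" "a' \<in> carrier k" "y' = z' \<oplus>\<^bsub>M\<^esub> a' \<odot>\<^bsub>M\<^esub> x"
          "u' = v' \<oplus>\<^bsub>Q\<^esub> a' \<odot>\<^bsub>Q\<^esub> q"
          unfolding G'_def by blast
        note c2 = G(1,2)[OF 2(1)]
        show "(y \<oplus>\<^bsub>M\<^esub> y', u \<oplus>\<^bsub>Q\<^esub> u') \<in> G'"
          by (rule G'I[OF G(4)[OF 1(1) 2(1)], of "a \<oplus>\<^bsub>k\<^esub> a'"])
            (use 1 2 c1 c2 x q(1) in \<open>auto simp: M.smult_l_distr Q.smult_l_distr M.M.add.m_ac Q.M.add.m_ac\<close>)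
      }
      fix b assume b: "b \<in> carrier k"
      show "(b \<odot>\<^bsub>M\<^esub> y, b \<odot>\<^bsub>Q\<^esub> u) \<in> G'"
        by (rule G'I[OF G(5)[OF b 1(1)], of "b \<otimes>\<^bsub>k\<^esub> a"])
          (use 1 b c1 x q(1) in \<open>auto simp: M.smult_r_distr Q.smult_r_distr M.smult_assoc1 Q.smult_assoc1\<close>)
    next
      fix u assume "(\<zero>\<^bsub>M\<^esub>, u) \<in> G'"
      then obtain z v a where 1: "(z, v) \<in> G" "a \<in> carrier k" "\<zero>\<^bsub>M\<^esub> = z \<oplus>\<^bsub>M\<^esub> a \<odot>\<^bsub>M\<^esub> x" "u = v \<oplus>\<^bsub>Q\<^esub> a \<odot>\<^bsub>Q\<^esub> q"
        unfolding G'_def by blast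
      note c1 = G(1,2)[OF 1(1)]
      \<comment> \<open>Single-valuedness is where the choice of \<open>q\<close> enters:
        \<open>a x\<close> already lies in the domain of \<open>G\<close> with value
        \<open>- v\<close>, and that value is \<open>a q\<close>.\<close>
      have "a \<odot>\<^bsub>M\<^esub> x = \<ominus>\<^bsub>M\<^esub> z"
        using 1(2,3) c1 x by (metis M.M.add.m_comm M.M.minus_equality M.smult_closed)
      then have *: "(a \<odot>\<^bsub>M\<^esub> x, \<ominus>\<^bsub>Q\<^esub> v) \<in> G" using neg[OF 1(1)] by simp
      then have "a \<in> I" using 1(2) by (auto simp: I_def)
      then have "a \<odot>\<^bsub>Q\<^esub> q = \<ominus>\<^bsub>Q\<^esub> v" using q(2) l[OF *] by simp
      then show "u = \<zero>\<^bsub>Q\<^esub>" using 1(4) c1 by (simp add: Q.M.r_neg)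
    qed
    then have "G' = G" using max GG' FG by (auto simp: S_def)
    moreover have "(x, q) \<in> G'"
      using x q(1) by (intro G'I[OF G(3), of "\<one>\<^bsub>k\<^esub>"]) auto
    ultimately show ?thesis by blast
  qed
  define h where "h x = (THE u. (x, u) \<in> G)" for x
  have h: "h x = u" if "(x, u) \<in> G" for x u
    unfolding h_def using that uniq by blast
  have hx: "(x, h x) \<in> G" if "x \<in> carrier M" for x
    using total[OF that] h by blast
  have "linear_map k M Q h"
    by (rule linear_mapI) (simp_all add: G(2)[OF hx] h[OF G(4)[OF hx hx]] h[OF G(5)[OF _ hx]])
  moreover have "\<forall>x u. (x, u) \<in> F \<longrightarrow> h x = u" using FG h by blast
  ultimately show ?thesis by blast
qed


text \<open>The pairs \<open>(b x, l x)\<close> form a single-valued graph because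
  \<open>b x = 0\<close> forces \<open>l x = 0\<close>. Thus \<open>l\<close> factors through
  \<open>b\<close> even when \<open>b\<close> has a kernel.\<close>

lemma (in injective_cogenerator) extend_along:
  fixes M :: "('r, 'a) module" and P :: "('r, 'b) module"
  assumes M: "module k M" and P: "module k P"
    and b: "linear_map k P M b" and l: "linear_map k P Q l"
    and ker: "\<And>x. x \<in> carrier P \<Longrightarrow> b x = \<zero>\<^bsub>M\<^esub> \<Longrightarrow> l x = \<zero>\<^bsub>Q\<^esub>"
  shows "\<exists>h. linear_map k M Q h \<and> (\<forall>x\<in>carrier P. h (b x) = l x)"
proof -
  interpret P: module k P by fact
  have "linear_graph k M Q ((\<lambda>x. (b x, l x)) ` carrier P)"
    unfolding linear_graph_def
  proof (intro conjI allI impI ballI)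
    show "(\<zero>\<^bsub>M\<^esub>, \<zero>\<^bsub>Q\<^esub>) \<in> (\<lambda>x. (b x, l x)) ` carrier P"
      using linear_map_zero[OF P M b] linear_map_zero[OF P Q.module_axioms l] by force
    show "(x \<oplus>\<^bsub>M\<^esub> y, u \<oplus>\<^bsub>Q\<^esub> v) \<in> (\<lambda>x. (b x, l x)) ` carrier P"
      if "(x, u) \<in> (\<lambda>x. (b x, l x)) ` carrier P" "(y, v) \<in> (\<lambda>x. (b x, l x)) ` carrier P" for x y u v
    proof -
      obtain s t where "s \<in> carrier P" "t \<in> carrier P" "x = b s" "u = l s" "y = b t" "v = l t"
        using \<open>(x, u) \<in> _\<close> \<open>(y, v) \<in> _\<close> by auto
      then show ?thesis
        by (intro image_eqI[of _ _ "s \<oplus>\<^bsub>P\<^esub> t"]) (simp_all add: linear_map_add[OF b] linear_map_add[OF l])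
    qed
    show "(a \<odot>\<^bsub>M\<^esub> x, a \<odot>\<^bsub>Q\<^esub> u) \<in> (\<lambda>x. (b x, l x)) ` carrier P"
      if "a \<in> carrier k" "(x, u) \<in> (\<lambda>x. (b x, l x)) ` carrier P" for a x u
    proof -
      obtain s where "s \<in> carrier P" "x = b s" "u = l s" using \<open>(x, u) \<in> _\<close> by auto
      then show ?thesis
        using that(1) by (intro image_eqI[of _ _ "a \<odot>\<^bsub>P\<^esub> s"]) (simp_all add: linear_map_smult[OF b] linear_map_smult[OF l])
    qed
  qed (use ker in \<open>auto simp: linear_map_closed[OF b] linear_map_closed[OF l]\<close>)
  from extend_graph[OF M this] show ?thesis by blast
qed

lemma linear_map_smult_const:
  assumes "module k M" "x \<in> carrier M"
  shows "linear_map k (regular_module k) M (\<lambda>a. a \<odot>\<^bsub>M\<^esub> x)"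
proof -
  interpret M: module k M by fact
  show ?thesis
    by (rule linear_mapI) (simp_all add: assms M.smult_l_distr M.smult_assoc1)
qed

text \<open>If \<open>I\<close> is the annihilator of \<open>x\<close> and \<open>q\<close> a
  nonzero element of \<open>Q\<close> killed by \<open>I\<close>, then sending \<open>a x\<close> to
  \<open>a q\<close> is well defined and extends to \<open>M\<close>. In contrast to
  \<open>cogenerator\<close>, this covers modules on every type.\<close>

lemma (in injective_cogenerator) separating_functional:
  fixes M :: "('r, 'a) module"
  assumes M: "module k M" and x: "x \<in> carrier M" "x \<noteq> \<zero>\<^bsub>M\<^esub>"
  shows "\<exists>h. linear_map k M Q h \<and> h x \<noteq> \<zero>\<^bsub>Q\<^esub>"
proof -
  interpret M: module k M by fact
  define I where "I = {a \<in> carrier k. a \<odot>\<^bsub>M\<^esub> x = \<zero>\<^bsub>M\<^esub>}"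
  have "ideal I k"
    by (rule idealI_cring[OF Q.R.cring_axioms])
      (use x in \<open>auto simp: I_def M.smult_l_distr M.smult_assoc1\<close>)
  moreover have "\<one>\<^bsub>k\<^esub> \<notin> I" using x by (simp add: I_def)
  ultimately obtain q where q: "q \<in> carrier Q" "q \<noteq> \<zero>\<^bsub>Q\<^esub>" "\<forall>a\<in>I. a \<odot>\<^bsub>Q\<^esub> q = \<zero>\<^bsub>Q\<^esub>"
    using annihilated_by_proper_ideal by blast
  then obtain h where "linear_map k M Q h" "\<forall>a\<in>carrier k. h (a \<odot>\<^bsub>M\<^esub> x) = a \<odot>\<^bsub>Q\<^esub> q"
    using extend_along[OF M module_regular[OF Q.R.cring_axioms] linear_map_smult_const[OF M x(1)]
        linear_map_smult_const[OF Q.module_axioms q(1)]]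
    by (auto simp: I_def)
  moreover have "h (\<one>\<^bsub>k\<^esub> \<odot>\<^bsub>M\<^esub> x) = \<one>\<^bsub>k\<^esub> \<odot>\<^bsub>Q\<^esub> q" using calculation by blast
  ultimately show ?thesis using q x by auto
qed

text \<open>Zorn's lemma for submodules that contain \<open>L\<close> and meet \<open>K\<close> only
  in 0. Maximality is applied in the form that every properly larger submodule meets
  \<open>K\<close> in a nonzero element.\<close>

lemma maximal_complement:
  assumes M: "module k M" and L: "submodule L k M" and LK: "L \<inter> K = {\<zero>\<^bsub>M\<^esub>}"
  obtains N where "submodule N k M" "L \<subseteq> N" "N \<inter> K = {\<zero>\<^bsub>M\<^esub>}"
    "\<And>N'. submodule N' k M \<Longrightarrow> N \<subseteq> N' \<Longrightarrow> N' \<inter> K = {\<zero>\<^bsub>M\<^esub>} \<Longrightarrow> N' = N"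
proof -
  interpret M: module k M by fact
  define S where "S = {N. submodule N k M \<and> L \<subseteq> N \<and> N \<inter> K = {\<zero>\<^bsub>M\<^esub>}}"
  have "S \<noteq> {}" using L LK by (auto simp: S_def)
  moreover have "\<Union>\<C> \<in> S" if "\<C> \<noteq> {}" "subset.chain S \<C>" for \<C>
  proof -
    have N: "submodule N k M" "L \<subseteq> N" "N \<inter> K = {\<zero>\<^bsub>M\<^esub>}" if "N \<in> \<C>" for N
      using that \<open>subset.chain S \<C>\<close> by (auto simp: subset.chain_def S_def)
    have two: "\<exists>G\<in>\<C>. p \<in> G \<and> r \<in> G" if pr: "p \<in> \<Union>\<C>" "r \<in> \<Union>\<C>" for p r
    proof -
      obtain G1 G2 where G: "G1 \<in> \<C>" "G2 \<in> \<C>" "p \<in> G1" "r \<in> G2" using pr by blast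
      then have "G1 \<subseteq> G2 \<or> G2 \<subseteq> G1"
        using \<open>subset.chain S \<C>\<close> by (auto simp: subset.chain_def)
      then show ?thesis using G by blast
    qed
    have "submodule (\<Union>\<C>) k M"
    proof (rule M.submoduleI')
      show "\<Union>\<C> \<subseteq> carrier M" using M.submodule_memD(1)[OF N(1)] by blast
      show "\<zero>\<^bsub>M\<^esub> \<in> \<Union>\<C>" using M.submodule_memD(2)[OF N(1)] \<open>\<C> \<noteq> {}\<close> by blast
      show "x \<oplus>\<^bsub>M\<^esub> y \<in> \<Union>\<C>" if "x \<in> \<Union>\<C>" "y \<in> \<Union>\<C>" for x y
        using two[OF that] M.submodule_memD(3)[OF N(1)] by blast
      show "a \<odot>\<^bsub>M\<^esub> x \<in> \<Union>\<C>" if "a \<in> carrier k" "x \<in> \<Union>\<C>" for a x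
        using M.submodule_memD(4)[OF N(1)] that by blast
    qed
    moreover have "L \<subseteq> \<Union>\<C>" using N(2) \<open>\<C> \<noteq> {}\<close> by blast
    moreover have "\<Union>\<C> \<inter> K = {\<zero>\<^bsub>M\<^esub>}" using N(3) \<open>\<C> \<noteq> {}\<close> by blast
    ultimately show ?thesis by (simp add: S_def)
  qed
  ultimately obtain N where "N \<in> S" "\<And>N'. N' \<in> S \<Longrightarrow> N \<subseteq> N' \<Longrightarrow> N' = N"
    using subset_Zorn_nonempty[of S] by metis
  then show ?thesis using that[of N] unfolding S_def by (smt (verit) mem_Collect_eq order_trans)
qed

lemma (in module) neg_zero: "\<ominus>\<^bsub>M\<^esub> \<zero>\<^bsub>M\<^esub> = \<zero>\<^bsub>M\<^esub>"
  by (metis M.a_inv_closed M.l_zero M.r_neg M.zero_closed)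

text \<open>The chain condition in \<open>artinian_ring\<close> speaks of sequences; if
  \<open>S\<close> had no minimal member, dependent choice would produce a strictly descending
  one.\<close>

lemma artinian_minimal_ideal:
  assumes "artinian_ring k" "S \<noteq> {}" "\<And>I. I \<in> S \<Longrightarrow> ideal I k"
  obtains (least) I where "I \<in> S" "\<And>J. J \<in> S \<Longrightarrow> J \<subseteq> I \<Longrightarrow> J = I"
proof (rule ccontr)
  assume "\<not> thesis"
  have *: "\<exists>J\<in>S. J \<subset> I" if "I \<in> S" for I
  proof (rule ccontr)
    assume "\<not> ?thesis"
    then have "J = I" if "J \<in> S" "J \<subseteq> I" for J using that by blast
    then show False using least[OF \<open>I \<in> S\<close>] \<open>\<not> thesis\<close> by blast
  qed
  obtain I0 where "I0 \<in> S" using assms(2) by blast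
  then have "\<exists>f. \<forall>n. f n \<in> S \<and> f (Suc n) \<subset> (f n :: 'a set)"
    by (intro dependent_nat_choice) (use * in auto)
  then obtain f where f: "\<And>n. f n \<in> S" "\<And>n. f (Suc n) \<subset> (f n :: 'a set)" by blast
  have desc: "(\<forall>n. ideal (f n) k) \<and> (\<forall>n. f (Suc n) \<subseteq> f n)" using f assms(3) by blast
  have "(\<forall>n. ideal (f n) k) \<and> (\<forall>n. f (Suc n) \<subseteq> f n) \<longrightarrow> (\<exists>n. \<forall>m\<ge>n. f m = f n)"
    using assms(1) unfolding artinian_ring_def by (elim conjE) (erule spec)
  then obtain n where "\<forall>m\<ge>n. f m = f n" using desc by blast
  then have "f (Suc n) = f n" using le_SucI[OF le_refl] by blast
  then show False using f(2)[of n] by blast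
qed

section \<open>The minimal injective cogenerator over an artinian ring\<close>

locale matlis =
  fixes k :: "'r ring" and Q :: "('r, 'q) module"
  assumes artinian: "artinian_ring k" and minimal: "minimal_injective_cogenerator k Q"

sublocale matlis \<subseteq> injective_cogenerator k Q
  using minimal
  by (simp add: injective_cogenerator_def injective_cogenerator_axioms_def
      minimal_injective_cogenerator_def injective_module_def)

context matlis
begin

text \<open>If \<open>x\<close> and \<open>y\<close> spanned distinct isomorphic simple submodules, a maximal complement of the second
  one containing the first would be a proper direct summand and still an injective cogenerator.\<close>

lemma simple_submodule_unique:
  assumes x: "x \<in> carrier Q" "x \<noteq> \<zero>\<^bsub>Q\<^esub>" and y: "y \<in> carrier Q"
    and m: "m \<subseteq> carrier k" "\<And>a. a \<in> m \<Longrightarrow> a \<odot>\<^bsub>Q\<^esub> x = \<zero>\<^bsub>Q\<^esub>" "\<And>a. a \<in> m \<Longrightarrow> a \<odot>\<^bsub>Q\<^esub> y = \<zero>\<^bsub>Q\<^esub>"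
    and max: "\<And>a. a \<in> carrier k \<Longrightarrow> a \<notin> m \<Longrightarrow> \<exists>b\<in>carrier k. \<exists>c\<in>m. b \<otimes>\<^bsub>k\<^esub> a \<oplus>\<^bsub>k\<^esub> c = \<one>\<^bsub>k\<^esub>"
  shows "\<exists>a\<in>carrier k. y = a \<odot>\<^bsub>Q\<^esub> x"
proof (rule ccontr)
  assume contra: "\<not> ?thesis"
  have y0: "y \<noteq> \<zero>\<^bsub>Q\<^esub>" using contra x(1) by (metis Q.R.zero_closed Q.smult_l_null)
  \<comment> \<open>\<open>m\<close> acts as a maximal ideal killing \<open>x\<close> and
    \<open>y\<close>, so every nonzero multiple of either element generates it back: both span
    simple submodules.\<close>
  have gen: "\<exists>b\<in>carrier k. b \<odot>\<^bsub>Q\<^esub> (a \<odot>\<^bsub>Q\<^esub> w) = w"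
    if wa: "w = x \<or> w = y" "a \<in> carrier k" "a \<odot>\<^bsub>Q\<^esub> w \<noteq> \<zero>\<^bsub>Q\<^esub>" for w a
  proof -
    have "a \<notin> m" using wa(1,3) m(2)[of a] m(3)[of a] by auto
    then obtain b c where b: "b \<in> carrier k" "c \<in> m" "b \<otimes>\<^bsub>k\<^esub> a \<oplus>\<^bsub>k\<^esub> c = \<one>\<^bsub>k\<^esub>"
      using max[OF wa(2)] by blast
    have w: "w \<in> carrier Q" using wa x y by auto
    have c: "c \<in> carrier k" using b(2) m(1) by blast
    have "w = (b \<otimes>\<^bsub>k\<^esub> a \<oplus>\<^bsub>k\<^esub> c) \<odot>\<^bsub>Q\<^esub> w" using b w by simp
    also have "\<dots> = b \<odot>\<^bsub>Q\<^esub> (a \<odot>\<^bsub>Q\<^esub> w) \<oplus>\<^bsub>Q\<^esub> c \<odot>\<^bsub>Q\<^esub> w"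
      using b(1) c wa(2) w by (simp add: Q.smult_l_distr Q.smult_assoc1)
    also have "c \<odot>\<^bsub>Q\<^esub> w = \<zero>\<^bsub>Q\<^esub>" using wa(1) m(2)[OF b(2)] m(3)[OF b(2)] by auto
    finally have "b \<odot>\<^bsub>Q\<^esub> (a \<odot>\<^bsub>Q\<^esub> w) = w"
      using b(1) wa(2) w by (metis Q.M.r_zero Q.smult_closed)
    then show ?thesis using b(1) by blast
  qed
  let ?X = "cyclic k Q x" and ?Y = "cyclic k Q y"
  note X = submodule_cyclic[OF Q.module_axioms x(1)] and Y = submodule_cyclic[OF Q.module_axioms y]
  have XY: "?X \<inter> ?Y = {\<zero>\<^bsub>Q\<^esub>}"
  proof -
    have "z = \<zero>\<^bsub>Q\<^esub>" if z: "z \<in> ?X" "z \<in> ?Y" for z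
    proof (rule ccontr)
      assume "z \<noteq> \<zero>\<^bsub>Q\<^esub>"
      obtain a b where ab: "a \<in> carrier k" "b \<in> carrier k" "z = a \<odot>\<^bsub>Q\<^esub> x" "z = b \<odot>\<^bsub>Q\<^esub> y"
        using z by (auto simp: cyclic_def)
      then obtain c where "c \<in> carrier k" "c \<odot>\<^bsub>Q\<^esub> z = y" using gen[of y b] \<open>z \<noteq> _\<close> by auto
      then have "y = (c \<otimes>\<^bsub>k\<^esub> a) \<odot>\<^bsub>Q\<^esub> x" "c \<otimes>\<^bsub>k\<^esub> a \<in> carrier k" using ab x by (auto simp: Q.smult_assoc1)
      then show False using contra by blast
    qed
    then show ?thesis using Q.submodule_memD(2)[OF X(1)] Q.submodule_memD(2)[OF Y(1)] by blast
  qed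
  obtain N where N: "submodule N k Q" "?X \<subseteq> N" "N \<inter> ?Y = {\<zero>\<^bsub>Q\<^esub>}"
    "\<And>N'. submodule N' k Q \<Longrightarrow> N \<subseteq> N' \<Longrightarrow> N' \<inter> ?Y = {\<zero>\<^bsub>Q\<^esub>} \<Longrightarrow> N' = N"
    using maximal_complement[OF Q.module_axioms X(1) XY] by metis
  \<comment> \<open>\<open>K\<close> is in turn maximal against \<open>N\<close>. Both maximality
    properties enter the proof that the projection below has image exactly \<open>N\<close>.\<close>
  obtain K where K: "submodule K k Q" "?Y \<subseteq> K" "K \<inter> N = {\<zero>\<^bsub>Q\<^esub>}"
    "\<And>N'. submodule N' k Q \<Longrightarrow> K \<subseteq> N' \<Longrightarrow> N' \<inter> N = {\<zero>\<^bsub>Q\<^esub>} \<Longrightarrow> N' = K"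
    using maximal_complement[OF Q.module_axioms Y(1), of N] N(3) by (metis inf_commute)
  note Nm = Q.submodule_memD[OF N(1)] and Km = Q.submodule_memD[OF K(1)]
  \<comment> \<open>The graph of the projection of the direct sum of \<open>N\<close> and
    \<open>K\<close> onto \<open>N\<close>; injectivity of \<open>Q\<close> extends it to an
    endomorphism \<open>h\<close>.\<close>
  let ?G = "{(n \<oplus>\<^bsub>Q\<^esub> c, n) | n c. n \<in> N \<and> c \<in> K}"
  have "linear_graph k Q Q ?G"
    unfolding linear_graph_def
  proof (intro conjI allI impI ballI)
    show "?G \<subseteq> carrier Q \<times> carrier Q" using Nm Km by auto
    have "\<zero>\<^bsub>Q\<^esub> = \<zero>\<^bsub>Q\<^esub> \<oplus>\<^bsub>Q\<^esub> \<zero>\<^bsub>Q\<^esub>" by simp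
    then show "(\<zero>\<^bsub>Q\<^esub>, \<zero>\<^bsub>Q\<^esub>) \<in> ?G" using Nm(2) Km(2) by blast
  next
    fix z w u v assume "(z, u) \<in> ?G" "(w, v) \<in> ?G"
    then obtain c d where *: "z = u \<oplus>\<^bsub>Q\<^esub> c" "w = v \<oplus>\<^bsub>Q\<^esub> d" "u \<in> N" "v \<in> N" "c \<in> K" "d \<in> K" by blast
    then have "z \<oplus>\<^bsub>Q\<^esub> w = (u \<oplus>\<^bsub>Q\<^esub> v) \<oplus>\<^bsub>Q\<^esub> (c \<oplus>\<^bsub>Q\<^esub> d)" using Nm(1) Km(1) by (simp add: Q.M.add.m_ac)
    then show "(z \<oplus>\<^bsub>Q\<^esub> w, u \<oplus>\<^bsub>Q\<^esub> v) \<in> ?G" using * Nm(3) Km(3) by blast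
  next
    fix a z u assume a: "a \<in> carrier k" and "(z, u) \<in> ?G"
    then obtain c where *: "z = u \<oplus>\<^bsub>Q\<^esub> c" "u \<in> N" "c \<in> K" by blast
    then have "a \<odot>\<^bsub>Q\<^esub> z = a \<odot>\<^bsub>Q\<^esub> u \<oplus>\<^bsub>Q\<^esub> a \<odot>\<^bsub>Q\<^esub> c" using a Nm(1) Km(1) by (simp add: Q.smult_r_distr)
    then show "(a \<odot>\<^bsub>Q\<^esub> z, a \<odot>\<^bsub>Q\<^esub> u) \<in> ?G" using * a Nm(4) Km(4) by blast
  next
    fix u assume "(\<zero>\<^bsub>Q\<^esub>, u) \<in> ?G"
    then obtain c where *: "\<zero>\<^bsub>Q\<^esub> = u \<oplus>\<^bsub>Q\<^esub> c" "u \<in> N" "c \<in> K" by blast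
    then have "u = \<ominus>\<^bsub>Q\<^esub> c" using Nm(1) Km(1) by (metis Q.M.minus_equality)
    then have "u \<in> K" using Km(5) * by simp
    then show "u = \<zero>\<^bsub>Q\<^esub>" using * K(3) by blast
  qed
  then obtain h where h: "linear_map k Q Q h" "\<And>n c. n \<in> N \<Longrightarrow> c \<in> K \<Longrightarrow> h (n \<oplus>\<^bsub>Q\<^esub> c) = n"
    using extend_graph[OF Q.module_axioms, of ?G] by blast
  have hN: "h n = n" if "n \<in> N" for n using h(2)[OF that Km(2)] Nm(1)[OF that] by simp
  have hK: "h c = \<zero>\<^bsub>Q\<^esub>" if "c \<in> K" for c using h(2)[OF Nm(2) that] Km(1)[OF that] by simp
  note hl = linear_map_closed[OF h(1)] linear_map_add[OF h(1)] linear_map_smult[OF h(1)]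
  have "submodule (h ` carrier Q) k Q"
  proof (rule Q.submoduleI')
    show "\<zero>\<^bsub>Q\<^esub> \<in> h ` carrier Q" using hN[OF Nm(2)] by (metis Q.M.zero_closed imageI)
    show "u \<oplus>\<^bsub>Q\<^esub> v \<in> h ` carrier Q" if "u \<in> h ` carrier Q" "v \<in> h ` carrier Q" for u v
      using that hl(2) by (auto simp flip: hl(2))
    show "a \<odot>\<^bsub>Q\<^esub> u \<in> h ` carrier Q" if "a \<in> carrier k" "u \<in> h ` carrier Q" for a u
      using that by (auto simp flip: hl(3))
  qed (use hl in auto)
  moreover have "N \<subseteq> h ` carrier Q" using hN Nm(1) by force
  \<comment> \<open>If \<open>h w\<close> were a nonzero element of \<open>?Y\<close>, then
    \<open>w\<close> would lie outside \<open>K\<close>, so \<open>K\<close> enlarged by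
    \<open>w\<close> would meet \<open>N\<close> in some nonzero \<open>n\<close>. Applying
    \<open>h\<close> gives \<open>n = a (h w)\<close>, an element of \<open>?Y\<close>, although
    \<open>N\<close> meets \<open>?Y\<close> only in 0.\<close>
  moreover have "h ` carrier Q \<inter> ?Y = {\<zero>\<^bsub>Q\<^esub>}"
  proof -
    have "h w = \<zero>\<^bsub>Q\<^esub>" if w: "w \<in> carrier Q" "h w \<in> ?Y" for w
    proof (rule ccontr)
      assume nz: "h w \<noteq> \<zero>\<^bsub>Q\<^esub>"
      then have "w \<notin> K" using hK by blast
      let ?W = "sum_sub Q K (cyclic k Q w)"
      note W = submodule_sum_sub[OF Q.module_axioms K(1) submodule_cyclic(1)[OF Q.module_axioms w(1)]]
      have "?W \<noteq> K" using W(3) submodule_cyclic(2)[OF Q.module_axioms w(1)] \<open>w \<notin> K\<close> by blast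
      then have "?W \<inter> N \<noteq> {\<zero>\<^bsub>Q\<^esub>}" using K(4) W by blast
      then obtain n where n: "n \<in> ?W" "n \<in> N" "n \<noteq> \<zero>\<^bsub>Q\<^esub>"
        using Q.submodule_memD(2)[OF W(1)] Nm(2) by blast
      then obtain c a where ca: "c \<in> K" "a \<in> carrier k" "n = c \<oplus>\<^bsub>Q\<^esub> a \<odot>\<^bsub>Q\<^esub> w"
        by (auto simp: sum_sub_def cyclic_def)
      have "n = h n" using hN n by simp
      also have "\<dots> = a \<odot>\<^bsub>Q\<^esub> h w" using ca w Km(1) hK hl by simp
      finally have "n \<in> ?Y" using Q.submodule_memD(4)[OF Y(1) ca(2) w(2)] by simp
      then show False using n N(3) by blast
    qed
    moreover have "\<zero>\<^bsub>Q\<^esub> \<in> h ` carrier Q" using hN[OF Nm(2)] by (metis Q.M.zero_closed imageI)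
    ultimately show ?thesis using Q.submodule_memD(2)[OF Y(1)] by blast
  qed
  ultimately have hQ: "h ` carrier Q = N" using N(4) by blast
  let ?N = "Q\<lparr>carrier := N\<rparr>"
  have modN: "module k ?N" using submodule.submodule_is_module[OF N(1) Q.module_axioms] .
  have hlin: "linear_map k Q ?N h" using h(1) hQ by (auto simp: linear_map_def)
  \<comment> \<open>\<open>h\<close> is a retraction of \<open>Q\<close> onto \<open>N\<close>, and
    a retract of an injective module is injective.\<close>
  have "injective_module k ?N"
    unfolding injective_module_def
  proof (intro conjI allI impI modN)
    fix A B :: "'r test_module" and f g
    assume *: "module k A \<and> module k B \<and> linear_map k A B f \<and> inj_on f (carrier A) \<and> linear_map k A ?N g"
    then have g: "linear_map k A Q g" using Nm(1) by (auto simp: linear_map_def Pi_iff)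
    then obtain j where j: "linear_map k B Q j" "\<forall>x\<in>carrier A. j (f x) = g x"
      using injective * unfolding injective_module_def by blast
    have "h (g x) = g x" if "x \<in> carrier A" for x
      using * that by (intro hN) (auto simp: linear_map_def Pi_iff)
    then show "\<exists>j. linear_map k B ?N j \<and> (\<forall>x\<in>carrier A. j (f x) = g x)"
      using linear_map_comp[OF j(1) hlin] j(2) by auto
  qed
  moreover have "cogenerator k ?N"
    unfolding cogenerator_def
  proof (intro conjI allI impI ballI modN)
    fix A :: "'r test_module" and a assume A: "module k A" and a: "a \<in> carrier A" "a \<noteq> \<zero>\<^bsub>A\<^esub>"
    obtain f where f: "linear_map k A Q f" "f a \<noteq> \<zero>\<^bsub>Q\<^esub>" using cogen A a unfolding cogenerator_def by blast
    define z where "z = f a"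
    have z: "z \<in> carrier Q" "z \<noteq> \<zero>\<^bsub>Q\<^esub>" using linear_map_closed[OF f(1) a(1)] f(2) by (auto simp: z_def)
    show "\<exists>f. linear_map k A ?N f \<and> f a \<noteq> \<zero>\<^bsub>?N\<^esub>"
    \<comment> \<open>If \<open>h\<close> kills \<open>z = f a\<close>, the functional has to be
      twisted first: maximality of \<open>N\<close> gives \<open>y = r z\<close> for some scalar
      \<open>r\<close>, and an endomorphism \<open>g\<close> with \<open>g y = x\<close> yields
      \<open>r (h (g z)) = x\<close>, which is nonzero.\<close>
    proof (cases "h z = \<zero>\<^bsub>Q\<^esub>")
      case False
      then show ?thesis using linear_map_comp[OF f(1) hlin] by (auto simp: z_def)
    next
      case True
      then have "z \<notin> N" using hN z by auto
      let ?W = "sum_sub Q N (cyclic k Q z)"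
      note W = submodule_sum_sub[OF Q.module_axioms N(1) submodule_cyclic(1)[OF Q.module_axioms z(1)]]
      have "?W \<noteq> N" using W(3) submodule_cyclic(2)[OF Q.module_axioms z(1)] \<open>z \<notin> N\<close> by blast
      then have "?W \<inter> ?Y \<noteq> {\<zero>\<^bsub>Q\<^esub>}" using N(4) W by blast
      then obtain y' where y': "y' \<in> ?W" "y' \<in> ?Y" "y' \<noteq> \<zero>\<^bsub>Q\<^esub>"
        using Q.submodule_memD(2)[OF W(1)] Q.submodule_memD(2)[OF Y(1)] by blast
      then obtain n c where nc: "n \<in> N" "c \<in> carrier k" "y' = n \<oplus>\<^bsub>Q\<^esub> c \<odot>\<^bsub>Q\<^esub> z"
        by (auto simp: sum_sub_def cyclic_def)
      have "n = h y'" using nc z Nm(1) hl hN True by simp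
      also have "\<dots> = \<zero>\<^bsub>Q\<^esub>" using hK K(2) y' by auto
      finally have y'c: "y' = c \<odot>\<^bsub>Q\<^esub> z" using nc z by simp
      obtain d where "d \<in> carrier k" "y' = d \<odot>\<^bsub>Q\<^esub> y" using y' by (auto simp: cyclic_def)
      then obtain e where e: "e \<in> carrier k" "e \<odot>\<^bsub>Q\<^esub> y' = y" using gen[of y d] y' by auto
      define r where "r = e \<otimes>\<^bsub>k\<^esub> c"
      have r: "r \<in> carrier k" "y = r \<odot>\<^bsub>Q\<^esub> z" using e nc y'c z by (auto simp: r_def Q.smult_assoc1)
      \<comment> \<open>A scalar killing the nonzero \<open>y\<close> must lie in \<open>m\<close>,
        hence kills \<open>x\<close>; so sending \<open>y\<close> to \<open>x\<close> is well
        defined.\<close>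
      have "b \<odot>\<^bsub>Q\<^esub> x = \<zero>\<^bsub>Q\<^esub>" if b: "b \<in> carrier k" "b \<odot>\<^bsub>Q\<^esub> y = \<zero>\<^bsub>Q\<^esub>" for b
      proof (cases "b \<in> m")
        case False
        then obtain b' c' where *: "b' \<in> carrier k" "c' \<in> m" "b' \<otimes>\<^bsub>k\<^esub> b \<oplus>\<^bsub>k\<^esub> c' = \<one>\<^bsub>k\<^esub>" using max b by blast
        then have c': "c' \<in> carrier k" using m(1) by blast
        have "y = (b' \<otimes>\<^bsub>k\<^esub> b \<oplus>\<^bsub>k\<^esub> c') \<odot>\<^bsub>Q\<^esub> y" using * y by simp
        also have "\<dots> = \<zero>\<^bsub>Q\<^esub>"
          using *(1) c' y b m(3)[OF *(2)] by (simp add: Q.smult_l_distr Q.smult_assoc1)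
        finally show ?thesis using y0 by simp
      qed (rule m(2))
      then obtain g where g: "linear_map k Q Q g" "\<forall>b\<in>carrier k. g (b \<odot>\<^bsub>Q\<^esub> y) = b \<odot>\<^bsub>Q\<^esub> x"
        using extend_along[OF Q.module_axioms module_regular[OF Q.R.cring_axioms]
            linear_map_smult_const[OF Q.module_axioms y] linear_map_smult_const[OF Q.module_axioms x(1)]]
        by auto
      have "g (\<one>\<^bsub>k\<^esub> \<odot>\<^bsub>Q\<^esub> y) = \<one>\<^bsub>k\<^esub> \<odot>\<^bsub>Q\<^esub> x" using g(2) by blast
      then have "g y = x" using x y by simp
      have F: "linear_map k A ?N (\<lambda>w. h (g (f w)))"
        using linear_map_comp[OF linear_map_comp[OF f(1) g(1)] hlin] .
      have "h (g (r \<odot>\<^bsub>Q\<^esub> f a)) = x" using r \<open>g y = x\<close> hN N(2) X(2) by (auto simp: z_def)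
      then have "r \<odot>\<^bsub>Q\<^esub> h (g (f a)) = x"
        using r(1) z(1) hl linear_map_closed[OF g(1)] linear_map_smult[OF g(1)] by (simp add: z_def)
      then have "h (g (f a)) \<noteq> \<zero>\<^bsub>Q\<^esub>" using x r(1) by auto
      then show ?thesis using F by auto
    qed
  qed
  \<comment> \<open>Minimality of \<open>Q\<close> enters here: \<open>N\<close> would be all of
    \<open>Q\<close>, yet it meets \<open>?Y\<close> only in 0 while \<open>y\<close> is
    nonzero.\<close>
  ultimately have "N = carrier Q"
    using minimal N(1) unfolding minimal_injective_cogenerator_def by blast
  then show False using N(3) y Y(2) y0 by auto
qed

text \<open>The induction runs over the submodules \<open>ann I\<close> of \<open>Q\<close> for ideals \<open>I\<close>: let \<open>I\<close> be minimal such that \<open>e\<close> is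
  a scalar \<open>c\<close> on \<open>ann I\<close>. If \<open>I\<close> were nonzero, there would be \<open>q'\<close> in \<open>Q\<close> with \<open>I q'\<close> simple. For
  \<open>a\<^sub>1\<close> in \<open>I\<close> with \<open>a\<^sub>1 q' \<noteq> 0\<close> and \<open>I'\<close> the annihilator of \<open>q'\<close> in \<open>I\<close>, multiplication by \<open>a\<^sub>1\<close> maps
  \<open>ann I'\<close> to a simple submodule with kernel \<open>ann I\<close>, so that \<open>e - c\<close> is a multiple of \<open>a\<^sub>1\<close> on \<open>ann I'\<close>.\<close>

lemma endomorphism_is_scalar:
  assumes e: "linear_map k Q Q e"
  shows "\<exists>c\<in>carrier k. \<forall>q\<in>carrier Q. e q = c \<odot>\<^bsub>Q\<^esub> q"
proof -
  note el = linear_map_closed[OF e] linear_map_add[OF e] linear_map_smult[OF e]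
  define ann where "ann I = {q \<in> carrier Q. \<forall>a\<in>I. a \<odot>\<^bsub>Q\<^esub> q = \<zero>\<^bsub>Q\<^esub>}" for I
  \<comment> \<open>The unit ideal belongs to \<open>S\<close>, since only 0 is killed by it. The
    aim is that a minimal member is the zero ideal, whose annihilator is all of
    \<open>Q\<close>.\<close>
  define S where "S = {I. ideal I k \<and> (\<exists>c\<in>carrier k. \<forall>q\<in>ann I. e q = c \<odot>\<^bsub>Q\<^esub> q)}"
  have "q = \<zero>\<^bsub>Q\<^esub>" if "q \<in> ann (carrier k)" for q
    using that Q.smult_one[of q] by (auto simp: ann_def)
  then have "\<forall>q\<in>ann (carrier k). e q = \<zero>\<^bsub>k\<^esub> \<odot>\<^bsub>Q\<^esub> q"
    using linear_map_zero[OF Q.module_axioms Q.module_axioms e] by fastforce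
  then have "carrier k \<in> S" using Q.R.oneideal by (auto simp: S_def)
  then have "S \<noteq> {}" by blast
  moreover have "ideal I k" if "I \<in> S" for I using that by (simp add: S_def)
  ultimately obtain I where I: "I \<in> S" "\<And>J. J \<in> S \<Longrightarrow> J \<subseteq> I \<Longrightarrow> J = I"
    using artinian_minimal_ideal[OF artinian, of S] by blast
  obtain c where c: "c \<in> carrier k" "\<And>q. q \<in> ann I \<Longrightarrow> e q = c \<odot>\<^bsub>Q\<^esub> q" using I by (auto simp: S_def)
  interpret I: ideal I k using I by (auto simp: S_def)
  have "i = \<zero>\<^bsub>k\<^esub>" if i: "i \<in> I" for i
  proof (rule ccontr)
    assume i0: "i \<noteq> \<zero>\<^bsub>k\<^esub>"
    have ik: "i \<in> carrier k" using i by (rule I.Icarr)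
    \<comment> \<open>A functional on the regular module is determined by its value
      \<open>q0\<close> at 1, so a nonzero \<open>i\<close> fails to kill some element of
      \<open>Q\<close>.\<close>
    obtain t where t: "linear_map k (regular_module k) Q t" "t i \<noteq> \<zero>\<^bsub>Q\<^esub>"
      using separating_functional[OF module_regular[OF Q.R.cring_axioms], of i] ik i0 by auto
    define q0 where "q0 = t \<one>\<^bsub>k\<^esub>"
    have q0: "q0 \<in> carrier Q" using linear_map_closed[OF t(1), of "\<one>\<^bsub>k\<^esub>"] by (simp add: q0_def)
    have iq0: "i \<odot>\<^bsub>Q\<^esub> q0 \<noteq> \<zero>\<^bsub>Q\<^esub>"
      using linear_map_smult[OF t(1), of i "\<one>\<^bsub>k\<^esub>"] ik t(2) by (simp add: q0_def)
    \<comment> \<open>The product of \<open>I\<close> and a minimal \<open>J\<close> still does not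
      kill \<open>q0\<close>. Any \<open>j\<close> in \<open>J\<close> witnessing this gives
      \<open>q' = j q0\<close>, for which \<open>I q'\<close> is nonzero and will be simple.\<close>
    define S' where "S' = {J. ideal J k \<and> (\<exists>j\<in>J. \<exists>a\<in>I. (a \<otimes>\<^bsub>k\<^esub> j) \<odot>\<^bsub>Q\<^esub> q0 \<noteq> \<zero>\<^bsub>Q\<^esub>)}"
    have "\<exists>j\<in>carrier k. \<exists>a\<in>I. (a \<otimes>\<^bsub>k\<^esub> j) \<odot>\<^bsub>Q\<^esub> q0 \<noteq> \<zero>\<^bsub>Q\<^esub>"
      by (rule bexI[of _ "\<one>\<^bsub>k\<^esub>"], rule bexI[OF _ i]) (use iq0 ik in simp_all)
    then have "carrier k \<in> S'" using Q.R.oneideal unfolding S'_def by blast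
    then have "S' \<noteq> {}" by blast
    moreover have "ideal J k" if "J \<in> S'" for J using that by (simp add: S'_def)
    ultimately obtain J where J: "J \<in> S'" "\<And>L. L \<in> S' \<Longrightarrow> L \<subseteq> J \<Longrightarrow> L = J"
      using artinian_minimal_ideal[OF artinian, of S'] by blast
    interpret J: ideal J k using J by (auto simp: S'_def)
    obtain j a1 where ja: "j \<in> J" "a1 \<in> I" "(a1 \<otimes>\<^bsub>k\<^esub> j) \<odot>\<^bsub>Q\<^esub> q0 \<noteq> \<zero>\<^bsub>Q\<^esub>"
      using J(1) unfolding S'_def by blast
    have jk: "j \<in> carrier k" "a1 \<in> carrier k" using ja J.Icarr I.Icarr by auto
    define q' where "q' = j \<odot>\<^bsub>Q\<^esub> q0"
    have q': "q' \<in> carrier Q" "a1 \<odot>\<^bsub>Q\<^esub> q' \<noteq> \<zero>\<^bsub>Q\<^esub>" using ja jk q0 by (auto simp: q'_def Q.smult_assoc1)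
    define m where "m = {a \<in> carrier k. \<forall>i\<in>I. i \<odot>\<^bsub>Q\<^esub> (a \<odot>\<^bsub>Q\<^esub> q') = \<zero>\<^bsub>Q\<^esub>}"
    have mk: "m \<subseteq> carrier k" by (auto simp: m_def)
    \<comment> \<open>Solvability of \<open>b a + c = 1\<close> stands for maximality of
      \<open>m\<close>. For \<open>a\<close> outside \<open>m\<close>, the ideal generated by
      \<open>a j\<close> still belongs to \<open>S'\<close> and so equals \<open>J\<close>; writing
      \<open>j = b a j\<close> shows that \<open>1 - b a\<close> kills \<open>q'\<close> and
      therefore lies in \<open>m\<close>.\<close>
    have max: "\<exists>b\<in>carrier k. \<exists>c\<in>m. b \<otimes>\<^bsub>k\<^esub> a \<oplus>\<^bsub>k\<^esub> c = \<one>\<^bsub>k\<^esub>" if a: "a \<in> carrier k" "a \<notin> m" for a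
    proof -
      obtain i' where i': "i' \<in> I" "i' \<odot>\<^bsub>Q\<^esub> (a \<odot>\<^bsub>Q\<^esub> q') \<noteq> \<zero>\<^bsub>Q\<^esub>" using a by (auto simp: m_def)
      have ik': "i' \<in> carrier k" using i'(1) by (rule I.Icarr)
      define L where "L = (\<lambda>b. b \<otimes>\<^bsub>k\<^esub> (a \<otimes>\<^bsub>k\<^esub> j)) ` carrier k"
      have "ideal L k"
      proof (rule idealI_cring[OF Q.R.cring_axioms])
        show "\<zero>\<^bsub>k\<^esub> \<in> L"
          using a(1) jk by (auto simp: L_def image_iff intro!: bexI[of _ "\<zero>\<^bsub>k\<^esub>"])
        show "u \<oplus>\<^bsub>k\<^esub> v \<in> L" if "u \<in> L" "v \<in> L" for u v
          using that a(1) jk by (auto simp: L_def simp flip: Q.R.l_distr)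
        show "b \<otimes>\<^bsub>k\<^esub> u \<in> L" if "b \<in> carrier k" "u \<in> L" for b u
          using that a(1) jk by (auto simp: L_def simp flip: Q.R.m_assoc)
      qed (use a(1) jk in \<open>auto simp: L_def\<close>)
      moreover have "\<exists>l\<in>L. \<exists>i\<in>I. (i \<otimes>\<^bsub>k\<^esub> l) \<odot>\<^bsub>Q\<^esub> q0 \<noteq> \<zero>\<^bsub>Q\<^esub>"
      proof (intro bexI)
        show "(i' \<otimes>\<^bsub>k\<^esub> (\<one>\<^bsub>k\<^esub> \<otimes>\<^bsub>k\<^esub> (a \<otimes>\<^bsub>k\<^esub> j))) \<odot>\<^bsub>Q\<^esub> q0 \<noteq> \<zero>\<^bsub>Q\<^esub>"
          using i' ik' a(1) jk q0 by (simp add: Q.smult_assoc1 q'_def)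
        show "\<one>\<^bsub>k\<^esub> \<otimes>\<^bsub>k\<^esub> (a \<otimes>\<^bsub>k\<^esub> j) \<in> L" unfolding L_def by (rule imageI) simp
      qed (rule i'(1))
      moreover have "L \<subseteq> J" using a(1) jk ja(1) by (auto simp: L_def J.I_l_closed)
      ultimately have "L = J" using J(2) by (auto simp: S'_def)
      then obtain b where b: "b \<in> carrier k" "j = b \<otimes>\<^bsub>k\<^esub> (a \<otimes>\<^bsub>k\<^esub> j)" using ja(1) by (auto simp: L_def)
      have bq: "(b \<otimes>\<^bsub>k\<^esub> a) \<odot>\<^bsub>Q\<^esub> q' = q'"
      proof -
        have "(b \<otimes>\<^bsub>k\<^esub> a) \<odot>\<^bsub>Q\<^esub> q' = (b \<otimes>\<^bsub>k\<^esub> (a \<otimes>\<^bsub>k\<^esub> j)) \<odot>\<^bsub>Q\<^esub> q0"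
          using b(1) a(1) jk q0 by (simp add: q'_def Q.smult_assoc1)
        then show ?thesis using b(2) by (simp add: q'_def)
      qed
      define c where "c = \<one>\<^bsub>k\<^esub> \<oplus>\<^bsub>k\<^esub> \<ominus>\<^bsub>k\<^esub> (b \<otimes>\<^bsub>k\<^esub> a)"
      have "c \<odot>\<^bsub>Q\<^esub> q' = \<zero>\<^bsub>Q\<^esub>"
        using b(1) a(1) q'(1) bq by (simp add: c_def Q.smult_l_distr Q.smult_l_minus Q.M.r_neg)
      then have "c \<in> m" using b(1) a(1) by (auto simp: m_def c_def I.Icarr)
      moreover have "b \<otimes>\<^bsub>k\<^esub> a \<oplus>\<^bsub>k\<^esub> c = \<one>\<^bsub>k\<^esub>"
        using b(1) a(1) by (simp add: c_def Q.R.add.m_lcomm Q.R.r_neg)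
      ultimately show ?thesis using b(1) by blast
    qed
    have one_dim: "\<exists>b\<in>carrier k. v = b \<odot>\<^bsub>Q\<^esub> u"
      if "u \<in> carrier Q" "v \<in> carrier Q" "u \<noteq> \<zero>\<^bsub>Q\<^esub>" "\<And>a. a \<in> m \<Longrightarrow> a \<odot>\<^bsub>Q\<^esub> u = \<zero>\<^bsub>Q\<^esub>"
        "\<And>a. a \<in> m \<Longrightarrow> a \<odot>\<^bsub>Q\<^esub> v = \<zero>\<^bsub>Q\<^esub>" for u v
      by (rule simple_submodule_unique[of u v m]) (use that mk max in auto)
    have m0: "a \<odot>\<^bsub>Q\<^esub> (i \<odot>\<^bsub>Q\<^esub> q') = \<zero>\<^bsub>Q\<^esub>" if "a \<in> m" "i \<in> I" for a i
    proof -
      have "a \<in> carrier k" "i \<in> carrier k" using that mk I.Icarr by auto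
      then have "a \<odot>\<^bsub>Q\<^esub> (i \<odot>\<^bsub>Q\<^esub> q') = i \<odot>\<^bsub>Q\<^esub> (a \<odot>\<^bsub>Q\<^esub> q')"
        using q'(1) by (simp add: Q.R.m_comm flip: Q.smult_assoc1)
      then show ?thesis using that by (simp add: m_def)
    qed
    \<comment> \<open>The next smaller candidate for \<open>S\<close>: by the map sending
      \<open>i\<close> to \<open>i q'\<close>, the quotient of \<open>I\<close> by \<open>I'\<close>
      is the simple module \<open>I q'\<close>.\<close>
    define I' where "I' = {i \<in> I. i \<odot>\<^bsub>Q\<^esub> q' = \<zero>\<^bsub>Q\<^esub>}"
    have idI': "ideal I' k"
      by (rule idealI_cring[OF Q.R.cring_axioms])
        (use q'(1) I.Icarr in \<open>auto simp: I'_def I.a_closed I.I_l_closed Q.smult_l_distr Q.smult_assoc1\<close>)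
    \<comment> \<open>Modulo \<open>I'\<close> every element of \<open>I\<close> is a multiple of
      \<open>a1\<close>, because \<open>I q'\<close> is one-dimensional. So on \<open>ann I'\<close>
      being killed by \<open>a1\<close> already means being killed by all of
      \<open>I\<close>.\<close>
    have F2: "q \<in> ann I" if q: "q \<in> ann I'" "a1 \<odot>\<^bsub>Q\<^esub> q = \<zero>\<^bsub>Q\<^esub>" for q
    proof -
      have qQ: "q \<in> carrier Q" using q by (simp add: ann_def)
      have "i \<odot>\<^bsub>Q\<^esub> q = \<zero>\<^bsub>Q\<^esub>" if i: "i \<in> I" for i
      proof -
        have ik: "i \<in> carrier k" using i by (rule I.Icarr)
        obtain b where b: "b \<in> carrier k" "i \<odot>\<^bsub>Q\<^esub> q' = b \<odot>\<^bsub>Q\<^esub> (a1 \<odot>\<^bsub>Q\<^esub> q')"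
          using one_dim[of "a1 \<odot>\<^bsub>Q\<^esub> q'" "i \<odot>\<^bsub>Q\<^esub> q'"] q' ja(2) i ik jk(2) m0 by auto
        define d where "d = i \<oplus>\<^bsub>k\<^esub> \<ominus>\<^bsub>k\<^esub> (b \<otimes>\<^bsub>k\<^esub> a1)"
        have "d \<in> I" using i ja(2) b(1) by (simp add: d_def I.a_closed I.I_l_closed)
        moreover have "d \<odot>\<^bsub>Q\<^esub> q' = \<zero>\<^bsub>Q\<^esub>"
          using ik b jk q' by (simp add: d_def Q.smult_l_distr Q.smult_l_minus Q.smult_assoc1 Q.M.r_neg)
        ultimately have "d \<odot>\<^bsub>Q\<^esub> q = \<zero>\<^bsub>Q\<^esub>" using q by (simp add: ann_def I'_def)
        then show ?thesis
          using ik b jk qQ q(2) by (simp add: d_def Q.smult_l_distr Q.smult_l_minus Q.smult_assoc1 Q.neg_zero)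
      qed
      then show ?thesis using qQ by (simp add: ann_def)
    qed
    \<comment> \<open>The products of \<open>m\<close> with \<open>a1\<close> lie in
      \<open>I'\<close>. Hence \<open>a1\<close> sends \<open>ann I'\<close> into the elements
      killed by \<open>m\<close>, where \<open>one_dim\<close> makes nonzero elements
      proportional.\<close>
    have F3: "a \<odot>\<^bsub>Q\<^esub> (a1 \<odot>\<^bsub>Q\<^esub> q) = \<zero>\<^bsub>Q\<^esub>" "a \<odot>\<^bsub>Q\<^esub> q \<in> ann I" if q: "q \<in> ann I'" "a \<in> m" for q a
    proof -
      have ak: "a \<in> carrier k" and qQ: "q \<in> carrier Q" using q mk by (auto simp: ann_def)
      have "a \<otimes>\<^bsub>k\<^esub> a1 \<in> I'"
        using m0[OF q(2) ja(2)] ak jk q'(1) ja(2) by (simp add: I'_def I.I_l_closed Q.smult_assoc1)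
      then have "(a \<otimes>\<^bsub>k\<^esub> a1) \<odot>\<^bsub>Q\<^esub> q = \<zero>\<^bsub>Q\<^esub>" using q by (simp add: ann_def)
      then show *: "a \<odot>\<^bsub>Q\<^esub> (a1 \<odot>\<^bsub>Q\<^esub> q) = \<zero>\<^bsub>Q\<^esub>" using ak jk qQ by (simp add: Q.smult_assoc1)
      show "a \<odot>\<^bsub>Q\<^esub> q \<in> ann I"
      proof (rule F2)
        have "i \<odot>\<^bsub>Q\<^esub> (a \<odot>\<^bsub>Q\<^esub> q) = \<zero>\<^bsub>Q\<^esub>" if i: "i \<in> I'" for i
        proof -
          have "i \<in> carrier k" using i I.Icarr by (auto simp: I'_def)
          then have "i \<odot>\<^bsub>Q\<^esub> (a \<odot>\<^bsub>Q\<^esub> q) = a \<odot>\<^bsub>Q\<^esub> (i \<odot>\<^bsub>Q\<^esub> q)"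
            using ak qQ by (simp add: Q.R.m_comm flip: Q.smult_assoc1)
          then show ?thesis using q(1) i ak by (simp add: ann_def)
        qed
        then show "a \<odot>\<^bsub>Q\<^esub> q \<in> ann I'" using ak qQ by (simp add: ann_def)
        have "a1 \<odot>\<^bsub>Q\<^esub> (a \<odot>\<^bsub>Q\<^esub> q) = a \<odot>\<^bsub>Q\<^esub> (a1 \<odot>\<^bsub>Q\<^esub> q)"
          using ak qQ jk by (simp add: Q.R.m_comm flip: Q.smult_assoc1)
        then show "a1 \<odot>\<^bsub>Q\<^esub> (a \<odot>\<^bsub>Q\<^esub> q) = \<zero>\<^bsub>Q\<^esub>" using * by simp
      qed
    qed
    \<comment> \<open>The error of the scalar \<open>c\<close>. It vanishes on \<open>ann I\<close>,
      which is the kernel of multiplication by \<open>a1\<close> on \<open>ann I'\<close>, so on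
      \<open>ann I'\<close> it depends only on \<open>a1 q\<close>.\<close>
    define e' where "e' q = e q \<oplus>\<^bsub>Q\<^esub> \<ominus>\<^bsub>Q\<^esub> (c \<odot>\<^bsub>Q\<^esub> q)" for q
    have e'Q: "e' q \<in> carrier Q" if "q \<in> carrier Q" for q using that c el by (simp add: e'_def)
    have e'0: "e' q = \<zero>\<^bsub>Q\<^esub>" if "q \<in> ann I" for q
      using c that el(1) by (simp add: e'_def ann_def Q.M.r_neg)
    have e's: "e' (a \<odot>\<^bsub>Q\<^esub> q) = a \<odot>\<^bsub>Q\<^esub> e' q" if "a \<in> carrier k" "q \<in> carrier Q" for a q
    proof -
      have "c \<odot>\<^bsub>Q\<^esub> (a \<odot>\<^bsub>Q\<^esub> q) = a \<odot>\<^bsub>Q\<^esub> (c \<odot>\<^bsub>Q\<^esub> q)"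
        using that c(1) by (simp add: Q.R.m_comm flip: Q.smult_assoc1)
      then show ?thesis using that c(1) el by (simp add: e'_def Q.smult_r_distr Q.smult_r_minus)
    qed
    have e'a: "e' (p \<oplus>\<^bsub>Q\<^esub> q) = e' p \<oplus>\<^bsub>Q\<^esub> e' q" if "p \<in> carrier Q" "q \<in> carrier Q" for p q
      using that c(1) el by (simp add: e'_def Q.smult_r_distr Q.M.minus_add Q.M.add.m_ac)
    have ee': "e q = e' q \<oplus>\<^bsub>Q\<^esub> c \<odot>\<^bsub>Q\<^esub> q" if "q \<in> carrier Q" for q
      using that c(1) el by (simp add: e'_def Q.M.a_assoc Q.M.l_neg)
    have "\<exists>d\<in>carrier k. \<forall>q\<in>ann I'. e' q = d \<odot>\<^bsub>Q\<^esub> q"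
    proof (cases "\<forall>q\<in>ann I'. a1 \<odot>\<^bsub>Q\<^esub> q = \<zero>\<^bsub>Q\<^esub>")
      case True
      then show ?thesis
        using F2 e'0 by (intro bexI[of _ "\<zero>\<^bsub>k\<^esub>"]) (auto simp: ann_def)
    next
      case False
      then obtain q1 where q1: "q1 \<in> ann I'" "a1 \<odot>\<^bsub>Q\<^esub> q1 \<noteq> \<zero>\<^bsub>Q\<^esub>" by blast
      have q1Q: "q1 \<in> carrier Q" using q1 by (simp add: ann_def)
      have "a \<odot>\<^bsub>Q\<^esub> e' q1 = \<zero>\<^bsub>Q\<^esub>" if "a \<in> m" for a
        using e'0[OF F3(2)[OF q1(1) that]] e's[of a q1] that mk q1Q by auto
      then obtain b where b: "b \<in> carrier k" "e' q1 = b \<odot>\<^bsub>Q\<^esub> (a1 \<odot>\<^bsub>Q\<^esub> q1)"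
        using one_dim[of "a1 \<odot>\<^bsub>Q\<^esub> q1" "e' q1"] q1 q1Q jk e'Q F3(1) by auto
      have "e' q = (b \<otimes>\<^bsub>k\<^esub> a1) \<odot>\<^bsub>Q\<^esub> q" if q: "q \<in> ann I'" for q
      proof -
        have qQ: "q \<in> carrier Q" using q by (simp add: ann_def)
        obtain d where d: "d \<in> carrier k" "a1 \<odot>\<^bsub>Q\<^esub> q = d \<odot>\<^bsub>Q\<^esub> (a1 \<odot>\<^bsub>Q\<^esub> q1)"
          using one_dim[of "a1 \<odot>\<^bsub>Q\<^esub> q1" "a1 \<odot>\<^bsub>Q\<^esub> q"] q1 q q1Q qQ jk F3(1) by auto
        \<comment> \<open>\<open>q\<close> and \<open>d q1\<close> have the same image under
          \<open>a1\<close>, so their difference lies in \<open>ann I\<close>, where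
          \<open>e'\<close> vanishes.\<close>
        define w where "w = q \<oplus>\<^bsub>Q\<^esub> \<ominus>\<^bsub>Q\<^esub> (d \<odot>\<^bsub>Q\<^esub> q1)"
        have wQ: "w \<in> carrier Q" using qQ d q1Q by (simp add: w_def)
        have da: "a1 \<odot>\<^bsub>Q\<^esub> (d \<odot>\<^bsub>Q\<^esub> q1) = d \<odot>\<^bsub>Q\<^esub> (a1 \<odot>\<^bsub>Q\<^esub> q1)"
          using d(1) jk q1Q by (simp add: Q.R.m_comm flip: Q.smult_assoc1)
        have "w \<in> ann I"
        proof (rule F2)
          have "i \<odot>\<^bsub>Q\<^esub> w = \<zero>\<^bsub>Q\<^esub>" if i: "i \<in> I'" for i
          proof -
            have ik: "i \<in> carrier k" using i I.Icarr by (auto simp: I'_def)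
            have "i \<odot>\<^bsub>Q\<^esub> (d \<odot>\<^bsub>Q\<^esub> q1) = d \<odot>\<^bsub>Q\<^esub> (i \<odot>\<^bsub>Q\<^esub> q1)"
              using ik d(1) q1Q by (simp add: Q.R.m_comm flip: Q.smult_assoc1)
            moreover have "i \<odot>\<^bsub>Q\<^esub> q = \<zero>\<^bsub>Q\<^esub>" "i \<odot>\<^bsub>Q\<^esub> q1 = \<zero>\<^bsub>Q\<^esub>" using q q1 i by (auto simp: ann_def)
            ultimately show ?thesis using ik d(1) q1Q qQ
              by (simp add: w_def Q.smult_r_distr Q.smult_r_minus Q.neg_zero)
          qed
          then show "w \<in> ann I'" using wQ by (simp add: ann_def)
          show "a1 \<odot>\<^bsub>Q\<^esub> w = \<zero>\<^bsub>Q\<^esub>"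
            using d q1Q qQ jk da by (simp add: w_def Q.smult_r_distr Q.smult_r_minus Q.M.r_neg)
        qed
        have "q = w \<oplus>\<^bsub>Q\<^esub> d \<odot>\<^bsub>Q\<^esub> q1" using qQ d(1) q1Q by (simp add: w_def Q.M.a_assoc Q.M.l_neg)
        then have "e' q = e' w \<oplus>\<^bsub>Q\<^esub> d \<odot>\<^bsub>Q\<^esub> e' q1" using wQ d(1) q1Q by (simp add: e'a e's)
        also have "\<dots> = d \<odot>\<^bsub>Q\<^esub> (b \<odot>\<^bsub>Q\<^esub> (a1 \<odot>\<^bsub>Q\<^esub> q1))"
          using e'0[OF \<open>w \<in> ann I\<close>] b d(1) jk q1Q by simp
        also have "\<dots> = b \<odot>\<^bsub>Q\<^esub> (d \<odot>\<^bsub>Q\<^esub> (a1 \<odot>\<^bsub>Q\<^esub> q1))"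
          using b(1) d(1) jk q1Q Q.R.m_lcomm[of b d a1] by (simp flip: Q.smult_assoc1)
        also have "\<dots> = (b \<otimes>\<^bsub>k\<^esub> a1) \<odot>\<^bsub>Q\<^esub> q" using d(2) b(1) jk qQ by (simp add: Q.smult_assoc1)
        finally show ?thesis .
      qed
      then show ?thesis using b(1) jk by (intro bexI[of _ "b \<otimes>\<^bsub>k\<^esub> a1"]) auto
    qed
    then obtain d where d: "d \<in> carrier k" "\<And>q. q \<in> ann I' \<Longrightarrow> e' q = d \<odot>\<^bsub>Q\<^esub> q" by blast
    \<comment> \<open>Thus \<open>e\<close> is the scalar \<open>d + c\<close> on
      \<open>ann I'\<close>, and minimality of \<open>I\<close> gives \<open>I' = I\<close>; but
      \<open>a1\<close> belongs to \<open>I\<close> and does not kill \<open>q'\<close>.\<close>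
    have "e q = (d \<oplus>\<^bsub>k\<^esub> c) \<odot>\<^bsub>Q\<^esub> q" if "q \<in> ann I'" for q
      using that d c(1) ee'[of q] by (auto simp: ann_def Q.smult_l_distr)
    then have "I' \<in> S" using idI' d(1) c(1) unfolding S_def by blast
    then have "I' = I" using I(2) by (auto simp: I'_def)
    then show False using ja(2) q'(2) by (auto simp: I'_def)
  qed
  then have "q \<in> ann I" if "q \<in> carrier Q" for q
    using that unfolding ann_def by fastforce
  then show ?thesis using c by blast
qed

text \<open>\<open>l\<close> factors through \<open>b\<close> by an endomorphism of
  \<open>Q\<close>, and such an endomorphism is a scalar.\<close>

lemma functional_is_multiple:
  fixes P :: "('r, 'a) module"
  assumes P: "module k P" and b: "linear_map k P Q b" and l: "linear_map k P Q l"
    and ker: "\<And>x. x \<in> carrier P \<Longrightarrow> b x = \<zero>\<^bsub>Q\<^esub> \<Longrightarrow> l x = \<zero>\<^bsub>Q\<^esub>"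
  shows "\<exists>c\<in>carrier k. \<forall>x\<in>carrier P. l x = c \<odot>\<^bsub>Q\<^esub> b x"
proof -
  obtain h where h: "linear_map k Q Q h" "\<forall>x\<in>carrier P. h (b x) = l x"
    using extend_along[OF Q.module_axioms P b l ker] by blast
  then obtain c where "c \<in> carrier k" "\<forall>q\<in>carrier Q. h q = c \<odot>\<^bsub>Q\<^esub> q"
    using endomorphism_is_scalar by blast
  then show ?thesis using h(2) linear_map_closed[OF b] by metis
qed

text \<open>Induction over a finite set of generators of \<open>H\<close>: on the common kernel of
  the other generators, \<open>l\<close> is a scalar multiple of the pairing with the new one, and
  subtracting this multiple leaves a functional to which the induction hypothesis applies.
  \<open>M\<close> may be arbitrary, which matters because it will be an Ext module.\<close>

lemma functional_from_pairing:
  fixes H :: "('r, 'h) module" and M :: "('r, 'a) module" and \<beta> :: "'h \<Rightarrow> 'a \<Rightarrow> 'q"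
  assumes H: "module k H" and M: "module k M" and fg: "finitely_generated k H"
    and \<beta>M: "\<And>h. h \<in> carrier H \<Longrightarrow> linear_map k M Q (\<beta> h)"
    and \<beta>H: "\<And>m. m \<in> carrier M \<Longrightarrow> linear_map k H Q (\<lambda>h. \<beta> h m)"
    and l: "linear_map k M Q l"
    and ker: "\<And>m. m \<in> carrier M \<Longrightarrow> (\<And>h. h \<in> carrier H \<Longrightarrow> \<beta> h m = \<zero>\<^bsub>Q\<^esub>) \<Longrightarrow> l m = \<zero>\<^bsub>Q\<^esub>"
  shows "\<exists>h\<in>carrier H. \<forall>m\<in>carrier M. l m = \<beta> h m"
proof -
  interpret H: module k H by fact
  interpret M: module k M by fact
  note bM = linear_map_closed[OF \<beta>M] linear_map_add[OF \<beta>M] linear_map_smult[OF \<beta>M]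
  note bH = linear_map_add[OF \<beta>H] linear_map_smult[OF \<beta>H]
  have b0: "\<beta> \<zero>\<^bsub>H\<^esub> m = \<zero>\<^bsub>Q\<^esub>" if "m \<in> carrier M" for m
    using linear_map_zero[OF H Q.module_axioms \<beta>H[OF that]] .
  have b0': "\<beta> h \<zero>\<^bsub>M\<^esub> = \<zero>\<^bsub>Q\<^esub>" if "h \<in> carrier H" for h
    using linear_map_zero[OF M Q.module_axioms \<beta>M[OF that]] .
  have fin: "\<exists>h\<in>carrier H. \<forall>m\<in>carrier M. l m = \<beta> h m"
    if "finite S" "S \<subseteq> carrier H" "linear_map k M Q l"
      "\<And>m. m \<in> carrier M \<Longrightarrow> (\<And>h. h \<in> S \<Longrightarrow> \<beta> h m = \<zero>\<^bsub>Q\<^esub>) \<Longrightarrow> l m = \<zero>\<^bsub>Q\<^esub>" for S l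
    using that
  proof (induction S arbitrary: l rule: finite_induct)
    case empty
    then show ?case using b0 by (intro bexI[of _ "\<zero>\<^bsub>H\<^esub>"]) auto
  next
    case (insert s S)
    note l = linear_map_closed[OF insert.prems(2)] linear_map_add[OF insert.prems(2)]
      linear_map_smult[OF insert.prems(2)]
    have s: "s \<in> carrier H" "S \<subseteq> carrier H" using insert.prems(1) by auto
    define P where "P = {m \<in> carrier M. \<forall>h\<in>S. \<beta> h m = \<zero>\<^bsub>Q\<^esub>}"
    have subP: "submodule P k M"
    proof (rule M.submoduleI')
      show "\<zero>\<^bsub>M\<^esub> \<in> P" using b0' s by (auto simp: P_def)
    qed (use s bM in \<open>auto simp: P_def subset_iff\<close>)
    let ?P = "M\<lparr>carrier := P\<rparr>"
    have "linear_map k ?P Q (\<beta> s)" "linear_map k ?P Q l"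
      using \<beta>M[OF s(1)] insert.prems(2) by (auto simp: linear_map_def P_def)
    moreover have "l m = \<zero>\<^bsub>Q\<^esub>" if "m \<in> P" "\<beta> s m = \<zero>\<^bsub>Q\<^esub>" for m
      using insert.prems(3)[of m] that by (auto simp: P_def)
    ultimately obtain c where c: "c \<in> carrier k" "\<And>m. m \<in> P \<Longrightarrow> l m = c \<odot>\<^bsub>Q\<^esub> \<beta> s m"
      using functional_is_multiple[OF submodule.submodule_is_module[OF subP M], of "\<beta> s" l] by auto
    define l' where "l' m = l m \<oplus>\<^bsub>Q\<^esub> \<ominus>\<^bsub>Q\<^esub> (c \<odot>\<^bsub>Q\<^esub> \<beta> s m)" for m
    have "linear_map k M Q l'"
    proof (rule linear_mapI)
      fix a m assume am: "a \<in> carrier k" "m \<in> carrier M"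
      have "c \<odot>\<^bsub>Q\<^esub> (a \<odot>\<^bsub>Q\<^esub> \<beta> s m) = a \<odot>\<^bsub>Q\<^esub> (c \<odot>\<^bsub>Q\<^esub> \<beta> s m)"
        using am c(1) bM(1)[OF s(1)] by (simp add: Q.R.m_comm flip: Q.smult_assoc1)
      then show "l' (a \<odot>\<^bsub>M\<^esub> m) = a \<odot>\<^bsub>Q\<^esub> l' m"
        using am c(1) s l bM by (simp add: l'_def Q.smult_r_distr Q.smult_r_minus)
    qed (use s c(1) l bM in \<open>simp_all add: l'_def Q.smult_r_distr Q.M.minus_add Q.M.add.m_ac\<close>)
    moreover have "l' m = \<zero>\<^bsub>Q\<^esub>" if "m \<in> carrier M" "\<And>h. h \<in> S \<Longrightarrow> \<beta> h m = \<zero>\<^bsub>Q\<^esub>" for m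
      using that c s bM by (simp add: l'_def P_def Q.M.r_neg)
    ultimately obtain h where h: "h \<in> carrier H" "\<And>m. m \<in> carrier M \<Longrightarrow> l' m = \<beta> h m"
      using insert.IH[OF s(2), of l'] by blast
    have "l m = \<beta> (h \<oplus>\<^bsub>H\<^esub> c \<odot>\<^bsub>H\<^esub> s) m" if m: "m \<in> carrier M" for m
    proof -
      have "l m = l' m \<oplus>\<^bsub>Q\<^esub> c \<odot>\<^bsub>Q\<^esub> \<beta> s m"
        using m c(1) s l bM by (simp add: l'_def Q.M.a_assoc Q.M.l_neg)
      then show ?thesis using h m c(1) s bH[OF m] by simp
    qed
    then show ?case using h(1) c(1) s(1) by (intro bexI[of _ "h \<oplus>\<^bsub>H\<^esub> c \<odot>\<^bsub>H\<^esub> s"]) auto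
  qed
  obtain S where S: "finite S" "S \<subseteq> carrier H" "\<And>N. submodule N k H \<Longrightarrow> S \<subseteq> N \<Longrightarrow> N = carrier H"
    using fg unfolding finitely_generated_def by blast
  show ?thesis
  proof (rule fin[OF S(1,2) l])
    fix m assume m: "m \<in> carrier M" "\<And>h. h \<in> S \<Longrightarrow> \<beta> h m = \<zero>\<^bsub>Q\<^esub>"
    \<comment> \<open>The elements of \<open>H\<close> orthogonal to \<open>m\<close> form a
      submodule, so orthogonality to the generators is orthogonality to all of
      \<open>H\<close>.\<close>
    have "submodule {h \<in> carrier H. \<beta> h m = \<zero>\<^bsub>Q\<^esub>} k H"
      by (rule H.submoduleI') (use bH[OF m(1)] b0[OF m(1)] in auto)
    then have "{h \<in> carrier H. \<beta> h m = \<zero>\<^bsub>Q\<^esub>} = carrier H"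
      by (rule S(3)) (use S(2) m(2) in auto)
    then show "l m = \<zero>\<^bsub>Q\<^esub>" using ker[OF m(1)] by blast
  qed
qed

end

section \<open>Linear categories\<close>

locale linear_cat =
  fixes k :: "'r ring" and C :: "('r, 'o, 'm) lcat"
  assumes linear_category: "linear_category k C"
begin

text \<open>Hom modules of different pairs of objects are disjoint, so a morphism determines its
  source and target. Recovering them by \<open>dm\<close> and \<open>cd\<close> removes object
  parameters: typing conditions become equations that simplification discharges.\<close>

definition Arr :: "'m \<Rightarrow> bool" where
  "Arr f \<longleftrightarrow> (\<exists>X\<in>Obj C. \<exists>Y\<in>Obj C. f \<in> Mor C X Y)"

definition dm :: "'m \<Rightarrow> 'o" where
  "dm f = (THE X. X \<in> Obj C \<and> (\<exists>Y\<in>Obj C. f \<in> Mor C X Y))"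

definition cd :: "'m \<Rightarrow> 'o" where
  "cd f = (THE Y. Y \<in> Obj C \<and> (\<exists>X\<in>Obj C. f \<in> Mor C X Y))"

abbreviation hom :: "'m \<Rightarrow> 'o \<Rightarrow> 'o \<Rightarrow> bool" where
  "hom f X Y \<equiv> Arr f \<and> dm f = X \<and> cd f = Y"

text \<open>The syntax nests to the right, in accordance with \<open>comp_assoc\<close>, which
  rewrites every composite into the form \<open>h \<bullet> (g \<bullet> f)\<close>.\<close>

definition comp :: "'m \<Rightarrow> 'm \<Rightarrow> 'm"  (infixr \<open>\<bullet>\<close> 75) where
  "g \<bullet> f = g \<cdot>\<^bsub>C\<^esub> f"

text \<open>The Hom module is read off from the first argument; the second is expected to be
  parallel to it.\<close>

definition plus :: "'m \<Rightarrow> 'm \<Rightarrow> 'm"  (infixl \<open>\<^bold>+\<close> 65) where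
  "f \<^bold>+ g = f \<oplus>\<^bsub>Hom C (dm f) (cd f)\<^esub> g"

definition neg :: "'m \<Rightarrow> 'm"  (\<open>\<^bold>-\<close>) where
  "\<^bold>- f = \<ominus>\<^bsub>Hom C (dm f) (cd f)\<^esub> f"

definition scal :: "'r \<Rightarrow> 'm \<Rightarrow> 'm"  (infixr \<open>\<^bold>*\<close> 70) where
  "a \<^bold>* f = a \<odot>\<^bsub>Hom C (dm f) (cd f)\<^esub> f"

abbreviation zr :: "'o \<Rightarrow> 'o \<Rightarrow> 'm" where
  "zr X Y \<equiv> \<zero>\<^bsub>Hom C X Y\<^esub>"

abbreviation Id :: "'o \<Rightarrow> 'm" where "Id \<equiv> Idt C"

lemma hom_module: "X \<in> Obj C \<Longrightarrow> Y \<in> Obj C \<Longrightarrow> module k (Hom C X Y)"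
  using linear_category unfolding linear_category_def by simp

lemma hom_disjoint:
  assumes "f \<in> Mor C X Y" "f \<in> Mor C X' Y'" "X \<in> Obj C" "Y \<in> Obj C" "X' \<in> Obj C" "Y' \<in> Obj C"
  shows "X = X' \<and> Y = Y'"
proof -
  have "\<forall>X\<in>Obj C. \<forall>Y\<in>Obj C. \<forall>X'\<in>Obj C. \<forall>Y'\<in>Obj C. Mor C X Y \<inter> Mor C X' Y' \<noteq> {} \<longrightarrow> X = X' \<and> Y = Y'"
    using linear_category unfolding linear_category_def by (elim conjE)
  then show ?thesis using assms by blast
qed

lemma homI:
  assumes "f \<in> Mor C X Y" "X \<in> Obj C" "Y \<in> Obj C"
  shows "hom f X Y"
proof -
  have "dm f = X" unfolding dm_def
    by (rule the_equality) (use assms hom_disjoint in blast)+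
  moreover have "cd f = Y" unfolding cd_def
    by (rule the_equality) (use assms hom_disjoint in blast)+
  ultimately show ?thesis using assms by (auto simp: Arr_def)
qed

lemma ArrD [simp]:
  assumes "Arr f"
  shows "f \<in> Mor C (dm f) (cd f)" "dm f \<in> Obj C" "cd f \<in> Obj C"
  using assms homI by (auto simp: Arr_def)

lemma hom_iff: "hom f X Y \<longleftrightarrow> X \<in> Obj C \<and> Y \<in> Obj C \<and> f \<in> Mor C X Y"
  using homI by auto

lemma ArrD': "Arr f \<Longrightarrow> dm f = X \<Longrightarrow> cd f = Y \<Longrightarrow> f \<in> Mor C X Y"
  by auto

lemma hom_Id [simp]: "X \<in> Obj C \<Longrightarrow> Arr (Id X)" "X \<in> Obj C \<Longrightarrow> dm (Id X) = X" "X \<in> Obj C \<Longrightarrow> cd (Id X) = X"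
  using homI[of "Id X" X X] linear_category unfolding linear_category_def by auto

lemma comp_linear:
  assumes "hom g Y Z" "X \<in> Obj C"
  shows "linear_map k (Hom C X Y) (Hom C X Z) (\<lambda>f. g \<bullet> f)"
    and "linear_map k (Hom C Z X) (Hom C Y X) (\<lambda>f. f \<bullet> g)"
  using linear_category assms unfolding linear_category_def comp_def by auto

lemma hom_comp [simp]:
  assumes "Arr f" "Arr g" "cd f = dm g"
  shows "Arr (g \<bullet> f)" "dm (g \<bullet> f) = dm f" "cd (g \<bullet> f) = cd g"
proof -
  have "g \<bullet> f \<in> Mor C (dm f) (cd g)"
    using linear_map_closed[OF comp_linear(1)[of g "dm g" "cd g" "dm f"], of f] assms by (metis ArrD)
  then show "Arr (g \<bullet> f)" "dm (g \<bullet> f) = dm f" "cd (g \<bullet> f) = cd g"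
    using homI[of "g \<bullet> f" "dm f" "cd g"] assms by auto
qed

lemma comp_Id [simp]: "Arr f \<Longrightarrow> dm f = X \<Longrightarrow> f \<bullet> Id X = f" "Arr f \<Longrightarrow> cd f = X \<Longrightarrow> Id X \<bullet> f = f"
  using linear_category unfolding linear_category_def comp_def by (metis ArrD)+

lemma comp_assoc [simp]:
  assumes "Arr f" "Arr g" "Arr h" "cd f = dm g" "cd g = dm h"
  shows "(h \<bullet> g) \<bullet> f = h \<bullet> (g \<bullet> f)"
proof -
  have "\<forall>W\<in>Obj C. \<forall>X\<in>Obj C. \<forall>Y\<in>Obj C. \<forall>Z\<in>Obj C. \<forall>f\<in>Mor C W X. \<forall>g\<in>Mor C X Y. \<forall>h\<in>Mor C Y Z.
        h \<cdot>\<^bsub>C\<^esub> (g \<cdot>\<^bsub>C\<^esub> f) = (h \<cdot>\<^bsub>C\<^esub> g) \<cdot>\<^bsub>C\<^esub> f"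
    using linear_category unfolding linear_category_def by blast
  then show ?thesis
    using assms ArrD unfolding comp_def by metis
qed

text \<open>In right-nested normal form a relation \<open>g \<bullet> f = w\<close> is hidden inside
  a longer composite; this rule applies it there.\<close>

lemma comp_reassoc:
  assumes "g \<bullet> f = w" "Arr f" "Arr g" "Arr x" "cd f = dm g" "cd x = dm f"
  shows "g \<bullet> (f \<bullet> x) = w \<bullet> x"
  using assms comp_assoc by metis

lemma hom_zr [simp]:
  assumes "X \<in> Obj C" "Y \<in> Obj C"
  shows "Arr (zr X Y)" "dm (zr X Y) = X" "cd (zr X Y) = Y"
proof -
  interpret module k "Hom C X Y" using assms by (rule hom_module)
  show "Arr (zr X Y)" "dm (zr X Y) = X" "cd (zr X Y) = Y" using homI[of "zr X Y" X Y] assms by auto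
qed

lemma hom_plus [simp]:
  assumes "Arr f" "Arr g" "dm f = dm g" "cd f = cd g"
  shows "Arr (f \<^bold>+ g)" "dm (f \<^bold>+ g) = dm g" "cd (f \<^bold>+ g) = cd g"
proof -
  interpret module k "Hom C (dm f) (cd f)" using assms by (intro hom_module) auto
  have "f \<^bold>+ g \<in> Mor C (dm f) (cd f)" unfolding plus_def using assms by (intro M.a_closed ArrD') auto
  then show "Arr (f \<^bold>+ g)" "dm (f \<^bold>+ g) = dm g" "cd (f \<^bold>+ g) = cd g"
    using homI[of "f \<^bold>+ g" "dm f" "cd f"] assms by auto
qed

lemma hom_neg [simp]:
  assumes "Arr f"
  shows "Arr (\<^bold>- f)" "dm (\<^bold>- f) = dm f" "cd (\<^bold>- f) = cd f"
proof -
  interpret module k "Hom C (dm f) (cd f)" using assms by (intro hom_module) auto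
  have "\<^bold>- f \<in> Mor C (dm f) (cd f)" unfolding neg_def using assms by (intro M.a_inv_closed ArrD') auto
  then show "Arr (\<^bold>- f)" "dm (\<^bold>- f) = dm f" "cd (\<^bold>- f) = cd f"
    using homI[of "\<^bold>- f" "dm f" "cd f"] assms by auto
qed

lemma hom_scal [simp]:
  assumes "Arr f" "a \<in> carrier k"
  shows "Arr (a \<^bold>* f)" "dm (a \<^bold>* f) = dm f" "cd (a \<^bold>* f) = cd f"
proof -
  interpret module k "Hom C (dm f) (cd f)" using assms by (intro hom_module) auto
  have "a \<^bold>* f \<in> Mor C (dm f) (cd f)" unfolding scal_def using assms by (intro smult_closed ArrD') auto
  then show "Arr (a \<^bold>* f)" "dm (a \<^bold>* f) = dm f" "cd (a \<^bold>* f) = cd f"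
    using homI[of "a \<^bold>* f" "dm f" "cd f"] assms by auto
qed

lemma comp_plus [simp]:
  assumes "Arr f" "Arr g" "dm f = dm g" "cd f = cd g" "Arr h"
  shows "cd g = dm h \<Longrightarrow> h \<bullet> (f \<^bold>+ g) = h \<bullet> f \<^bold>+ h \<bullet> g"
    and "cd h = dm g \<Longrightarrow> (f \<^bold>+ g) \<bullet> h = f \<bullet> h \<^bold>+ g \<bullet> h"
proof -
  have fg: "f \<in> Mor C (dm g) (cd g)" "g \<in> Mor C (dm g) (cd g)"
    by (rule ArrD'; simp add: assms)+
  show "h \<bullet> (f \<^bold>+ g) = h \<bullet> f \<^bold>+ h \<bullet> g" if "cd g = dm h"
    using linear_map_add[OF comp_linear(1)[of h "cd g" "cd h" "dm g"] fg] assms that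
    by (simp add: plus_def)
  show "(f \<^bold>+ g) \<bullet> h = f \<bullet> h \<^bold>+ g \<bullet> h" if "cd h = dm g"
    using linear_map_add[OF comp_linear(2)[of h "dm h" "dm g" "cd g"] fg] assms that
    by (simp add: plus_def)
qed

lemma comp_scal [simp]:
  assumes "Arr f" "Arr h" "a \<in> carrier k"
  shows "cd f = dm h \<Longrightarrow> h \<bullet> (a \<^bold>* f) = a \<^bold>* (h \<bullet> f)"
    and "cd h = dm f \<Longrightarrow> (a \<^bold>* f) \<bullet> h = a \<^bold>* (f \<bullet> h)"
proof -
  have f: "f \<in> Mor C (dm f) (cd f)" by (simp add: assms)
  show "h \<bullet> (a \<^bold>* f) = a \<^bold>* (h \<bullet> f)" if "cd f = dm h"
    using linear_map_smult[OF comp_linear(1)[of h "cd f" "cd h" "dm f"] assms(3) f] assms that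
    by (simp add: scal_def)
  show "(a \<^bold>* f) \<bullet> h = a \<^bold>* (f \<bullet> h)" if "cd h = dm f"
    using linear_map_smult[OF comp_linear(2)[of h "dm h" "dm f" "cd f"] assms(3) f] assms that
    by (simp add: scal_def)
qed

lemma comp_zr [simp]:
  assumes "Arr h" "X \<in> Obj C"
  shows "dm h = Y \<Longrightarrow> h \<bullet> zr X Y = zr X (cd h)" and "cd h = Y \<Longrightarrow> zr Y X \<bullet> h = zr (dm h) X"
proof -
  show "h \<bullet> zr X Y = zr X (cd h)" if "dm h = Y"
    using linear_map_zero[OF hom_module hom_module comp_linear(1)[of h Y "cd h" X]] assms that by auto
  show "zr Y X \<bullet> h = zr (dm h) X" if "cd h = Y"
    using linear_map_zero[OF hom_module hom_module comp_linear(2)[of h "dm h" Y X]] assms that by auto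
qed

lemma comp_neg [simp]:
  assumes "Arr f" "Arr h"
  shows "cd f = dm h \<Longrightarrow> h \<bullet> (\<^bold>- f) = \<^bold>- (h \<bullet> f)"
    and "cd h = dm f \<Longrightarrow> (\<^bold>- f) \<bullet> h = \<^bold>- (f \<bullet> h)"
proof -
  have f: "f \<in> Mor C (dm f) (cd f)" by (simp add: assms)
  show "h \<bullet> (\<^bold>- f) = \<^bold>- (h \<bullet> f)" if "cd f = dm h"
  proof -
    have "h \<bullet> (\<ominus>\<^bsub>Hom C (dm f) (cd f)\<^esub> f) = \<ominus>\<^bsub>Hom C (dm f) (cd h)\<^esub> (h \<bullet> f)"
      by (rule linear_map_neg[OF hom_module hom_module comp_linear(1) f]) (use assms that in simp_all)
    then show ?thesis using assms that by (simp add: neg_def)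
  qed
  show "(\<^bold>- f) \<bullet> h = \<^bold>- (f \<bullet> h)" if "cd h = dm f"
  proof -
    have "(\<ominus>\<^bsub>Hom C (dm f) (cd f)\<^esub> f) \<bullet> h = \<ominus>\<^bsub>Hom C (dm h) (cd f)\<^esub> (f \<bullet> h)"
      by (rule linear_map_neg[OF hom_module hom_module comp_linear(2) f]) (use assms that in simp_all)
    then show ?thesis using assms that by (simp add: neg_def)
  qed
qed

lemma
  assumes "Arr f" "Arr g" "dm f = dm g" "cd f = cd g"
  shows plus_comm: "f \<^bold>+ g = g \<^bold>+ f"
    and plus_assoc: "Arr h \<Longrightarrow> dm g = dm h \<Longrightarrow> cd g = cd h \<Longrightarrow> (f \<^bold>+ g) \<^bold>+ h = f \<^bold>+ (g \<^bold>+ h)"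
    and plus_lcomm: "Arr h \<Longrightarrow> dm g = dm h \<Longrightarrow> cd g = cd h \<Longrightarrow> f \<^bold>+ (g \<^bold>+ h) = g \<^bold>+ (f \<^bold>+ h)"
    and plus_neg_cancel: "f \<^bold>+ (\<^bold>- f \<^bold>+ g) = g" "\<^bold>- f \<^bold>+ (f \<^bold>+ g) = g"
proof -
  interpret module k "Hom C (dm g) (cd g)" using assms by (intro hom_module) auto
  have f: "f \<in> Mor C (dm g) (cd g)" "g \<in> Mor C (dm g) (cd g)" by (rule ArrD'; simp add: assms)+
  have *: "x \<^bold>+ y = x \<oplus>\<^bsub>Hom C (dm g) (cd g)\<^esub> y" "\<^bold>- x = \<ominus>\<^bsub>Hom C (dm g) (cd g)\<^esub> x"
    if "x \<in> Mor C (dm g) (cd g)" for x y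
    using homI[OF that] assms by (simp_all add: plus_def neg_def)
  show "f \<^bold>+ g = g \<^bold>+ f" using f by (simp add: * M.a_comm)
  show "f \<^bold>+ (\<^bold>- f \<^bold>+ g) = g" "\<^bold>- f \<^bold>+ (f \<^bold>+ g) = g"
    using f by (simp_all add: * M.r_neg1 M.r_neg2)
  show "(f \<^bold>+ g) \<^bold>+ h = f \<^bold>+ (g \<^bold>+ h)" "f \<^bold>+ (g \<^bold>+ h) = g \<^bold>+ (f \<^bold>+ h)"
    if "Arr h" "dm g = dm h" "cd g = cd h"
  proof -
    have h: "h \<in> Mor C (dm g) (cd g)" by (rule ArrD') (use that in simp_all)
    show "(f \<^bold>+ g) \<^bold>+ h = f \<^bold>+ (g \<^bold>+ h)" "f \<^bold>+ (g \<^bold>+ h) = g \<^bold>+ (f \<^bold>+ h)"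
      using f h by (simp_all add: * M.a_assoc M.a_lcomm)
  qed
qed

lemmas plus_ac = plus_assoc plus_comm plus_lcomm

lemma
  assumes "Arr f"
  shows plus_neg [simp]: "f \<^bold>+ \<^bold>- f = zr (dm f) (cd f)" "\<^bold>- f \<^bold>+ f = zr (dm f) (cd f)"
    and plus_zr [simp]: "dm f = X \<Longrightarrow> cd f = Y \<Longrightarrow> f \<^bold>+ zr X Y = f"
      "dm f = X \<Longrightarrow> cd f = Y \<Longrightarrow> zr X Y \<^bold>+ f = f"
    and scal_one [simp]: "\<one>\<^bsub>k\<^esub> \<^bold>* f = f"
proof -
  interpret module k "Hom C (dm f) (cd f)" using assms by (intro hom_module) auto
  have *: "x \<^bold>+ y = x \<oplus>\<^bsub>Hom C (dm f) (cd f)\<^esub> y" "\<^bold>- x = \<ominus>\<^bsub>Hom C (dm f) (cd f)\<^esub> x"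
    if "x \<in> Mor C (dm f) (cd f)" for x y
    using homI[OF that] assms by (simp_all add: plus_def neg_def)
  show "f \<^bold>+ \<^bold>- f = zr (dm f) (cd f)" "\<^bold>- f \<^bold>+ f = zr (dm f) (cd f)"
    "\<one>\<^bsub>k\<^esub> \<^bold>* f = f"
    using assms by (simp_all add: * M.r_neg M.l_neg scal_def)
  show "f \<^bold>+ zr X Y = f" "zr X Y \<^bold>+ f = f" if "dm f = X" "cd f = Y"
    using assms by (simp_all add: * flip: that)
qed

lemma plus_neg_zrD:
  assumes "f \<^bold>+ \<^bold>- g = zr X Y" "Arr f" "Arr g" "dm f = X" "cd f = Y" "dm g = X" "cd g = Y"
  shows "f = g"
proof -
  have "f = (f \<^bold>+ \<^bold>- g) \<^bold>+ g" using assms(2-) by (simp add: plus_assoc)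
  then show ?thesis using assms by simp
qed

section \<open>Isomorphisms, pushouts, pullbacks and biproducts in terms of sources and
  targets\<close>

lemma is_iso_iff: "X \<in> Obj C \<Longrightarrow> Y \<in> Obj C \<Longrightarrow>
  is_iso C X Y f \<longleftrightarrow> hom f X Y \<and> (\<exists>g. hom g Y X \<and> g \<bullet> f = Id X \<and> f \<bullet> g = Id Y)"
  unfolding is_iso_def hom_iff comp_def by auto

text \<open>The test object is not quantified, being the common target of the test morphisms; the
  universal property is thus instantiated with morphisms alone.\<close>

lemma is_pushout_iff:
  assumes "X \<in> Obj C" "A \<in> Obj C" "B \<in> Obj C" "P \<in> Obj C"
  shows "is_pushout C X A B P f g i j \<longleftrightarrow> hom f X A \<and> hom g X B \<and> hom i A P \<and> hom j B P \<and> i \<bullet> f = j \<bullet> g \<and>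
    (\<forall>a b. Arr a \<longrightarrow> Arr b \<longrightarrow> dm a = A \<longrightarrow> dm b = B \<longrightarrow> cd a = cd b \<longrightarrow> a \<bullet> f = b \<bullet> g \<longrightarrow>
      (\<exists>!u. hom u P (cd b) \<and> u \<bullet> i = a \<and> u \<bullet> j = b))"
proof -
  have "(\<forall>T\<in>Obj C. \<forall>a\<in>Mor C A T. \<forall>b\<in>Mor C B T. a \<bullet> f = b \<bullet> g \<longrightarrow>
        (\<exists>!u. u \<in> Mor C P T \<and> u \<bullet> i = a \<and> u \<bullet> j = b)) \<longleftrightarrow>
    (\<forall>a b. Arr a \<longrightarrow> Arr b \<longrightarrow> dm a = A \<longrightarrow> dm b = B \<longrightarrow> cd a = cd b \<longrightarrow> a \<bullet> f = b \<bullet> g \<longrightarrow>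
      (\<exists>!u. hom u P (cd b) \<and> u \<bullet> i = a \<and> u \<bullet> j = b))" (is "?L = ?R")
  proof
    assume L: ?L
    show ?R
    proof (intro allI impI)
      fix a b assume *: "Arr a" "Arr b" "dm a = A" "dm b = B" "cd a = cd b" "a \<bullet> f = b \<bullet> g"
      have "(hom u P (cd b)) = (u \<in> Mor C P (cd b))" for u using hom_iff[of u P "cd b"] assms * by simp
      then show "\<exists>!u. hom u P (cd b) \<and> u \<bullet> i = a \<and> u \<bullet> j = b"
        using L * ArrD'[of a A "cd b"] ArrD'[of b B "cd b"] by simp
    qed
  next
    assume R: ?R
    show ?L
    proof (intro ballI impI)
      fix T a b assume *: "T \<in> Obj C" "a \<in> Mor C A T" "b \<in> Mor C B T" "a \<bullet> f = b \<bullet> g"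
      then have ab: "hom a A T" "hom b B T" using homI assms by auto
      have "(hom u P T) = (u \<in> Mor C P T)" for u using hom_iff[of u P T] assms * by simp
      then show "\<exists>!u. u \<in> Mor C P T \<and> u \<bullet> i = a \<and> u \<bullet> j = b"
        using R[rule_format, of a b] * ab by simp
    qed
  qed
  moreover have "hom f X A = (f \<in> Mor C X A)" "hom g X B = (g \<in> Mor C X B)"
    "hom i A P = (i \<in> Mor C A P)" "hom j B P = (j \<in> Mor C B P)"
    using hom_iff assms by simp_all
  ultimately show ?thesis unfolding is_pushout_def comp_def by (simp only:)
qed

lemma is_pullback_iff:
  assumes "X \<in> Obj C" "A \<in> Obj C" "B \<in> Obj C" "P \<in> Obj C"
  shows "is_pullback C P A B X p q f g \<longleftrightarrow> hom p P A \<and> hom q P B \<and> hom f A X \<and> hom g B X \<and> f \<bullet> p = g \<bullet> q \<and>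
    (\<forall>a b. Arr a \<longrightarrow> Arr b \<longrightarrow> cd a = A \<longrightarrow> cd b = B \<longrightarrow> dm a = dm b \<longrightarrow> f \<bullet> a = g \<bullet> b \<longrightarrow>
      (\<exists>!u. hom u (dm b) P \<and> p \<bullet> u = a \<and> q \<bullet> u = b))"
proof -
  have "(\<forall>T\<in>Obj C. \<forall>a\<in>Mor C T A. \<forall>b\<in>Mor C T B. f \<bullet> a = g \<bullet> b \<longrightarrow>
        (\<exists>!u. u \<in> Mor C T P \<and> p \<bullet> u = a \<and> q \<bullet> u = b)) \<longleftrightarrow>
    (\<forall>a b. Arr a \<longrightarrow> Arr b \<longrightarrow> cd a = A \<longrightarrow> cd b = B \<longrightarrow> dm a = dm b \<longrightarrow> f \<bullet> a = g \<bullet> b \<longrightarrow>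
      (\<exists>!u. hom u (dm b) P \<and> p \<bullet> u = a \<and> q \<bullet> u = b))" (is "?L = ?R")
  proof
    assume L: ?L
    show ?R
    proof (intro allI impI)
      fix a b assume *: "Arr a" "Arr b" "cd a = A" "cd b = B" "dm a = dm b" "f \<bullet> a = g \<bullet> b"
      have "(hom u (dm b) P) = (u \<in> Mor C (dm b) P)" for u using hom_iff[of u "dm b" P] assms * by simp
      then show "\<exists>!u. hom u (dm b) P \<and> p \<bullet> u = a \<and> q \<bullet> u = b"
        using L * ArrD'[of a "dm b" A] ArrD'[of b "dm b" B] by simp
    qed
  next
    assume R: ?R
    show ?L
    proof (intro ballI impI)
      fix T a b assume *: "T \<in> Obj C" "a \<in> Mor C T A" "b \<in> Mor C T B" "f \<bullet> a = g \<bullet> b"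
      then have ab: "hom a T A" "hom b T B" using homI assms by auto
      have "(hom u T P) = (u \<in> Mor C T P)" for u using hom_iff[of u T P] assms * by simp
      then show "\<exists>!u. u \<in> Mor C T P \<and> p \<bullet> u = a \<and> q \<bullet> u = b"
        using R[rule_format, of a b] * ab by simp
    qed
  qed
  moreover have "hom p P A = (p \<in> Mor C P A)" "hom q P B = (q \<in> Mor C P B)"
    "hom f A X = (f \<in> Mor C A X)" "hom g B X = (g \<in> Mor C B X)"
    using hom_iff assms by simp_all
  ultimately show ?thesis unfolding is_pullback_def comp_def by (simp only:)
qed

lemma biprodD:
  assumes "is_biprod C A B S" "A \<in> Obj C" "B \<in> Obj C"
  shows "Bob S \<in> Obj C" "hom (in1 S) A (Bob S)" "hom (in2 S) B (Bob S)"
    "hom (pr1 S) (Bob S) A" "hom (pr2 S) (Bob S) B"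
    "pr1 S \<bullet> in1 S = Id A" "pr2 S \<bullet> in2 S = Id B" "pr1 S \<bullet> in2 S = zr B A" "pr2 S \<bullet> in1 S = zr A B"
    "in1 S \<bullet> pr1 S \<^bold>+ in2 S \<bullet> pr2 S = Id (Bob S)"
proof -
  note * = assms(1)[unfolded is_biprod_def]
  show S: "Bob S \<in> Obj C" using * by blast
  show "hom (in1 S) A (Bob S)" "hom (in2 S) B (Bob S)" "hom (pr1 S) (Bob S) A" "hom (pr2 S) (Bob S) B"
    using homI * assms(2,3) S by blast+
  then show "pr1 S \<bullet> in1 S = Id A" "pr2 S \<bullet> in2 S = Id B" "pr1 S \<bullet> in2 S = zr B A" "pr2 S \<bullet> in1 S = zr A B"
    "in1 S \<bullet> pr1 S \<^bold>+ in2 S \<bullet> pr2 S = Id (Bob S)"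
    using * by (simp_all add: plus_def) (simp_all add: comp_def)
qed

lemma biprod_map_eq:
  assumes "is_biprod C A B S" "is_biprod C A' B' T" "hom f A A'" "hom g B B'"
  shows "biprod_map C S T f g = in1 T \<bullet> f \<bullet> pr1 S \<^bold>+ in2 T \<bullet> g \<bullet> pr2 S"
proof -
  have o: "A \<in> Obj C" "B \<in> Obj C" "A' \<in> Obj C" "B' \<in> Obj C" using assms ArrD by metis+
  note S = biprodD[OF assms(1) o(1,2)] and T = biprodD[OF assms(2) o(3,4)]
  have "in1 T \<bullet> f \<bullet> pr1 S = (in1 T \<bullet> f) \<bullet> pr1 S" "in2 T \<bullet> g \<bullet> pr2 S = (in2 T \<bullet> g) \<bullet> pr2 S"
    "hom (in1 T \<bullet> f \<bullet> pr1 S) (Bob S) (Bob T)"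
    using S(2-5) T(2-5) assms(3,4) by simp_all
  then show ?thesis by (simp add: biprod_map_def plus_def) (simp add: comp_def)
qed

end

section \<open>Conflations and their morphisms\<close>

locale exact_cat =
  fixes k :: "'r ring" and C :: "('r, 'o, 'm) lcat" and E :: "('m \<times> 'm) set"
  assumes exact: "exact_category k C E"

sublocale exact_cat \<subseteq> linear_cat k C
  using exact by unfold_locales (simp add: exact_category_def additive_category_def)

context exact_cat
begin

text \<open>Conflations are handled as bare pairs of morphisms, as they occur in Ext classes; the
  three objects are recovered as \<open>lft\<close>, \<open>mid\<close> and
  \<open>rgt\<close>.\<close>

definition conf :: "'m \<times> 'm \<Rightarrow> bool" where
  "conf c \<longleftrightarrow> (\<exists>A B X. conflation C E A B X (fst c) (snd c))"

definition lft :: "'m \<times> 'm \<Rightarrow> 'o" where "lft c = dm (fst c)"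
definition mid :: "'m \<times> 'm \<Rightarrow> 'o" where "mid c = cd (fst c)"
definition rgt :: "'m \<times> 'm \<Rightarrow> 'o" where "rgt c = cd (snd c)"

lemma ends_pair [simp]: "lft (i, p) = dm i" "mid (i, p) = cd i" "rgt (i, p) = cd p"
  by (simp_all add: lft_def mid_def rgt_def)

lemma conflation_iff:
  "conflation C E A B X i p \<longleftrightarrow> conf (i, p) \<and> lft (i, p) = A \<and> mid (i, p) = B \<and> rgt (i, p) = X"
proof
  assume c: "conflation C E A B X i p"
  then have "hom i A B" "hom p B X" using homI by (auto simp: conflation_def)
  then show "conf (i, p) \<and> lft (i, p) = A \<and> mid (i, p) = B \<and> rgt (i, p) = X"
    using c by (auto simp: conf_def lft_def mid_def rgt_def)
next
  assume *: "conf (i, p) \<and> lft (i, p) = A \<and> mid (i, p) = B \<and> rgt (i, p) = X"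
  then obtain A' B' X' where c: "conflation C E A' B' X' i p" by (auto simp: conf_def)
  then have "hom i A' B'" "hom p B' X'" using homI by (auto simp: conflation_def)
  then show "conflation C E A B X i p" using * c by (auto simp: lft_def mid_def rgt_def)
qed

lemma confD [simp]:
  assumes "conf c"
  shows "Arr (fst c)" "dm (fst c) = lft c" "cd (fst c) = mid c"
    "Arr (snd c)" "dm (snd c) = mid c" "cd (snd c) = rgt c"
    "lft c \<in> Obj C" "mid c \<in> Obj C" "rgt c \<in> Obj C"
proof -
  obtain A B X where "conflation C E A B X (fst c) (snd c)" using assms by (auto simp: conf_def)
  then have "hom (fst c) A B" "hom (snd c) B X" using homI by (auto simp: conflation_def)
  then show "Arr (fst c)" "dm (fst c) = lft c" "cd (fst c) = mid c"
    "Arr (snd c)" "dm (snd c) = mid c" "cd (snd c) = rgt c"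
    "lft c \<in> Obj C" "mid c \<in> Obj C" "rgt c \<in> Obj C"
    by (auto simp: lft_def mid_def rgt_def)
qed

lemma conflation_conf:
  assumes "conf c"
  shows "conflation C E (lft c) (mid c) (rgt c) (fst c) (snd c)"
  using assms by (simp add: conflation_iff)

text \<open>The axiom only asserts that suitable objects exist; disjointness of the Hom modules
  forces them to be the recorded ends.\<close>

lemma kernel_cokernel:
  assumes "conf c"
  shows "is_kernel C (lft c) (mid c) (rgt c) (fst c) (snd c)"
    "is_cokernel C (lft c) (mid c) (rgt c) (fst c) (snd c)"
proof -
  have "(fst c, snd c) \<in> E" using conflation_conf[OF assms] by (simp add: conflation_def)
  moreover have "\<forall>(i, p)\<in>E. \<exists>A\<in>Obj C. \<exists>B\<in>Obj C. \<exists>X\<in>Obj C.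
        is_kernel C A B X i p \<and> is_cokernel C A B X i p"
    using exact unfolding exact_category_def by (elim conjE)
  ultimately obtain A B X where o: "A \<in> Obj C" "B \<in> Obj C" "X \<in> Obj C"
    and *: "is_kernel C A B X (fst c) (snd c)" "is_cokernel C A B X (fst c) (snd c)" by auto
  have "hom (fst c) A B" "hom (snd c) B X" using homI * o by (auto simp: is_kernel_def)
  then have "A = lft c" "B = mid c" "X = rgt c" using assms by auto
  then show "is_kernel C (lft c) (mid c) (rgt c) (fst c) (snd c)"
    "is_cokernel C (lft c) (mid c) (rgt c) (fst c) (snd c)" using * by auto
qed

lemma conf_zero [simp]:
  assumes "conf c"
  shows "snd c \<bullet> fst c = zr (lft c) (rgt c)"
    "Arr x \<Longrightarrow> cd x = lft c \<Longrightarrow> snd c \<bullet> (fst c \<bullet> x) = zr (dm x) (rgt c)"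
proof -
  show *: "snd c \<bullet> fst c = zr (lft c) (rgt c)"
    using kernel_cokernel(1)[OF assms] by (simp add: is_kernel_def comp_def)
  show "snd c \<bullet> (fst c \<bullet> x) = zr (dm x) (rgt c)" if "Arr x" "cd x = lft c"
    using comp_reassoc[OF *, of x] that assms by simp
qed

lemma kernel_factor:
  assumes "conf c" "Arr t" "cd t = mid c" "snd c \<bullet> t = zr (dm t) (rgt c)"
  obtains u where "Arr u" "dm u = dm t" "cd u = lft c" "fst c \<bullet> u = t"
proof -
  have "\<exists>!u. u \<in> Mor C (dm t) (lft c) \<and> fst c \<cdot>\<^bsub>C\<^esub> u = t"
    using kernel_cokernel(1)[OF assms(1)] ArrD'[OF assms(2) refl assms(3)] assms
    unfolding is_kernel_def comp_def by simp
  then obtain u where "u \<in> Mor C (dm t) (lft c)" "fst c \<bullet> u = t" by (auto simp: comp_def)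
  then show thesis using that homI[of u "dm t" "lft c"] assms by auto
qed

lemma cokernel_factor:
  assumes "conf c" "Arr t" "dm t = mid c" "t \<bullet> fst c = zr (lft c) (cd t)"
  obtains u where "Arr u" "dm u = rgt c" "cd u = cd t" "u \<bullet> snd c = t"
proof -
  have "\<exists>!u. u \<in> Mor C (rgt c) (cd t) \<and> u \<cdot>\<^bsub>C\<^esub> snd c = t"
    using kernel_cokernel(2)[OF assms(1)] ArrD'[OF assms(2,3) refl] assms
    unfolding is_cokernel_def comp_def by simp
  then obtain u where "u \<in> Mor C (rgt c) (cd t)" "u \<bullet> snd c = t" by (auto simp: comp_def)
  then show thesis using that homI[of u "rgt c" "cd t"] assms by auto
qed

lemma conf_mono:
  assumes "conf c" "fst c \<bullet> u = fst c \<bullet> v" "Arr u" "Arr v" "dm u = dm v" "cd u = lft c" "cd v = lft c"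
  shows "u = v"
proof -
  let ?t = "fst c \<bullet> v"
  have t: "?t \<in> Mor C (dm v) (mid c)" by (rule ArrD') (use assms in simp_all)
  have "snd c \<bullet> ?t = zr (dm v) (rgt c)" using assms by simp
  then have "\<exists>!u. u \<in> Mor C (dm v) (lft c) \<and> fst c \<bullet> u = ?t"
    using kernel_cokernel(1)[OF assms(1)] t assms unfolding is_kernel_def comp_def by simp
  moreover have "u \<in> Mor C (dm v) (lft c)" "v \<in> Mor C (dm v) (lft c)"
    by (rule ArrD'; simp add: assms)+
  ultimately show ?thesis using assms(2) by blast
qed

lemma conf_epi:
  assumes "conf c" "u \<bullet> snd c = v \<bullet> snd c" "Arr u" "Arr v" "cd u = cd v" "dm u = rgt c" "dm v = rgt c"
  shows "u = v"
proof -
  let ?t = "v \<bullet> snd c"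
  have t: "?t \<in> Mor C (mid c) (cd v)" by (rule ArrD') (use assms in simp_all)
  have "?t \<bullet> fst c = zr (lft c) (cd v)" using assms by simp
  then have "\<exists>!u. u \<in> Mor C (rgt c) (cd v) \<and> u \<bullet> snd c = ?t"
    using kernel_cokernel(2)[OF assms(1)] t assms unfolding is_cokernel_def comp_def by simp
  moreover have "u \<in> Mor C (rgt c) (cd v)" "v \<in> Mor C (rgt c) (cd v)"
    by (rule ArrD'; simp add: assms)+
  ultimately show ?thesis using assms(2) by blast
qed

section \<open>Isomorphisms, and the exchange of kernels and cokernels\<close>

definition isop :: "'m \<Rightarrow> 'm \<Rightarrow> bool" where
  "isop f g \<longleftrightarrow> Arr f \<and> Arr g \<and> dm g = cd f \<and> cd g = dm f \<and> g \<bullet> f = Id (dm f) \<and> f \<bullet> g = Id (cd f)"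

lemma is_iso_isop: "is_iso C X Y f \<longleftrightarrow> (\<exists>g. isop f g) \<and> dm f = X \<and> cd f = Y" if "X \<in> Obj C" "Y \<in> Obj C"
  using is_iso_iff[OF that] by (auto simp: isop_def)

lemma isop_Id: "X \<in> Obj C \<Longrightarrow> isop (Id X) (Id X)"
  by (simp add: isop_def)

lemma conf_transport:
  assumes c: "conf c" and d: "Arr (fst d)" "Arr (snd d)" "cd (fst d) = dm (snd d)"
    and iso: "isop a a'" "isop b b'" "isop x x'"
    and a: "dm a = lft c" "cd a = dm (fst d)" and b: "dm b = mid c" "cd b = cd (fst d)"
    and x: "dm x = rgt c" "cd x = cd (snd d)"
    and eq: "fst d \<bullet> a = b \<bullet> fst c" "snd d \<bullet> b = x \<bullet> snd c"
  shows "conf d"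
proof -
  have "is_iso C (lft c) (dm (fst d)) a" "is_iso C (mid c) (cd (fst d)) b" "is_iso C (rgt c) (cd (snd d)) x"
    using assms by (auto simp: is_iso_isop)
  moreover have "\<forall>A B X i p A' B' X' i' p' a b x.
        conflation C E A B X i p \<and> A' \<in> Obj C \<and> B' \<in> Obj C \<and> X' \<in> Obj C \<and>
        i' \<in> Mor C A' B' \<and> p' \<in> Mor C B' X' \<and>
        is_iso C A A' a \<and> is_iso C B B' b \<and> is_iso C X X' x \<and>
        i' \<cdot>\<^bsub>C\<^esub> a = b \<cdot>\<^bsub>C\<^esub> i \<and> p' \<cdot>\<^bsub>C\<^esub> b = x \<cdot>\<^bsub>C\<^esub> p
        \<longrightarrow> conflation C E A' B' X' i' p'"
    using exact unfolding exact_category_def by (elim conjE)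
  moreover have "fst d \<in> Mor C (dm (fst d)) (cd (fst d))" "snd d \<in> Mor C (cd (fst d)) (cd (snd d))"
    using ArrD'[OF d(1) refl refl] ArrD'[OF d(2) d(3)[symmetric] refl] by auto
  ultimately have "conflation C E (dm (fst d)) (cd (fst d)) (cd (snd d)) (fst d) (snd d)"
    using conflation_conf[OF c] d eq unfolding comp_def by (meson ArrD(2,3))
  then show ?thesis by (auto simp: conf_def)
qed

text \<open>Two cokernels of one inflation differ by an isomorphism, and the exact structure is
  closed under isomorphism. This produces conflations with a prescribed deflation when an axiom
  supplies only the inflation.\<close>

lemma conf_cokernel:
  assumes c: "conf c" and p: "Arr p" "dm p = mid c" "p \<bullet> fst c = zr (lft c) (cd p)"
    and fac: "\<And>f. Arr f \<Longrightarrow> dm f = mid c \<Longrightarrow> f \<bullet> fst c = zr (lft c) (cd f) \<Longrightarrow>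
      \<exists>g. Arr g \<and> dm g = cd p \<and> cd g = cd f \<and> g \<bullet> p = f"
    and epi: "\<And>u v. \<lbrakk>u \<bullet> p = v \<bullet> p; Arr u; Arr v; dm u = cd p; dm v = cd p; cd u = cd v\<rbrakk> \<Longrightarrow> u = v"
  shows "conf (fst c, p)"
proof -
  obtain x where x: "Arr x" "dm x = rgt c" "cd x = cd p" "x \<bullet> snd c = p"
    using cokernel_factor[OF c p] .
  obtain y where y: "Arr y" "dm y = cd p" "cd y = rgt c" "y \<bullet> p = snd c"
    using fac[of "snd c"] c by auto
  have "y \<bullet> x = Id (rgt c)"
    by (rule conf_epi[OF c]) (use x y c p in simp_all)
  moreover have "x \<bullet> y = Id (cd p)"
    by (rule epi) (use x y c p in simp_all)
  ultimately have "isop x y" using x y by (simp add: isop_def)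
  then show ?thesis
    by (intro conf_transport[OF c, of "(fst c, p)" "Id (lft c)" "Id (lft c)" "Id (mid c)" "Id (mid c)" x y])
      (use c p x isop_Id in simp_all)
qed

text \<open>Dual to \<open>conf_cokernel\<close>: two kernels of one deflation differ by an
  isomorphism.\<close>

lemma conf_kernel:
  assumes c: "conf c" and i: "Arr i" "cd i = mid c" "snd c \<bullet> i = zr (dm i) (rgt c)"
    and fac: "\<And>f. Arr f \<Longrightarrow> cd f = mid c \<Longrightarrow> snd c \<bullet> f = zr (dm f) (rgt c) \<Longrightarrow>
      \<exists>g. Arr g \<and> cd g = dm i \<and> dm g = dm f \<and> i \<bullet> g = f"
    and mono: "\<And>u v. \<lbrakk>i \<bullet> u = i \<bullet> v; Arr u; Arr v; cd u = dm i; cd v = dm i; dm u = dm v\<rbrakk> \<Longrightarrow> u = v"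
  shows "conf (i, snd c)"
proof -
  obtain x where x: "Arr x" "dm x = dm i" "cd x = lft c" "fst c \<bullet> x = i"
    using kernel_factor[OF c i] .
  obtain y where y: "Arr y" "cd y = dm i" "dm y = lft c" "i \<bullet> y = fst c"
    using fac[of "fst c"] c by auto
  have "x \<bullet> y = Id (lft c)"
    by (rule conf_mono[OF c]) (use x y c i comp_assoc[of y x "fst c", symmetric] in \<open>simp_all del: comp_assoc\<close>)
  moreover have "y \<bullet> x = Id (dm i)"
    by (rule mono) (use x y c i comp_assoc[of x y i, symmetric] in \<open>simp_all del: comp_assoc\<close>)
  ultimately have "isop y x" using x y by (simp add: isop_def)
  then show ?thesis
    by (intro conf_transport[OF c, of "(i, snd c)" y x "Id (mid c)" "Id (mid c)" "Id (rgt c)" "Id (rgt c)"])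
      (use c i y isop_Id in simp_all)
qed

text \<open>A morphism of conflations recorded by its outer components; the middle one is quantified
  away because Ext classes see only the ends. With \<open>f\<close> an identity it means that
  \<open>d\<close> represents the pushout of \<open>c\<close> along \<open>g\<close>, with
  \<open>g\<close> an identity that \<open>c\<close> represents the pullback of \<open>d\<close>
  along \<open>f\<close>.\<close>

definition cm :: "'m \<Rightarrow> 'm \<Rightarrow> 'm \<times> 'm \<Rightarrow> 'm \<times> 'm \<Rightarrow> bool" where
  "cm g f c d \<longleftrightarrow> conf c \<and> conf d \<and> hom g (lft c) (lft d) \<and> hom f (rgt c) (rgt d) \<and>
     (\<exists>h. hom h (mid c) (mid d) \<and> h \<bullet> fst c = fst d \<bullet> g \<and> snd d \<bullet> h = f \<bullet> snd c)"

lemma cmI: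
  assumes "conf c" "conf d" "Arr g" "Arr f" "Arr h"
    "dm g = lft c" "cd g = lft d" "dm f = rgt c" "cd f = rgt d" "dm h = mid c" "cd h = mid d"
    "h \<bullet> fst c = fst d \<bullet> g" "snd d \<bullet> h = f \<bullet> snd c"
  shows "cm g f c d"
  using assms by (auto simp: cm_def)

lemma cmD:
  assumes "cm g f c d"
  shows "conf c" "conf d" "Arr g" "dm g = lft c" "cd g = lft d" "Arr f" "dm f = rgt c" "cd f = rgt d"
  using assms by (auto simp: cm_def)

lemma cmE:
  assumes "cm g f c d"
  obtains h where "Arr h" "dm h = mid c" "cd h = mid d" "h \<bullet> fst c = fst d \<bullet> g" "snd d \<bullet> h = f \<bullet> snd c"
  using assms by (auto simp: cm_def)

lemma cm_refl: "conf c \<Longrightarrow> cm (Id (lft c)) (Id (rgt c)) c c"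
  by (rule cmI[of _ _ _ _ "Id (mid c)"]) simp_all

lemma cm_comp:
  assumes "cm g f c d" "cm g' f' d e"
  shows "cm (g' \<bullet> g) (f' \<bullet> f) c e"
proof -
  note c = cmD[OF assms(1)] and d = cmD[OF assms(2)]
  obtain h where h: "Arr h" "dm h = mid c" "cd h = mid d" "h \<bullet> fst c = fst d \<bullet> g" "snd d \<bullet> h = f \<bullet> snd c"
    using cmE[OF assms(1)] .
  obtain h' where h': "Arr h'" "dm h' = mid d" "cd h' = mid e" "h' \<bullet> fst d = fst e \<bullet> g'" "snd e \<bullet> h' = f' \<bullet> snd d"
    using cmE[OF assms(2)] .
  show ?thesis
  proof (rule cmI[of _ _ _ _ "h' \<bullet> h"])
    show "(h' \<bullet> h) \<bullet> fst c = fst e \<bullet> g' \<bullet> g"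
      using c d h h' comp_reassoc[OF h'(4), of g] by simp
    show "snd e \<bullet> h' \<bullet> h = (f' \<bullet> f) \<bullet> snd c"
      using c d h h' comp_reassoc[OF h'(5), of h] by simp
  qed (use c d h h' in simp_all)
qed

text \<open>\<open>h\<close> maps the kernel of \<open>snd c\<close> into the kernel of
  \<open>snd d\<close>, and \<open>g\<close> is the induced map.\<close>

lemma cm_fill_left:
  assumes c: "conf c" "conf d" and h: "Arr h" "dm h = mid c" "cd h = mid d"
    and f: "Arr f" "dm f = rgt c" "cd f = rgt d" and eq: "snd d \<bullet> h = f \<bullet> snd c"
  obtains g where "cm g f c d" "h \<bullet> fst c = fst d \<bullet> g"
proof -
  have "snd d \<bullet> (h \<bullet> fst c) = zr (lft c) (rgt d)"
    using comp_reassoc[OF eq, of "fst c"] c h f by simp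
  then obtain g where g: "Arr g" "dm g = lft c" "cd g = lft d" "fst d \<bullet> g = h \<bullet> fst c"
    using kernel_factor[OF c(2), of "h \<bullet> fst c"] c h by auto
  show thesis
    by (rule that[of g], rule cmI[of _ _ _ _ h]) (use g c h f eq in simp_all)
qed

lemma cm_fill_right:
  assumes c: "conf c" "conf d" and h: "Arr h" "dm h = mid c" "cd h = mid d"
    and g: "Arr g" "dm g = lft c" "cd g = lft d" and eq: "h \<bullet> fst c = fst d \<bullet> g"
  obtains f where "cm g f c d" "snd d \<bullet> h = f \<bullet> snd c"
proof -
  have "(snd d \<bullet> h) \<bullet> fst c = zr (lft c) (rgt d)"
    using c h g eq by simp
  then obtain f where f: "Arr f" "dm f = rgt c" "cd f = rgt d" "f \<bullet> snd c = snd d \<bullet> h"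
    using cokernel_factor[OF c(1), of "snd d \<bullet> h"] c h by auto
  show thesis
    by (rule that[of f], rule cmI[of _ _ _ _ h]) (use f c h g eq in simp_all)
qed

section \<open>Pushouts and pullbacks of conflations\<close>

lemma inflation_iff: "inflation C E A B i \<longleftrightarrow> (\<exists>c. conf c \<and> fst c = i \<and> lft c = A \<and> mid c = B)"
  by (auto simp: inflation_def conflation_iff)

lemma deflation_iff: "deflation C E B X p \<longleftrightarrow> (\<exists>c. conf c \<and> snd c = p \<and> mid c = B \<and> rgt c = X)"
  by (auto simp: deflation_def conflation_iff)

definition po_square :: "'m \<Rightarrow> 'm \<times> 'm \<Rightarrow> 'm \<times> 'm \<Rightarrow> 'm \<Rightarrow> bool" where
  "po_square g c d h \<longleftrightarrow> conf c \<and> conf d \<and> rgt d = rgt c \<and> snd d \<bullet> h = snd c \<and>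
     is_pushout C (lft c) (lft d) (mid c) (mid d) g (fst c) (fst d) h"

definition pb_square :: "'m \<Rightarrow> 'm \<times> 'm \<Rightarrow> 'm \<times> 'm \<Rightarrow> 'm \<Rightarrow> bool" where
  "pb_square f d c h \<longleftrightarrow> conf c \<and> conf d \<and> lft d = lft c \<and> h \<bullet> fst d = fst c \<and>
     is_pullback C (mid d) (rgt d) (mid c) (rgt c) (snd d) h f (snd c)"

lemma po_squareD:
  assumes "po_square g c d h"
  shows "conf c" "conf d" "rgt d = rgt c" "hom g (lft c) (lft d)" "hom h (mid c) (mid d)"
    "fst d \<bullet> g = h \<bullet> fst c" "snd d \<bullet> h = snd c"
    "\<And>a b. \<lbrakk>Arr a; Arr b; dm a = lft d; dm b = mid c; cd a = cd b; a \<bullet> g = b \<bullet> fst c\<rbrakk> \<Longrightarrow>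
      \<exists>!u. hom u (mid d) (cd b) \<and> u \<bullet> fst d = a \<and> u \<bullet> h = b"
proof -
  show 1: "conf c" "conf d" "rgt d = rgt c" "snd d \<bullet> h = snd c" using assms by (auto simp: po_square_def)
  have "is_pushout C (lft c) (lft d) (mid c) (mid d) g (fst c) (fst d) h"
    using assms by (simp add: po_square_def)
  note * = this[unfolded is_pushout_iff[OF confD(7)[OF 1(1)] confD(7)[OF 1(2)] confD(8)[OF 1(1)] confD(8)[OF 1(2)]]]
  show "hom g (lft c) (lft d)" "hom h (mid c) (mid d)" "fst d \<bullet> g = h \<bullet> fst c" using * by auto
  show "\<And>a b. \<lbrakk>Arr a; Arr b; dm a = lft d; dm b = mid c; cd a = cd b; a \<bullet> g = b \<bullet> fst c\<rbrakk> \<Longrightarrow>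
      \<exists>!u. hom u (mid d) (cd b) \<and> u \<bullet> fst d = a \<and> u \<bullet> h = b" using * by blast
qed

lemma pb_squareD:
  assumes "pb_square f d c h"
  shows "conf c" "conf d" "lft d = lft c" "hom f (rgt d) (rgt c)" "hom h (mid d) (mid c)"
    "f \<bullet> snd d = snd c \<bullet> h" "h \<bullet> fst d = fst c"
    "\<And>a b. \<lbrakk>Arr a; Arr b; cd a = rgt d; cd b = mid c; dm a = dm b; f \<bullet> a = snd c \<bullet> b\<rbrakk> \<Longrightarrow>
      \<exists>!u. hom u (dm b) (mid d) \<and> snd d \<bullet> u = a \<and> h \<bullet> u = b"
proof -
  show 1: "conf c" "conf d" "lft d = lft c" "h \<bullet> fst d = fst c" using assms by (auto simp: pb_square_def)
  have "is_pullback C (mid d) (rgt d) (mid c) (rgt c) (snd d) h f (snd c)"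
    using assms by (simp add: pb_square_def)
  note * = this[unfolded is_pullback_iff[OF confD(9)[OF 1(1)] confD(9)[OF 1(2)] confD(8)[OF 1(1)] confD(8)[OF 1(2)]]]
  show "hom f (rgt d) (rgt c)" "hom h (mid d) (mid c)" "f \<bullet> snd d = snd c \<bullet> h" using * by auto
  show "\<And>a b. \<lbrakk>Arr a; Arr b; cd a = rgt d; cd b = mid c; dm a = dm b; f \<bullet> a = snd c \<bullet> b\<rbrakk> \<Longrightarrow>
      \<exists>!u. hom u (dm b) (mid d) \<and> snd d \<bullet> u = a \<and> h \<bullet> u = b" using * by blast
qed

lemma po_square_ext:
  assumes "po_square g c d h" "Arr u" "Arr v" "dm u = mid d" "dm v = mid d" "cd u = cd v"
    "u \<bullet> fst d = v \<bullet> fst d" "u \<bullet> h = v \<bullet> h"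
  shows "u = v"
proof -
  note p = po_squareD[OF assms(1)]
  have "\<exists>!w. hom w (mid d) (cd (v \<bullet> h)) \<and> w \<bullet> fst d = v \<bullet> fst d \<and> w \<bullet> h = v \<bullet> h"
    by (rule p(8)) (use p(1-7) assms(2-) in simp_all)
  moreover have "hom u (mid d) (cd (v \<bullet> h)) \<and> u \<bullet> fst d = v \<bullet> fst d \<and> u \<bullet> h = v \<bullet> h"
    "hom v (mid d) (cd (v \<bullet> h))"
    using p(1-7) assms(2-) by simp_all
  ultimately show ?thesis by blast
qed

lemma pb_square_ext:
  assumes "pb_square f d c h" "Arr u" "Arr v" "cd u = mid d" "cd v = mid d" "dm u = dm v"
    "snd d \<bullet> u = snd d \<bullet> v" "h \<bullet> u = h \<bullet> v"
  shows "u = v"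
proof -
  note p = pb_squareD[OF assms(1)]
  have "\<exists>!w. hom w (dm (h \<bullet> v)) (mid d) \<and> snd d \<bullet> w = snd d \<bullet> v \<and> h \<bullet> w = h \<bullet> v"
    by (rule p(8)) (use p(1-7) assms(2-) comp_reassoc[OF p(6), of v] in simp_all)
  moreover have "hom u (dm (h \<bullet> v)) (mid d) \<and> snd d \<bullet> u = snd d \<bullet> v \<and> h \<bullet> u = h \<bullet> v"
    "hom v (dm (h \<bullet> v)) (mid d)"
    using p(1-7) assms(2-) by simp_all
  ultimately show ?thesis by blast
qed

text \<open>The axiom yields an inflation out of \<open>cd g\<close> without identifying its
  cokernel. The pushout property, applied to 0 and \<open>snd c\<close>, gives a map
  \<open>u\<close> to the right end of \<open>c\<close>; it is a cokernel because maps out of the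
  pushout killing \<open>fst d\<close> correspond to maps out of \<open>mid c\<close> killing
  \<open>fst c\<close>.\<close>

lemma pushout_exists:
  assumes c: "conf c" and g: "Arr g" "dm g = lft c"
  obtains d h where "po_square g c d h" "lft d = cd g"
proof -
  have "\<forall>A B A' i f. inflation C E A B i \<and> A' \<in> Obj C \<and> f \<in> Mor C A A' \<longrightarrow>
        (\<exists>B'\<in>Obj C. \<exists>f' i'. is_pushout C A B A' B' i f f' i' \<and> inflation C E A' B' i')"
    using exact unfolding exact_category_def by (elim conjE)
  moreover have "inflation C E (lft c) (mid c) (fst c)" using c unfolding inflation_iff by blast
  moreover have "g \<in> Mor C (lft c) (cd g)" using ArrD'[OF g refl] .
  ultimately obtain B' h i' where o: "B' \<in> Obj C" and po: "is_pushout C (lft c) (mid c) (cd g) B' (fst c) g h i'"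
    and i': "inflation C E (cd g) B' i'" using g by (meson ArrD(3))
  obtain d where d: "conf d" "i' = fst d" "lft d = cd g" "B' = mid d" using i' unfolding inflation_iff by blast
  note * = po[unfolded is_pushout_iff[OF confD(7)[OF c] confD(8)[OF c] ArrD(3)[OF g(1)] o]]
  have h: "Arr h" "dm h = mid c" "cd h = mid d" "h \<bullet> fst c = fst d \<bullet> g" using * d by auto
  have univ: "\<exists>!u. hom u (mid d) (cd b) \<and> u \<bullet> fst d = a \<and> u \<bullet> h = b"
    if ab: "Arr a" "Arr b" "dm a = lft d" "dm b = mid c" "cd a = cd b" "a \<bullet> g = b \<bullet> fst c" for a b
  proof -
    have "\<exists>!u. hom u B' (cd a) \<and> u \<bullet> h = b \<and> u \<bullet> i' = a" using * ab d by metis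
    then show ?thesis using ab d by (simp add: conj_commute conj_left_commute)
  qed
  obtain u where u: "Arr u" "dm u = mid d" "cd u = rgt c" "u \<bullet> fst d = zr (lft d) (rgt c)" "u \<bullet> h = snd c"
    using univ[of "zr (lft d) (rgt c)" "snd c"] c d g by auto
  have ext: "v = w" if "Arr v" "Arr w" "dm v = mid d" "dm w = mid d" "cd v = cd w"
    "v \<bullet> fst d = w \<bullet> fst d" "v \<bullet> h = w \<bullet> h" for v w
  proof -
    have "\<exists>!x. hom x (mid d) (cd (w \<bullet> h)) \<and> x \<bullet> fst d = w \<bullet> fst d \<and> x \<bullet> h = w \<bullet> h"
      by (rule univ) (use that c d g h in simp_all)
    moreover have "hom v (mid d) (cd (w \<bullet> h)) \<and> v \<bullet> fst d = w \<bullet> fst d \<and> v \<bullet> h = w \<bullet> h"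
      "hom w (mid d) (cd (w \<bullet> h))"
      using that h d by simp_all
    ultimately show ?thesis by blast
  qed
  have "conf (fst d, u)"
  proof (rule conf_cokernel[OF d(1)])
    fix f assume f: "Arr f" "dm f = mid d" "f \<bullet> fst d = zr (lft d) (cd f)"
    have "(f \<bullet> h) \<bullet> fst c = zr (lft c) (cd f)"
      using f h c d g comp_reassoc[OF f(3), of g] by simp
    then obtain v where v: "Arr v" "dm v = rgt c" "cd v = cd f" "v \<bullet> snd c = f \<bullet> h"
      using cokernel_factor[OF c, of "f \<bullet> h"] f h by auto
    have "v \<bullet> u = f"
      by (rule ext) (use v u f h d c g in simp_all)
    then show "\<exists>g. Arr g \<and> dm g = cd u \<and> cd g = cd f \<and> g \<bullet> u = f" using v u by auto
  next
    fix v w assume vw: "v \<bullet> u = w \<bullet> u" "Arr v" "Arr w" "dm v = cd u" "dm w = cd u" "cd v = cd w"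
    have "(v \<bullet> u) \<bullet> h = (w \<bullet> u) \<bullet> h" using vw by simp
    then have "v \<bullet> snd c = w \<bullet> snd c" using vw(2-) u h c d g by simp
    then show "v = w" by (rule conf_epi[OF c]) (use vw u c d in simp_all)
  qed (use u d c in simp_all)
  moreover have "lft (fst d, u) = cd g" "mid (fst d, u) = mid d" "rgt (fst d, u) = rgt c"
    using d u by simp_all
  moreover have "is_pushout C (lft c) (cd g) (mid c) (mid d) g (fst c) (fst d) h"
    unfolding is_pushout_iff[OF confD(7)[OF c] ArrD(3)[OF g(1)] confD(8)[OF c] confD(8)[OF d(1)]]
    using g h c d univ by auto
  ultimately have "po_square g c (fst d, u) h" using c u by (simp add: po_square_def)
  then show thesis using that \<open>lft (fst d, u) = cd g\<close> by blast
qed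

text \<open>Dual to \<open>pushout_exists\<close>: the axiom yields the deflation, and the inflation
  \<open>u\<close> is induced by 0 and \<open>fst c\<close>.\<close>

lemma pullback_exists:
  assumes c: "conf c" and f: "Arr f" "cd f = rgt c"
  obtains d h where "pb_square f d c h" "rgt d = dm f"
proof -
  have "\<forall>B X X' p f. deflation C E B X p \<and> X' \<in> Obj C \<and> f \<in> Mor C X' X \<longrightarrow>
        (\<exists>B'\<in>Obj C. \<exists>f' p'. is_pullback C B' B X' X f' p' p f \<and> deflation C E B' X' p')"
    using exact unfolding exact_category_def by (elim conjE)
  moreover have "deflation C E (mid c) (rgt c) (snd c)" using c unfolding deflation_iff by blast
  moreover have "f \<in> Mor C (dm f) (rgt c)" using ArrD'[OF f(1) refl f(2)] .
  ultimately obtain B' h p' where o: "B' \<in> Obj C" and pb: "is_pullback C B' (mid c) (dm f) (rgt c) h p' (snd c) f"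
    and p': "deflation C E B' (dm f) p'" using f by (meson ArrD(2))
  obtain d where d: "conf d" "p' = snd d" "rgt d = dm f" "B' = mid d" using p' unfolding deflation_iff by blast
  note * = pb[unfolded is_pullback_iff[OF confD(9)[OF c] confD(8)[OF c] ArrD(2)[OF f(1)] o]]
  have h: "Arr h" "dm h = mid d" "cd h = mid c" "snd c \<bullet> h = f \<bullet> snd d" using * d by auto
  have univ: "\<exists>!u. hom u (dm b) (mid d) \<and> snd d \<bullet> u = a \<and> h \<bullet> u = b"
    if ab: "Arr a" "Arr b" "cd a = rgt d" "cd b = mid c" "dm a = dm b" "f \<bullet> a = snd c \<bullet> b" for a b
  proof -
    have "\<exists>!u. hom u (dm a) B' \<and> h \<bullet> u = b \<and> p' \<bullet> u = a" using * ab d by metis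
    then show ?thesis using ab d by (simp add: conj_commute conj_left_commute)
  qed
  obtain u where u: "Arr u" "dm u = lft c" "cd u = mid d" "snd d \<bullet> u = zr (lft c) (rgt d)" "h \<bullet> u = fst c"
    using univ[of "zr (lft c) (rgt d)" "fst c"] c d f by auto
  have ext: "v = w" if "Arr v" "Arr w" "cd v = mid d" "cd w = mid d" "dm v = dm w"
    "snd d \<bullet> v = snd d \<bullet> w" "h \<bullet> v = h \<bullet> w" for v w
  proof -
    have "\<exists>!x. hom x (dm (h \<bullet> w)) (mid d) \<and> snd d \<bullet> x = snd d \<bullet> w \<and> h \<bullet> x = h \<bullet> w"
      by (rule univ) (use that c d f h comp_reassoc[OF h(4), of w] in simp_all)
    moreover have "hom v (dm (h \<bullet> w)) (mid d) \<and> snd d \<bullet> v = snd d \<bullet> w \<and> h \<bullet> v = h \<bullet> w"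
      "hom w (dm (h \<bullet> w)) (mid d)"
      using that h d by simp_all
    ultimately show ?thesis by blast
  qed
  have "conf (u, snd d)"
  proof (rule conf_kernel[OF d(1)])
    fix t assume t: "Arr t" "cd t = mid d" "snd d \<bullet> t = zr (dm t) (rgt d)"
    have "snd c \<bullet> (h \<bullet> t) = zr (dm t) (rgt c)"
      using t h c d f comp_reassoc[OF h(4), of t] by simp
    then obtain v where v: "Arr v" "cd v = lft c" "dm v = dm t" "fst c \<bullet> v = h \<bullet> t"
      using kernel_factor[OF c, of "h \<bullet> t"] t h by auto
    have "u \<bullet> v = t"
      by (rule ext) (use v u t h d c f comp_reassoc[OF u(4), of v] comp_reassoc[OF u(5), of v] in simp_all)
    then show "\<exists>g. Arr g \<and> cd g = dm u \<and> dm g = dm t \<and> u \<bullet> g = t" using v u by auto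
  next
    fix v w assume vw: "u \<bullet> v = u \<bullet> w" "Arr v" "Arr w" "cd v = dm u" "cd w = dm u" "dm v = dm w"
    have "h \<bullet> (u \<bullet> v) = h \<bullet> (u \<bullet> w)" using vw by simp
    then have "fst c \<bullet> v = fst c \<bullet> w"
      using vw(2-) u h c d f comp_reassoc[OF u(5), of v] comp_reassoc[OF u(5), of w] by simp
    then show "v = w" by (rule conf_mono[OF c]) (use vw u c d in simp_all)
  qed (use u d c in simp_all)
  moreover have "rgt (u, snd d) = dm f" "mid (u, snd d) = mid d" "lft (u, snd d) = lft c"
    using d u by simp_all
  moreover have "is_pullback C (mid d) (dm f) (mid c) (rgt c) (snd d) h f (snd c)"
    unfolding is_pullback_iff[OF confD(9)[OF c] ArrD(2)[OF f(1)] confD(8)[OF c] confD(8)[OF d(1)]]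
    using f h c d univ by auto
  ultimately have "pb_square f (u, snd d) c h" using c u by (simp add: pb_square_def)
  then show thesis using that \<open>rgt (u, snd d) = dm f\<close> by blast
qed

lemma po_square_cm: "po_square g c d h \<Longrightarrow> cm g (Id (rgt c)) c d"
  using po_squareD(1-7)[of g c d h] by (intro cmI[of _ _ _ _ h]) auto

lemma pb_square_cm: "pb_square f d c h \<Longrightarrow> cm (Id (lft c)) f d c"
  using pb_squareD(1-7)[of f d c h] by (intro cmI[of _ _ _ _ h]) auto

text \<open>The middle map is induced by \<open>fst e\<close> and the given middle map
  \<open>t\<close>; its compatibility with the deflations is checked on the two legs of the
  pushout.\<close>

lemma po_square_factor:
  assumes "po_square g c d h" "cm g f c e"
  shows "cm (Id (lft d)) f d e"
proof -
  note p = po_squareD[OF assms(1)] and e = cmD[OF assms(2)]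
  obtain t where t: "Arr t" "dm t = mid c" "cd t = mid e" "t \<bullet> fst c = fst e \<bullet> g" "snd e \<bullet> t = f \<bullet> snd c"
    using cmE[OF assms(2)] .
  obtain u where u: "Arr u" "dm u = mid d" "cd u = mid e" "u \<bullet> fst d = fst e" "u \<bullet> h = t"
    using p(8)[of "fst e" t] p(1-7) e t by auto
  have "snd e \<bullet> u = f \<bullet> snd d"
    by (rule po_square_ext[OF assms(1)]) (use p(1-7) e t u in simp_all)
  then show ?thesis using p(1-7) e u by (intro cmI[of _ _ _ _ u]) auto
qed

lemma pb_square_factor:
  assumes "pb_square f d c h" "cm g f e c"
  shows "cm g (Id (rgt d)) e d"
proof -
  note p = pb_squareD[OF assms(1)] and e = cmD[OF assms(2)]
  obtain t where t: "Arr t" "dm t = mid e" "cd t = mid c" "t \<bullet> fst e = fst c \<bullet> g" "snd c \<bullet> t = f \<bullet> snd e"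
    using cmE[OF assms(2)] .
  obtain u where u: "Arr u" "dm u = mid e" "cd u = mid d" "snd d \<bullet> u = snd e" "h \<bullet> u = t"
    using p(8)[of "snd e" t] p(1-7) e t by auto
  have "u \<bullet> fst e = fst d \<bullet> g"
    by (rule pb_square_ext[OF assms(1)])
      (use p(1-7) e t u comp_reassoc[OF u(4), of "fst e"] comp_reassoc[OF u(5), of "fst e"]
        comp_reassoc[OF p(7), of g] in simp_all)
  then show ?thesis using p(1-7) e u by (intro cmI[of _ _ _ _ u]) auto
qed

text \<open>The inverse is written down in terms of elements. An \<open>m\<close> in the middle of
  \<open>d\<close> has, on the pullback \<open>e\<close>, a partner \<open>n\<close> in the middle
  of \<open>c\<close> with the same image on the right; then \<open>m - h n\<close> comes from some
  \<open>r\<close> on the left, and \<open>m\<close> is sent to \<open>n + r\<close>. This does not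
  depend on \<open>n\<close>, so it descends along the deflation \<open>b\<close> to
  \<open>mid d\<close>.\<close>

lemma five_lemma:
  assumes c: "conf c" "conf d" and o: "lft d = lft c" "rgt d = rgt c"
    and h: "Arr h" "dm h = mid c" "cd h = mid d" "h \<bullet> fst c = fst d" "snd d \<bullet> h = snd c"
  obtains h' where "isop h h'"
proof -
  obtain e a where e: "pb_square (snd d) e c a" "rgt e = mid d"
    using pullback_exists[OF c(1), of "snd d"] c o by auto
  note p = pb_squareD[OF e(1)]
  define b where "b = snd e"
  have b: "Arr b" "dm b = mid e" "cd b = mid d" using p(1-7) e by (auto simp: b_def)
  have pab: "snd d \<bullet> b = snd c \<bullet> a" using p(1-7) by (simp add: b_def)
  define x where "x = b \<^bold>+ \<^bold>- (h \<bullet> a)"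
  have x: "Arr x" "dm x = mid e" "cd x = mid d" using b h p(1-7) by (simp_all add: x_def)
  have "snd d \<bullet> x = zr (mid e) (rgt d)"
    using b h p(1-7) pab c comp_reassoc[OF h(5), of a] by (simp add: x_def)
  then obtain r where r: "Arr r" "dm r = mid e" "cd r = lft d" "fst d \<bullet> r = x"
    using kernel_factor[OF c(2), of x] x by auto
  define w where "w = fst e"
  have w: "Arr w" "dm w = lft c" "cd w = mid e" "a \<bullet> w = fst c" "b \<bullet> w = zr (lft c) (mid d)"
    using p(1-7) e by (auto simp: w_def b_def)
  have "r \<bullet> w = \<^bold>- (Id (lft c))"
  proof (rule conf_mono[OF c(2)])
    have "fst d \<bullet> (r \<bullet> w) = x \<bullet> w" using comp_reassoc[OF r(4), of w] r w c by simp
    also have "\<dots> = \<^bold>- (fst d)"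
      using b h p(1-7) w c o by (simp add: x_def)
    finally show "fst d \<bullet> (r \<bullet> w) = fst d \<bullet> \<^bold>- (Id (lft c))" using c o by simp
  qed (use r w c o in simp_all)
  \<comment> \<open>The identity corrected so that it kills the kernel \<open>w\<close> of
    \<open>b\<close>; followed by \<open>a\<close> it is the assignment
    \<open>n + r\<close>.\<close>
  define y where "y = Id (mid e) \<^bold>+ w \<bullet> r"
  have y: "Arr y" "dm y = mid e" "cd y = mid e" using w r o p(1-7) by (simp_all add: y_def)
  have "y \<bullet> fst e = zr (lft e) (mid e)"
    using w r o p(1-7) \<open>r \<bullet> w = _\<close> by (simp add: y_def flip: w_def)
  then obtain s where s: "Arr s" "dm s = mid d" "cd s = mid e" "s \<bullet> b = y"
    using cokernel_factor[OF p(2), of y] y e(2) by (auto simp: b_def)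
  define v where "v = a \<bullet> s"
  have v: "Arr v" "dm v = mid d" "cd v = mid c" using s p(1-7) by (simp_all add: v_def)
  have "h \<bullet> v = Id (mid d)"
  proof (rule conf_epi[OF p(2)])
    have "(h \<bullet> v) \<bullet> b = h \<bullet> (a \<bullet> y)" using s h p(1-7) b by (simp add: v_def)
    also have "\<dots> = h \<bullet> a \<^bold>+ fst d \<bullet> r"
      using h p(1-7) w r o c comp_reassoc[OF w(4), of r] comp_reassoc[OF h(4), of r] by (simp add: y_def)
    also have "\<dots> = b" using h p(1-7) b c r(4) by (simp add: x_def plus_ac plus_neg_cancel)
    finally show "(h \<bullet> v) \<bullet> snd e = Id (mid d) \<bullet> snd e" using b by (simp add: b_def)
  qed (use h v e(2) c in simp_all)
  moreover have "v \<bullet> h = Id (mid c)"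
  proof (rule plus_neg_zrD)
    define z where "z = v \<bullet> h \<^bold>+ \<^bold>- (Id (mid c))"
    have z: "Arr z" "dm z = mid c" "cd z = mid c" using v h c by (simp_all add: z_def)
    have hz: "h \<bullet> z = zr (mid c) (mid d)"
      using v h c comp_reassoc[OF \<open>h \<bullet> v = _\<close>, of h] by (simp add: z_def)
    have "snd c \<bullet> z = snd d \<bullet> (h \<bullet> z)" using comp_reassoc[OF h(5), of z] z h c by simp
    then have "snd c \<bullet> z = zr (mid c) (rgt c)" using hz c o by simp
    then obtain u where u: "Arr u" "dm u = mid c" "cd u = lft c" "fst c \<bullet> u = z"
      using kernel_factor[OF c(1), of z] z by auto
    have "fst d \<bullet> u = fst d \<bullet> zr (mid c) (lft c)"
      using comp_reassoc[OF h(4), of u] u hz h c o by simp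
    then have "u = zr (mid c) (lft c)"
      by (rule conf_mono[OF c(2)]) (use u c o in simp_all)
    then have "z = zr (mid c) (mid c)" using u c by auto
    then show "v \<bullet> h \<^bold>+ \<^bold>- (Id (mid c)) = zr (mid c) (mid c)" by (simp add: z_def)
  qed (use v h c in simp_all)
  ultimately have "isop h v" using h v by (simp add: isop_def)
  then show thesis by (rule that)
qed

end

lemma (in linear_cat) neg_zr [simp]: "X \<in> Obj C \<Longrightarrow> Y \<in> Obj C \<Longrightarrow> \<^bold>- (zr X Y) = zr X Y"
  using module.neg_zero[OF hom_module, of X Y] by (simp add: neg_def)

context exact_cat
begin

subsection \<open>Classes of conflations\<close>

text \<open>Only a ladder with identities at the ends is required; by \<open>five_lemma\<close> its
  middle map is an isomorphism, which makes the relation symmetric.\<close>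

definition eqv :: "'m \<times> 'm \<Rightarrow> 'm \<times> 'm \<Rightarrow> bool" where
  "eqv c d \<longleftrightarrow> cm (Id (lft c)) (Id (rgt c)) c d"

definition cl :: "'m \<times> 'm \<Rightarrow> ('m \<times> 'm) set" where
  "cl c = {d. eqv c d}"

lemma eqvD:
  assumes "eqv c d"
  shows "conf c" "conf d" "lft d = lft c" "rgt d = rgt c"
proof -
  note * = cmD[OF assms[unfolded eqv_def]]
  show "conf c" "conf d" "lft d = lft c" "rgt d = rgt c" using * by auto
qed

lemma eqv_isoE:
  assumes "eqv c d"
  obtains h h' where "isop h h'" "dm h = mid c" "cd h = mid d" "h \<bullet> fst c = fst d" "snd d \<bullet> h = snd c"
proof -
  note e = eqvD[OF assms]
  obtain h where h: "Arr h" "dm h = mid c" "cd h = mid d" "h \<bullet> fst c = fst d \<bullet> Id (lft c)" "snd d \<bullet> h = Id (rgt c) \<bullet> snd c"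
    using cmE[OF assms[unfolded eqv_def]] .
  have h': "h \<bullet> fst c = fst d" "snd d \<bullet> h = snd c" using h e by simp_all
  obtain h' where "isop h h'" using five_lemma[OF e h(1-3) h'] .
  then show thesis using that h(2,3) h' by blast
qed

lemma eqv_refl: "conf c \<Longrightarrow> eqv c c"
  by (simp add: eqv_def cm_refl)

lemma eqv_sym:
  assumes "eqv c d"
  shows "eqv d c"
proof -
  note e = eqvD[OF assms]
  obtain h h' where h: "isop h h'" "dm h = mid c" "cd h = mid d" "h \<bullet> fst c = fst d" "snd d \<bullet> h = snd c"
    using eqv_isoE[OF assms] .
  note i = h(1)[unfolded isop_def]
  have "h' \<bullet> fst d = fst c"
    using comp_reassoc[of h' h "Id (mid c)" "fst c"] i h e by simp
  moreover have "snd c \<bullet> h' = snd d"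
  proof -
    have "snd c \<bullet> h' = (snd d \<bullet> h) \<bullet> h'" using h by simp
    also have "\<dots> = snd d" using i h(2,3) e by simp
    finally show ?thesis .
  qed
  ultimately show ?thesis
    unfolding eqv_def by (intro cmI[of _ _ _ _ h']) (use i h e in simp_all)
qed

lemma eqv_trans: "eqv c d \<Longrightarrow> eqv d e \<Longrightarrow> eqv c e"
  using cm_comp[of "Id (lft c)" "Id (rgt c)" c d "Id (lft c)" "Id (rgt c)" e] eqvD[of c d]
  by (simp add: eqv_def)

lemma cl_eq_iff: "conf c \<Longrightarrow> cl c = cl d \<longleftrightarrow> eqv c d"
  unfolding cl_def using eqv_refl eqv_sym eqv_trans by blast

lemma ext_class_eq:
  assumes "conf c"
  shows "ext_class C E (rgt c) (lft c) c = cl c"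
proof (rule Set.set_eqI)
  fix d
  have "d \<in> ext_class C E (rgt c) (lft c) c \<longleftrightarrow> (\<exists>A A' h.
     conflation C E (lft c) A (rgt c) (fst c) (snd c) \<and> conflation C E (lft c) A' (rgt c) (fst d) (snd d) \<and>
     is_iso C A A' h \<and> h \<bullet> fst c = fst d \<and> snd d \<bullet> h = snd c)"
    unfolding ext_class_def comp_def by (simp add: case_prod_beta)
  also have "\<dots> \<longleftrightarrow> eqv c d"
  proof
    assume "\<exists>A A' h. conflation C E (lft c) A (rgt c) (fst c) (snd c) \<and> conflation C E (lft c) A' (rgt c) (fst d) (snd d) \<and>
     is_iso C A A' h \<and> h \<bullet> fst c = fst d \<and> snd d \<bullet> h = snd c"
    then obtain A A' h where *: "conflation C E (lft c) A (rgt c) (fst c) (snd c)"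
      "conflation C E (lft c) A' (rgt c) (fst d) (snd d)"
      "is_iso C A A' h" "h \<bullet> fst c = fst d" "snd d \<bullet> h = snd c" by blast
    then have d: "conf d" "lft d = lft c" "rgt d = rgt c" "A' = mid d" "A = mid c"
      using assms by (auto simp: conflation_iff)
    then have "hom h (mid c) (mid d)"
      using is_iso_iff[of "mid c" "mid d" h] *(3) assms by simp
    then show "eqv c d" unfolding eqv_def
      by (intro cmI[of _ _ _ _ h]) (use d * assms in simp_all)
  next
    assume eq: "eqv c d"
    obtain h h' where h: "isop h h'" "dm h = mid c" "cd h = mid d" "h \<bullet> fst c = fst d" "snd d \<bullet> h = snd c"
      using eqv_isoE[OF eq] .
    have "is_iso C (mid c) (mid d) h" using h is_iso_isop[of "mid c" "mid d" h] eqvD[OF eq] by auto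
    then show "\<exists>A A' h. conflation C E (lft c) A (rgt c) (fst c) (snd c) \<and> conflation C E (lft c) A' (rgt c) (fst d) (snd d) \<and>
     is_iso C A A' h \<and> h \<bullet> fst c = fst d \<and> snd d \<bullet> h = snd c"
      using conflation_conf[of c] conflation_conf[of d] eqvD[OF eq] h by metis
  qed
  finally show "d \<in> ext_class C E (rgt c) (lft c) c \<longleftrightarrow> d \<in> cl c" by (simp add: cl_def)
qed

lemma carrier_Ext: "carrier (Ext C E X Y) = {cl c | c. conf c \<and> lft c = Y \<and> rgt c = X}"
proof -
  have "(\<exists>A. conflation C E Y A X i p) \<longleftrightarrow> conf (i, p) \<and> lft (i, p) = Y \<and> rgt (i, p) = X" for i p
    by (auto simp: conflation_iff)
  then have "carrier (Ext C E X Y) = {ext_class C E X Y c | c. conf c \<and> lft c = Y \<and> rgt c = X}"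
    by (auto simp: Ext_def simp del: ends_pair) 
  also have "\<dots> = {cl c | c. conf c \<and> lft c = Y \<and> rgt c = X}"
    using ext_class_eq by (intro Collect_cong) metis
  finally show ?thesis .
qed

lemma cl_in_Ext: "conf c \<Longrightarrow> cl c \<in> carrier (Ext C E (rgt c) (lft c))"
  unfolding carrier_Ext by blast

lemma in_ExtE:
  assumes "\<xi> \<in> carrier (Ext C E X Y)"
  obtains c where "conf c" "Y = lft c" "X = rgt c" "\<xi> = cl c"
  using assms unfolding carrier_Ext by blast


subsection \<open>Functoriality of Ext\<close>

text \<open>\<open>ext_po\<close> collects the results of all choices of pushouts. For this set to
  be a full equivalence class, being a pushout has to be invariant under equivalence.\<close>

lemma po_square_transport:
  assumes po: "po_square g c d h" and e: "eqv d e"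
  obtains h' where "po_square g c e h'"
proof -
  note p = po_squareD(1-7)[OF po] and q = eqvD[OF e]
  obtain u u' where u: "isop u u'" "dm u = mid d" "cd u = mid e" "u \<bullet> fst d = fst e" "snd e \<bullet> u = snd d"
    using eqv_isoE[OF e] .
  note i = u(1)[unfolded isop_def]
  have u'e: "u' \<bullet> fst e = fst d"
    using comp_reassoc[of u' u "Id (mid d)" "fst d"] i u q by simp
  have "is_pushout C (lft c) (lft e) (mid c) (mid e) g (fst c) (fst e) (u \<bullet> h)"
    unfolding is_pushout_iff[OF confD(7)[OF p(1)] confD(7)[OF q(2)] confD(8)[OF p(1)] confD(8)[OF q(2)]]
  proof (intro conjI allI impI)
    show "fst e \<bullet> g = (u \<bullet> h) \<bullet> fst c"
      using p q i u(2,3) comp_reassoc[OF u(4), of g] by simp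
    fix a b assume ab: "Arr a" "Arr b" "dm a = lft e" "dm b = mid c" "cd a = cd b" "a \<bullet> g = b \<bullet> fst c"
    then obtain v where v: "Arr v" "dm v = mid d" "cd v = cd b" "v \<bullet> fst d = a" "v \<bullet> h = b"
      using po_squareD(8)[OF po, of a b] q by auto
    show "\<exists>!w. hom w (mid e) (cd b) \<and> w \<bullet> fst e = a \<and> w \<bullet> (u \<bullet> h) = b"
    proof (rule ex1I[of _ "v \<bullet> u'"])
      show "hom (v \<bullet> u') (mid e) (cd b) \<and> (v \<bullet> u') \<bullet> fst e = a \<and> (v \<bullet> u') \<bullet> (u \<bullet> h) = b"
        using v i u(2,3) q p u'e comp_reassoc[of u' u "Id (mid d)" h] by simp
      fix w assume w: "hom w (mid e) (cd b) \<and> w \<bullet> fst e = a \<and> w \<bullet> (u \<bullet> h) = b"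
      have "w \<bullet> u = v"
        by (rule po_square_ext[OF po]) (use w v i u p q in simp_all)
      then have "v \<bullet> u' = (w \<bullet> u) \<bullet> u'" by simp
      also have "\<dots> = w" using w i u(2,3) by simp
      finally show "w = v \<bullet> u'" by simp
    qed
  qed (use p q i u(2,3) in simp_all)
  then have "po_square g c e (u \<bullet> h)"
    using p q u i comp_reassoc[OF u(5), of h] by (simp add: po_square_def)
  then show thesis by (rule that)
qed

lemma pb_square_transport:
  assumes pb: "pb_square f d c h" and e: "eqv d e"
  obtains h' where "pb_square f e c h'"
proof -
  note p = pb_squareD(1-7)[OF pb] and q = eqvD[OF e]
  obtain u u' where u: "isop u u'" "dm u = mid d" "cd u = mid e" "u \<bullet> fst d = fst e" "snd e \<bullet> u = snd d"
    using eqv_isoE[OF e] .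
  note i = u(1)[unfolded isop_def]
  have u'e: "u' \<bullet> fst e = fst d" "snd d \<bullet> u' = snd e"
  proof -
    show "u' \<bullet> fst e = fst d" using comp_reassoc[of u' u "Id (mid d)" "fst d"] i u q by simp
    have "snd d \<bullet> u' = (snd e \<bullet> u) \<bullet> u'" using u by simp
    also have "\<dots> = snd e" using i u(2,3) q by simp
    finally show "snd d \<bullet> u' = snd e" .
  qed
  have "is_pullback C (mid e) (rgt e) (mid c) (rgt c) (snd e) (h \<bullet> u') f (snd c)"
    unfolding is_pullback_iff[OF confD(9)[OF p(1)] confD(9)[OF q(2)] confD(8)[OF p(1)] confD(8)[OF q(2)]]
  proof (intro conjI allI impI)
    show "f \<bullet> snd e = snd c \<bullet> (h \<bullet> u')"
      using p q i u(2,3) comp_reassoc[OF p(6), of u'] u'e(2) by simp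
    fix a b assume ab: "Arr a" "Arr b" "cd a = rgt e" "cd b = mid c" "dm a = dm b" "f \<bullet> a = snd c \<bullet> b"
    then obtain v where v: "Arr v" "dm v = dm b" "cd v = mid d" "snd d \<bullet> v = a" "h \<bullet> v = b"
      using pb_squareD(8)[OF pb, of a b] q by auto
    show "\<exists>!w. hom w (dm b) (mid e) \<and> snd e \<bullet> w = a \<and> (h \<bullet> u') \<bullet> w = b"
    proof (rule ex1I[of _ "u \<bullet> v"])
      show "hom (u \<bullet> v) (dm b) (mid e) \<and> snd e \<bullet> (u \<bullet> v) = a \<and> (h \<bullet> u') \<bullet> (u \<bullet> v) = b"
        using v i u(2,3) q p comp_reassoc[of u' u "Id (mid d)" v] comp_reassoc[OF u(5), of v] by simp
      fix w assume w: "hom w (dm b) (mid e) \<and> snd e \<bullet> w = a \<and> (h \<bullet> u') \<bullet> w = b"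
      then have wt: "Arr w" "dm w = dm b" "cd w = mid e" and wa: "snd e \<bullet> w = a" and wb: "(h \<bullet> u') \<bullet> w = b"
        by blast+
      have "h \<bullet> (u' \<bullet> w) = (h \<bullet> u') \<bullet> w"
        by (rule comp_assoc[symmetric]) (use wt i u(2,3) p(5) in simp_all)
      then have hv: "h \<bullet> (u' \<bullet> w) = h \<bullet> v" using wb v(5) by metis
      have "snd d \<bullet> (u' \<bullet> w) = snd e \<bullet> w"
        by (rule comp_reassoc[OF u'e(2)]) (use wt i p(2) u(2,3) in simp_all)
      then have dv: "snd d \<bullet> (u' \<bullet> w) = snd d \<bullet> v" using wa v(4) by metis
      have "u' \<bullet> w = v"
        by (rule pb_square_ext[OF pb _ _ _ _ _ dv hv]) (use wt v(1-3) i u(2,3) in simp_all)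
      then show "w = u \<bullet> v" using wt i u(2,3) comp_reassoc[of u u' "Id (mid e)" w] by simp
    qed
  qed (use p q i u(2,3) in simp_all)
  then have "pb_square f e c (h \<bullet> u')"
    using p q u'e i u(2,3) by (simp add: pb_square_def)
  then show thesis by (rule that)
qed

lemma cm_eqv:
  "cm g f c d \<Longrightarrow> eqv d e \<Longrightarrow> cm g f c e"
  "eqv b c \<Longrightarrow> cm g f c d \<Longrightarrow> cm g f b d"
  subgoal using cm_comp[of g f c d "Id (lft d)" "Id (rgt d)" e] cmD[of g f c d] by (simp add: eqv_def)
  subgoal using cm_comp[of "Id (lft b)" "Id (rgt b)" b c g f d] cmD[of g f c d] eqvD[of b c] by (simp add: eqv_def)
  done

lemma pushout_cm:
  assumes "conf c" "Arr g" "dm g = lft c"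
  obtains d where "cm g (Id (rgt c)) c d" "conf d" "lft d = cd g" "rgt d = rgt c"
proof -
  obtain d h where d: "po_square g c d h" "lft d = cd g" using pushout_exists[OF assms] .
  then show thesis using that[of d] po_square_cm[OF d(1)] po_squareD(2,3)[OF d(1)] by blast
qed

lemma pullback_cm:
  assumes "conf c" "Arr f" "cd f = rgt c"
  obtains d where "cm (Id (lft c)) f d c" "conf d" "lft d = lft c" "rgt d = dm f"
proof -
  obtain d h where d: "pb_square f d c h" "rgt d = dm f" using pullback_exists[OF assms] .
  then show thesis using that[of d] pb_square_cm[OF d(1)] pb_squareD(2,3)[OF d(1)] by blast
qed

text \<open>Any \<open>d\<close> reached from \<open>c\<close> by such a ladder is equivalent to the
  constructed pushout and inherits its universal property. This lets ladders stand in for pushout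
  squares.\<close>

lemma cm_factor_po:
  assumes "cm g f c e" "cm g (Id (rgt c)) c d"
  shows "cm (Id (lft d)) f d e"
proof -
  note e = cmD[OF assms(1)] and d = cmD[OF assms(2)]
  obtain d0 h where d0: "po_square g c d0 h" "lft d0 = cd g"
    using pushout_exists[OF e(1,3,4)] .
  note p = po_squareD(1-7)[OF d0(1)]
  have "eqv d0 d" using po_square_factor[OF d0(1) assms(2)] p by (simp add: eqv_def)
  then show ?thesis using cm_eqv(2)[OF eqv_sym po_square_factor[OF d0(1) assms(1)]] d0 d by simp
qed

lemma cm_factor_pb:
  assumes "cm g f e c" "cm (Id (lft c)) f d c"
  shows "cm g (Id (rgt d)) e d"
proof -
  note e = cmD[OF assms(1)] and d = cmD[OF assms(2)]
  obtain d0 h where d0: "pb_square f d0 c h" "rgt d0 = dm f"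
    using pullback_exists[OF e(2,6,8)] .
  note p = pb_squareD(1-7)[OF d0(1)]
  have "lft d = lft c" using d(4,1,2) by simp
  have "eqv d d0" using pb_square_factor[OF d0(1) assms(2)] d(7) \<open>lft d = lft c\<close> d0(2) by (simp add: eqv_def)
  then show ?thesis using cm_eqv(1)[OF pb_square_factor[OF d0(1) assms(1)] eqv_sym] d0(2) d(7) by simp
qed

text \<open>One inclusion is uniqueness of pushouts up to equivalence, the other their invariance
  under equivalence. With this rule a single ladder computes the class, whatever representative and
  pushout are chosen.\<close>

lemma ext_po_cl:
  assumes "cm g (Id (rgt c)) c d"
  shows "ext_po C E g (cl c) = cl d"
proof (intro Set.set_eqI iffI)
  note d = cmD[OF assms]
  fix e assume "e \<in> ext_po C E g (cl c)"
  then obtain c1 Y Y' A A' X h where *: "c1 \<in> cl c" "conflation C E Y A X (fst c1) (snd c1)"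
    "conflation C E Y' A' X (fst e) (snd e)" "is_pushout C Y Y' A A' g (fst c1) (fst e) h" "snd e \<bullet> h = snd c1"
    by (auto simp: ext_po_def comp_def)
  then have "po_square g c1 e h" by (auto simp: po_square_def conflation_iff)
  then have "cm g (Id (rgt c1)) c1 e" by (rule po_square_cm)
  moreover have c1: "eqv c c1" using * by (simp add: cl_def)
  ultimately have "cm g (Id (rgt c)) c e" using cm_eqv(2) eqvD(4) by metis
  then have "cm (Id (lft d)) (Id (rgt c)) d e" using cm_factor_po assms by blast
  then show "e \<in> cl d" using d by (simp add: cl_def eqv_def)
next
  note d = cmD[OF assms]
  fix e assume "e \<in> cl d"
  then have "eqv d e" by (simp add: cl_def)
  obtain d0 h where d0: "po_square g c d0 h" "lft d0 = cd g" using pushout_exists[OF d(1,3,4)] .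
  have "eqv d0 d" using po_square_factor[OF d0(1) assms] po_squareD(3)[OF d0(1)] by (simp add: eqv_def)
  then obtain h' where h': "po_square g c e h'"
    using po_square_transport[OF d0(1) eqv_trans] \<open>eqv d e\<close> by blast
  then have "snd e \<cdot>\<^bsub>C\<^esub> h' = snd c" "is_pushout C (lft c) (lft e) (mid c) (mid e) g (fst c) (fst e) h'"
    "conflation C E (lft c) (mid c) (rgt c) (fst c) (snd c)"
    "conflation C E (lft e) (mid e) (rgt c) (fst e) (snd e)"
    using conflation_conf[of c] conflation_conf[of e] by (auto simp: po_square_def comp_def)
  moreover have "c \<in> cl c" using eqv_refl[OF d(1)] by (simp add: cl_def)
  ultimately have "\<exists>c1\<in>cl c. \<exists>Y Y' A A' X h. conflation C E Y A X (fst c1) (snd c1) \<and>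
      conflation C E Y' A' X (fst e) (snd e) \<and> is_pushout C Y Y' A A' g (fst c1) (fst e) h \<and>
      snd e \<cdot>\<^bsub>C\<^esub> h = snd c1"
    by blast
  then show "e \<in> ext_po C E g (cl c)" unfolding ext_po_def by (simp add: case_prod_beta)
qed

lemma ext_pb_cl:
  assumes "cm (Id (lft c)) f d c"
  shows "ext_pb C E f (cl c) = cl d"
proof (intro Set.set_eqI iffI)
  note d = cmD[OF assms]
  have ld: "lft d = lft c" using d(4,1,2) by simp
  fix e assume "e \<in> ext_pb C E f (cl c)"
  then obtain c1 Y A A' X X' h where *: "c1 \<in> cl c" "conflation C E Y A X (fst c1) (snd c1)"
    "conflation C E Y A' X' (fst e) (snd e)" "is_pullback C A' X' A X (snd e) h f (snd c1)" "h \<bullet> fst e = fst c1"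
    by (auto simp: ext_pb_def comp_def)
  then have "pb_square f e c1 h" by (auto simp: pb_square_def conflation_iff)
  then have e: "cm (Id (lft c1)) f e c1" by (rule pb_square_cm)
  have c1: "eqv c c1" using * by (simp add: cl_def)
  have "cm (Id (lft c)) f e c" using cm_eqv(1)[OF e eqv_sym[OF c1]] eqvD(3)[OF c1] by simp
  then have F: "cm (Id (lft c)) (Id (rgt d)) e d" using cm_factor_pb assms by blast
  have "lft e = lft c" using cmD(4)[OF F] d(2) by simp
  moreover have "rgt e = rgt d" using cmD(7)[OF F] d(1) by simp
  ultimately have "eqv e d" using F by (simp add: eqv_def)
  then show "e \<in> cl d" by (simp add: cl_def eqv_sym)
next
  note d = cmD[OF assms]
  have ld: "lft d = lft c" using d(4,1,2) by simp
  fix e assume "e \<in> cl d"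
  then have "eqv d e" by (simp add: cl_def)
  obtain d0 h where d0: "pb_square f d0 c h" "rgt d0 = dm f" using pullback_exists[OF d(2,6,8)] .
  have "eqv d d0" using pb_square_factor[OF d0(1) assms] d0(2) d(7) ld by (simp add: eqv_def)
  then obtain h' where h': "pb_square f e c h'"
    using pb_square_transport[OF d0(1) eqv_trans[OF eqv_sym]] \<open>eqv d e\<close> by blast
  then have "h' \<cdot>\<^bsub>C\<^esub> fst e = fst c" "is_pullback C (mid e) (rgt e) (mid c) (rgt c) (snd e) h' f (snd c)"
    "conflation C E (lft c) (mid c) (rgt c) (fst c) (snd c)"
    "conflation C E (lft c) (mid e) (rgt e) (fst e) (snd e)"
    using conflation_conf[of c] conflation_conf[of e] by (auto simp: pb_square_def comp_def)
  moreover have "c \<in> cl c" using eqv_refl[OF d(2)] by (simp add: cl_def)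
  ultimately have "\<exists>c1\<in>cl c. \<exists>Y A A' X X' h. conflation C E Y A X (fst c1) (snd c1) \<and>
      conflation C E Y A' X' (fst e) (snd e) \<and> is_pullback C A' X' A X (snd e) h f (snd c1) \<and>
      h \<cdot>\<^bsub>C\<^esub> fst e = fst c1"
    by blast
  then show "e \<in> ext_pb C E f (cl c)" unfolding ext_pb_def by (simp add: case_prod_beta)
qed

lemma
  assumes "\<xi> \<in> carrier (Ext C E X Y)" "hom g Y Y'"
  shows ext_po_closed: "ext_po C E g \<xi> \<in> carrier (Ext C E X Y')"
    and ext_po_comp: "hom g' Y' Y'' \<Longrightarrow> ext_po C E g' (ext_po C E g \<xi>) = ext_po C E (g' \<bullet> g) \<xi>"
proof -
  obtain c where c: "conf c" "Y = lft c" "X = rgt c" "\<xi> = cl c" using in_ExtE[OF assms(1)] .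
  obtain d where d: "cm g (Id (rgt c)) c d" "conf d" "lft d = cd g" "rgt d = rgt c"
    using pushout_cm[of c g] c assms by auto
  show "ext_po C E g \<xi> \<in> carrier (Ext C E X Y')"
    using ext_po_cl[OF d(1)] cl_in_Ext[OF d(2)] c d assms by auto
  show "ext_po C E g' (ext_po C E g \<xi>) = ext_po C E (g' \<bullet> g) \<xi>" if g': "hom g' Y' Y''"
  proof -
    have "Arr g'" "dm g' = lft d" using g' d assms by auto
    then obtain e where e: "cm g' (Id (rgt d)) d e" "conf e" "lft e = cd g'" "rgt e = rgt d"
      using pushout_cm[OF d(2)] by blast
    have "cm (g' \<bullet> g) (Id (rgt c)) c e" using cm_comp[OF d(1) e(1)] c d by simp
    then show ?thesis using ext_po_cl d e c by simp
  qed
qed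

lemma
  assumes "\<xi> \<in> carrier (Ext C E X Y)" "hom f X' X"
  shows ext_pb_closed: "ext_pb C E f \<xi> \<in> carrier (Ext C E X' Y)"
    and ext_pb_comp: "hom f' X'' X' \<Longrightarrow> ext_pb C E f' (ext_pb C E f \<xi>) = ext_pb C E (f \<bullet> f') \<xi>"
    and ext_pb_po: "hom g Y Y' \<Longrightarrow> ext_pb C E f (ext_po C E g \<xi>) = ext_po C E g (ext_pb C E f \<xi>)"
proof -
  obtain c where c: "conf c" "Y = lft c" "X = rgt c" "\<xi> = cl c" using in_ExtE[OF assms(1)] .
  obtain d where d: "cm (Id (lft c)) f d c" "conf d" "lft d = lft c" "rgt d = dm f"
    using pullback_cm[of c f] c assms by auto
  show "ext_pb C E f \<xi> \<in> carrier (Ext C E X' Y)"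
    using ext_pb_cl[OF d(1)] cl_in_Ext[OF d(2)] c d assms by auto
  show "ext_pb C E f' (ext_pb C E f \<xi>) = ext_pb C E (f \<bullet> f') \<xi>" if f': "hom f' X'' X'"
  proof -
    have "Arr f'" "cd f' = rgt d" using f' d assms by auto
    then obtain e where e: "cm (Id (lft d)) f' e d" "conf e" "lft e = lft d" "rgt e = dm f'"
      using pullback_cm[OF d(2)] by blast
    have "cm (Id (lft c)) (f \<bullet> f') e c" using cm_comp[OF e(1) d(1)] c d by simp
    then show ?thesis using ext_pb_cl d e c by simp
  qed
  show "ext_pb C E f (ext_po C E g \<xi>) = ext_po C E g (ext_pb C E f \<xi>)" if g: "hom g Y Y'"
  proof -
    have "Arr g" "dm g = lft c" using g c by auto
    then obtain e where e: "cm g (Id (rgt c)) c e" "conf e" "lft e = cd g" "rgt e = rgt c"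
      using pushout_cm[OF c(1)] by blast
    have "Arr f" "cd f = rgt e" using assms c e by auto
    then obtain e' where e': "cm (Id (lft e)) f e' e" "conf e'" "lft e' = lft e" "rgt e' = dm f"
      using pullback_cm[OF e(2)] by blast
    \<comment> \<open>The composite ladder from \<open>d\<close> over \<open>c\<close> to
      \<open>e\<close> has outer components \<open>g\<close> and \<open>f\<close>. Factored through
      \<open>e'\<close>, the pullback of the pushout, it exhibits \<open>e'\<close> as a pushout of
      the pullback \<open>d\<close>.\<close>
    have "cm g f d e" using cm_comp[OF d(1) e(1)] c assms g by simp
    then have "cm g (Id (rgt e')) d e'" by (rule cm_factor_pb[OF _ e'(1)])
    then show ?thesis
      using ext_po_cl[OF e(1)] ext_pb_cl[OF e'(1)] ext_pb_cl[OF d(1)] ext_po_cl[of g d e'] c d e' by simp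
  qed
qed

lemma
  assumes "\<xi> \<in> carrier (Ext C E X Y)"
  shows ext_po_Id: "ext_po C E (Id Y) \<xi> = \<xi>" and ext_pb_Id: "ext_pb C E (Id X) \<xi> = \<xi>"
proof -
  obtain c where c: "conf c" "Y = lft c" "X = rgt c" "\<xi> = cl c" using in_ExtE[OF assms] .
  from c(2-4) show "ext_po C E (Id Y) \<xi> = \<xi>" "ext_pb C E (Id X) \<xi> = \<xi>"
    using ext_po_cl[OF cm_refl[OF c(1)]] ext_pb_cl[OF cm_refl[OF c(1)]] by simp_all
qed


subsection \<open>Split conflations\<close>

definition splits :: "'m \<times> 'm \<Rightarrow> bool" where
  "splits d \<longleftrightarrow> conf d \<and> (\<exists>s. hom s (rgt d) (mid d) \<and> snd d \<bullet> s = Id (rgt d))"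

text \<open>For a section \<open>s\<close> the endomorphism \<open>1 - s p\<close> factors through
  the kernel of \<open>p\<close>; for a retraction \<open>r\<close> the endomorphism
  \<open>1 - i r\<close> factors through the cokernel of \<open>i\<close>.\<close>

lemma splits_iff_retraction:
  "splits d \<longleftrightarrow> conf d \<and> (\<exists>r. hom r (mid d) (lft d) \<and> r \<bullet> fst d = Id (lft d))"
proof (cases "conf d")
  case d: True
  show ?thesis
  proof
    assume "splits d"
    then obtain s where s: "hom s (rgt d) (mid d)" "snd d \<bullet> s = Id (rgt d)" by (auto simp: splits_def)
    define t where "t = Id (mid d) \<^bold>+ \<^bold>- (s \<bullet> snd d)"
    have t: "Arr t" "dm t = mid d" "cd t = mid d" using s d by (simp_all add: t_def)
    have "snd d \<bullet> t = zr (mid d) (rgt d)"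
      using s d comp_reassoc[OF s(2), of "snd d"] by (simp add: t_def)
    then obtain r where r: "Arr r" "dm r = mid d" "cd r = lft d" "fst d \<bullet> r = t"
      using kernel_factor[OF d, of t] t by auto
    have "r \<bullet> fst d = Id (lft d)"
    proof (rule conf_mono[OF d])
      have "fst d \<bullet> (r \<bullet> fst d) = t \<bullet> fst d" using comp_reassoc[OF r(4), of "fst d"] r d by simp
      also have "\<dots> = fst d" using s d by (simp add: t_def)
      finally show "fst d \<bullet> (r \<bullet> fst d) = fst d \<bullet> Id (lft d)" using d by simp
    qed (use r d in simp_all)
    then show "conf d \<and> (\<exists>r. hom r (mid d) (lft d) \<and> r \<bullet> fst d = Id (lft d))" using r d by auto
  next
    assume "conf d \<and> (\<exists>r. hom r (mid d) (lft d) \<and> r \<bullet> fst d = Id (lft d))"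
    then obtain r where r: "hom r (mid d) (lft d)" "r \<bullet> fst d = Id (lft d)" by auto
    define t where "t = Id (mid d) \<^bold>+ \<^bold>- (fst d \<bullet> r)"
    have t: "Arr t" "dm t = mid d" "cd t = mid d" using r d by (simp_all add: t_def)
    have "t \<bullet> fst d = zr (lft d) (mid d)" using r d by (simp add: t_def)
    then obtain s where s: "Arr s" "dm s = rgt d" "cd s = mid d" "s \<bullet> snd d = t"
      using cokernel_factor[OF d, of t] t by auto
    have "snd d \<bullet> s = Id (rgt d)"
    proof (rule conf_epi[OF d])
      show "(snd d \<bullet> s) \<bullet> snd d = Id (rgt d) \<bullet> snd d" using s r d by (simp add: t_def)
    qed (use s d in simp_all)
    then show "splits d" using s d by (auto simp: splits_def)
  qed
qed (simp add: splits_def)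

text \<open>Exactness at the connecting map from Hom to Ext. A retraction of \<open>fst d\<close>
  composed with the ladder map \<open>h\<close> extends \<open>g\<close>; conversely, for an
  extension \<open>t\<close>, the map \<open>h - fst d t\<close> kills \<open>fst c\<close> and
  factors through \<open>snd c\<close> to a section.\<close>

lemma splits_po:
  assumes "cm g (Id (rgt c)) c d"
  shows "splits d \<longleftrightarrow> (\<exists>t. hom t (mid c) (lft d) \<and> t \<bullet> fst c = g)"
proof -
  note e = cmD[OF assms]
  have rd: "rgt d = rgt c" using e by simp
  obtain h where h: "Arr h" "dm h = mid c" "cd h = mid d" "h \<bullet> fst c = fst d \<bullet> g" "snd d \<bullet> h = Id (rgt c) \<bullet> snd c"
    using cmE[OF assms] .
  show ?thesis
  proof
    assume "splits d"
    then obtain r where r: "hom r (mid d) (lft d)" "r \<bullet> fst d = Id (lft d)"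
      by (auto simp: splits_iff_retraction)
    then show "\<exists>t. hom t (mid c) (lft d) \<and> t \<bullet> fst c = g"
      using h e comp_reassoc[OF r(2), of g] by (intro exI[of _ "r \<bullet> h"]) simp
  next
    assume "\<exists>t. hom t (mid c) (lft d) \<and> t \<bullet> fst c = g"
    then obtain t where t: "hom t (mid c) (lft d)" "t \<bullet> fst c = g" by blast
    define u where "u = h \<^bold>+ \<^bold>- (fst d \<bullet> t)"
    have u: "Arr u" "dm u = mid c" "cd u = mid d" using t h e by (simp_all add: u_def)
    have "u \<bullet> fst c = zr (lft c) (mid d)" using t h e by (simp add: u_def)
    then obtain s where s: "Arr s" "dm s = rgt c" "cd s = mid d" "s \<bullet> snd c = u"
      using cokernel_factor[OF e(1), of u] u by auto
    have "snd d \<bullet> s = Id (rgt c)"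
    proof (rule conf_epi[OF e(1)])
      show "(snd d \<bullet> s) \<bullet> snd c = Id (rgt c) \<bullet> snd c" using s t h e rd by (simp add: u_def)
    qed (use s e rd in simp_all)
    then show "splits d" using s e rd by (auto simp: splits_def)
  qed
qed

lemma splits_pb:
  assumes "cm (Id (lft c)) f d c"
  shows "splits d \<longleftrightarrow> (\<exists>t. hom t (rgt d) (mid c) \<and> snd c \<bullet> t = f)"
proof -
  note e = cmD[OF assms]
  have ld: "lft d = lft c" using e(4,1,2) by simp
  obtain h where h: "Arr h" "dm h = mid d" "cd h = mid c" "h \<bullet> fst d = fst c \<bullet> Id (lft c)" "snd c \<bullet> h = f \<bullet> snd d"
    using cmE[OF assms] .
  show ?thesis
  proof
    assume "splits d"
    then obtain s where s: "hom s (rgt d) (mid d)" "snd d \<bullet> s = Id (rgt d)" by (auto simp: splits_def)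
    then show "\<exists>t. hom t (rgt d) (mid c) \<and> snd c \<bullet> t = f"
      using h e comp_reassoc[OF h(5), of s] by (intro exI[of _ "h \<bullet> s"]) simp
  next
    assume "\<exists>t. hom t (rgt d) (mid c) \<and> snd c \<bullet> t = f"
    then obtain t where t: "hom t (rgt d) (mid c)" "snd c \<bullet> t = f" by blast
    define u where "u = h \<^bold>+ \<^bold>- (t \<bullet> snd d)"
    have u: "Arr u" "dm u = mid d" "cd u = mid c" using t h e by (simp_all add: u_def)
    have "snd c \<bullet> u = zr (mid d) (rgt c)"
      using t h e comp_reassoc[OF t(2), of "snd d"] by (simp add: u_def)
    then obtain r where r: "Arr r" "dm r = mid d" "cd r = lft c" "fst c \<bullet> r = u"
      using kernel_factor[OF e(2), of u] u by auto
    have "r \<bullet> fst d = Id (lft c)"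
    proof (rule conf_mono[OF e(2)])
      have "fst c \<bullet> (r \<bullet> fst d) = u \<bullet> fst d" using comp_reassoc[OF r(4), of "fst d"] r e ld by simp
      also have "\<dots> = fst c" using t h e ld by (simp add: u_def)
      finally show "fst c \<bullet> (r \<bullet> fst d) = fst c \<bullet> Id (lft c)" using e by simp
    qed (use r e ld in simp_all)
    then show "splits d" using r e ld by (auto simp: splits_iff_retraction)
  qed
qed

lemma split_conflations_eq: "split_conflations C E X Y = {d. splits d \<and> lft d = Y \<and> rgt d = X}"
proof -
  have "(i, p) \<in> split_conflations C E X Y \<longleftrightarrow> splits (i, p) \<and> lft (i, p) = Y \<and> rgt (i, p) = X" for i p
  proof (cases "conf (i, p) \<and> lft (i, p) = Y \<and> rgt (i, p) = X")
    case True
    note c = confD[of "(i, p)"]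
    have "(\<exists>s\<in>Mor C X (mid (i, p)). p \<cdot>\<^bsub>C\<^esub> s = Id X) \<longleftrightarrow> (\<exists>s. hom s X (mid (i, p)) \<and> p \<bullet> s = Id X)"
      using hom_iff[of _ X "mid (i, p)"] c True unfolding comp_def by blast
    then show ?thesis
      using True by (auto simp: split_conflations_def splits_def conflation_iff)
  qed (auto simp: split_conflations_def splits_def conflation_iff)
  then show ?thesis by auto
qed

text \<open>The zero of \<open>Ext\<close> is defined as the set of all split conflations; this
  identifies it as a single class, the pushout along 0 of any conflation with the right end in
  question.\<close>

lemma zero_class_po:
  assumes "cm (zr (lft c) Y) (Id (rgt c)) c d" "Y \<in> Obj C"
  shows "split_conflations C E (rgt c) Y = cl d"
proof -
  note e = cmD[OF assms(1)]
  have d: "lft d = Y" "rgt d = rgt c" using e assms(2) by auto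
  have "splits d" unfolding splits_po[OF assms(1)]
    using e d assms(2) by (intro exI[of _ "zr (mid c) Y"]) simp
  have "eqv d e \<longleftrightarrow> splits e \<and> lft e = Y \<and> rgt e = rgt c" for e
  proof
    assume de: "eqv d e"
    then have "cm (zr (lft c) Y) (Id (rgt c)) c e" using cm_eqv(1) assms by blast
    from splits_po[OF this] have "splits e"
      using e eqvD[OF de] assms(2) d by (auto intro: exI[of _ "zr (mid c) Y"])
    then show "splits e \<and> lft e = Y \<and> rgt e = rgt c" using eqvD[OF de] d by simp
  next
    assume *: "splits e \<and> lft e = Y \<and> rgt e = rgt c"
    then obtain s where s: "conf e" "hom s (rgt e) (mid e)" "snd e \<bullet> s = Id (rgt e)" by (auto simp: splits_def)
    \<comment> \<open>A section of \<open>e\<close> composed with \<open>snd c\<close> is the middle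
      map of a ladder from \<open>c\<close> whose left component is 0.\<close>
    have "cm (zr (lft c) Y) (Id (rgt c)) c e"
      by (rule cmI[of _ _ _ _ "s \<bullet> snd c"])
        (use s * \<open>conf c\<close> assms(2) comp_reassoc[OF s(3), of "snd c"] in simp_all)
    then have "cm (Id (lft d)) (Id (rgt c)) d e" by (rule cm_factor_po[OF _ assms(1)])
    then show "eqv d e" using d by (simp add: eqv_def)
  qed
  then show ?thesis by (auto simp: split_conflations_eq cl_def)
qed

lemma splits_zero: "splits d \<longleftrightarrow> conf d \<and> cl d = split_conflations C E (rgt d) (lft d)"
proof (cases "conf d")
  case d: True
  obtain e where e: "cm (zr (lft d) (lft d)) (Id (rgt d)) d e" "conf e" "lft e = lft d" "rgt e = rgt d"
    using pushout_cm[OF d, of "zr (lft d) (lft d)"] d by auto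
  have *: "split_conflations C E (rgt d) (lft d) = cl e" using zero_class_po[OF e(1)] d by simp
  have "splits d \<longleftrightarrow> d \<in> cl e" using * by (auto simp: split_conflations_eq)
  also have "\<dots> \<longleftrightarrow> eqv d e" unfolding cl_def using eqv_sym by blast
  finally show ?thesis using d * cl_eq_iff by simp
qed (simp add: splits_def)

end

subsection \<open>Baer sums\<close>

context linear_cat
begin

lemma biprod_cancel:
  assumes "is_biprod C A B S" "A \<in> Obj C" "B \<in> Obj C" "Arr x"
  shows "cd x = A \<Longrightarrow> pr1 S \<bullet> (in1 S \<bullet> x) = x" "cd x = B \<Longrightarrow> pr2 S \<bullet> (in2 S \<bullet> x) = x"
    "cd x = B \<Longrightarrow> pr1 S \<bullet> (in2 S \<bullet> x) = zr (dm x) A" "cd x = A \<Longrightarrow> pr2 S \<bullet> (in1 S \<bullet> x) = zr (dm x) B"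
proof -
  note S = biprodD[OF assms(1-3)]
  show "cd x = A \<Longrightarrow> pr1 S \<bullet> (in1 S \<bullet> x) = x" "cd x = B \<Longrightarrow> pr2 S \<bullet> (in2 S \<bullet> x) = x"
    "cd x = B \<Longrightarrow> pr1 S \<bullet> (in2 S \<bullet> x) = zr (dm x) A" "cd x = A \<Longrightarrow> pr2 S \<bullet> (in1 S \<bullet> x) = zr (dm x) B"
    using S(2-5) assms(2-) comp_reassoc[OF S(6), of x] comp_reassoc[OF S(7), of x]
      comp_reassoc[OF S(8), of x] comp_reassoc[OF S(9), of x] by simp_all
qed

lemma biprod_ext:
  assumes "is_biprod C A B S" "A \<in> Obj C" "B \<in> Obj C" "Arr u" "Arr v" "dm u = Bob S" "dm v = Bob S"
    "cd u = cd v" "u \<bullet> in1 S = v \<bullet> in1 S" "u \<bullet> in2 S = v \<bullet> in2 S"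
  shows "u = v"
proof -
  note S = biprodD[OF assms(1-3)]
  have *: "w = w \<bullet> in1 S \<bullet> pr1 S \<^bold>+ w \<bullet> in2 S \<bullet> pr2 S" if "Arr w" "dm w = Bob S" for w
  proof -
    have "w = w \<bullet> (in1 S \<bullet> pr1 S \<^bold>+ in2 S \<bullet> pr2 S)" using S(1,10) that by simp
    then show ?thesis using S(2-5) that by simp
  qed
  have "w \<bullet> in1 S \<bullet> pr1 S = (w \<bullet> in1 S) \<bullet> pr1 S" "w \<bullet> in2 S \<bullet> pr2 S = (w \<bullet> in2 S) \<bullet> pr2 S"
    if "Arr w" "dm w = Bob S" for w using S(2-5) that by simp_all
  then show ?thesis using *[of u] *[of v] assms(4-) by metis
qed

text \<open>Allows \<open>inflation_plus_Id\<close>, which treats the first summand, to be applied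
  to the second one.\<close>

definition swap_biprod :: "('o, 'm) biprod \<Rightarrow> ('o, 'm) biprod" where
  "swap_biprod S = \<lparr>Bob = Bob S, in1 = in2 S, in2 = in1 S, pr1 = pr2 S, pr2 = pr1 S\<rparr>"

lemma swap_biprod_sel [simp]:
  "Bob (swap_biprod S) = Bob S" "in1 (swap_biprod S) = in2 S" "in2 (swap_biprod S) = in1 S"
  "pr1 (swap_biprod S) = pr2 S" "pr2 (swap_biprod S) = pr1 S"
  by (simp_all add: swap_biprod_def)

lemma is_biprod_swap:
  assumes "is_biprod C A B S" "A \<in> Obj C" "B \<in> Obj C"
  shows "is_biprod C B A (swap_biprod S)"
proof -
  note S = biprodD[OF assms]
  have "in2 S \<bullet> pr2 S \<^bold>+ in1 S \<bullet> pr1 S = Id (Bob S)"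
    using S(10) S(2-5) plus_comm[of "in2 S \<bullet> pr2 S" "in1 S \<bullet> pr1 S"] by simp
  then have "in2 S \<cdot>\<^bsub>C\<^esub> pr2 S \<oplus>\<^bsub>Hom C (Bob S) (Bob S)\<^esub> in1 S \<cdot>\<^bsub>C\<^esub> pr1 S = Id (Bob S)"
    using S(2-5) by (simp add: plus_def) (simp add: comp_def)
  then show ?thesis using assms(1) by (simp add: is_biprod_def)
qed

end

context exact_cat
begin

lemma biprod_exists: "A \<in> Obj C \<Longrightarrow> B \<in> Obj C \<Longrightarrow> \<exists>S. is_biprod C A B S"
  using exact by (simp add: exact_category_def additive_category_def)

text \<open>The pullback of the two middle terms over the common right end maps to it by a composite
  of deflations, and the conflation of this composite maps to both given ones. Hence two classes
  with the same right end are pushouts of one conflation, which replaces Baer sums by addition in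
  Hom.\<close>

lemma common_refinement:
  assumes c: "conf c" "conf d" and r: "rgt d = rgt c"
  obtains e a b where "cm a (Id (rgt c)) e c" "cm b (Id (rgt c)) e d"
proof -
  obtain q h where q: "pb_square (snd d) q c h" "rgt q = mid d"
    using pullback_exists[OF c(1), of "snd d"] c r by auto
  note p = pb_squareD(1-7)[OF q(1)]
  have "\<forall>A B X p q. deflation C E A B p \<and> deflation C E B X q \<longrightarrow> deflation C E A X (q \<cdot>\<^bsub>C\<^esub> p)"
    using exact unfolding exact_category_def by (elim conjE)
  moreover have "deflation C E (mid q) (mid d) (snd q)" "deflation C E (mid d) (rgt d) (snd d)"
    unfolding deflation_iff using p(2) q(2) c(2) by blast+
  ultimately have "deflation C E (mid q) (rgt d) (snd d \<bullet> snd q)" unfolding comp_def by blast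
  then obtain e where e: "conf e" "snd e = snd d \<bullet> snd q" "mid e = mid q" "rgt e = rgt d"
    unfolding deflation_iff by blast
  obtain b where b: "cm b (Id (rgt c)) e d"
    by (rule cm_fill_left[OF e(1) c(2), of "snd q" "Id (rgt c)"]) (use e p q(2) c r in simp_all)
  obtain a where a: "cm a (Id (rgt c)) e c"
    by (rule cm_fill_left[OF e(1) c(1), of h "Id (rgt c)"]) (use e p q(2) c r in simp_all)
  show thesis using that[OF a b] .
qed

text \<open>The map \<open>fst c \<oplus> 1\<close> is the pushout of \<open>fst c\<close> along the
  first injection of \<open>SY\<close>; \<open>u\<close> and \<open>v\<close> identify the pushout
  object with \<open>Bob SA\<close>.\<close>

lemma inflation_plus_Id:
  assumes c: "conf c" and B: "B \<in> Obj C"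
    and Y: "is_biprod C (lft c) B SY" and A: "is_biprod C (mid c) B SA"
  obtains e where "conf e" "fst e = in1 SA \<bullet> fst c \<bullet> pr1 SY \<^bold>+ in2 SA \<bullet> pr2 SY"
    "lft e = Bob SY" "mid e = Bob SA"
proof -
  note SY = biprodD[OF Y confD(7)[OF c] B] and SA = biprodD[OF A confD(8)[OF c] B]
  note cY = biprod_cancel[OF Y confD(7)[OF c] B] and cA = biprod_cancel[OF A confD(8)[OF c] B]
  obtain d h where d: "po_square (in1 SY) c d h" "lft d = Bob SY"
    using pushout_exists[OF c, of "in1 SY"] SY by auto
  note p = po_squareD(1-7)[OF d(1)]
  define i where "i = in1 SA \<bullet> fst c \<bullet> pr1 SY \<^bold>+ in2 SA \<bullet> pr2 SY"
  have i: "Arr i" "dm i = Bob SY" "cd i = Bob SA" using SY(2-5) SA(2-5) c by (simp_all add: i_def)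
  have iin: "i \<bullet> in1 SY = in1 SA \<bullet> fst c" "i \<bullet> in2 SY = in2 SA"
    using SY SA c B by (simp_all add: i_def)
  obtain u where u: "Arr u" "dm u = mid d" "cd u = Bob SA" "u \<bullet> fst d = i" "u \<bullet> h = in1 SA"
    using po_squareD(8)[OF d(1), of i "in1 SA"] i iin SA(2) d(2) by auto
  define v where "v = h \<bullet> pr1 SA \<^bold>+ fst d \<bullet> in2 SY \<bullet> pr2 SA"
  have v: "Arr v" "dm v = Bob SA" "cd v = mid d" using p d(2) SA(2-5) SY(2-5) c by (simp_all add: v_def)
  have uv: "u \<bullet> v = Id (Bob SA)"
  proof -
    have "u \<bullet> v = in1 SA \<bullet> pr1 SA \<^bold>+ i \<bullet> (in2 SY \<bullet> pr2 SA)"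
      using u(1-3) p d(2) SA(2-5) SY(2-5) c comp_reassoc[OF u(5), of "pr1 SA"]
        comp_reassoc[OF u(4), of "in2 SY \<bullet> pr2 SA"] by (simp add: v_def)
    also have "i \<bullet> (in2 SY \<bullet> pr2 SA) = in2 SA \<bullet> pr2 SA"
      using i SA(2-5) SY(2-5) comp_reassoc[OF iin(2), of "pr2 SA"] by simp
    finally show ?thesis using SA(10) by simp
  qed
  have vi: "v \<bullet> i = fst d"
  proof (rule biprod_ext[OF Y confD(7)[OF c] B])
    have "(v \<bullet> i) \<bullet> in1 SY = v \<bullet> (in1 SA \<bullet> fst c)" using v i SY(2-5) iin by simp
    also have "\<dots> = h \<bullet> fst c"
      using p d(2) SA(1-5) SY(1-5) c B cA by (simp add: v_def SA(6-9))
    finally show "(v \<bullet> i) \<bullet> in1 SY = fst d \<bullet> in1 SY" using p by simp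
    have "(v \<bullet> i) \<bullet> in2 SY = v \<bullet> in2 SA" using v i SY(2-5) iin by simp
    also have "\<dots> = fst d \<bullet> in2 SY"
      using p d(2) SA(1-5) SY(1-5) c B by (simp add: v_def SA(6-9))
    finally show "(v \<bullet> i) \<bullet> in2 SY = fst d \<bullet> in2 SY" .
  qed (use v i p d(2) in simp_all)
  have "v \<bullet> u = Id (mid d)"
  proof (rule po_square_ext[OF d(1)])
    show "(v \<bullet> u) \<bullet> fst d = Id (mid d) \<bullet> fst d" using v u p vi by simp
    have "(v \<bullet> u) \<bullet> h = v \<bullet> in1 SA" using v u p by simp
    also have "\<dots> = h" using p d(2) SA(1-5) SY(1-5) c B by (simp add: v_def SA(6-9))
    finally show "(v \<bullet> u) \<bullet> h = Id (mid d) \<bullet> h" using p by simp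
  qed (use u v p in simp_all)
  then have iso: "isop u v" using u v uv by (simp add: isop_def)
  have eq: "(snd c \<bullet> pr1 SA) \<bullet> u = snd d"
  proof (rule po_square_ext[OF d(1)])
    have "((snd c \<bullet> pr1 SA) \<bullet> u) \<bullet> fst d = snd c \<bullet> (pr1 SA \<bullet> i)" using u p SA(2-5) c by simp
    also have "pr1 SA \<bullet> i = fst c \<bullet> pr1 SY"
      using SA(1-5) SY(1-5) c B cA by (simp add: i_def)
    finally show "((snd c \<bullet> pr1 SA) \<bullet> u) \<bullet> fst d = snd d \<bullet> fst d"
      using p SY(2-5) d(2) by simp
    show "((snd c \<bullet> pr1 SA) \<bullet> u) \<bullet> h = snd d \<bullet> h" using u p SA(2-6) c by simp
  qed (use u p SA(2-5) c in simp_all)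
  have "conf (i, snd c \<bullet> pr1 SA)"
    by (rule conf_transport[OF p(2), of _ "Id (Bob SY)" "Id (Bob SY)" u v "Id (rgt c)" "Id (rgt c)"])
      (use iso isop_Id i u p d(2) SA(2-5) SY(1) c eq in simp_all)
  then show thesis using that[of "(i, snd c \<bullet> pr1 SA)"] i by (simp add: i_def)
qed

text \<open>The sum of the two inflations is the composite of \<open>1 \<oplus> fst d\<close>
  followed by \<open>fst c \<oplus> 1\<close>, both inflations by \<open>inflation_plus_Id\<close>.
  The sum of the deflations is then verified to be a cokernel of it.\<close>

lemma conf_direct_sum:
  assumes c: "conf c" "conf d" and Y: "is_biprod C (lft c) (lft d) SY"
    and A: "is_biprod C (mid c) (mid d) SA" and X: "is_biprod C (rgt c) (rgt d) SX"
  shows "conf (biprod_map C SY SA (fst c) (fst d), biprod_map C SA SX (snd c) (snd d))"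
proof -
  note oc = confD(7-9)[OF c(1)] and od = confD(7-9)[OF c(2)]
  note SY = biprodD[OF Y oc(1) od(1)] and SA = biprodD[OF A oc(2) od(2)] and SX = biprodD[OF X oc(3) od(3)]
  note cY = biprod_cancel[OF Y oc(1) od(1)] and cA = biprod_cancel[OF A oc(2) od(2)]
    and cX = biprod_cancel[OF X oc(3) od(3)]
  obtain SM where M: "is_biprod C (lft c) (mid d) SM" using biprod_exists[OF oc(1) od(2)] by blast
  note SM = biprodD[OF M oc(1) od(2)] and cM = biprod_cancel[OF M oc(1) od(2)]
  define i where "i = biprod_map C SY SA (fst c) (fst d)"
  define p where "p = biprod_map C SA SX (snd c) (snd d)"
  have i_eq: "i = in1 SA \<bullet> fst c \<bullet> pr1 SY \<^bold>+ in2 SA \<bullet> fst d \<bullet> pr2 SY"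
    unfolding i_def by (rule biprod_map_eq[OF Y A]) (use c in simp_all)
  have p_eq: "p = in1 SX \<bullet> snd c \<bullet> pr1 SA \<^bold>+ in2 SX \<bullet> snd d \<bullet> pr2 SA"
    unfolding p_def by (rule biprod_map_eq[OF A X]) (use c in simp_all)
  have i: "Arr i" "dm i = Bob SY" "cd i = Bob SA" using SY(2-5) SA(2-5) c by (simp_all add: i_eq)
  have p: "Arr p" "dm p = Bob SA" "cd p = Bob SX" using SX(2-5) SA(2-5) c by (simp_all add: p_eq)
  obtain e where e: "conf e" "fst e = in1 SA \<bullet> fst c \<bullet> pr1 SM \<^bold>+ in2 SA \<bullet> pr2 SM" "lft e = Bob SM" "mid e = Bob SA"
    using inflation_plus_Id[OF c(1) od(2) M A] .
  obtain e' where e': "conf e'" "fst e' = in2 SM \<bullet> fst d \<bullet> pr2 SY \<^bold>+ in1 SM \<bullet> pr1 SY" "lft e' = Bob SY" "mid e' = Bob SM"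
    using inflation_plus_Id[OF c(2) oc(1) is_biprod_swap[OF Y oc(1) od(1)] is_biprod_swap[OF M oc(1) od(2)]] by auto
  have "i = fst e \<bullet> fst e'"
    unfolding e(2) e'(2)
    using SM SY(1-5) SA(1-5) c cM by (simp add: i_eq plus_comm)
  moreover have "\<forall>A B X i j. inflation C E A B i \<and> inflation C E B X j \<longrightarrow> inflation C E A X (j \<cdot>\<^bsub>C\<^esub> i)"
    using exact unfolding exact_category_def by (elim conjE)
  moreover have "inflation C E (Bob SY) (Bob SM) (fst e')" "inflation C E (Bob SM) (Bob SA) (fst e)"
    unfolding inflation_iff using e e' by blast+
  ultimately have "inflation C E (Bob SY) (Bob SA) i" unfolding comp_def by blast
  then obtain q where q: "conf q" "i = fst q" "lft q = Bob SY" "mid q = Bob SA"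
    unfolding inflation_iff by blast
  have pin: "p \<bullet> in1 SA = in1 SX \<bullet> snd c" "p \<bullet> in2 SA = in2 SX \<bullet> snd d"
    using SA SX(1-5) c by (simp_all add: p_eq)
  have iin: "i \<bullet> in1 SY = in1 SA \<bullet> fst c" "i \<bullet> in2 SY = in2 SA \<bullet> fst d"
    using SY SA(1-5) c by (simp_all add: i_eq)
  have "conf (fst q, p)"
  proof (rule conf_cokernel[OF q(1)])
    have "p \<bullet> i = zr (Bob SY) (Bob SX)"
      using SA(1-5) SX(1-5) SY(1-5) c cA by (simp add: i_eq p_eq)
    then show "p \<bullet> fst q = zr (lft q) (cd p)" using q p by simp
  next
    fix f assume f: "Arr f" "dm f = mid q" "f \<bullet> fst q = zr (lft q) (cd f)"
    then have fi: "f \<bullet> i = zr (Bob SY) (cd f)" using q by simp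
    have fd: "dm f = Bob SA" using f q by simp
    have "(f \<bullet> in1 SA) \<bullet> fst c = (f \<bullet> i) \<bullet> in1 SY"
      using f(1) fd i iin SA(2-5) SY(2-5) c by simp
    also have "\<dots> = zr (lft c) (cd f)" using fi SY(1-5) f(1) by simp
    finally obtain a where a: "Arr a" "dm a = rgt c" "cd a = cd f" "a \<bullet> snd c = f \<bullet> in1 SA"
      using cokernel_factor[OF c(1), of "f \<bullet> in1 SA"] f(1) fd SA(2-5) by auto
    have "(f \<bullet> in2 SA) \<bullet> fst d = (f \<bullet> i) \<bullet> in2 SY"
      using f(1) fd i iin SA(2-5) SY(2-5) c by simp
    also have "\<dots> = zr (lft d) (cd f)" using fi SY(1-5) f(1) by simp
    finally obtain b where b: "Arr b" "dm b = rgt d" "cd b = cd f" "b \<bullet> snd d = f \<bullet> in2 SA"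
      using cokernel_factor[OF c(2), of "f \<bullet> in2 SA"] f(1) fd SA(2-5) by auto
    define g where "g = a \<bullet> pr1 SX \<^bold>+ b \<bullet> pr2 SX"
    have g: "Arr g" "dm g = Bob SX" "cd g = cd f" using a b SX(2-5) by (simp_all add: g_def)
    have gin: "g \<bullet> in1 SX = a" "g \<bullet> in2 SX = b"
      using a b SX oc od f(1) by (simp_all add: g_def)
    have "g \<bullet> p = f"
    proof (rule biprod_ext[OF A oc(2) od(2)])
      show "(g \<bullet> p) \<bullet> in1 SA = f \<bullet> in1 SA"
        using g p SA(2-5) SX(2-5) c pin a comp_reassoc[OF gin(1), of "snd c"] by simp
      show "(g \<bullet> p) \<bullet> in2 SA = f \<bullet> in2 SA"
        using g p SA(2-5) SX(2-5) c pin b comp_reassoc[OF gin(2), of "snd d"] by simp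
    qed (use g p f(1) fd in simp_all)
    then show "\<exists>g. Arr g \<and> dm g = cd p \<and> cd g = cd f \<and> g \<bullet> p = f" using g p by auto
  next
    fix u v assume uv: "u \<bullet> p = v \<bullet> p" "Arr u" "Arr v" "dm u = cd p" "dm v = cd p" "cd u = cd v"
    have "(u \<bullet> p) \<bullet> in1 SA = (v \<bullet> p) \<bullet> in1 SA" "(u \<bullet> p) \<bullet> in2 SA = (v \<bullet> p) \<bullet> in2 SA" using uv(1) by simp_all
    then have *: "(u \<bullet> in1 SX) \<bullet> snd c = (v \<bullet> in1 SX) \<bullet> snd c" "(u \<bullet> in2 SX) \<bullet> snd d = (v \<bullet> in2 SX) \<bullet> snd d"
      using uv(2-) p SA(2-5) SX(2-5) c pin by simp_all
    have "u \<bullet> in1 SX = v \<bullet> in1 SX"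
      by (rule conf_epi[OF c(1) *(1)]) (use uv(2-) p SX(2-5) in simp_all)
    moreover have "u \<bullet> in2 SX = v \<bullet> in2 SX"
      by (rule conf_epi[OF c(2) *(2)]) (use uv(2-) p SX(2-5) in simp_all)
    moreover have "dm u = Bob SX" "dm v = Bob SX" using uv(4,5) p(3) by simp_all
    ultimately show "u = v" using biprod_ext[OF X oc(3) od(3) uv(2,3)] uv(6) by blast
  qed (use p q in simp_all)
  then show ?thesis using q by (simp add: i_def p_def)
qed

text \<open>By \<open>common_refinement\<close> either of the last two properties determines the class of \<open>F\<close>; hence the
  representatives and biproducts chosen in the definition of \<open>ext_add\<close> are immaterial.\<close>

lemma baer_sum:
  assumes c: "conf c" "conf d" and ends: "lft d = lft c" "rgt d = rgt c"
  obtains F where "conf F" "lft F = lft c" "rgt F = rgt c"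
    "ext_add C E (rgt c) (lft c) (cl c) (cl d) = cl F"
    "\<And>e a b. cm a (Id (rgt c)) e c \<Longrightarrow> cm b (Id (rgt c)) e d \<Longrightarrow> cm (a \<^bold>+ b) (Id (rgt c)) e F"
    "\<And>e a b. cm (Id (lft c)) a c e \<Longrightarrow> cm (Id (lft c)) b d e \<Longrightarrow> cm (Id (lft c)) (a \<^bold>+ b) F e"
proof -
  let ?X = "rgt c" and ?Y = "lft c"
  have o: "?X \<in> Obj C" "?Y \<in> Obj C" using c by simp_all
  \<comment> \<open>The properties demanded of the sum, stated for an arbitrary \<open>F\<close> so
    that the outcomes of different choices can be compared.\<close>
  define good where "good F \<longleftrightarrow> conf F \<and> lft F = ?Y \<and> rgt F = ?X \<and>
    (\<forall>e a b. cm a (Id ?X) e c \<longrightarrow> cm b (Id ?X) e d \<longrightarrow> cm (a \<^bold>+ b) (Id ?X) e F) \<and>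
    (\<forall>e a b. cm (Id ?Y) a c e \<longrightarrow> cm (Id ?Y) b d e \<longrightarrow> cm (Id ?Y) (a \<^bold>+ b) F e)" for F
  define summand where "summand c1 d1 SX SY SA = ext_po C E (pr1 SY \<oplus>\<^bsub>Hom C (Bob SY) ?Y\<^esub> pr2 SY)
           (ext_pb C E (in1 SX \<oplus>\<^bsub>Hom C ?X (Bob SX)\<^esub> in2 SX)
             (ext_class C E (Bob SX) (Bob SY)
               (biprod_map C SY SA (fst c1) (fst d1), biprod_map C SA SX (snd c1) (snd d1))))"
    for c1 d1 SX SY SA
  \<comment> \<open>Every choice of representatives and biproducts yields a good conflation, not
    just the one fixed at the end; \<open>unique\<close> then collapses the results to one
    class.\<close>
  have key: "\<exists>F. good F \<and> summand c1 d1 SX SY SA = cl F"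
    if c1: "eqv c c1" "eqv d d1" and X: "is_biprod C ?X ?X SX" and Y: "is_biprod C ?Y ?Y SY"
      and A: "is_biprod C (mid c1) (mid d1) SA" for c1 d1 SX SY SA
  proof -
    note q = eqvD[OF c1(1)] and r = eqvD[OF c1(2)]
    note oc = confD(7-9)[OF q(2)] and od = confD(7-9)[OF r(2)]
    note SY = biprodD[OF Y o(2) o(2)] and SA = biprodD[OF A oc(2) od(2)] and SX = biprodD[OF X o(1) o(1)]
    note cY = biprod_cancel[OF Y o(2) o(2)] and cA = biprod_cancel[OF A oc(2) od(2)]
      and cX = biprod_cancel[OF X o(1) o(1)]
    have ends1: "lft d1 = ?Y" "rgt d1 = ?X" using r ends by simp_all
    define S where "S = (biprod_map C SY SA (fst c1) (fst d1), biprod_map C SA SX (snd c1) (snd d1))"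
    have S: "conf S"
      unfolding S_def by (rule conf_direct_sum) (use q r ends1 X Y A in simp_all)
    have S1: "fst S = in1 SA \<bullet> fst c1 \<bullet> pr1 SY \<^bold>+ in2 SA \<bullet> fst d1 \<bullet> pr2 SY"
      unfolding S_def fst_conv by (rule biprod_map_eq[OF Y A]) (use q r ends1 in simp_all)
    have S2: "snd S = in1 SX \<bullet> snd c1 \<bullet> pr1 SA \<^bold>+ in2 SX \<bullet> snd d1 \<bullet> pr2 SA"
      unfolding S_def snd_conv by (rule biprod_map_eq[OF A X]) (use q r ends1 in simp_all)
    have "dm (fst S) = Bob SY" "cd (fst S) = Bob SA" "cd (snd S) = Bob SX"
      using SY(2-5) SA(2-5) SX(2-5) q r ends1 unfolding S1 S2 by simp_all
    then have Se: "lft S = Bob SY" "mid S = Bob SA" "rgt S = Bob SX" using S by simp_all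
    \<comment> \<open>\<open>D\<close> is the diagonal of the right end, \<open>N\<close> the
      codiagonal of the left end. \<open>P\<close> is the pullback of the direct sum
      \<open>S\<close> along \<open>D\<close>, and \<open>F\<close> the pushout of \<open>P\<close>
      along \<open>N\<close>.\<close>
    define D where "D = in1 SX \<^bold>+ in2 SX"
    define N where "N = pr1 SY \<^bold>+ pr2 SY"
    have D: "Arr D" "dm D = ?X" "cd D = Bob SX" using SX(2-5) by (simp_all add: D_def)
    have N: "Arr N" "dm N = Bob SY" "cd N = ?Y" using SY(2-5) by (simp_all add: N_def)
    have "Arr D" "cd D = rgt S" using D Se by simp_all
    then obtain P where P: "cm (Id (lft S)) D P S" "conf P" "lft P = lft S" "rgt P = dm D"
      using pullback_cm[OF S] by blast
    have "Arr N" "dm N = lft P" using N P Se by simp_all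
    then obtain F where F: "cm N (Id (rgt P)) P F" "conf F" "lft F = cd N" "rgt F = rgt P"
      using pushout_cm[OF P(2)] by blast
    have "ext_class C E (Bob SX) (Bob SY) S = cl S" using ext_class_eq[OF S] Se by simp
    then have "ext_po C E N (ext_pb C E D (ext_class C E (Bob SX) (Bob SY) S)) = cl F"
      using ext_pb_cl[OF P(1)] ext_po_cl[OF F(1)] by simp
    moreover have "N = pr1 SY \<oplus>\<^bsub>Hom C (Bob SY) ?Y\<^esub> pr2 SY" "D = in1 SX \<oplus>\<^bsub>Hom C ?X (Bob SX)\<^esub> in2 SX"
      using SX(2) SY(4) by (simp_all add: N_def D_def plus_def)
    ultimately have "summand c1 d1 SX SY SA = cl F" by (simp add: summand_def S_def)
    moreover have "cm (a \<^bold>+ b) (Id ?X) e F" if ab: "cm a (Id ?X) e c" "cm b (Id ?X) e d" for e a b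
    proof -
      note m1 = cm_eqv(1)[OF ab(1) c1(1)] and m2 = cm_eqv(1)[OF ab(2) c1(2)]
      note e1 = cmD[OF m1] and e2 = cmD[OF m2]
      have re: "rgt e = ?X" using e1 o by simp
      obtain u where u: "Arr u" "dm u = mid e" "cd u = mid c1" "u \<bullet> fst e = fst c1 \<bullet> a" "snd c1 \<bullet> u = Id ?X \<bullet> snd e"
        using cmE[OF m1] .
      obtain v where v: "Arr v" "dm v = mid e" "cd v = mid d1" "v \<bullet> fst e = fst d1 \<bullet> b" "snd d1 \<bullet> v = Id ?X \<bullet> snd e"
        using cmE[OF m2] .
      \<comment> \<open>\<open>a\<close> and \<open>b\<close> combined into a map to the biproduct.
        It is the left component of a ladder from \<open>e\<close> to \<open>S\<close> over the
        diagonal, so the ladder factors through \<open>P\<close>, and the codiagonal turns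
        \<open>G\<close> into \<open>a + b\<close>.\<close>
      define G where "G = in1 SY \<bullet> a \<^bold>+ in2 SY \<bullet> b"
      have ab': "Arr a" "dm a = lft e" "cd a = ?Y" "Arr b" "dm b = lft e" "cd b = ?Y"
        using e1 e2 q ends1 by simp_all
      have "cm G D e S"
      proof (rule cmI[of _ _ _ _ "in1 SA \<bullet> u \<^bold>+ in2 SA \<bullet> v"])
        have "fst S \<bullet> G = in1 SA \<bullet> fst c1 \<bullet> a \<^bold>+ in2 SA \<bullet> fst d1 \<bullet> b"
          unfolding S1 G_def using SY(1-5) SA(1-5) q r ends1 cY ab' e1(1) by simp
        then show "(in1 SA \<bullet> u \<^bold>+ in2 SA \<bullet> v) \<bullet> fst e = fst S \<bullet> G"
          using SA(2-5) u v e1(1) by simp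
        have "snd S \<bullet> (in1 SA \<bullet> u \<^bold>+ in2 SA \<bullet> v) = in1 SX \<bullet> snd e \<^bold>+ in2 SX \<bullet> snd e"
          unfolding S2 using SX(1-5) SA(1-5) q r ends1 cA u v e1(1) re by simp
        then show "snd S \<bullet> (in1 SA \<bullet> u \<^bold>+ in2 SA \<bullet> v) = D \<bullet> snd e"
          using SX(2-5) e1(1) re by (simp add: D_def)
      qed (use S Se SY(2-5) SA(2-5) ab' u v e1(1) re D in \<open>simp_all add: G_def\<close>)
      then have "cm G (Id (rgt P)) e P" by (rule cm_factor_pb[OF _ P(1)])
      then have "cm (N \<bullet> G) (Id (rgt P) \<bullet> Id (rgt P)) e F" by (rule cm_comp) (rule F(1))
      moreover have "N \<bullet> G = a \<^bold>+ b"
        unfolding N_def G_def using SY(1-5) cY ab' e1(1) o by simp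
      ultimately show ?thesis using P D o by simp
    qed
    moreover have "cm (Id ?Y) (a \<^bold>+ b) F e" if ab: "cm (Id ?Y) a c e" "cm (Id ?Y) b d e" for e a b
    proof -
      note m1 = cm_eqv(2)[OF eqv_sym[OF c1(1)] ab(1)] and m2 = cm_eqv(2)[OF eqv_sym[OF c1(2)] ab(2)]
      note e1 = cmD[OF m1] and e2 = cmD[OF m2]
      have le: "lft e = ?Y" using e1(5) o by simp
      obtain u where u: "Arr u" "dm u = mid c1" "cd u = mid e" "u \<bullet> fst c1 = fst e \<bullet> Id ?Y" "snd e \<bullet> u = a \<bullet> snd c1"
        using cmE[OF m1] .
      obtain v where v: "Arr v" "dm v = mid d1" "cd v = mid e" "v \<bullet> fst d1 = fst e \<bullet> Id ?Y" "snd e \<bullet> v = b \<bullet> snd d1"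
        using cmE[OF m2] .
      have u4: "u \<bullet> fst c1 = fst e" "v \<bullet> fst d1 = fst e" using u(4) v(4) e1(2) le by simp_all
      \<comment> \<open>Dually, \<open>a\<close> and \<open>b\<close> combined into a map out of the
        biproduct; preceded by the diagonal it is \<open>a + b\<close>.\<close>
      define G where "G = a \<bullet> pr1 SX \<^bold>+ b \<bullet> pr2 SX"
      have ab': "Arr a" "dm a = ?X" "cd a = rgt e" "Arr b" "dm b = ?X" "cd b = rgt e"
        using e1 e2 q ends1 by simp_all
      have "cm N G S e"
      proof (rule cmI[of _ _ _ _ "u \<bullet> pr1 SA \<^bold>+ v \<bullet> pr2 SA"])
        have "(u \<bullet> pr1 SA \<^bold>+ v \<bullet> pr2 SA) \<bullet> fst S = u \<bullet> fst c1 \<bullet> pr1 SY \<^bold>+ v \<bullet> fst d1 \<bullet> pr2 SY"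
          unfolding S1 using SY(1-5) SA(1-5) q r ends1 cA u(1-3) v(1-3) e1(2) by simp
        also have "\<dots> = fst e \<bullet> pr1 SY \<^bold>+ fst e \<bullet> pr2 SY"
          using SY(1-5) q r ends1 u(1-3) v(1-3) comp_reassoc[OF u4(1), of "pr1 SY"]
            comp_reassoc[OF u4(2), of "pr2 SY"] by simp
        finally show "(u \<bullet> pr1 SA \<^bold>+ v \<bullet> pr2 SA) \<bullet> fst S = fst e \<bullet> N"
          unfolding N_def using SY(1-5) e1(2) le by simp
        have "G \<bullet> snd S = a \<bullet> snd c1 \<bullet> pr1 SA \<^bold>+ b \<bullet> snd d1 \<bullet> pr2 SA"
          unfolding S2 G_def using SX(1-5) SA(1-5) q r ends1 cX ab' e1(2) by simp
        also have "\<dots> = snd e \<bullet> u \<bullet> pr1 SA \<^bold>+ snd e \<bullet> v \<bullet> pr2 SA"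
          using SA(1-5) q r ends1 u(1-3) v(1-3) ab' e1(2) comp_reassoc[OF u(5), of "pr1 SA"]
            comp_reassoc[OF v(5), of "pr2 SA"] by simp
        finally show "snd e \<bullet> (u \<bullet> pr1 SA \<^bold>+ v \<bullet> pr2 SA) = G \<bullet> snd S"
          using SA(1-5) u(1-3) v(1-3) e1(2) by simp
      qed (use S Se SX(2-5) SA(2-5) ab' u(1-3) v(1-3) e1(2) le N in \<open>simp_all add: G_def\<close>)
      then have "cm (N \<bullet> Id (lft S)) (G \<bullet> D) P e" by (rule cm_comp[OF P(1)])
      moreover have "G \<bullet> D = a \<^bold>+ b"
        unfolding G_def D_def using SX ab' e1(2) o by simp
      moreover have "N \<bullet> Id (lft S) = N" using N Se by simp
      ultimately have "cm N (a \<^bold>+ b) P e" by simp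
      then have "cm (Id (lft F)) (a \<^bold>+ b) F e" by (rule cm_factor_po[OF _ F(1)])
      then show ?thesis using F N by simp
    qed
    moreover have "conf F" "lft F = ?Y" "rgt F = ?X" using F P N D by simp_all
    ultimately show ?thesis unfolding good_def by blast
  qed
  have unique: "cl F = cl G" if "good F" "good G" for F G
  proof -
    obtain e a b where e: "cm a (Id ?X) e c" "cm b (Id ?X) e d"
      using common_refinement[OF c ends(2)] by blast
    have re: "rgt e = ?X" using cmD(7)[OF e(1)] o by simp
    have "cm (a \<^bold>+ b) (Id ?X) e F" "cm (a \<^bold>+ b) (Id ?X) e G" using that e unfolding good_def by blast+
    then have "cm (Id (lft F)) (Id ?X) F G" using cm_factor_po re by metis
    then show ?thesis using that cl_eq_iff by (auto simp: good_def eqv_def)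
  qed
  \<comment> \<open>The middle objects quantified in \<open>ext_add\<close> are forced to be
    \<open>mid c1\<close> and \<open>mid d1\<close>; this brings the definition into the form
    treated by \<open>key\<close>.\<close>
  have add_iff: "x \<in> ext_add C E ?X ?Y (cl c) (cl d) \<longleftrightarrow> (\<exists>c1 d1 SX SY SA. eqv c c1 \<and> eqv d d1 \<and>
      is_biprod C ?X ?X SX \<and> is_biprod C ?Y ?Y SY \<and> is_biprod C (mid c1) (mid d1) SA \<and>
      x \<in> summand c1 d1 SX SY SA)" for x
  proof -
    have "x \<in> ext_add C E ?X ?Y (cl c) (cl d) \<longleftrightarrow> (\<exists>c1\<in>cl c. \<exists>d1\<in>cl d. \<exists>A B SX SY SA.
       conflation C E ?Y A ?X (fst c1) (snd c1) \<and> conflation C E ?Y B ?X (fst d1) (snd d1) \<and>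
       is_biprod C ?X ?X SX \<and> is_biprod C ?Y ?Y SY \<and> is_biprod C A B SA \<and> x \<in> summand c1 d1 SX SY SA)"
      by (simp add: ext_add_def summand_def case_prod_beta)
    also have "\<dots> \<longleftrightarrow> (\<exists>c1\<in>cl c. \<exists>d1\<in>cl d. \<exists>SX SY SA.
       is_biprod C ?X ?X SX \<and> is_biprod C ?Y ?Y SY \<and> is_biprod C (mid c1) (mid d1) SA \<and>
       x \<in> summand c1 d1 SX SY SA)"
    proof (intro bex_cong refl)
      fix c1 d1 assume "c1 \<in> cl c" "d1 \<in> cl d"
      then have *: "eqv c c1" "eqv d d1" by (simp_all add: cl_def)
      have "conflation C E ?Y A ?X (fst c1) (snd c1) \<longleftrightarrow> A = mid c1" for A
        using eqvD[OF *(1)] by (auto simp: conflation_iff)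
      moreover have "conflation C E ?Y A ?X (fst d1) (snd d1) \<longleftrightarrow> A = mid d1" for A
        using eqvD[OF *(2)] ends by (auto simp: conflation_iff)
      ultimately show "(\<exists>A B SX SY SA.
       conflation C E ?Y A ?X (fst c1) (snd c1) \<and> conflation C E ?Y B ?X (fst d1) (snd d1) \<and>
       is_biprod C ?X ?X SX \<and> is_biprod C ?Y ?Y SY \<and> is_biprod C A B SA \<and> x \<in> summand c1 d1 SX SY SA) \<longleftrightarrow>
       (\<exists>SX SY SA. is_biprod C ?X ?X SX \<and> is_biprod C ?Y ?Y SY \<and> is_biprod C (mid c1) (mid d1) SA \<and>
       x \<in> summand c1 d1 SX SY SA)" by simp
    qed
    finally show ?thesis unfolding cl_def by blast
  qed
  obtain SX SY SA where S: "is_biprod C ?X ?X SX" "is_biprod C ?Y ?Y SY" "is_biprod C (mid c) (mid d) SA"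
    using biprod_exists o c confD(8) by metis
  obtain F where F: "good F" "summand c d SX SY SA = cl F"
    using key[OF eqv_refl[OF c(1)] eqv_refl[OF c(2)] S] by blast
  have "ext_add C E ?X ?Y (cl c) (cl d) = cl F"
  proof (rule Set.set_eqI)
    fix x
    show "x \<in> ext_add C E ?X ?Y (cl c) (cl d) \<longleftrightarrow> x \<in> cl F"
    proof
      assume "x \<in> ext_add C E ?X ?Y (cl c) (cl d)"
      then obtain G where "good G" "x \<in> cl G" unfolding add_iff using key by metis
      then show "x \<in> cl F" using unique F(1) by blast
    next
      assume "x \<in> cl F"
      then show "x \<in> ext_add C E ?X ?Y (cl c) (cl d)"
        unfolding add_iff using eqv_refl[OF c(1)] eqv_refl[OF c(2)] S F(2) by blast
    qed
  qed
  then show thesis using that[of F] F(1) unfolding good_def by blast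
qed

end

subsection \<open>Ext as a bimodule\<close>

lemma (in linear_cat)
  assumes "Arr f" "a \<in> carrier k"
  shows scal_l_distr: "b \<in> carrier k \<Longrightarrow> (a \<oplus>\<^bsub>k\<^esub> b) \<^bold>* f = a \<^bold>* f \<^bold>+ b \<^bold>* f"
    and scal_mult: "b \<in> carrier k \<Longrightarrow> (a \<otimes>\<^bsub>k\<^esub> b) \<^bold>* f = a \<^bold>* (b \<^bold>* f)"
    and scal_r_distr: "Arr g \<Longrightarrow> dm f = dm g \<Longrightarrow> cd f = cd g \<Longrightarrow> a \<^bold>* (f \<^bold>+ g) = a \<^bold>* f \<^bold>+ a \<^bold>* g"
proof -
  interpret module k "Hom C (dm f) (cd f)" using assms by (intro hom_module) auto
  have *: "x \<^bold>+ y = x \<oplus>\<^bsub>Hom C (dm f) (cd f)\<^esub> y" "c \<^bold>* x = c \<odot>\<^bsub>Hom C (dm f) (cd f)\<^esub> x"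
    if "x \<in> Mor C (dm f) (cd f)" for x y c
    using homI[OF that] assms by (simp_all add: plus_def scal_def)
  show "(a \<oplus>\<^bsub>k\<^esub> b) \<^bold>* f = a \<^bold>* f \<^bold>+ b \<^bold>* f" "(a \<otimes>\<^bsub>k\<^esub> b) \<^bold>* f = a \<^bold>* (b \<^bold>* f)" if "b \<in> carrier k"
    using assms that by (simp_all add: * smult_l_distr smult_assoc1)
  show "a \<^bold>* (f \<^bold>+ g) = a \<^bold>* f \<^bold>+ a \<^bold>* g" if "Arr g" "dm f = dm g" "cd f = cd g"
  proof -
    have "g \<in> Mor C (dm f) (cd f)" by (rule ArrD') (use that in simp_all)
    then show ?thesis using assms by (simp add: * smult_r_distr)
  qed
qed

context exact_cat
begin

lemma Ext_sel [simp]: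
  "add (Ext C E X Y) = ext_add C E X Y"
  "\<zero>\<^bsub>Ext C E X Y\<^esub> = split_conflations C E X Y"
  "a \<odot>\<^bsub>Ext C E X Y\<^esub> \<xi> = ext_po C E (a \<odot>\<^bsub>Hom C Y Y\<^esub> Id Y) \<xi>"
  by (simp_all add: Ext_def)

text \<open>\<open>c\<close> itself refines its two pushouts, so the first ladder property of
  \<open>baer_sum\<close> applies with \<open>e = c\<close>. Sums in Ext are thus computed by sums
  of morphisms.\<close>

lemma ext_add_po:
  assumes c: "conf c" and a: "hom a (lft c) Y" and b: "hom b (lft c) Y"
  shows "ext_add C E (rgt c) Y (ext_po C E a (cl c)) (ext_po C E b (cl c)) = ext_po C E (a \<^bold>+ b) (cl c)"
proof -
  have "Arr a" "dm a = lft c" "Arr b" "dm b = lft c" using a b by auto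
  then obtain d e where d: "cm a (Id (rgt c)) c d" "conf d" "lft d = cd a" "rgt d = rgt c"
    and e: "cm b (Id (rgt c)) c e" "conf e" "lft e = cd b" "rgt e = rgt c"
    using pushout_cm[OF c] by metis
  have r: "lft e = lft d" "rgt e = rgt d" "rgt c = rgt d" "Y = lft d" using d e a b by auto
  obtain F where F: "ext_add C E (rgt d) (lft d) (cl d) (cl e) = cl F"
    "\<And>x a b. cm a (Id (rgt d)) x d \<Longrightarrow> cm b (Id (rgt d)) x e \<Longrightarrow> cm (a \<^bold>+ b) (Id (rgt d)) x F"
    using baer_sum[OF d(2) e(2) r(1,2)] by metis
  have "cm (a \<^bold>+ b) (Id (rgt c)) c F" using F(2)[of a c b] d(1) e(1) r(3) by simp
  then show ?thesis using ext_po_cl d(1) e(1) F(1) r by metis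
qed

text \<open>The second ladder property of \<open>baer_sum\<close>, with \<open>c\<close> as the
  common target of its two pullbacks.\<close>

lemma ext_add_pb:
  assumes c: "conf c" and a: "hom a X (rgt c)" and b: "hom b X (rgt c)"
  shows "ext_add C E X (lft c) (ext_pb C E a (cl c)) (ext_pb C E b (cl c)) = ext_pb C E (a \<^bold>+ b) (cl c)"
proof -
  have "Arr a" "cd a = rgt c" "Arr b" "cd b = rgt c" using a b by auto
  then obtain d e where d: "cm (Id (lft c)) a d c" "conf d" "lft d = lft c" "rgt d = dm a"
    and e: "cm (Id (lft c)) b e c" "conf e" "lft e = lft c" "rgt e = dm b"
    using pullback_cm[OF c] by metis
  have r: "lft e = lft d" "rgt e = rgt d" "lft c = lft d" "X = rgt d" using d e a b by auto
  obtain F where F: "ext_add C E (rgt d) (lft d) (cl d) (cl e) = cl F"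
    "\<And>x a b. cm (Id (lft d)) a d x \<Longrightarrow> cm (Id (lft d)) b e x \<Longrightarrow> cm (Id (lft d)) (a \<^bold>+ b) F x"
    using baer_sum[OF d(2) e(2) r(1,2)] by metis
  have "cm (Id (lft c)) (a \<^bold>+ b) F c" using F(2)[of a c b] d(1) e(1) r(3) by simp
  then show ?thesis using ext_pb_cl d(1) e(1) F(1) r by metis
qed

lemma ext_smult_po:
  assumes c: "conf c" and a: "hom a (lft c) Y" and r: "r \<in> carrier k"
  shows "r \<odot>\<^bsub>Ext C E (rgt c) Y\<^esub> ext_po C E a (cl c) = ext_po C E (r \<^bold>* a) (cl c)"
proof -
  have Y: "Y \<in> Obj C" using a by auto
  then have "r \<odot>\<^bsub>Hom C Y Y\<^esub> Id Y = r \<^bold>* Id Y" by (simp add: scal_def)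
  moreover have "hom (r \<^bold>* Id Y) Y Y" using Y r by simp
  ultimately have "r \<odot>\<^bsub>Ext C E (rgt c) Y\<^esub> ext_po C E a (cl c) = ext_po C E ((r \<^bold>* Id Y) \<bullet> a) (cl c)"
    using ext_po_comp[OF cl_in_Ext[OF c] a] by simp
  then show ?thesis using a r Y by simp
qed

lemma zero_po:
  assumes c: "conf c" and Y: "Y \<in> Obj C"
  shows "split_conflations C E (rgt c) Y = ext_po C E (zr (lft c) Y) (cl c)"
proof -
  have "Arr (zr (lft c) Y)" "dm (zr (lft c) Y) = lft c" using c Y by simp_all
  then obtain d where "cm (zr (lft c) Y) (Id (rgt c)) c d" using pushout_cm[OF c] by metis
  then show ?thesis using zero_class_po[OF _ Y] ext_po_cl by metis
qed

text \<open>Finitely many classes in \<open>Ext(X, Y)\<close> are pushouts of one conflation; in this way the module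
  axioms for \<open>Ext\<close> are inherited from those for \<open>Hom\<close>.\<close>

lemma common_po:
  assumes "\<xi> \<in> carrier (Ext C E X Y)" "\<zeta> \<in> carrier (Ext C E X Y')"
  obtains e a b where "conf e" "X = rgt e" "hom a (lft e) Y" "hom b (lft e) Y'"
    "\<xi> = ext_po C E a (cl e)" "\<zeta> = ext_po C E b (cl e)"
proof -
  obtain c where c: "conf c" "Y = lft c" "X = rgt c" "\<xi> = cl c" using in_ExtE[OF assms(1)] .
  obtain d where d: "conf d" "Y' = lft d" "X = rgt d" "\<zeta> = cl d" using in_ExtE[OF assms(2)] .
  have r: "rgt d = rgt c" using c d by simp
  obtain e a b where e: "cm a (Id (rgt c)) e c" "cm b (Id (rgt c)) e d"
    using common_refinement[OF c(1) d(1) r] .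
  note * = cmD[OF e(1)] and ** = cmD[OF e(2)]
  have "rgt e = rgt c" using * by simp
  then show thesis
    using that[of e a b] * ** c d e ext_po_cl[of a e c] ext_po_cl[of b e d] by simp
qed

lemma common_po3:
  assumes "\<xi> \<in> carrier (Ext C E X Y)" "\<zeta> \<in> carrier (Ext C E X Y)" "\<chi> \<in> carrier (Ext C E X Y)"
  obtains e a b c where "conf e" "X = rgt e" "hom a (lft e) Y" "hom b (lft e) Y" "hom c (lft e) Y"
    "\<xi> = ext_po C E a (cl e)" "\<zeta> = ext_po C E b (cl e)" "\<chi> = ext_po C E c (cl e)"
proof -
  obtain d a b where d: "conf d" "X = rgt d" "hom a (lft d) Y" "hom b (lft d) Y"
    "\<xi> = ext_po C E a (cl d)" "\<zeta> = ext_po C E b (cl d)"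
    using common_po[OF assms(1,2)] .
  have "cl d \<in> carrier (Ext C E X (lft d))" using cl_in_Ext[OF d(1)] d(2) by simp
  then obtain e f c where e: "conf e" "X = rgt e" "hom f (lft e) (lft d)" "hom c (lft e) Y"
    "cl d = ext_po C E f (cl e)" "\<chi> = ext_po C E c (cl e)"
    using common_po[OF _ assms(3)] by metis
  have "ext_po C E g (cl d) = ext_po C E (g \<bullet> f) (cl e)" if "hom g (lft d) Y" for g
    using ext_po_comp[OF cl_in_Ext[OF e(1)] e(3) that] e(5) by simp
  then show thesis
    using that[of e "a \<bullet> f" "b \<bullet> f" c] d e by simp
qed

text \<open>Supplies a conflation ending in \<open>X\<close> from which the zero class of
  \<open>Ext\<close> can be pushed out.\<close>

lemma conf_exists:
  assumes "X \<in> Obj C"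
  obtains c where "conf c" "rgt c = X"
proof -
  have "\<forall>A\<in>Obj C. deflation C E A A (Id A)"
    using exact unfolding exact_category_def by (elim conjE)
  then have "deflation C E X X (Id X)" using assms by blast
  then show thesis using that unfolding deflation_iff by blast
qed

lemma po_in_Ext:
  assumes "conf c" "hom a (lft c) Y"
  shows "ext_po C E a (cl c) \<in> carrier (Ext C E (rgt c) Y)"
  by (rule ext_po_closed[OF cl_in_Ext[OF assms(1)] assms(2)])

lemma module_Ext:
  assumes X: "X \<in> Obj C" and Y: "Y \<in> Obj C"
  shows "module k (Ext C E X Y)"
proof -
  interpret H: module k "Hom C Y Y" using Y Y by (rule hom_module)
  let ?E = "Ext C E X Y"
  have add: "ext_po C E a (cl e) \<oplus>\<^bsub>?E\<^esub> ext_po C E b (cl e) = ext_po C E (a \<^bold>+ b) (cl e)"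
    if "conf e" "X = rgt e" "hom a (lft e) Y" "hom b (lft e) Y" for e a b
    using ext_add_po[OF that(1,3,4)] that(2) by simp
  have smult: "r \<odot>\<^bsub>?E\<^esub> ext_po C E a (cl e) = ext_po C E (r \<^bold>* a) (cl e)"
    if "conf e" "X = rgt e" "hom a (lft e) Y" "r \<in> carrier k" for e a r
    using ext_smult_po[OF that(1,3,4)] that(2) by simp
  have closed: "ext_po C E a (cl e) \<in> carrier ?E" if "conf e" "X = rgt e" "hom a (lft e) Y" for e a
    using po_in_Ext[OF that(1,3)] that(2) by simp
  show ?thesis
  proof (rule moduleI)
    show "cring k" by (rule H.R.cring_axioms)
    show "abelian_group ?E"
    proof (rule abelian_groupI)
      fix x y assume "x \<in> carrier ?E" "y \<in> carrier ?E"
      then obtain e a b where e: "conf e" "X = rgt e" "hom a (lft e) Y" "hom b (lft e) Y"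
        "x = ext_po C E a (cl e)" "y = ext_po C E b (cl e)" using common_po by blast
      then have ab: "hom (a \<^bold>+ b) (lft e) Y" by simp
      show "x \<oplus>\<^bsub>?E\<^esub> y \<in> carrier ?E" using closed[OF e(1,2) ab] add[OF e(1-4)] e(5,6) by metis
      have "a \<^bold>+ b = b \<^bold>+ a" using e(3,4) by (intro plus_comm) simp_all
      then show "x \<oplus>\<^bsub>?E\<^esub> y = y \<oplus>\<^bsub>?E\<^esub> x" using add[OF e(1,2,3,4)] add[OF e(1,2,4,3)] e(5,6) by metis
    next
      fix x y z assume "x \<in> carrier ?E" "y \<in> carrier ?E" "z \<in> carrier ?E"
      then obtain e a b c where e: "conf e" "X = rgt e" "hom a (lft e) Y" "hom b (lft e) Y" "hom c (lft e) Y"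
        "x = ext_po C E a (cl e)" "y = ext_po C E b (cl e)" "z = ext_po C E c (cl e)" using common_po3 by blast
      have s: "hom (a \<^bold>+ b) (lft e) Y" "hom (b \<^bold>+ c) (lft e) Y" using e by simp_all
      have "(a \<^bold>+ b) \<^bold>+ c = a \<^bold>+ (b \<^bold>+ c)" using e by (intro plus_assoc) simp_all
      then show "x \<oplus>\<^bsub>?E\<^esub> y \<oplus>\<^bsub>?E\<^esub> z = x \<oplus>\<^bsub>?E\<^esub> (y \<oplus>\<^bsub>?E\<^esub> z)"
        using add[OF e(1,2,3,4)] add[OF e(1,2,4,5)] add[OF e(1,2) s(1) e(5)] add[OF e(1,2,3) s(2)] e(6-8)
        by metis
    next
      obtain e where e: "conf e" "rgt e = X" using conf_exists[OF X] .
      have z: "hom (zr (lft e) Y) (lft e) Y" using e Y by simp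
      show "\<zero>\<^bsub>?E\<^esub> \<in> carrier ?E"
        using zero_po[OF e(1) Y] closed[OF e(1) e(2)[symmetric] z] e(2) by simp
    next
      fix x assume "x \<in> carrier ?E"
      then obtain e where e: "conf e" "Y = lft e" "X = rgt e" "x = cl e" by (rule in_ExtE)
      let ?z = "zr (lft e) Y" and ?i = "Id (lft e)"
      have h: "hom ?z (lft e) Y" "hom ?i (lft e) Y" "hom (\<^bold>- ?i) (lft e) Y" using e(1,2) by simp_all
      have x: "x = ext_po C E ?i (cl e)" using ext_po_Id[OF cl_in_Ext[OF e(1)]] e(4) by simp
      have z: "\<zero>\<^bsub>?E\<^esub> = ext_po C E ?z (cl e)" using zero_po[OF e(1) Y] e(3) by simp
      have "?z \<^bold>+ ?i = ?i" using e(1,2) by simp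
      then show "\<zero>\<^bsub>?E\<^esub> \<oplus>\<^bsub>?E\<^esub> x = x" using add[OF e(1,3) h(1,2)] x z by metis
      have "\<^bold>- ?i \<^bold>+ ?i = ?z" using e(1,2) by simp
      then have "ext_po C E (\<^bold>- ?i) (cl e) \<oplus>\<^bsub>?E\<^esub> x = \<zero>\<^bsub>?E\<^esub>"
        using add[OF e(1,3) h(3,2)] x z by metis
      then show "\<exists>y\<in>carrier ?E. y \<oplus>\<^bsub>?E\<^esub> x = \<zero>\<^bsub>?E\<^esub>" using closed[OF e(1,3) h(3)] by blast
    qed
    fix r x assume r: "r \<in> carrier k" and x: "x \<in> carrier ?E"
    obtain e a b where e: "conf e" "X = rgt e" "hom a (lft e) Y" "hom b (lft e) Y"
      "x = ext_po C E a (cl e)" "x = ext_po C E b (cl e)" using common_po[OF x x] .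
    have ra: "hom (r \<^bold>* a) (lft e) Y" using e r by simp
    show "r \<odot>\<^bsub>?E\<^esub> x \<in> carrier ?E" using closed[OF e(1,2) ra] smult[OF e(1-3) r] e(5) by metis
    fix s assume s: "s \<in> carrier k"
    have sa: "hom (s \<^bold>* a) (lft e) Y" using e s by simp
    have "(r \<oplus>\<^bsub>k\<^esub> s) \<^bold>* a = r \<^bold>* a \<^bold>+ s \<^bold>* a" "(r \<otimes>\<^bsub>k\<^esub> s) \<^bold>* a = r \<^bold>* (s \<^bold>* a)"
      using e r s by (auto intro: scal_l_distr scal_mult)
    moreover have "r \<oplus>\<^bsub>k\<^esub> s \<in> carrier k" "r \<otimes>\<^bsub>k\<^esub> s \<in> carrier k" using r s by auto
    ultimately show "(r \<oplus>\<^bsub>k\<^esub> s) \<odot>\<^bsub>?E\<^esub> x = r \<odot>\<^bsub>?E\<^esub> x \<oplus>\<^bsub>?E\<^esub> s \<odot>\<^bsub>?E\<^esub> x"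
      "(r \<otimes>\<^bsub>k\<^esub> s) \<odot>\<^bsub>?E\<^esub> x = r \<odot>\<^bsub>?E\<^esub> (s \<odot>\<^bsub>?E\<^esub> x)"
      using smult[OF e(1-3)] smult[OF e(1,2) sa] add[OF e(1,2) ra sa] r s e(5) by metis+
  next
    fix r x y assume r: "r \<in> carrier k" and "x \<in> carrier ?E" "y \<in> carrier ?E"
    then obtain e a b where e: "conf e" "X = rgt e" "hom a (lft e) Y" "hom b (lft e) Y"
        "x = ext_po C E a (cl e)" "y = ext_po C E b (cl e)" using common_po by blast
    have h: "hom (a \<^bold>+ b) (lft e) Y" "hom (r \<^bold>* a) (lft e) Y" "hom (r \<^bold>* b) (lft e) Y" using e r by simp_all
    have "r \<^bold>* (a \<^bold>+ b) = r \<^bold>* a \<^bold>+ r \<^bold>* b" using e r by (intro scal_r_distr) simp_all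
    then show "r \<odot>\<^bsub>?E\<^esub> (x \<oplus>\<^bsub>?E\<^esub> y) = r \<odot>\<^bsub>?E\<^esub> x \<oplus>\<^bsub>?E\<^esub> r \<odot>\<^bsub>?E\<^esub> y"
      using smult[OF e(1-3) r] smult[OF e(1,2,4) r] smult[OF e(1,2) h(1) r] add[OF e(1-4)] add[OF e(1,2) h(2,3)]
        e(5,6) by metis
  next
    fix x assume x: "x \<in> carrier ?E"
    obtain e a b where e: "conf e" "X = rgt e" "hom a (lft e) Y" "hom b (lft e) Y"
      "x = ext_po C E a (cl e)" "x = ext_po C E b (cl e)" using common_po[OF x x] .
    show "\<one>\<^bsub>k\<^esub> \<odot>\<^bsub>?E\<^esub> x = x" using smult[OF e(1-3) H.R.one_closed] e by simp
  qed
qed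

lemma ext_po_linear:
  assumes X: "X \<in> Obj C" and g: "hom g Y Y'"
  shows "linear_map k (Ext C E X Y) (Ext C E X Y') (ext_po C E g)"
proof (rule linear_mapI)
  fix x assume x: "x \<in> carrier (Ext C E X Y)"
  show "ext_po C E g x \<in> carrier (Ext C E X Y')" using ext_po_closed[OF x g] .
  fix y assume "y \<in> carrier (Ext C E X Y)"
  with x obtain e a b where e: "conf e" "X = rgt e" "hom a (lft e) Y" "hom b (lft e) Y"
    "x = ext_po C E a (cl e)" "y = ext_po C E b (cl e)" using common_po by blast
  have comp: "ext_po C E g (ext_po C E a (cl e)) = ext_po C E (g \<bullet> a) (cl e)" if "hom a (lft e) Y" for a
    using ext_po_comp[OF cl_in_Ext[OF e(1)] that g] .
  have h: "hom (a \<^bold>+ b) (lft e) Y" "hom (g \<bullet> a) (lft e) Y'" "hom (g \<bullet> b) (lft e) Y'" using e g by auto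
  have "g \<bullet> (a \<^bold>+ b) = g \<bullet> a \<^bold>+ g \<bullet> b" using e g by simp
  then show "ext_po C E g (x \<oplus>\<^bsub>Ext C E X Y\<^esub> y) = ext_po C E g x \<oplus>\<^bsub>Ext C E X Y'\<^esub> ext_po C E g y"
    using comp[OF e(3)] comp[OF e(4)] comp[OF h(1)] ext_add_po[OF e(1,3,4)] ext_add_po[OF e(1) h(2,3)] e(2,5,6)
    by simp
next
  fix r x assume r: "r \<in> carrier k" and x: "x \<in> carrier (Ext C E X Y)"
  obtain e a b where e: "conf e" "X = rgt e" "hom a (lft e) Y" "hom b (lft e) Y"
    "x = ext_po C E a (cl e)" "x = ext_po C E b (cl e)" using common_po[OF x x] .
  have comp: "ext_po C E g (ext_po C E a (cl e)) = ext_po C E (g \<bullet> a) (cl e)" if "hom a (lft e) Y" for a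
    using ext_po_comp[OF cl_in_Ext[OF e(1)] that g] .
  have h: "hom (r \<^bold>* a) (lft e) Y" "hom (g \<bullet> a) (lft e) Y'" using e g r by auto
  have "g \<bullet> (r \<^bold>* a) = r \<^bold>* (g \<bullet> a)" using e g r by simp
  then show "ext_po C E g (r \<odot>\<^bsub>Ext C E X Y\<^esub> x) = r \<odot>\<^bsub>Ext C E X Y'\<^esub> ext_po C E g x"
    using comp[OF e(3)] comp[OF h(1)] ext_smult_po[OF e(1,3) r] ext_smult_po[OF e(1) h(2) r] e(2,5)
    by metis
qed

lemma ext_po_linear':
  assumes "\<xi> \<in> carrier (Ext C E X Y)" and Y': "Y' \<in> Obj C"
  shows "linear_map k (Hom C Y Y') (Ext C E X Y') (\<lambda>g. ext_po C E g \<xi>)"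
proof -
  obtain c where c: "conf c" "Y = lft c" "X = rgt c" "\<xi> = cl c" using in_ExtE[OF assms(1)] .
  have Y: "Y \<in> Obj C" using c by simp
  have hom: "hom g Y Y'" if "g \<in> Mor C Y Y'" for g using homI[OF that Y Y'] .
  show ?thesis
  proof (rule linear_mapI)
    fix g assume g: "g \<in> Mor C Y Y'"
    show "ext_po C E g \<xi> \<in> carrier (Ext C E X Y')" using ext_po_closed[OF assms(1) hom[OF g]] .
    show "ext_po C E (a \<odot>\<^bsub>Hom C Y Y'\<^esub> g) \<xi> = a \<odot>\<^bsub>Ext C E X Y'\<^esub> ext_po C E g \<xi>" if "a \<in> carrier k" for a
      using ext_smult_po[OF c(1) hom[OF g, unfolded c(2)] that] c hom[OF g] by (simp add: scal_def)
    fix g' assume g': "g' \<in> Mor C Y Y'"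
    show "ext_po C E (g \<oplus>\<^bsub>Hom C Y Y'\<^esub> g') \<xi> = ext_po C E g \<xi> \<oplus>\<^bsub>Ext C E X Y'\<^esub> ext_po C E g' \<xi>"
      using ext_add_po[OF c(1) hom[OF g, unfolded c(2)] hom[OF g', unfolded c(2)]] c hom[OF g]
      by (simp add: plus_def)
  qed
qed

lemma ext_pb_linear:
  assumes Y: "Y \<in> Obj C" and f: "hom f X' X"
  shows "linear_map k (Ext C E X Y) (Ext C E X' Y) (ext_pb C E f)"
proof -
  \<comment> \<open>\<open>d\<close> is the pullback of \<open>e\<close> along \<open>f\<close>.
    Since pullback commutes with pushout, classes pushed out from \<open>e\<close> go to classes
    pushed out from \<open>d\<close> along the same morphisms, where sums and multiples are
    known.\<close>
  have pb: "\<exists>d. conf d \<and> rgt d = X' \<and> lft d = lft e \<and>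
      (\<forall>a. hom a (lft e) Y \<longrightarrow> ext_pb C E f (ext_po C E a (cl e)) = ext_po C E a (cl d))"
    if e: "conf e" "X = rgt e" for e
  proof -
    have "Arr f" "cd f = rgt e" using f e by auto
    then obtain d where d: "cm (Id (lft e)) f d e" "conf d" "lft d = lft e" "rgt d = dm f"
      using pullback_cm[OF e(1)] by metis
    have "ext_pb C E f (ext_po C E a (cl e)) = ext_po C E a (cl d)" if "hom a (lft e) Y" for a
      using ext_pb_po[OF cl_in_Ext[OF e(1)] f[unfolded e(2)] that] ext_pb_cl[OF d(1)] by simp
    then show ?thesis using d(2-4) f by (intro exI[of _ d]) auto
  qed
  show ?thesis
  proof (rule linear_mapI)
    fix x assume x: "x \<in> carrier (Ext C E X Y)"
    show "ext_pb C E f x \<in> carrier (Ext C E X' Y)" using ext_pb_closed[OF x f] .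
    fix y assume "y \<in> carrier (Ext C E X Y)"
    with x obtain e a b where e: "conf e" "X = rgt e" "hom a (lft e) Y" "hom b (lft e) Y"
      "x = ext_po C E a (cl e)" "y = ext_po C E b (cl e)" using common_po by blast
    obtain d where d: "conf d" "rgt d = X'" "lft d = lft e"
      "\<And>a. hom a (lft e) Y \<Longrightarrow> ext_pb C E f (ext_po C E a (cl e)) = ext_po C E a (cl d)"
      using pb[OF e(1,2)] by blast
    have h: "hom (a \<^bold>+ b) (lft e) Y" using e by simp
    show "ext_pb C E f (x \<oplus>\<^bsub>Ext C E X Y\<^esub> y) = ext_pb C E f x \<oplus>\<^bsub>Ext C E X' Y\<^esub> ext_pb C E f y"
      using d(4)[OF e(3)] d(4)[OF e(4)] d(4)[OF h] ext_add_po[OF e(1,3,4)]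
        ext_add_po[OF d(1) e(3,4)[folded d(3)]] e(2,5,6) d(2) by simp
  next
    fix r x assume r: "r \<in> carrier k" and x: "x \<in> carrier (Ext C E X Y)"
    obtain e a b where e: "conf e" "X = rgt e" "hom a (lft e) Y" "hom b (lft e) Y"
      "x = ext_po C E a (cl e)" "x = ext_po C E b (cl e)" using common_po[OF x x] .
    obtain d where d: "conf d" "rgt d = X'" "lft d = lft e"
      "\<And>a. hom a (lft e) Y \<Longrightarrow> ext_pb C E f (ext_po C E a (cl e)) = ext_po C E a (cl d)"
      using pb[OF e(1,2)] by blast
    have h: "hom (r \<^bold>* a) (lft e) Y" using e r by simp
    show "ext_pb C E f (r \<odot>\<^bsub>Ext C E X Y\<^esub> x) = r \<odot>\<^bsub>Ext C E X' Y\<^esub> ext_pb C E f x"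
      using d(4)[OF e(3)] d(4)[OF h] ext_smult_po[OF e(1,3) r] ext_smult_po[OF d(1) e(3)[folded d(3)] r]
        e(2,5) d(2) by metis
  qed
qed

lemma ext_pb_linear':
  assumes "\<xi> \<in> carrier (Ext C E X Y)" and X': "X' \<in> Obj C"
  shows "linear_map k (Hom C X' X) (Ext C E X' Y) (\<lambda>f. ext_pb C E f \<xi>)"
proof -
  obtain c where c: "conf c" "Y = lft c" "X = rgt c" "\<xi> = cl c" using in_ExtE[OF assms(1)] .
  have o: "X \<in> Obj C" "Y \<in> Obj C" using c by simp_all
  have hom: "hom f X' X" if "f \<in> Mor C X' X" for f using homI[OF that X' o(1)] .
  show ?thesis
  proof (rule linear_mapI)
    fix f assume "f \<in> Mor C X' X"
    then have f: "hom f X' X" by (rule hom)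
    show "ext_pb C E f \<xi> \<in> carrier (Ext C E X' Y)" using ext_pb_closed[OF assms(1) f] .
    show "ext_pb C E (a \<odot>\<^bsub>Hom C X' X\<^esub> f) \<xi> = a \<odot>\<^bsub>Ext C E X' Y\<^esub> ext_pb C E f \<xi>" if a: "a \<in> carrier k" for a
    proof -
      have "Arr f" "cd f = rgt c" using f c by auto
      then obtain d where d: "cm (Id (lft c)) f d c" "conf d" "lft d = lft c" "rgt d = dm f"
        using pullback_cm[OF c(1)] by metis
      have i: "hom (a \<^bold>* Id Y) (lft d) Y" using o a c d by simp
      then obtain e where e: "cm (a \<^bold>* Id Y) (Id (rgt d)) d e" "conf e" "lft e = cd (a \<^bold>* Id Y)" "rgt e = rgt d"
        using pushout_cm[OF d(2)] by metis
      obtain h where h: "Arr h" "dm h = mid d" "cd h = mid c" "h \<bullet> fst d = fst c \<bullet> Id (lft c)" "snd c \<bullet> h = f \<bullet> snd d"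
        using cmE[OF d(1)] .
      \<comment> \<open>Scalars act by pushout along \<open>a Id\<close>. Multiplying the middle map
        of the pullback ladder by \<open>a\<close> gives a ladder with outer components
        \<open>a Id\<close> and \<open>a f\<close>; factored through the pushout \<open>e\<close>,
        it shows \<open>e\<close> to be the pullback along \<open>a f\<close>.\<close>
      have "cm (a \<^bold>* Id Y) (a \<^bold>* f) d c"
        by (rule cmI[of _ _ _ _ "a \<^bold>* h"]) (use h d c f a in simp_all)
      then have "cm (Id (lft e)) (a \<^bold>* f) e c" by (rule cm_factor_po[OF _ e(1)])
      then have "cm (Id (lft c)) (a \<^bold>* f) e c" using e i c by simp
      then have "ext_pb C E (a \<^bold>* f) \<xi> = ext_po C E (a \<^bold>* Id Y) (ext_pb C E f \<xi>)"
        using ext_pb_cl ext_po_cl[OF e(1)] ext_pb_cl[OF d(1)] c by simp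
      then show ?thesis using f o by (simp add: scal_def)
    qed
    fix f' assume "f' \<in> Mor C X' X"
    then have f': "hom f' X' X" by (rule hom)
    show "ext_pb C E (f \<oplus>\<^bsub>Hom C X' X\<^esub> f') \<xi> = ext_pb C E f \<xi> \<oplus>\<^bsub>Ext C E X' Y\<^esub> ext_pb C E f' \<xi>"
      using ext_add_pb[OF c(1) f[unfolded c(3)] f'[unfolded c(3)]] c f by (simp add: plus_def)
  qed
qed

text \<open>Exactness of Hom(Y, X) to Ext(Y, Z) to Ext(Y, B), where \<open>B\<close> is the middle
  term and \<open>i\<close> the inflation of \<open>\<xi>\<close>. If the pushout of
  \<open>\<zeta>\<close> along \<open>i\<close> splits, then \<open>i\<close> extends to the middle
  term of \<open>\<zeta>\<close>, and the induced map of right ends is \<open>f\<close>.\<close>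

lemma connecting_pb:
  assumes "\<xi> \<in> carrier (Ext C E X Z)"
  shows "\<exists>B i. hom i Z B \<and> ext_po C E i \<xi> = \<zero>\<^bsub>Ext C E X B\<^esub> \<and>
    (\<forall>Y \<zeta>. \<zeta> \<in> carrier (Ext C E Y Z) \<longrightarrow> ext_po C E i \<zeta> = \<zero>\<^bsub>Ext C E Y B\<^esub> \<longrightarrow> (\<exists>f. hom f Y X \<and> \<zeta> = ext_pb C E f \<xi>))"
proof -
  obtain c where c: "conf c" "Z = lft c" "X = rgt c" "\<xi> = cl c" using in_ExtE[OF assms] .
  have split: "ext_po C E (fst c) (cl d) = \<zero>\<^bsub>Ext C E (rgt d) (mid c)\<^esub> \<longleftrightarrow>
      (\<exists>t. hom t (mid d) (mid c) \<and> t \<bullet> fst d = fst c)" if d: "conf d" "lft d = lft c" for d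
  proof -
    have "Arr (fst c)" "dm (fst c) = lft d" using c(1) d by simp_all
    then obtain e where e: "cm (fst c) (Id (rgt d)) d e" "conf e" "lft e = cd (fst c)" "rgt e = rgt d"
      using pushout_cm[OF d(1)] by metis
    then show ?thesis using splits_po[OF e(1)] splits_zero[of e] ext_po_cl[OF e(1)] c(1) by simp
  qed
  show ?thesis
  proof (rule exI[of _ "mid c"], rule exI[of _ "fst c"], intro conjI allI impI)
    show "ext_po C E (fst c) \<xi> = \<zero>\<^bsub>Ext C E X (mid c)\<^esub>"
      using split[OF c(1) refl] c by (auto intro!: exI[of _ "Id (mid c)"])
    fix Y \<zeta> assume "\<zeta> \<in> carrier (Ext C E Y Z)" and z: "ext_po C E (fst c) \<zeta> = \<zero>\<^bsub>Ext C E Y (mid c)\<^esub>"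
    then obtain d where d: "conf d" "Z = lft d" "Y = rgt d" "\<zeta> = cl d" using in_ExtE by blast
    have ld: "lft d = lft c" using c d by simp
    obtain t where t: "hom t (mid d) (mid c)" "t \<bullet> fst d = fst c" using split[OF d(1) ld] z d by auto
    obtain f where f: "cm (Id (lft c)) f d c"
      by (rule cm_fill_right[OF d(1) c(1), of t "Id (lft c)"]) (use t c d ld in simp_all)
    then show "\<exists>f. hom f Y X \<and> \<zeta> = ext_pb C E f \<xi>"
      using ext_pb_cl[OF f] cmD[OF f] c d by auto
  qed (use c in simp_all)
qed

text \<open>Dual, with the deflation of \<open>\<xi>\<close>: exactness of Hom(Z, Y) to Ext(X, Y) to
  Ext(B, Y).\<close>

lemma connecting_po:
  assumes "\<xi> \<in> carrier (Ext C E X Z)"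
  shows "\<exists>B p. hom p B X \<and> ext_pb C E p \<xi> = \<zero>\<^bsub>Ext C E B Z\<^esub> \<and>
    (\<forall>Y \<zeta>. \<zeta> \<in> carrier (Ext C E X Y) \<longrightarrow> ext_pb C E p \<zeta> = \<zero>\<^bsub>Ext C E B Y\<^esub> \<longrightarrow> (\<exists>g. hom g Z Y \<and> \<zeta> = ext_po C E g \<xi>))"
proof -
  obtain c where c: "conf c" "Z = lft c" "X = rgt c" "\<xi> = cl c" using in_ExtE[OF assms] .
  have split: "ext_pb C E (snd c) (cl d) = \<zero>\<^bsub>Ext C E (mid c) (lft d)\<^esub> \<longleftrightarrow>
      (\<exists>t. hom t (mid c) (mid d) \<and> snd d \<bullet> t = snd c)" if d: "conf d" "rgt d = rgt c" for d
  proof -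
    have "Arr (snd c)" "cd (snd c) = rgt d" using c(1) d by simp_all
    then obtain e where e: "cm (Id (lft d)) (snd c) e d" "conf e" "lft e = lft d" "rgt e = dm (snd c)"
      using pullback_cm[OF d(1)] by metis
    then show ?thesis using splits_pb[OF e(1)] splits_zero[of e] ext_pb_cl[OF e(1)] c(1) by simp
  qed
  show ?thesis
  proof (rule exI[of _ "mid c"], rule exI[of _ "snd c"], intro conjI allI impI)
    show "ext_pb C E (snd c) \<xi> = \<zero>\<^bsub>Ext C E (mid c) Z\<^esub>"
      using split[OF c(1) refl] c by (auto intro!: exI[of _ "Id (mid c)"])
    fix Y \<zeta> assume "\<zeta> \<in> carrier (Ext C E X Y)" and z: "ext_pb C E (snd c) \<zeta> = \<zero>\<^bsub>Ext C E (mid c) Y\<^esub>"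
    then obtain d where d: "conf d" "Y = lft d" "X = rgt d" "\<zeta> = cl d" using in_ExtE by blast
    have rd: "rgt d = rgt c" using c d by simp
    obtain t where t: "hom t (mid c) (mid d)" "snd d \<bullet> t = snd c" using split[OF d(1) rd] z d by auto
    obtain g where g: "cm g (Id (rgt c)) c d"
      by (rule cm_fill_left[OF c(1) d(1), of t "Id (rgt c)"]) (use t c d rd in simp_all)
    then show "\<exists>g. hom g Z Y \<and> \<zeta> = ext_po C E g \<xi>"
      using ext_po_cl[OF g] cmD[OF g] c d by auto
  qed (use c in simp_all)
qed

end

section \<open>Universal functionals on Ext\<close>

text \<open>A functional \<open>\<theta>\<close> on \<open>Ext(Y, T)\<close> is right universal if \<open>g \<mapsto> \<theta> \<circ> Ext(Y, g)\<close> identifies the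
  injectively stable Hom functor of \<open>T\<close> with \<open>D Ext(Y, -)\<close>. Left universality is the same notion with
  the roles of the two arguments exchanged.\<close>

definition right_universal :: "'r ring \<Rightarrow> ('r, 'q) module \<Rightarrow> 'o set \<Rightarrow> ('o \<Rightarrow> 'o \<Rightarrow> ('r, 'm) module)
    \<Rightarrow> ('o \<Rightarrow> 'o \<Rightarrow> ('r, 'e) module) \<Rightarrow> ('m \<Rightarrow> 'e \<Rightarrow> 'e) \<Rightarrow> 'o \<Rightarrow> 'o \<Rightarrow> ('e \<Rightarrow> 'q) \<Rightarrow> bool" where
  "right_universal k Q Ob H Bi po Y T \<theta> \<longleftrightarrow> linear_map k (Bi Y T) Q \<theta> \<and>
     (\<forall>M\<in>Ob. (\<forall>l. linear_map k (Bi Y M) Q l \<longrightarrow>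
         (\<exists>g\<in>carrier (H M T). \<forall>\<xi>\<in>carrier (Bi Y M). l \<xi> = \<theta> (po g \<xi>))) \<and>
       (\<forall>g\<in>carrier (H M T). (\<forall>\<xi>\<in>carrier (Bi Y M). \<theta> (po g \<xi>) = \<zero>\<^bsub>Q\<^esub>) \<longrightarrow>
         (\<forall>X\<in>Ob. \<forall>\<xi>\<in>carrier (Bi X M). po g \<xi> = \<zero>\<^bsub>Bi X T\<^esub>)))"

abbreviation (input) left_universal :: "'r ring \<Rightarrow> ('r, 'q) module \<Rightarrow> 'o set \<Rightarrow> ('o \<Rightarrow> 'o \<Rightarrow> ('r, 'm) module)
    \<Rightarrow> ('o \<Rightarrow> 'o \<Rightarrow> ('r, 'e) module) \<Rightarrow> ('m \<Rightarrow> 'e \<Rightarrow> 'e) \<Rightarrow> 'o \<Rightarrow> 'o \<Rightarrow> ('e \<Rightarrow> 'q) \<Rightarrow> bool" where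
  "left_universal k Q Ob H Bi pb Y T \<equiv> right_universal k Q Ob (\<lambda>X Y. H Y X) (\<lambda>X Y. Bi Y X) pb T Y"

lemma right_universalD:
  assumes "right_universal k Q Ob H Bi po Y T \<theta>"
  shows "linear_map k (Bi Y T) Q \<theta>"
    "M \<in> Ob \<Longrightarrow> linear_map k (Bi Y M) Q l \<Longrightarrow> \<exists>g\<in>carrier (H M T). \<forall>\<xi>\<in>carrier (Bi Y M). l \<xi> = \<theta> (po g \<xi>)"
    "\<lbrakk>M \<in> Ob; g \<in> carrier (H M T); \<And>\<xi>. \<xi> \<in> carrier (Bi Y M) \<Longrightarrow> \<theta> (po g \<xi>) = \<zero>\<^bsub>Q\<^esub>; X \<in> Ob; \<xi> \<in> carrier (Bi X M)\<rbrakk>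
      \<Longrightarrow> po g \<xi> = \<zero>\<^bsub>Bi X T\<^esub>"
  using assms unfolding right_universal_def by blast+

text \<open>Ext over \<open>C\<close> reduced to what the duality argument uses. The axioms come in
  pairs exchanged by reversing morphisms, so the locale is closed under passing to the opposite
  category. The two connecting axioms are what remains of the long exact sequences.\<close>

locale ext_bimodule = matlis k Q
  for k :: "'r ring" and Q :: "('r, 'q) module" +
  fixes Ob :: "'o set" and H :: "'o \<Rightarrow> 'o \<Rightarrow> ('r, 'm) module" and cmp :: "'m \<Rightarrow> 'm \<Rightarrow> 'm"
    and idt :: "'o \<Rightarrow> 'm" and Bi :: "'o \<Rightarrow> 'o \<Rightarrow> ('r, 'e) module" and po pb :: "'m \<Rightarrow> 'e \<Rightarrow> 'e"
  assumes H_module: "X \<in> Ob \<Longrightarrow> Y \<in> Ob \<Longrightarrow> module k (H X Y)"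
    and H_finite: "X \<in> Ob \<Longrightarrow> Y \<in> Ob \<Longrightarrow> finitely_generated k (H X Y)"
    and idt_closed: "X \<in> Ob \<Longrightarrow> idt X \<in> carrier (H X X)"
    and cmp_closed: "\<lbrakk>X \<in> Ob; Y \<in> Ob; Z \<in> Ob; f \<in> carrier (H X Y); g \<in> carrier (H Y Z)\<rbrakk> \<Longrightarrow> cmp g f \<in> carrier (H X Z)"
    and Bi_module: "X \<in> Ob \<Longrightarrow> Y \<in> Ob \<Longrightarrow> module k (Bi X Y)"
    and po_linear: "\<lbrakk>X \<in> Ob; Y \<in> Ob; Y' \<in> Ob; g \<in> carrier (H Y Y')\<rbrakk> \<Longrightarrow> linear_map k (Bi X Y) (Bi X Y') (po g)"
    and po_linear': "\<lbrakk>X \<in> Ob; Y \<in> Ob; Y' \<in> Ob; \<xi> \<in> carrier (Bi X Y)\<rbrakk> \<Longrightarrow> linear_map k (H Y Y') (Bi X Y') (\<lambda>g. po g \<xi>)"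
    and pb_linear: "\<lbrakk>X \<in> Ob; Y \<in> Ob; X' \<in> Ob; f \<in> carrier (H X' X)\<rbrakk> \<Longrightarrow> linear_map k (Bi X Y) (Bi X' Y) (pb f)"
    and pb_linear': "\<lbrakk>X \<in> Ob; Y \<in> Ob; X' \<in> Ob; \<xi> \<in> carrier (Bi X Y)\<rbrakk> \<Longrightarrow> linear_map k (H X' X) (Bi X' Y) (\<lambda>f. pb f \<xi>)"
    and po_idt: "\<lbrakk>X \<in> Ob; Y \<in> Ob; \<xi> \<in> carrier (Bi X Y)\<rbrakk> \<Longrightarrow> po (idt Y) \<xi> = \<xi>"
    and pb_idt: "\<lbrakk>X \<in> Ob; Y \<in> Ob; \<xi> \<in> carrier (Bi X Y)\<rbrakk> \<Longrightarrow> pb (idt X) \<xi> = \<xi>"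
    and po_cmp: "\<lbrakk>X \<in> Ob; Y \<in> Ob; Y' \<in> Ob; Y'' \<in> Ob; \<xi> \<in> carrier (Bi X Y); g \<in> carrier (H Y Y'); g' \<in> carrier (H Y' Y'')\<rbrakk>
      \<Longrightarrow> po (cmp g' g) \<xi> = po g' (po g \<xi>)"
    and pb_cmp: "\<lbrakk>X \<in> Ob; Y \<in> Ob; X' \<in> Ob; X'' \<in> Ob; \<xi> \<in> carrier (Bi X Y); f \<in> carrier (H X' X); f' \<in> carrier (H X'' X')\<rbrakk>
      \<Longrightarrow> pb (cmp f f') \<xi> = pb f' (pb f \<xi>)"
    and pb_po: "\<lbrakk>X \<in> Ob; Y \<in> Ob; X' \<in> Ob; Y' \<in> Ob; \<xi> \<in> carrier (Bi X Y); f \<in> carrier (H X' X); g \<in> carrier (H Y Y')\<rbrakk>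
      \<Longrightarrow> pb f (po g \<xi>) = po g (pb f \<xi>)"
    and connecting_pb: "\<lbrakk>X \<in> Ob; Z \<in> Ob; \<xi> \<in> carrier (Bi X Z)\<rbrakk> \<Longrightarrow>
      \<exists>B\<in>Ob. \<exists>i\<in>carrier (H Z B). po i \<xi> = \<zero>\<^bsub>Bi X B\<^esub> \<and>
        (\<forall>Y\<in>Ob. \<forall>\<zeta>\<in>carrier (Bi Y Z). po i \<zeta> = \<zero>\<^bsub>Bi Y B\<^esub> \<longrightarrow> (\<exists>f\<in>carrier (H Y X). \<zeta> = pb f \<xi>))"
    and connecting_po: "\<lbrakk>X \<in> Ob; Z \<in> Ob; \<xi> \<in> carrier (Bi X Z)\<rbrakk> \<Longrightarrow>
      \<exists>B\<in>Ob. \<exists>p\<in>carrier (H B X). pb p \<xi> = \<zero>\<^bsub>Bi B Z\<^esub> \<and>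
        (\<forall>Y\<in>Ob. \<forall>\<zeta>\<in>carrier (Bi X Y). pb p \<zeta> = \<zero>\<^bsub>Bi B Y\<^esub> \<longrightarrow> (\<exists>g\<in>carrier (H Z Y). \<zeta> = po g \<xi>))"
begin

lemma ext_bimodule_op: "ext_bimodule k Q Ob (\<lambda>X Y. H Y X) (\<lambda>g f. cmp f g) idt (\<lambda>X Y. Bi Y X) pb po"
  apply (intro ext_bimodule.intro ext_bimodule_axioms.intro matlis_axioms)
  subgoal by (rule H_module)
  subgoal by (rule H_finite)
  subgoal by (rule idt_closed)
  subgoal for X Y Z f g by (rule cmp_closed[of Z Y X g f])
  subgoal by (rule Bi_module)
  subgoal for X Y Y' g by (rule pb_linear[of Y X Y' g])
  subgoal for X Y Y' \<xi> by (rule pb_linear'[of Y X Y' \<xi>])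
  subgoal for X Y X' f by (rule po_linear[of Y X X' f])
  subgoal for X Y X' \<xi> by (rule po_linear'[of Y X X' \<xi>])
  subgoal for X Y \<xi> by (rule pb_idt[of Y X \<xi>])
  subgoal for X Y \<xi> by (rule po_idt[of Y X \<xi>])
  subgoal for X Y Y' Y'' \<xi> g g' by (rule pb_cmp[of Y X Y' Y'' \<xi> g g'])
  subgoal for X Y X' X'' \<xi> f f' by (rule po_cmp[of Y X X' X'' \<xi> f f'])
  subgoal for X Y X' Y' \<xi> f g by (rule pb_po[of Y X Y' X' \<xi> g f, symmetric])
  subgoal for X Z \<xi> by (rule connecting_po[of Z X \<xi>])
  subgoal for X Z \<xi> by (rule connecting_pb[of Z X \<xi>])
  done

text \<open>For surjectivity on the left it suffices, by Matlis duality for the finitely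
  generated module \<open>Hom(Y, X)\<close>, that no nonzero \<open>\<xi>\<close> in \<open>Ext(X, T)\<close> satisfies \<open>\<theta>(f\<^sup>* \<xi>) = 0\<close> for
  all \<open>f\<close>. If \<open>i\<close> is the inflation of \<open>\<xi>\<close>, then the \<open>f\<^sup>* \<xi>\<close> form the kernel of \<open>i\<^sub>*\<close>, so \<open>\<theta>\<close> factors
  through \<open>i\<^sub>*\<close> as \<open>\<theta> = \<theta> \<circ> (h i)\<^sub>*\<close>; hence \<open>h i\<close> acts on Ext as the identity and \<open>\<xi> = h\<^sub>* i\<^sub>* \<xi> = 0\<close>.\<close>

theorem right_universal_imp_left_universal:
  assumes Y: "Y \<in> Ob" and T: "T \<in> Ob" and univ: "right_universal k Q Ob H Bi po Y T \<theta>"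
  shows "left_universal k Q Ob H Bi pb Y T \<theta>"
proof -
  note U = right_universalD[OF univ]
  note closed = linear_map_closed[OF po_linear] linear_map_closed[OF pb_linear]
  have \<theta>0: "\<theta> \<zero>\<^bsub>Bi Y T\<^esub> = \<zero>\<^bsub>Q\<^esub>"
    by (rule linear_map_zero[OF Bi_module[OF Y T] Q.module_axioms U(1)])
  have po0: "po g \<zero>\<^bsub>Bi X Z\<^esub> = \<zero>\<^bsub>Bi X Z'\<^esub>" if "X \<in> Ob" "Z \<in> Ob" "Z' \<in> Ob" "g \<in> carrier (H Z Z')" for g X Z Z'
    by (rule linear_map_zero[OF Bi_module Bi_module po_linear]) (use that in simp_all)
  have nondeg: "\<xi> = \<zero>\<^bsub>Bi X T\<^esub>"
    if X: "X \<in> Ob" and \<xi>: "\<xi> \<in> carrier (Bi X T)"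
      and zero: "\<And>f. f \<in> carrier (H Y X) \<Longrightarrow> \<theta> (pb f \<xi>) = \<zero>\<^bsub>Q\<^esub>" for X \<xi>
  proof -
    obtain B i where B: "B \<in> Ob" and i: "i \<in> carrier (H T B)" and i\<xi>: "po i \<xi> = \<zero>\<^bsub>Bi X B\<^esub>"
      and conn: "\<And>\<zeta>. \<zeta> \<in> carrier (Bi Y T) \<Longrightarrow> po i \<zeta> = \<zero>\<^bsub>Bi Y B\<^esub> \<Longrightarrow> \<exists>f\<in>carrier (H Y X). \<zeta> = pb f \<xi>"
      using connecting_pb[OF X T \<xi>] Y by blast
    have "\<theta> \<zeta> = \<zero>\<^bsub>Q\<^esub>" if "\<zeta> \<in> carrier (Bi Y T)" "po i \<zeta> = \<zero>\<^bsub>Bi Y B\<^esub>" for \<zeta>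
      using conn[OF that] zero by blast
    then obtain l where l: "linear_map k (Bi Y B) Q l" "\<And>\<zeta>. \<zeta> \<in> carrier (Bi Y T) \<Longrightarrow> l (po i \<zeta>) = \<theta> \<zeta>"
      using extend_along[OF Bi_module[OF Y B] Bi_module[OF Y T] po_linear[OF Y T B i] U(1)] by blast
    obtain h where h: "h \<in> carrier (H B T)" "\<And>\<zeta>. \<zeta> \<in> carrier (Bi Y B) \<Longrightarrow> l \<zeta> = \<theta> (po h \<zeta>)"
      using U(2)[OF B l(1)] by blast
    interpret HT: module k "H T T" by (rule H_module[OF T T])
    interpret EX: module k "Bi X T" by (rule Bi_module[OF X T])
    \<comment> \<open>\<open>U(3)\<close> speaks of morphisms along which the functional vanishes,
      hence the difference of \<open>h i\<close> and the identity.\<close>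
    define u where "u = cmp h i \<oplus>\<^bsub>H T T\<^esub> \<ominus>\<^bsub>H T T\<^esub> idt T"
    have hi: "cmp h i \<in> carrier (H T T)" by (rule cmp_closed[OF T B T i h(1)])
    have u: "u \<in> carrier (H T T)" using hi idt_closed[OF T] by (simp add: u_def)
    have pou: "po u \<zeta> = po h (po i \<zeta>) \<oplus>\<^bsub>Bi X' T\<^esub> \<ominus>\<^bsub>Bi X' T\<^esub> \<zeta>"
      if X': "X' \<in> Ob" and \<zeta>: "\<zeta> \<in> carrier (Bi X' T)" for X' \<zeta>
    proof -
      note lin = po_linear'[OF X' T T \<zeta>]
      have "po u \<zeta> = po (cmp h i) \<zeta> \<oplus>\<^bsub>Bi X' T\<^esub> \<ominus>\<^bsub>Bi X' T\<^esub> po (idt T) \<zeta>"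
        unfolding u_def using linear_map_add[OF lin hi HT.M.a_inv_closed[OF idt_closed[OF T]]]
          linear_map_neg[OF HT.module_axioms Bi_module[OF X' T] lin idt_closed[OF T]] by simp
      then show ?thesis using po_cmp[OF X' T B T \<zeta> i h(1)] po_idt[OF X' T \<zeta>] by simp
    qed
    have "\<theta> (po u \<zeta>) = \<zero>\<^bsub>Q\<^esub>" if \<zeta>: "\<zeta> \<in> carrier (Bi Y T)" for \<zeta>
    proof -
      interpret EY: module k "Bi Y T" by (rule Bi_module[OF Y T])
      have i\<zeta>: "po i \<zeta> \<in> carrier (Bi Y B)" using closed(1)[OF Y T B i \<zeta>] .
      have hi\<zeta>: "po h (po i \<zeta>) \<in> carrier (Bi Y T)" using closed(1)[OF Y B T h(1) i\<zeta>] .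
      have "\<theta> (po u \<zeta>) = \<theta> (po h (po i \<zeta>)) \<oplus>\<^bsub>Q\<^esub> \<ominus>\<^bsub>Q\<^esub> \<theta> \<zeta>"
        unfolding pou[OF Y \<zeta>] using linear_map_add[OF U(1) hi\<zeta> EY.M.a_inv_closed[OF \<zeta>]]
          linear_map_neg[OF EY.module_axioms Q.module_axioms U(1) \<zeta>] by simp
      also have "\<theta> (po h (po i \<zeta>)) = \<theta> \<zeta>" using h(2)[OF i\<zeta>] l(2)[OF \<zeta>] by simp
      finally show ?thesis using linear_map_closed[OF U(1) \<zeta>] by (simp add: Q.M.r_neg)
    qed
    then have "po u \<xi> = \<zero>\<^bsub>Bi X T\<^esub>" by (rule U(3)[OF T u _ X \<xi>])
    then have "\<zero>\<^bsub>Bi X T\<^esub> \<oplus>\<^bsub>Bi X T\<^esub> \<ominus>\<^bsub>Bi X T\<^esub> \<xi> = \<zero>\<^bsub>Bi X T\<^esub>"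
      using pou[OF X \<xi>] i\<xi> po0[OF X B T h(1)] by simp
    then show ?thesis using \<xi> EX.M.minus_minus[OF \<xi>] EX.neg_zero by simp
  qed
  show ?thesis
    unfolding right_universal_def
  proof (intro conjI ballI allI impI U(1))
    fix X l assume X: "X \<in> Ob" and l: "linear_map k (Bi X T) Q l"
    show "\<exists>f\<in>carrier (H Y X). \<forall>\<xi>\<in>carrier (Bi X T). l \<xi> = \<theta> (pb f \<xi>)"
    proof (rule functional_from_pairing[OF H_module[OF Y X] Bi_module[OF X T] H_finite[OF Y X] _ _ l])
      show "linear_map k (Bi X T) Q (\<lambda>\<xi>. \<theta> (pb f \<xi>))" if "f \<in> carrier (H Y X)" for f
        by (rule linear_map_comp[OF pb_linear[OF X T Y that] U(1)])
      show "linear_map k (H Y X) Q (\<lambda>f. \<theta> (pb f \<xi>))" if "\<xi> \<in> carrier (Bi X T)" for \<xi>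
        by (rule linear_map_comp[OF pb_linear'[OF X T Y that] U(1)])
      fix \<xi> assume \<xi>: "\<xi> \<in> carrier (Bi X T)" "\<And>f. f \<in> carrier (H Y X) \<Longrightarrow> \<theta> (pb f \<xi>) = \<zero>\<^bsub>Q\<^esub>"
      have "\<xi> = \<zero>\<^bsub>Bi X T\<^esub>" by (rule nondeg[OF X \<xi>])
      then show "l \<xi> = \<zero>\<^bsub>Q\<^esub>"
        using linear_map_zero[OF Bi_module[OF X T] Q.module_axioms l] by simp
    qed
  next
    fix X f Z \<xi>
    assume X: "X \<in> Ob" and f: "f \<in> carrier (H Y X)" and zero: "\<forall>\<xi>\<in>carrier (Bi X T). \<theta> (pb f \<xi>) = \<zero>\<^bsub>Q\<^esub>"
      and Z: "Z \<in> Ob" and \<xi>: "\<xi> \<in> carrier (Bi X Z)"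
    show "pb f \<xi> = \<zero>\<^bsub>Bi Y Z\<^esub>"
    proof (rule ccontr)
      have f\<xi>: "pb f \<xi> \<in> carrier (Bi Y Z)" using closed(2)[OF X Z Y f \<xi>] .
      assume "pb f \<xi> \<noteq> \<zero>\<^bsub>Bi Y Z\<^esub>"
      \<comment> \<open>Injectivity by duality: a functional \<open>l\<close> detecting
        \<open>pb f \<xi>\<close> has the form \<open>\<theta> \<circ> po g\<close> by right
        universality, and \<open>pb f\<close> can be moved past \<open>po g\<close>, where
        \<open>\<theta> \<circ> pb f\<close> is zero.\<close>
      then obtain l where l: "linear_map k (Bi Y Z) Q l" "l (pb f \<xi>) \<noteq> \<zero>\<^bsub>Q\<^esub>"
        using separating_functional[OF Bi_module[OF Y Z] f\<xi>] by blast
      obtain g where g: "g \<in> carrier (H Z T)" "\<forall>\<zeta>\<in>carrier (Bi Y Z). l \<zeta> = \<theta> (po g \<zeta>)"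
        using U(2)[OF Z l(1)] by blast
      have "l (pb f \<xi>) = \<theta> (pb f (po g \<xi>))" using g(2) f\<xi> pb_po[OF X Z Y T \<xi> f g(1)] by simp
      also have "\<dots> = \<zero>\<^bsub>Q\<^esub>" using zero closed(1)[OF X Z T g(1) \<xi>] by blast
      finally show False using l(2) by simp
    qed
  qed
qed

text \<open>The converse is the same theorem in the opposite bimodule, with \<open>Y\<close> and
  \<open>T\<close> exchanged.\<close>

theorem left_universal_iff_right_universal:
  assumes "Y \<in> Ob" "T \<in> Ob"
  shows "left_universal k Q Ob H Bi pb Y T \<theta> \<longleftrightarrow> right_universal k Q Ob H Bi po Y T \<theta>"
  using right_universal_imp_left_universal[OF assms]
    ext_bimodule.right_universal_imp_left_universal[OF ext_bimodule_op assms(2,1)] by blast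

end


section \<open>Quotients by ideals of morphisms\<close>

text \<open>Instantiated below both with the injectively and with the projectively trivial
  morphisms.\<close>

locale ideal_quotient = linear_cat k C
  for k :: "'r ring" and C :: "('r, 'o, 'm) lcat" +
  fixes J :: "'o \<Rightarrow> 'o \<Rightarrow> 'm set"
  assumes J_submodule: "X \<in> Obj C \<Longrightarrow> Y \<in> Obj C \<Longrightarrow> submodule (J X Y) k (Hom C X Y)"
    and J_left: "\<lbrakk>X \<in> Obj C; Y \<in> Obj C; f \<in> J X Y; hom g Y Z\<rbrakk> \<Longrightarrow> g \<bullet> f \<in> J X Z"
    and J_right: "\<lbrakk>Y \<in> Obj C; Z \<in> Obj C; g \<in> J Y Z; hom f X Y\<rbrakk> \<Longrightarrow> g \<bullet> f \<in> J X Z"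
begin

abbreviation qc :: "'m \<Rightarrow> 'm set" where "qc f \<equiv> quot_class C J f"

lemma quotient_module: "X \<in> Obj C \<Longrightarrow> Y \<in> Obj C \<Longrightarrow> quotient_module k (Hom C X Y) (J X Y)"
  by (simp add: quotient_module_def quotient_module_axioms_def hom_module J_submodule)

text \<open>\<open>quot_class\<close> takes no ends as arguments; disjointness of the Hom modules
  leaves only one pair of objects for \<open>f\<close>.\<close>

lemma qc_eq_coset:
  assumes "hom f X Y"
  shows "qc f = J X Y +>\<^bsub>Hom C X Y\<^esub> f"
proof -
  have "X' = X \<and> Y' = Y" if "X' \<in> Obj C" "Y' \<in> Obj C" "f \<in> Mor C X' Y'" for X' Y'
    using homI[OF that(3,1,2)] assms by simp
  moreover have "X \<in> Obj C" "Y \<in> Obj C" "f \<in> Mor C X Y" using assms hom_iff by blast+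
  ultimately show ?thesis unfolding quot_class_def by blast
qed

lemma Mor_quot:
  assumes "X \<in> Obj C" "Y \<in> Obj C"
  shows "Mor (quot_cat C J) X Y = {qc f | f. hom f X Y}"
proof -
  interpret quotient_module k "Hom C X Y" "J X Y" using assms by (rule quotient_module)
  have "Mor (quot_cat C J) X Y = (\<lambda>f. J X Y +>\<^bsub>Hom C X Y\<^esub> f) ` Mor C X Y"
    using carrier_quot by (simp add: quot_cat_def)
  also have "\<dots> = {qc f | f. hom f X Y}"
    using qc_eq_coset hom_iff assms by (auto simp: image_iff) metis+
  finally show ?thesis .
qed

lemma qc_eq_iff:
  assumes "hom f X Y" "hom g X Y"
  shows "qc f = qc g \<longleftrightarrow> f \<^bold>+ \<^bold>- g \<in> J X Y"
proof -
  have o: "X \<in> Obj C" "Y \<in> Obj C" and m: "f \<in> Mor C X Y" "g \<in> Mor C X Y" using assms hom_iff by blast+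
  interpret quotient_module k "Hom C X Y" "J X Y" using o by (rule quotient_module)
  show ?thesis
    using coset_eq_iff[OF m] qc_eq_coset[OF assms(1)] qc_eq_coset[OF assms(2)] assms
    by (simp add: plus_def neg_def)
qed

lemma mem_qcD:
  assumes "g \<in> qc f" "hom f X Y"
  shows "hom g X Y" "qc g = qc f"
proof -
  have o: "X \<in> Obj C" "Y \<in> Obj C" and m: "f \<in> Mor C X Y" using assms hom_iff by blast+
  interpret quotient_module k "Hom C X Y" "J X Y" using o by (rule quotient_module)
  have g: "g \<in> Mor C X Y" "g \<oplus>\<^bsub>Hom C X Y\<^esub> \<ominus>\<^bsub>Hom C X Y\<^esub> f \<in> J X Y"
    using assms(1) mem_coset_iff[OF m] qc_eq_coset[OF assms(2)] by auto
  show hg: "hom g X Y" using homI[OF g(1) o] .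
  show "qc g = qc f" using coset_eq_iff[OF g(1) m] g(2) qc_eq_coset[OF hg] qc_eq_coset[OF assms(2)] by simp
qed

lemma self_in_qc:
  assumes "hom f X Y"
  shows "f \<in> qc f"
proof -
  have o: "X \<in> Obj C" "Y \<in> Obj C" and m: "f \<in> Mor C X Y" using assms hom_iff by blast+
  interpret quotient_module k "Hom C X Y" "J X Y" using o by (rule quotient_module)
  show ?thesis using coset_self[OF m] qc_eq_coset[OF assms] by simp
qed

text \<open>Composition in \<open>quot_cat\<close> is a union over all representatives. It is a
  union of equal classes because \<open>g' f' - g f = (g' - g) f' + g (f' - f)\<close> lies in the
  ideal.\<close>

lemma qc_comp:
  assumes f: "hom f X Y" and g: "hom g Y Z"
  shows "qc g \<cdot>\<^bsub>quot_cat C J\<^esub> qc f = qc (g \<bullet> f)"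
proof -
  have o: "X \<in> Obj C" "Y \<in> Obj C" "Z \<in> Obj C" using f g hom_iff by blast+
  have "qc (g' \<bullet> f') = qc (g \<bullet> f)" if "g' \<in> qc g" "f' \<in> qc f" for g' f'
  proof -
    note g' = mem_qcD[OF that(1) g] and f' = mem_qcD[OF that(2) f]
    have "g' \<^bold>+ \<^bold>- g \<in> J Y Z" "f' \<^bold>+ \<^bold>- f \<in> J X Y"
      using qc_eq_iff[OF g'(1) g] g'(2) qc_eq_iff[OF f'(1) f] f'(2) by auto
    then have "(g' \<^bold>+ \<^bold>- g) \<bullet> f' \<in> J X Z" "g \<bullet> (f' \<^bold>+ \<^bold>- f) \<in> J X Z"
      using J_right[OF o(2,3) _ f'(1)] J_left[OF o(1,2) _ g] by auto
    then have "(g' \<^bold>+ \<^bold>- g) \<bullet> f' \<oplus>\<^bsub>Hom C X Z\<^esub> g \<bullet> (f' \<^bold>+ \<^bold>- f) \<in> J X Z"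
      using module.submodule_memD(3)[OF hom_module J_submodule] o by blast
    moreover have "(g' \<^bold>+ \<^bold>- g) \<bullet> f' \<oplus>\<^bsub>Hom C X Z\<^esub> g \<bullet> (f' \<^bold>+ \<^bold>- f) = g' \<bullet> f' \<^bold>+ \<^bold>- (g \<bullet> f)"
    proof -
      have "(g' \<^bold>+ \<^bold>- g) \<bullet> f' \<oplus>\<^bsub>Hom C X Z\<^esub> g \<bullet> (f' \<^bold>+ \<^bold>- f) = (g' \<^bold>+ \<^bold>- g) \<bullet> f' \<^bold>+ g \<bullet> (f' \<^bold>+ \<^bold>- f)"
        using f g f'(1) g'(1) unfolding plus_def[of "(g' \<^bold>+ \<^bold>- g) \<bullet> f'"] by simp
      also have "\<dots> = g' \<bullet> f' \<^bold>+ \<^bold>- (g \<bullet> f)"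
        using f g f'(1) g'(1) by (simp add: plus_assoc plus_neg_cancel)
      finally show ?thesis .
    qed
    ultimately show ?thesis
      using qc_eq_iff[of "g' \<bullet> f'" X Z "g \<bullet> f"] f g f'(1) g'(1) by simp
  qed
  then have "(\<Union>g'\<in>qc g. \<Union>f'\<in>qc f. qc (g' \<bullet> f')) = (\<Union>g'\<in>qc g. \<Union>f'\<in>qc f. qc (g \<bullet> f))" by simp
  also have "\<dots> = qc (g \<bullet> f)" using self_in_qc[OF f] self_in_qc[OF g] by blast
  finally show ?thesis by (simp add: quot_cat_def comp_def)
qed

lemma
  assumes "X \<in> Obj C" "Y \<in> Obj C"
  shows qc_add: "hom f X Y \<Longrightarrow> hom g X Y \<Longrightarrow> qc f \<oplus>\<^bsub>Hom (quot_cat C J) X Y\<^esub> qc g = qc (f \<^bold>+ g)"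
    and qc_smult: "hom f X Y \<Longrightarrow> a \<in> carrier k \<Longrightarrow> a \<odot>\<^bsub>Hom (quot_cat C J) X Y\<^esub> qc f = qc (a \<^bold>* f)"
proof -
  interpret quotient_module k "Hom C X Y" "J X Y" using assms by (rule quotient_module)
  show "qc f \<oplus>\<^bsub>Hom (quot_cat C J) X Y\<^esub> qc g = qc (f \<^bold>+ g)" if h: "hom f X Y" "hom g X Y"
  proof -
    have m: "f \<in> Mor C X Y" "g \<in> Mor C X Y" using h hom_iff by blast+
    have "hom (f \<^bold>+ g) X Y" using h by simp
    from qc_eq_coset[OF this] show ?thesis
      using add_quot[OF m] qc_eq_coset[OF h(1)] qc_eq_coset[OF h(2)] h by (simp add: quot_cat_def plus_def)
  qed
  show "a \<odot>\<^bsub>Hom (quot_cat C J) X Y\<^esub> qc f = qc (a \<^bold>* f)" if h: "hom f X Y" "a \<in> carrier k"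
  proof -
    have m: "f \<in> Mor C X Y" using h hom_iff by blast
    have "hom (a \<^bold>* f) X Y" using h by simp
    from qc_eq_coset[OF this] show ?thesis
      using smult_quot[OF h(2) m] qc_eq_coset[OF h(1)] h by (simp add: quot_cat_def scal_def)
  qed
qed

lemma quot_cat_sel [simp]: "Obj (quot_cat C J) = Obj C" "Idt (quot_cat C J) X = qc (Id X)"
  by (simp_all add: quot_cat_def)

end

section \<open>The stable categories\<close>

lemma (in module) diff_zero_iff:
  assumes "x \<in> carrier M" "y \<in> carrier M"
  shows "x \<oplus>\<^bsub>M\<^esub> \<ominus>\<^bsub>M\<^esub> y = \<zero>\<^bsub>M\<^esub> \<longleftrightarrow> x = y"
  using assms by (metis M.add.inv_closed M.minus_equality M.minus_minus M.r_neg)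

locale ar_setting = exact_cat k C E + matlis k Q
  for k :: "'r ring" and Q :: "('r, 'q) module" and C :: "('r, 'o, 'm) lcat" and E :: "('m \<times> 'm) set" +
  assumes hom_finite: "hom_finite k C"

context exact_cat
begin

abbreviation Ex :: "'o \<Rightarrow> 'o \<Rightarrow> ('r, ('m \<times> 'm) set) module" where "Ex \<equiv> Ext C E"
abbreviation po :: "'m \<Rightarrow> ('m \<times> 'm) set \<Rightarrow> ('m \<times> 'm) set" where "po \<equiv> ext_po C E"
abbreviation pb :: "'m \<Rightarrow> ('m \<times> 'm) set \<Rightarrow> ('m \<times> 'm) set" where "pb \<equiv> ext_pb C E"

lemma hom_MorI: "hom f X Y \<Longrightarrow> f \<in> Mor C X Y"
  by (simp add: hom_iff)

end

context exact_cat
begin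

section \<open>The injectively stable category and right universal functionals\<close>

lemma po_diff:
  assumes "hom f Y Y'" "hom g Y Y'" "\<xi> \<in> carrier (Ex X Y)" "X \<in> Obj C"
  shows "po (f \<^bold>+ \<^bold>- g) \<xi> = \<zero>\<^bsub>Ex X Y'\<^esub> \<longleftrightarrow> po f \<xi> = po g \<xi>"
    and "po (zr Y Y') \<xi> = \<zero>\<^bsub>Ex X Y'\<^esub>"
proof -
  have o: "Y \<in> Obj C" "Y' \<in> Obj C" using assms hom_iff by blast+
  have m: "f \<in> Mor C Y Y'" "g \<in> Mor C Y Y'" using assms hom_iff by blast+
  interpret N: module k "Ex X Y'" by (rule module_Ext[OF assms(4) o(2)])
  interpret M: module k "Hom C Y Y'" by (rule hom_module[OF o])
  note lin = ext_po_linear'[OF assms(3) o(2)]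
  have "po (f \<^bold>+ \<^bold>- g) \<xi> = po f \<xi> \<oplus>\<^bsub>Ex X Y'\<^esub> \<ominus>\<^bsub>Ex X Y'\<^esub> po g \<xi>"
    using linear_map_add[OF lin m(1) M.M.a_inv_closed[OF m(2)]]
      linear_map_neg[OF M.module_axioms N.module_axioms lin m(2)] assms by (simp only: plus_def neg_def)
  then show "po (f \<^bold>+ \<^bold>- g) \<xi> = \<zero>\<^bsub>Ex X Y'\<^esub> \<longleftrightarrow> po f \<xi> = po g \<xi>"
    using N.diff_zero_iff linear_map_closed[OF lin m(1)] linear_map_closed[OF lin m(2)] by metis
  show "po (zr Y Y') \<xi> = \<zero>\<^bsub>Ex X Y'\<^esub>"
    using linear_map_zero[OF M.module_axioms N.module_axioms lin] .
qed

lemma po_zero_class: "X \<in> Obj C \<Longrightarrow> hom g Y Y' \<Longrightarrow> po g \<zero>\<^bsub>Ex X Y\<^esub> = \<zero>\<^bsub>Ex X Y'\<^esub>"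
  using linear_map_zero[OF module_Ext module_Ext ext_po_linear] hom_iff by blast

lemma inj_trivial_iff: "f \<in> inj_trivial C E Y Y' \<longleftrightarrow>
    f \<in> Mor C Y Y' \<and> (\<forall>X\<in>Obj C. \<forall>\<xi>\<in>carrier (Ex X Y). po f \<xi> = \<zero>\<^bsub>Ex X Y'\<^esub>)"
  unfolding inj_trivial_def by blast

text \<open>Linearity of \<open>po g \<xi>\<close> in \<open>g\<close> makes the trivial morphisms
  submodules; functoriality of \<open>po\<close> makes them an ideal.\<close>

lemma inj_quotient: "ideal_quotient k C (inj_trivial C E)"
proof (intro ideal_quotient.intro ideal_quotient_axioms.intro linear_cat_axioms)
  fix X Y assume o: "X \<in> Obj C" "Y \<in> Obj C"
  interpret M: module k "Hom C X Y" by (rule hom_module[OF o])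
  show "submodule (inj_trivial C E X Y) k (Hom C X Y)"
  proof (rule M.submoduleI')
    show "\<zero>\<^bsub>Hom C X Y\<^esub> \<in> inj_trivial C E X Y"
      unfolding inj_trivial_iff using po_diff(2)[of "zr X Y" X Y "zr X Y"] o by (auto intro: hom_MorI)
  next
    fix f g assume fg: "f \<in> inj_trivial C E X Y" "g \<in> inj_trivial C E X Y"
    then have m: "f \<in> Mor C X Y" "g \<in> Mor C X Y" by (simp_all add: inj_trivial_iff)
    have "po (f \<oplus>\<^bsub>Hom C X Y\<^esub> g) \<xi> = \<zero>\<^bsub>Ex Z Y\<^esub>" if "Z \<in> Obj C" "\<xi> \<in> carrier (Ex Z X)" for Z \<xi>
    proof -
      interpret N: module k "Ex Z Y" by (rule module_Ext[OF that(1) o(2)])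
      have "po f \<xi> = \<zero>\<^bsub>Ex Z Y\<^esub>" "po g \<xi> = \<zero>\<^bsub>Ex Z Y\<^esub>" using fg that by (auto simp only: inj_trivial_iff)
      then show ?thesis
        using linear_map_add[OF ext_po_linear'[OF that(2) o(2)] m] N.M.l_zero[OF N.M.zero_closed] by metis
    qed
    then show "f \<oplus>\<^bsub>Hom C X Y\<^esub> g \<in> inj_trivial C E X Y"
      using m by (simp only: inj_trivial_iff M.M.a_closed) blast
  next
    fix a f assume a: "a \<in> carrier k" and f: "f \<in> inj_trivial C E X Y"
    then have m: "f \<in> Mor C X Y" by (simp add: inj_trivial_iff)
    have "po (a \<odot>\<^bsub>Hom C X Y\<^esub> f) \<xi> = \<zero>\<^bsub>Ex Z Y\<^esub>" if "Z \<in> Obj C" "\<xi> \<in> carrier (Ex Z X)" for Z \<xi>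
    proof -
      interpret N: module k "Ex Z Y" by (rule module_Ext[OF that(1) o(2)])
      have "po f \<xi> = \<zero>\<^bsub>Ex Z Y\<^esub>" using f that by (auto simp only: inj_trivial_iff)
      then show ?thesis
        using linear_map_smult[OF ext_po_linear'[OF that(2) o(2)] a m] N.smult_r_null[OF a] by metis
    qed
    then show "a \<odot>\<^bsub>Hom C X Y\<^esub> f \<in> inj_trivial C E X Y"
      using m a by (simp only: inj_trivial_iff M.smult_closed) blast
  qed (auto simp: inj_trivial_iff)
next
  fix X Y Z f g assume o: "X \<in> Obj C" "Y \<in> Obj C" and f: "f \<in> inj_trivial C E X Y" and g: "hom g Y Z"
  have hf: "hom f X Y" by (rule homI) (use f o in \<open>simp_all add: inj_trivial_iff\<close>)
  have "po (g \<bullet> f) \<xi> = \<zero>\<^bsub>Ex W Z\<^esub>" if W: "W \<in> Obj C" and \<xi>: "\<xi> \<in> carrier (Ex W X)" for W \<xi>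
  proof -
    have "po f \<xi> = \<zero>\<^bsub>Ex W Y\<^esub>" using f W \<xi> unfolding inj_trivial_iff by blast
    then show ?thesis using ext_po_comp[OF \<xi> hf g] po_zero_class[OF W g] by metis
  qed
  then show "g \<bullet> f \<in> inj_trivial C E X Z" unfolding inj_trivial_iff using hf g by (auto intro: hom_MorI)
next
  fix Y Z X f g assume o: "Y \<in> Obj C" "Z \<in> Obj C" and g: "g \<in> inj_trivial C E Y Z" and f: "hom f X Y"
  have hg: "hom g Y Z" by (rule homI) (use g o in \<open>simp_all add: inj_trivial_iff\<close>)
  have "po (g \<bullet> f) \<xi> = \<zero>\<^bsub>Ex W Z\<^esub>" if W: "W \<in> Obj C" and \<xi>: "\<xi> \<in> carrier (Ex W X)" for W \<xi>
  proof -
    have "po g (po f \<xi>) = \<zero>\<^bsub>Ex W Z\<^esub>" using g W ext_po_closed[OF \<xi> f] unfolding inj_trivial_iff by blast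
    then show ?thesis using ext_po_comp[OF \<xi> f hg] by metis
  qed
  then show "g \<bullet> f \<in> inj_trivial C E X Z" unfolding inj_trivial_iff using hg f by (auto intro: hom_MorI)
qed

end

sublocale exact_cat \<subseteq> I: ideal_quotient k C "inj_trivial C E"
  by (rule inj_quotient)

context exact_cat
begin

text \<open>Equality in the injectively stable category is equality of the actions on Ext; stable
  morphisms are compared through representatives by this criterion.\<close>

lemma I_eq_iff:
  assumes "hom f Y Y'" "hom g Y Y'"
  shows "I.qc f = I.qc g \<longleftrightarrow> (\<forall>X\<in>Obj C. \<forall>\<xi>\<in>carrier (Ex X Y). po f \<xi> = po g \<xi>)"
proof -
  have "hom (f \<^bold>+ \<^bold>- g) Y Y'" using assms by simp
  then show ?thesis
    unfolding I.qc_eq_iff[OF assms] inj_trivial_iff using po_diff(1)[OF assms] hom_MorI by blast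
qed

lemma Mor_inj_stable: "X \<in> Obj C \<Longrightarrow> Y \<in> Obj C \<Longrightarrow> Mor (inj_stable C E) X Y = {I.qc f | f. hom f X Y}"
  unfolding inj_stable_def by (rule I.Mor_quot)

lemma inj_stable_comp: "hom f X Y \<Longrightarrow> hom g Y Z \<Longrightarrow> I.qc g \<cdot>\<^bsub>inj_stable C E\<^esub> I.qc f = I.qc (g \<bullet> f)"
  unfolding inj_stable_def by (rule I.qc_comp)

lemma inj_stable_sel [simp]: "Obj (inj_stable C E) = Obj C" "Idt (inj_stable C E) X = I.qc (Id X)"
  unfolding inj_stable_def by simp_all

end

context ar_setting
begin

abbreviation r_univ :: "'o \<Rightarrow> 'o \<Rightarrow> (('m \<times> 'm) set \<Rightarrow> 'q) \<Rightarrow> bool" where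
  "r_univ \<equiv> right_universal k Q (Obj C) (Hom C) Ex po"

text \<open>Yoneda's lemma: naturality, applied to the identity class of \<open>T\<close>, expresses
  \<open>\<phi>\<close> through the one functional \<open>\<phi> T (I.qc (Id T))\<close>.
  Surjectivity and injectivity of \<open>\<phi>\<close> then become the two halves of
  universality.\<close>

lemma represents_r_universal:
  assumes rep: "represents_r k Q C E Y T \<phi>" and Y: "Y \<in> Obj C"
  shows "hom g M T \<Longrightarrow> \<phi> M (I.qc g) = (\<lambda>\<xi>\<in>carrier (Ex Y M). \<phi> T (I.qc (Id T)) (po g \<xi>))"
    and "r_univ Y T (\<phi> T (I.qc (Id T)))"
    and "\<phi> T (I.qc (Id T)) \<in> extensional (carrier (Ex Y T))"
proof -
  define \<theta> where "\<theta> = \<phi> T (I.qc (Id T))"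
  have T: "T \<in> Obj C" using rep by (simp add: represents_r_def)
  have iso: "linear_iso k (Hom (inj_stable C E) M T) (dual k Q (Ex Y M)) (\<phi> M)" if "M \<in> Obj C" for M
    using rep that by (simp add: represents_r_def)
  have nat: "\<phi> M (U \<cdot>\<^bsub>inj_stable C E\<^esub> I.qc g) = dual_map (Ex Y M) (po g) (\<phi> N U)"
    if "M \<in> Obj C" "N \<in> Obj C" "g \<in> Mor C M N" "U \<in> Mor (inj_stable C E) N T" for M N g U
    using rep that by (simp add: represents_r_def)
  have bij: "bij_betw (\<phi> M) {I.qc f | f. hom f M T} {l \<in> extensional (carrier (Ex Y M)). linear_map k (Ex Y M) Q l}"
    if "M \<in> Obj C" for M
    using iso[OF that] Mor_inj_stable[OF that T] by (simp add: linear_iso_def dual_def)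
  have hI: "hom (Id T) T T" using T by simp
  have formula: "\<phi> M (I.qc g) = (\<lambda>\<xi>\<in>carrier (Ex Y M). \<theta> (po g \<xi>))" if g: "hom g M T" for g M
  proof -
    have "I.qc (Id T) \<in> Mor (inj_stable C E) T T" using Mor_inj_stable[OF T T] hI by blast
    moreover have "M \<in> Obj C" "g \<in> Mor C M T" using g hom_iff by blast+
    ultimately have "\<phi> M (I.qc (Id T) \<cdot>\<^bsub>inj_stable C E\<^esub> I.qc g) = dual_map (Ex Y M) (po g) \<theta>"
      using nat T unfolding \<theta>_def by blast
    moreover have "Id T \<bullet> g = g" using g by simp
    ultimately show ?thesis using inj_stable_comp[OF g hI] by (simp add: dual_map_def)
  qed
  have \<theta>: "\<theta> \<in> extensional (carrier (Ex Y T))" "linear_map k (Ex Y T) Q \<theta>"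
    using bij_betwE[OF bij[OF T]] hI unfolding \<theta>_def by blast+
  have \<theta>0: "\<theta> \<zero>\<^bsub>Ex Y T\<^esub> = \<zero>\<^bsub>Q\<^esub>"
    by (rule linear_map_zero[OF module_Ext[OF Y T] Q.module_axioms \<theta>(2)])
  have "r_univ Y T \<theta>"
    unfolding right_universal_def
  proof (intro conjI ballI allI impI \<theta>(2))
    fix M l assume M: "M \<in> Obj C" and l: "linear_map k (Ex Y M) Q l"
    \<comment> \<open>Elements of \<open>dual\<close> are extensional, so a functional is cut down
      to the carrier before surjectivity of \<open>\<phi>\<close> is applied to it.\<close>
    have "restrict l (carrier (Ex Y M)) \<in> {l \<in> extensional (carrier (Ex Y M)). linear_map k (Ex Y M) Q l}"
      using linear_map_cong[OF module_Ext[OF Y M] l, of "restrict l (carrier (Ex Y M))"] by simp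
    then obtain g where g: "hom g M T" "\<phi> M (I.qc g) = restrict l (carrier (Ex Y M))"
      using bij_betw_imp_surj_on[OF bij[OF M]] by (smt (verit) imageE mem_Collect_eq)
    have "l \<xi> = \<theta> (po g \<xi>)" if "\<xi> \<in> carrier (Ex Y M)" for \<xi>
      using fun_cong[OF g(2), of \<xi>] formula[OF g(1)] that by simp
    then show "\<exists>g\<in>carrier (Hom C M T). \<forall>\<xi>\<in>carrier (Ex Y M). l \<xi> = \<theta> (po g \<xi>)"
      using hom_MorI[OF g(1)] by blast
  next
    fix M g X \<xi> assume M: "M \<in> Obj C" and g: "g \<in> Mor C M T"
      and z: "\<forall>\<xi>\<in>carrier (Ex Y M). \<theta> (po g \<xi>) = \<zero>\<^bsub>Q\<^esub>" and X: "X \<in> Obj C" and \<xi>: "\<xi> \<in> carrier (Ex X M)"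
    have hg: "hom g M T" using homI[OF g M T] .
    have hz: "hom (zr M T) M T" using M T by simp
    have "\<phi> M (I.qc g) = \<phi> M (I.qc (zr M T))"
      unfolding formula[OF hg] formula[OF hz]
      using z \<theta>0 po_diff(2)[OF hg hg _ Y] by (intro restrict_ext) metis
    then have "I.qc g = I.qc (zr M T)"
      using bij_betw_imp_inj_on[OF bij[OF M]] hg hz by (auto dest: inj_onD)
    then show "po g \<xi> = \<zero>\<^bsub>Ex X T\<^esub>"
      using I_eq_iff[OF hg hz] po_diff(2)[OF hg hg \<xi> X] X \<xi> by metis
  qed
  then show "r_univ Y T (\<phi> T (I.qc (Id T)))" "\<phi> T (I.qc (Id T)) \<in> extensional (carrier (Ex Y T))"
    "hom g M T \<Longrightarrow> \<phi> M (I.qc g) = (\<lambda>\<xi>\<in>carrier (Ex Y M). \<phi> T (I.qc (Id T)) (po g \<xi>))"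
    using \<theta>(1) formula[of g M] unfolding \<theta>_def by blast+
qed

text \<open>The functional vanishes along \<open>f - g\<close>, which is therefore injectively
  trivial by universality. Later identities between injectively stable morphisms rest on this
  test.\<close>

lemma r_univ_eqI:
  assumes Y: "Y \<in> Obj C" and U: "r_univ Y T \<theta>" and f: "hom f M T" and g: "hom g M T"
    and eq: "\<And>\<xi>. \<xi> \<in> carrier (Ex Y M) \<Longrightarrow> \<theta> (po f \<xi>) = \<theta> (po g \<xi>)"
  shows "I.qc f = I.qc g"
  unfolding I_eq_iff[OF f g]
proof (intro ballI)
  fix X \<xi> assume X: "X \<in> Obj C" and \<xi>: "\<xi> \<in> carrier (Ex X M)"
  have o: "M \<in> Obj C" "T \<in> Obj C" using f by auto
  have h: "hom (f \<^bold>+ \<^bold>- g) M T" using f g by simp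
  have "\<theta> (po (f \<^bold>+ \<^bold>- g) \<zeta>) = \<zero>\<^bsub>Q\<^esub>" if \<zeta>: "\<zeta> \<in> carrier (Ex Y M)" for \<zeta>
  proof -
    interpret M: module k "Hom C M T" by (rule hom_module[OF o])
    have m: "f \<in> Mor C M T" "g \<in> Mor C M T" using hom_MorI f g by blast+
    note lin = linear_map_comp[OF ext_po_linear'[OF \<zeta> o(2)] right_universalD(1)[OF U]]
    have "\<theta> (po (f \<^bold>+ \<^bold>- g) \<zeta>) = \<theta> (po f \<zeta>) \<oplus>\<^bsub>Q\<^esub> \<ominus>\<^bsub>Q\<^esub> \<theta> (po g \<zeta>)"
      using linear_map_add[OF lin m(1) M.M.a_inv_closed[OF m(2)]]
        linear_map_neg[OF M.module_axioms Q.module_axioms lin m(2)] f g by (simp only: plus_def neg_def)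
    then show ?thesis using eq[OF \<zeta>] linear_map_closed[OF lin m(2)] Q.M.r_neg by metis
  qed
  then have "po (f \<^bold>+ \<^bold>- g) \<xi> = \<zero>\<^bsub>Ex X T\<^esub>"
    by (rule right_universalD(3)[OF U o(1) hom_MorI[OF h] _ X \<xi>])
  then show "po f \<xi> = po g \<xi>" using po_diff(1)[OF f g \<xi> X] by blast
qed

text \<open>Converse of \<open>represents_r_universal\<close>. A class is evaluated at an
  arbitrarily chosen representative, and \<open>formula\<close> shows that the choice is
  immaterial.\<close>

lemma universal_represents_r:
  assumes Y: "Y \<in> Obj C" and T: "T \<in> Obj C" and U: "r_univ Y T \<theta>"
  shows "\<exists>\<phi>. represents_r k Q C E Y T \<phi>"
proof -
  define \<phi> where "\<phi> M V = (\<lambda>\<xi>\<in>carrier (Ex Y M). \<theta> (po (SOME g. g \<in> V) \<xi>))" for M V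
  have formula: "\<phi> M (I.qc g) = (\<lambda>\<xi>\<in>carrier (Ex Y M). \<theta> (po g \<xi>))" if g: "hom g M T" for M g
  proof -
    have "(SOME g'. g' \<in> I.qc g) \<in> I.qc g" using I.self_in_qc[OF g] by (rule someI)
    note * = I.mem_qcD[OF this g]
    have "po (SOME g'. g' \<in> I.qc g) \<xi> = po g \<xi>" if "\<xi> \<in> carrier (Ex Y M)" for \<xi>
      using I_eq_iff[OF *(1) g] *(2) that Y by blast
    then show ?thesis unfolding \<phi>_def by (intro restrict_ext) simp
  qed
  have lin: "linear_map k (Hom C M T) Q (\<lambda>g. \<theta> (po g \<xi>))" if "\<xi> \<in> carrier (Ex Y M)" for M \<xi>
    by (rule linear_map_comp[OF ext_po_linear'[OF that T] right_universalD(1)[OF U]])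
  have dual: "carrier (dual k Q (Ex Y M)) = {l \<in> extensional (carrier (Ex Y M)). linear_map k (Ex Y M) Q l}" for M
    by (simp add: dual_def)
  have "linear_iso k (Hom (inj_stable C E) M T) (dual k Q (Ex Y M)) (\<phi> M)" if M: "M \<in> Obj C" for M
  proof -
    have closed: "\<phi> M (I.qc g) \<in> carrier (dual k Q (Ex Y M))" if g: "hom g M T" for g
      unfolding formula[OF g] dual
      using linear_map_cong[OF module_Ext[OF Y M]
          linear_map_comp[OF ext_po_linear[OF Y g] right_universalD(1)[OF U]],
          of "\<lambda>\<xi>\<in>carrier (Ex Y M). \<theta> (po g \<xi>)"] by simp
    have "linear_map k (Hom (inj_stable C E) M T) (dual k Q (Ex Y M)) (\<phi> M)"
    proof (rule linear_mapI)
      fix V assume "V \<in> Mor (inj_stable C E) M T"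
      then obtain f where f: "hom f M T" "V = I.qc f" using Mor_inj_stable[OF M T] by blast
      then show "\<phi> M V \<in> carrier (dual k Q (Ex Y M))" using closed by simp
      {
        fix W assume "W \<in> Mor (inj_stable C E) M T"
        then obtain g where g: "hom g M T" "W = I.qc g" using Mor_inj_stable[OF M T] by blast
        have h: "hom (f \<^bold>+ g) M T" using f g by simp
        have "\<theta> (po (f \<^bold>+ g) \<xi>) = \<theta> (po f \<xi>) \<oplus>\<^bsub>Q\<^esub> \<theta> (po g \<xi>)" if "\<xi> \<in> carrier (Ex Y M)" for \<xi>
          using linear_map_add[OF lin[OF that] hom_MorI[OF f(1)] hom_MorI[OF g(1)]] f by (simp add: plus_def)
        then show "\<phi> M (V \<oplus>\<^bsub>Hom (inj_stable C E) M T\<^esub> W) = \<phi> M V \<oplus>\<^bsub>dual k Q (Ex Y M)\<^esub> \<phi> M W"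
          using I.qc_add[OF M T f(1) g(1)] formula[OF f(1)] formula[OF g(1)] formula[OF h] f(2) g(2)
          by (auto simp: inj_stable_def dual_def intro!: restrict_ext)
      }
      fix a assume a: "a \<in> carrier k"
      have h: "hom (a \<^bold>* f) M T" using f a by simp
      have "\<theta> (po (a \<^bold>* f) \<xi>) = a \<odot>\<^bsub>Q\<^esub> \<theta> (po f \<xi>)" if "\<xi> \<in> carrier (Ex Y M)" for \<xi>
        using linear_map_smult[OF lin[OF that] a hom_MorI[OF f(1)]] f by (simp add: scal_def)
      then show "\<phi> M (a \<odot>\<^bsub>Hom (inj_stable C E) M T\<^esub> V) = a \<odot>\<^bsub>dual k Q (Ex Y M)\<^esub> \<phi> M V"
        using I.qc_smult[OF M T f(1) a] formula[OF f(1)] formula[OF h] f(2)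
        by (auto simp: inj_stable_def dual_def intro!: restrict_ext)
    qed
    moreover have "bij_betw (\<phi> M) (Mor (inj_stable C E) M T) (carrier (dual k Q (Ex Y M)))"
      unfolding Mor_inj_stable[OF M T]
    proof (rule bij_betwI')
      fix V W assume "V \<in> {I.qc f | f. hom f M T}" "W \<in> {I.qc f | f. hom f M T}"
      then obtain f g where f: "hom f M T" "V = I.qc f" and g: "hom g M T" "W = I.qc g" by blast
      have "V = W" if "\<phi> M V = \<phi> M W"
        unfolding f(2) g(2)
      proof (rule r_univ_eqI[OF Y U f(1) g(1)])
        show "\<theta> (po f \<xi>) = \<theta> (po g \<xi>)" if "\<xi> \<in> carrier (Ex Y M)" for \<xi>
          using fun_cong[OF \<open>\<phi> M V = \<phi> M W\<close>, of \<xi>] formula[OF f(1)] formula[OF g(1)] f(2) g(2) that by simp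
      qed
      then show "\<phi> M V = \<phi> M W \<longleftrightarrow> V = W" by blast
    next
      show "\<phi> M V \<in> carrier (dual k Q (Ex Y M))" if "V \<in> {I.qc f | f. hom f M T}" for V
        using that closed by blast
      fix l assume "l \<in> carrier (dual k Q (Ex Y M))"
      then have l: "l \<in> extensional (carrier (Ex Y M))" "linear_map k (Ex Y M) Q l" by (simp_all add: dual)
      obtain g where g: "g \<in> Mor C M T" "\<forall>\<xi>\<in>carrier (Ex Y M). l \<xi> = \<theta> (po g \<xi>)"
        using right_universalD(2)[OF U M l(2)] by blast
      have hg: "hom g M T" using homI[OF g(1) M T] .
      have "l = \<phi> M (I.qc g)"
        unfolding formula[OF hg] by (rule extensionalityI[OF l(1)]) (use g(2) in simp_all)
      then show "\<exists>V\<in>{I.qc f | f. hom f M T}. l = \<phi> M V" using hg by blast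
    qed
    ultimately show ?thesis by (simp add: linear_iso_def)
  qed
  moreover have "\<phi> M (V \<cdot>\<^bsub>inj_stable C E\<^esub> I.qc g) = dual_map (Ex Y M) (po g) (\<phi> N V)"
    if o: "M \<in> Obj C" "N \<in> Obj C" and g: "g \<in> Mor C M N" and V: "V \<in> Mor (inj_stable C E) N T" for M N g V
  proof -
    obtain f where f: "hom f N T" "V = I.qc f" using V Mor_inj_stable[OF o(2) T] by blast
    have hg: "hom g M N" using homI[OF g o] .
    have h: "hom (f \<bullet> g) M T" using f(1) hg by simp
    have "\<theta> (po (f \<bullet> g) \<xi>) = \<phi> N V (po g \<xi>)" if "\<xi> \<in> carrier (Ex Y M)" for \<xi>
      using ext_po_comp[OF that hg f(1)] ext_po_closed[OF that hg] formula[OF f(1)] f(2) by simp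
    then show ?thesis
      using inj_stable_comp[OF hg f(1)] formula[OF h] f(2) by (auto simp: dual_map_def intro!: restrict_ext)
  qed
  ultimately have "represents_r k Q C E Y T \<phi>" using T by (simp add: represents_r_def)
  then show ?thesis by (rule exI[of _ \<phi>])
qed

end

context exact_cat
begin

section \<open>The projectively stable category and left universal functionals\<close>

lemma pb_diff:
  assumes "hom f Y' Y" "hom g Y' Y" "\<xi> \<in> carrier (Ex Y X)" "X \<in> Obj C"
  shows "pb (f \<^bold>+ \<^bold>- g) \<xi> = \<zero>\<^bsub>Ex Y' X\<^esub> \<longleftrightarrow> pb f \<xi> = pb g \<xi>"
    and "pb (zr Y' Y) \<xi> = \<zero>\<^bsub>Ex Y' X\<^esub>"
proof -
  have o: "Y \<in> Obj C" "Y' \<in> Obj C" using assms hom_iff by blast+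
  have m: "f \<in> Mor C Y' Y" "g \<in> Mor C Y' Y" using assms hom_iff by blast+
  interpret N: module k "Ex Y' X" by (rule module_Ext[OF o(2) assms(4)])
  interpret M: module k "Hom C Y' Y" by (rule hom_module[OF o(2,1)])
  note lin = ext_pb_linear'[OF assms(3) o(2)]
  have "pb (f \<^bold>+ \<^bold>- g) \<xi> = pb f \<xi> \<oplus>\<^bsub>Ex Y' X\<^esub> \<ominus>\<^bsub>Ex Y' X\<^esub> pb g \<xi>"
    using linear_map_add[OF lin m(1) M.M.a_inv_closed[OF m(2)]]
      linear_map_neg[OF M.module_axioms N.module_axioms lin m(2)] assms by (simp only: plus_def neg_def)
  then show "pb (f \<^bold>+ \<^bold>- g) \<xi> = \<zero>\<^bsub>Ex Y' X\<^esub> \<longleftrightarrow> pb f \<xi> = pb g \<xi>"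
    using N.diff_zero_iff linear_map_closed[OF lin m(1)] linear_map_closed[OF lin m(2)] by metis
  show "pb (zr Y' Y) \<xi> = \<zero>\<^bsub>Ex Y' X\<^esub>"
    using linear_map_zero[OF M.module_axioms N.module_axioms lin] .
qed

lemma pb_zero_class: "X \<in> Obj C \<Longrightarrow> hom g Y' Y \<Longrightarrow> pb g \<zero>\<^bsub>Ex Y X\<^esub> = \<zero>\<^bsub>Ex Y' X\<^esub>"
  using linear_map_zero[OF module_Ext module_Ext ext_pb_linear] hom_iff by blast

lemma proj_trivial_iff: "f \<in> proj_trivial C E Y' Y \<longleftrightarrow>
    f \<in> Mor C Y' Y \<and> (\<forall>X\<in>Obj C. \<forall>\<xi>\<in>carrier (Ex Y X). pb f \<xi> = \<zero>\<^bsub>Ex Y' X\<^esub>)"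
  unfolding proj_trivial_def by blast

lemma proj_quotient: "ideal_quotient k C (proj_trivial C E)"
proof (intro ideal_quotient.intro ideal_quotient_axioms.intro linear_cat_axioms)
  fix X Y assume o: "X \<in> Obj C" "Y \<in> Obj C"
  interpret M: module k "Hom C Y X" by (rule hom_module[OF o(2,1)])
  show "submodule (proj_trivial C E Y X) k (Hom C Y X)"
  proof (rule M.submoduleI')
    show "\<zero>\<^bsub>Hom C Y X\<^esub> \<in> proj_trivial C E Y X"
      unfolding proj_trivial_iff using pb_diff(2)[of "zr Y X" Y X "zr Y X"] o by (auto intro: hom_MorI)
  next
    fix f g assume fg: "f \<in> proj_trivial C E Y X" "g \<in> proj_trivial C E Y X"
    then have m: "f \<in> Mor C Y X" "g \<in> Mor C Y X" by (simp_all add: proj_trivial_iff)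
    have "pb (f \<oplus>\<^bsub>Hom C Y X\<^esub> g) \<xi> = \<zero>\<^bsub>Ex Y Z\<^esub>" if "Z \<in> Obj C" "\<xi> \<in> carrier (Ex X Z)" for Z \<xi>
    proof -
      interpret N: module k "Ex Y Z" by (rule module_Ext[OF o(2) that(1)])
      have "pb f \<xi> = \<zero>\<^bsub>Ex Y Z\<^esub>" "pb g \<xi> = \<zero>\<^bsub>Ex Y Z\<^esub>" using fg that by (auto simp only: proj_trivial_iff)
      then show ?thesis
        using linear_map_add[OF ext_pb_linear'[OF that(2) o(2)] m] N.M.l_zero[OF N.M.zero_closed] by metis
    qed
    then show "f \<oplus>\<^bsub>Hom C Y X\<^esub> g \<in> proj_trivial C E Y X"
      using m by (simp only: proj_trivial_iff M.M.a_closed) blast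
  next
    fix a f assume a: "a \<in> carrier k" and f: "f \<in> proj_trivial C E Y X"
    then have m: "f \<in> Mor C Y X" by (simp add: proj_trivial_iff)
    have "pb (a \<odot>\<^bsub>Hom C Y X\<^esub> f) \<xi> = \<zero>\<^bsub>Ex Y Z\<^esub>" if "Z \<in> Obj C" "\<xi> \<in> carrier (Ex X Z)" for Z \<xi>
    proof -
      interpret N: module k "Ex Y Z" by (rule module_Ext[OF o(2) that(1)])
      have "pb f \<xi> = \<zero>\<^bsub>Ex Y Z\<^esub>" using f that by (auto simp only: proj_trivial_iff)
      then show ?thesis
        using linear_map_smult[OF ext_pb_linear'[OF that(2) o(2)] a m] N.smult_r_null[OF a] by metis
    qed
    then show "a \<odot>\<^bsub>Hom C Y X\<^esub> f \<in> proj_trivial C E Y X"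
      using m a by (simp only: proj_trivial_iff M.smult_closed) blast
  qed (auto simp: proj_trivial_iff)
next
  fix X Y Z f g assume o: "X \<in> Obj C" "Y \<in> Obj C" and f: "f \<in> proj_trivial C E Y X" and g: "hom g Z Y"
  have hf: "hom f Y X" by (rule homI) (use f o in \<open>simp_all add: proj_trivial_iff\<close>)
  have "pb (f \<bullet> g) \<xi> = \<zero>\<^bsub>Ex Z W\<^esub>" if W: "W \<in> Obj C" and \<xi>: "\<xi> \<in> carrier (Ex X W)" for W \<xi>
  proof -
    have "pb f \<xi> = \<zero>\<^bsub>Ex Y W\<^esub>" using f W \<xi> unfolding proj_trivial_iff by blast
    then show ?thesis using ext_pb_comp[OF \<xi> hf g] pb_zero_class[OF W g] by metis
  qed
  then show "f \<bullet> g \<in> proj_trivial C E Z X" unfolding proj_trivial_iff using hf g by (auto intro: hom_MorI)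
next
  fix Y Z X f g assume o: "Y \<in> Obj C" "Z \<in> Obj C" and g: "g \<in> proj_trivial C E Z Y" and f: "hom f Y X"
  have hg: "hom g Z Y" by (rule homI) (use g o in \<open>simp_all add: proj_trivial_iff\<close>)
  have "pb (f \<bullet> g) \<xi> = \<zero>\<^bsub>Ex Z W\<^esub>" if W: "W \<in> Obj C" and \<xi>: "\<xi> \<in> carrier (Ex X W)" for W \<xi>
  proof -
    have "pb g (pb f \<xi>) = \<zero>\<^bsub>Ex Z W\<^esub>" using g W ext_pb_closed[OF \<xi> f] unfolding proj_trivial_iff by blast
    then show ?thesis using ext_pb_comp[OF \<xi> f hg] by metis
  qed
  then show "f \<bullet> g \<in> proj_trivial C E Z X" unfolding proj_trivial_iff using hg f by (auto intro: hom_MorI)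
qed

end

sublocale exact_cat \<subseteq> P: ideal_quotient k C "proj_trivial C E"
  by (rule proj_quotient)

context exact_cat
begin

lemma P_eq_iff:
  assumes "hom f Y' Y" "hom g Y' Y"
  shows "P.qc f = P.qc g \<longleftrightarrow> (\<forall>X\<in>Obj C. \<forall>\<xi>\<in>carrier (Ex Y X). pb f \<xi> = pb g \<xi>)"
proof -
  have "hom (f \<^bold>+ \<^bold>- g) Y' Y" using assms by simp
  then show ?thesis
    unfolding P.qc_eq_iff[OF assms] proj_trivial_iff using pb_diff(1)[OF assms] hom_MorI by blast
qed

lemma Mor_proj_stable: "X \<in> Obj C \<Longrightarrow> Y \<in> Obj C \<Longrightarrow> Mor (proj_stable C E) X Y = {P.qc f | f. hom f X Y}"
  unfolding proj_stable_def by (rule P.Mor_quot)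

lemma proj_stable_comp: "hom f X Y \<Longrightarrow> hom g Y Z \<Longrightarrow> P.qc g \<cdot>\<^bsub>proj_stable C E\<^esub> P.qc f = P.qc (g \<bullet> f)"
  unfolding proj_stable_def by (rule P.qc_comp)

lemma proj_stable_sel [simp]: "Obj (proj_stable C E) = Obj C" "Idt (proj_stable C E) X = P.qc (Id X)"
  unfolding proj_stable_def by simp_all

end

context ar_setting
begin

abbreviation l_univ :: "'o \<Rightarrow> 'o \<Rightarrow> (('m \<times> 'm) set \<Rightarrow> 'q) \<Rightarrow> bool" where
  "l_univ \<equiv> left_universal k Q (Obj C) (Hom C) Ex pb"

text \<open>Yoneda's lemma on the covariant side. Here \<open>Y\<close> is the second argument of
  Ext and \<open>T\<close> the corepresenting object, so the functional lives on
  \<open>Ext(T, Y)\<close> and \<open>l_univ\<close> takes its arguments in the order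
  \<open>T Y\<close>.\<close>

lemma represents_l_universal:
  assumes rep: "represents_l k Q C E Y T \<psi>" and Y: "Y \<in> Obj C"
  shows "hom g T M \<Longrightarrow> \<psi> M (P.qc g) = (\<lambda>\<xi>\<in>carrier (Ex M Y). \<psi> T (P.qc (Id T)) (pb g \<xi>))"
    and "l_univ T Y (\<psi> T (P.qc (Id T)))"
    and "\<psi> T (P.qc (Id T)) \<in> extensional (carrier (Ex T Y))"
proof -
  define \<kappa> where "\<kappa> = \<psi> T (P.qc (Id T))"
  have T: "T \<in> Obj C" using rep by (simp add: represents_l_def)
  have iso: "linear_iso k (Hom (proj_stable C E) T M) (dual k Q (Ex M Y)) (\<psi> M)" if "M \<in> Obj C" for M
    using rep that by (simp add: represents_l_def)
  have nat: "\<psi> M (P.qc g \<cdot>\<^bsub>proj_stable C E\<^esub> U) = dual_map (Ex M Y) (pb g) (\<psi> N U)"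
    if "M \<in> Obj C" "N \<in> Obj C" "g \<in> Mor C N M" "U \<in> Mor (proj_stable C E) T N" for M N g U
    using rep that by (simp add: represents_l_def)
  have bij: "bij_betw (\<psi> M) {P.qc f | f. hom f T M} {l \<in> extensional (carrier (Ex M Y)). linear_map k (Ex M Y) Q l}"
    if "M \<in> Obj C" for M
    using iso[OF that] Mor_proj_stable[OF T that] by (simp add: linear_iso_def dual_def)
  have hI: "hom (Id T) T T" using T by simp
  have formula: "\<psi> M (P.qc g) = (\<lambda>\<xi>\<in>carrier (Ex M Y). \<kappa> (pb g \<xi>))" if g: "hom g T M" for g M
  proof -
    have "P.qc (Id T) \<in> Mor (proj_stable C E) T T" using Mor_proj_stable[OF T T] hI by blast
    moreover have "M \<in> Obj C" "g \<in> Mor C T M" using g hom_iff by blast+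
    ultimately have "\<psi> M (P.qc g \<cdot>\<^bsub>proj_stable C E\<^esub> P.qc (Id T)) = dual_map (Ex M Y) (pb g) \<kappa>"
      using nat T unfolding \<kappa>_def by blast
    moreover have "g \<bullet> Id T = g" using g by simp
    ultimately show ?thesis using proj_stable_comp[OF hI g] by (simp add: dual_map_def)
  qed
  have \<kappa>: "\<kappa> \<in> extensional (carrier (Ex T Y))" "linear_map k (Ex T Y) Q \<kappa>"
    using bij_betwE[OF bij[OF T]] hI unfolding \<kappa>_def by blast+
  have \<kappa>0: "\<kappa> \<zero>\<^bsub>Ex T Y\<^esub> = \<zero>\<^bsub>Q\<^esub>"
    by (rule linear_map_zero[OF module_Ext[OF T Y] Q.module_axioms \<kappa>(2)])
  have "l_univ T Y \<kappa>"
    unfolding right_universal_def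
  proof (intro conjI ballI allI impI \<kappa>(2))
    fix M l assume M: "M \<in> Obj C" and l: "linear_map k (Ex M Y) Q l"
    have "restrict l (carrier (Ex M Y)) \<in> {l \<in> extensional (carrier (Ex M Y)). linear_map k (Ex M Y) Q l}"
      using linear_map_cong[OF module_Ext[OF M Y] l, of "restrict l (carrier (Ex M Y))"] by simp
    then obtain g where g: "hom g T M" "\<psi> M (P.qc g) = restrict l (carrier (Ex M Y))"
      using bij_betw_imp_surj_on[OF bij[OF M]] by (smt (verit) imageE mem_Collect_eq)
    have "l \<xi> = \<kappa> (pb g \<xi>)" if "\<xi> \<in> carrier (Ex M Y)" for \<xi>
      using fun_cong[OF g(2), of \<xi>] formula[OF g(1)] that by simp
    then show "\<exists>g\<in>carrier (Hom C T M). \<forall>\<xi>\<in>carrier (Ex M Y). l \<xi> = \<kappa> (pb g \<xi>)"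
      using hom_MorI[OF g(1)] by blast
  next
    fix M g X \<xi> assume M: "M \<in> Obj C" and g: "g \<in> Mor C T M"
      and z: "\<forall>\<xi>\<in>carrier (Ex M Y). \<kappa> (pb g \<xi>) = \<zero>\<^bsub>Q\<^esub>" and X: "X \<in> Obj C" and \<xi>: "\<xi> \<in> carrier (Ex M X)"
    have hg: "hom g T M" using homI[OF g T M] .
    have hz: "hom (zr T M) T M" using M T by simp
    have "\<psi> M (P.qc g) = \<psi> M (P.qc (zr T M))"
      unfolding formula[OF hg] formula[OF hz]
      using z \<kappa>0 pb_diff(2)[OF hg hg _ Y] by (intro restrict_ext) metis
    then have "P.qc g = P.qc (zr T M)"
      using bij_betw_imp_inj_on[OF bij[OF M]] hg hz by (auto dest: inj_onD)
    then show "pb g \<xi> = \<zero>\<^bsub>Ex T X\<^esub>"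
      using P_eq_iff[OF hg hz] pb_diff(2)[OF hg hg \<xi> X] X \<xi> by metis
  qed
  then show "l_univ T Y (\<psi> T (P.qc (Id T)))" "\<psi> T (P.qc (Id T)) \<in> extensional (carrier (Ex T Y))"
    "hom g T M \<Longrightarrow> \<psi> M (P.qc g) = (\<lambda>\<xi>\<in>carrier (Ex M Y). \<psi> T (P.qc (Id T)) (pb g \<xi>))"
    using \<kappa>(1) formula[of g M] unfolding \<kappa>_def by blast+
qed

lemma l_univ_eqI:
  assumes Y: "Y \<in> Obj C" and U: "l_univ T Y \<kappa>" and f: "hom f T M" and g: "hom g T M"
    and eq: "\<And>\<xi>. \<xi> \<in> carrier (Ex M Y) \<Longrightarrow> \<kappa> (pb f \<xi>) = \<kappa> (pb g \<xi>)"
  shows "P.qc f = P.qc g"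
  unfolding P_eq_iff[OF f g]
proof (intro ballI)
  fix X \<xi> assume X: "X \<in> Obj C" and \<xi>: "\<xi> \<in> carrier (Ex M X)"
  have o: "M \<in> Obj C" "T \<in> Obj C" using f by auto
  have h: "hom (f \<^bold>+ \<^bold>- g) T M" using f g by simp
  have "\<kappa> (pb (f \<^bold>+ \<^bold>- g) \<zeta>) = \<zero>\<^bsub>Q\<^esub>" if \<zeta>: "\<zeta> \<in> carrier (Ex M Y)" for \<zeta>
  proof -
    interpret M: module k "Hom C T M" by (rule hom_module[OF o(2,1)])
    have m: "f \<in> Mor C T M" "g \<in> Mor C T M" using hom_MorI f g by blast+
    note lin = linear_map_comp[OF ext_pb_linear'[OF \<zeta> o(2)] right_universalD(1)[OF U]]
    have "\<kappa> (pb (f \<^bold>+ \<^bold>- g) \<zeta>) = \<kappa> (pb f \<zeta>) \<oplus>\<^bsub>Q\<^esub> \<ominus>\<^bsub>Q\<^esub> \<kappa> (pb g \<zeta>)"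
      using linear_map_add[OF lin m(1) M.M.a_inv_closed[OF m(2)]]
        linear_map_neg[OF M.module_axioms Q.module_axioms lin m(2)] f g by (simp only: plus_def neg_def)
    then show ?thesis using eq[OF \<zeta>] linear_map_closed[OF lin m(2)] Q.M.r_neg by metis
  qed
  then have "pb (f \<^bold>+ \<^bold>- g) \<xi> = \<zero>\<^bsub>Ex T X\<^esub>"
    by (rule right_universalD(3)[OF U o(1) hom_MorI[OF h] _ X \<xi>])
  then show "pb f \<xi> = pb g \<xi>" using pb_diff(1)[OF f g \<xi> X] by blast
qed

lemma universal_represents_l:
  assumes Y: "Y \<in> Obj C" and T: "T \<in> Obj C" and U: "l_univ T Y \<kappa>"
  shows "\<exists>\<psi>. represents_l k Q C E Y T \<psi>"
proof -
  define \<psi> where "\<psi> M V = (\<lambda>\<xi>\<in>carrier (Ex M Y). \<kappa> (pb (SOME g. g \<in> V) \<xi>))" for M V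
  have formula: "\<psi> M (P.qc g) = (\<lambda>\<xi>\<in>carrier (Ex M Y). \<kappa> (pb g \<xi>))" if g: "hom g T M" for M g
  proof -
    have "(SOME g'. g' \<in> P.qc g) \<in> P.qc g" using P.self_in_qc[OF g] by (rule someI)
    note * = P.mem_qcD[OF this g]
    have "pb (SOME g'. g' \<in> P.qc g) \<xi> = pb g \<xi>" if "\<xi> \<in> carrier (Ex M Y)" for \<xi>
      using P_eq_iff[OF *(1) g] *(2) that Y by blast
    then show ?thesis unfolding \<psi>_def by (intro restrict_ext) simp
  qed
  have lin: "linear_map k (Hom C T M) Q (\<lambda>g. \<kappa> (pb g \<xi>))" if "\<xi> \<in> carrier (Ex M Y)" for M \<xi>
    by (rule linear_map_comp[OF ext_pb_linear'[OF that T] right_universalD(1)[OF U]])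
  have dual: "carrier (dual k Q (Ex M Y)) = {l \<in> extensional (carrier (Ex M Y)). linear_map k (Ex M Y) Q l}" for M
    by (simp add: dual_def)
  have "linear_iso k (Hom (proj_stable C E) T M) (dual k Q (Ex M Y)) (\<psi> M)" if M: "M \<in> Obj C" for M
  proof -
    have closed: "\<psi> M (P.qc g) \<in> carrier (dual k Q (Ex M Y))" if g: "hom g T M" for g
      unfolding formula[OF g] dual
      using linear_map_cong[OF module_Ext[OF M Y]
          linear_map_comp[OF ext_pb_linear[OF Y g] right_universalD(1)[OF U]],
          of "\<lambda>\<xi>\<in>carrier (Ex M Y). \<kappa> (pb g \<xi>)"] by simp
    have "linear_map k (Hom (proj_stable C E) T M) (dual k Q (Ex M Y)) (\<psi> M)"
    proof (rule linear_mapI)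
      fix V assume "V \<in> Mor (proj_stable C E) T M"
      then obtain f where f: "hom f T M" "V = P.qc f" using Mor_proj_stable[OF T M] by blast
      then show "\<psi> M V \<in> carrier (dual k Q (Ex M Y))" using closed by simp
      {
        fix W assume "W \<in> Mor (proj_stable C E) T M"
        then obtain g where g: "hom g T M" "W = P.qc g" using Mor_proj_stable[OF T M] by blast
        have h: "hom (f \<^bold>+ g) T M" using f g by simp
        have "\<kappa> (pb (f \<^bold>+ g) \<xi>) = \<kappa> (pb f \<xi>) \<oplus>\<^bsub>Q\<^esub> \<kappa> (pb g \<xi>)" if "\<xi> \<in> carrier (Ex M Y)" for \<xi>
          using linear_map_add[OF lin[OF that] hom_MorI[OF f(1)] hom_MorI[OF g(1)]] f by (simp add: plus_def)
        then show "\<psi> M (V \<oplus>\<^bsub>Hom (proj_stable C E) T M\<^esub> W) = \<psi> M V \<oplus>\<^bsub>dual k Q (Ex M Y)\<^esub> \<psi> M W"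
          using P.qc_add[OF T M f(1) g(1)] formula[OF f(1)] formula[OF g(1)] formula[OF h] f(2) g(2)
          by (auto simp: proj_stable_def dual_def intro!: restrict_ext)
      }
      fix a assume a: "a \<in> carrier k"
      have h: "hom (a \<^bold>* f) T M" using f a by simp
      have "\<kappa> (pb (a \<^bold>* f) \<xi>) = a \<odot>\<^bsub>Q\<^esub> \<kappa> (pb f \<xi>)" if "\<xi> \<in> carrier (Ex M Y)" for \<xi>
        using linear_map_smult[OF lin[OF that] a hom_MorI[OF f(1)]] f by (simp add: scal_def)
      then show "\<psi> M (a \<odot>\<^bsub>Hom (proj_stable C E) T M\<^esub> V) = a \<odot>\<^bsub>dual k Q (Ex M Y)\<^esub> \<psi> M V"
        using P.qc_smult[OF T M f(1) a] formula[OF f(1)] formula[OF h] f(2)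
        by (auto simp: proj_stable_def dual_def intro!: restrict_ext)
    qed
    moreover have "bij_betw (\<psi> M) (Mor (proj_stable C E) T M) (carrier (dual k Q (Ex M Y)))"
      unfolding Mor_proj_stable[OF T M]
    proof (rule bij_betwI')
      fix V W assume "V \<in> {P.qc f | f. hom f T M}" "W \<in> {P.qc f | f. hom f T M}"
      then obtain f g where f: "hom f T M" "V = P.qc f" and g: "hom g T M" "W = P.qc g" by blast
      have "V = W" if "\<psi> M V = \<psi> M W"
        unfolding f(2) g(2)
      proof (rule l_univ_eqI[OF Y U f(1) g(1)])
        show "\<kappa> (pb f \<xi>) = \<kappa> (pb g \<xi>)" if "\<xi> \<in> carrier (Ex M Y)" for \<xi>
          using fun_cong[OF \<open>\<psi> M V = \<psi> M W\<close>, of \<xi>] formula[OF f(1)] formula[OF g(1)] f(2) g(2) that by simp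
      qed
      then show "\<psi> M V = \<psi> M W \<longleftrightarrow> V = W" by blast
    next
      show "\<psi> M V \<in> carrier (dual k Q (Ex M Y))" if "V \<in> {P.qc f | f. hom f T M}" for V
        using that closed by blast
      fix l assume "l \<in> carrier (dual k Q (Ex M Y))"
      then have l: "l \<in> extensional (carrier (Ex M Y))" "linear_map k (Ex M Y) Q l" by (simp_all add: dual)
      obtain g where g: "g \<in> Mor C T M" "\<forall>\<xi>\<in>carrier (Ex M Y). l \<xi> = \<kappa> (pb g \<xi>)"
        using right_universalD(2)[OF U M l(2)] by blast
      have hg: "hom g T M" using homI[OF g(1) T M] .
      have "l = \<psi> M (P.qc g)"
        unfolding formula[OF hg] by (rule extensionalityI[OF l(1)]) (use g(2) in simp_all)
      then show "\<exists>V\<in>{P.qc f | f. hom f T M}. l = \<psi> M V" using hg by blast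
    qed
    ultimately show ?thesis by (simp add: linear_iso_def)
  qed
  moreover have "\<psi> M (P.qc g \<cdot>\<^bsub>proj_stable C E\<^esub> V) = dual_map (Ex M Y) (pb g) (\<psi> N V)"
    if o: "M \<in> Obj C" "N \<in> Obj C" and g: "g \<in> Mor C N M" and V: "V \<in> Mor (proj_stable C E) T N" for M N g V
  proof -
    obtain f where f: "hom f T N" "V = P.qc f" using V Mor_proj_stable[OF T o(2)] by blast
    have hg: "hom g N M" using homI[OF g o(2,1)] .
    have h: "hom (g \<bullet> f) T M" using f(1) hg by simp
    have "\<kappa> (pb (g \<bullet> f) \<xi>) = \<psi> N V (pb g \<xi>)" if "\<xi> \<in> carrier (Ex M Y)" for \<xi>
      using ext_pb_comp[OF that hg f(1)] ext_pb_closed[OF that hg] formula[OF f(1)] f(2) by simp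
    then show ?thesis
      using proj_stable_comp[OF f(1) hg] formula[OF h] f(2) by (auto simp: dual_map_def intro!: restrict_ext)
  qed
  ultimately have "represents_l k Q C E Y T \<psi>" using T by (simp add: represents_l_def)
  then show ?thesis by (rule exI[of _ \<psi>])
qed

end

section \<open>The Auslander-Reiten translations\<close>

lemma is_functor_comp:
  "is_functor A B F \<Longrightarrow> is_functor B D G \<Longrightarrow> is_functor A D (comp_functor G F)"
  by (simp add: is_functor_def comp_functor_def)

lemma is_functor_id: "is_functor A A id_functor"
  by (simp add: is_functor_def id_functor_def)

context ar_setting
begin

section \<open>Two-sided universality of functionals on Ext\<close>

lemma bimodule: "ext_bimodule k Q (Obj C) (Hom C) (Comp C) (Idt C) Ex po pb"
  apply (intro ext_bimodule.intro ext_bimodule_axioms.intro matlis_axioms)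
  subgoal by (rule hom_module)
  subgoal using hom_finite by (simp add: hom_finite_def)
  subgoal by (intro hom_MorI) simp
  subgoal for X Y Z f g
  proof -
    assume "X \<in> Obj C" "Y \<in> Obj C" "Z \<in> Obj C" "f \<in> Mor C X Y" "g \<in> Mor C Y Z"
    then have "hom f X Y" "hom g Y Z" using homI by blast+
    then have "hom (g \<bullet> f) X Z" by simp
    from hom_MorI[OF this] show "g \<cdot>\<^bsub>C\<^esub> f \<in> Mor C X Z" by (simp only: comp_def)
  qed
  subgoal by (rule module_Ext)
  subgoal for X Y Y' g by (rule ext_po_linear[OF _ homI])
  subgoal for X Y Y' \<xi> by (rule ext_po_linear')
  subgoal for X Y X' f by (rule ext_pb_linear[OF _ homI])
  subgoal for X Y X' \<xi> by (rule ext_pb_linear')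
  subgoal for X Y \<xi> by (rule ext_po_Id)
  subgoal for X Y \<xi> by (rule ext_pb_Id)
  subgoal for X Y Y' Y'' \<xi> g g'
    using ext_po_comp[of \<xi> X Y g Y' g' Y''] homI[of g Y Y'] homI[of g' Y' Y''] by (simp add: comp_def)
  subgoal for X Y X' X'' \<xi> f f'
    using ext_pb_comp[of \<xi> X Y f X' f' X''] homI[of f X' X] homI[of f' X'' X'] by (simp add: comp_def)
  subgoal for X Y X' Y' \<xi> f g using ext_pb_po[of \<xi> X Y f X' g Y'] homI[of f X' X] homI[of g Y Y'] by simp
  subgoal for X Z \<xi> using connecting_pb[of \<xi> X Z] hom_iff by metis
  subgoal for X Z \<xi> using connecting_po[of \<xi> X Z] hom_iff by metis
  done

lemmas l_univ_iff_r_univ = ext_bimodule.left_universal_iff_right_universal[OF bimodule]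

text \<open>Universality is carried as \<open>r_univ\<close> throughout; its equivalence with
  \<open>l_univ\<close> provides morphisms out of \<open>Y\<close>, as \<open>univ_right\<close>
  provides morphisms into \<open>T\<close>.\<close>

lemma univ_left:
  assumes "r_univ Y T \<theta>" "Y \<in> Obj C" "T \<in> Obj C" "M \<in> Obj C" "linear_map k (Ex M T) Q l"
  obtains f where "hom f Y M" "\<And>\<xi>. \<xi> \<in> carrier (Ex M T) \<Longrightarrow> \<theta> (pb f \<xi>) = l \<xi>"
proof -
  have U: "l_univ Y T \<theta>" using l_univ_iff_r_univ assms by blast
  obtain f where "f \<in> Mor C Y M" "\<forall>\<xi>\<in>carrier (Ex M T). l \<xi> = \<theta> (pb f \<xi>)"
    using right_universalD(2)[OF U assms(4,5)] by blast
  then show thesis using that homI[of f Y M] assms(2,4) by metis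
qed

lemma univ_right:
  assumes "r_univ Y T \<theta>" "Y \<in> Obj C" "T \<in> Obj C" "M \<in> Obj C" "linear_map k (Ex Y M) Q l"
  obtains g where "hom g M T" "\<And>\<xi>. \<xi> \<in> carrier (Ex Y M) \<Longrightarrow> \<theta> (po g \<xi>) = l \<xi>"
proof -
  obtain g where "g \<in> Mor C M T" "\<forall>\<xi>\<in>carrier (Ex Y M). l \<xi> = \<theta> (po g \<xi>)"
    using right_universalD(2)[OF assms(1,4,5)] by blast
  then show thesis using that homI[of g M T] assms(3,4) by metis
qed

end

text \<open>The choices are total functions, constrained only on \<open>Obj_r\<close> and
  \<open>Obj_l\<close>. That \<open>t\<close> and \<open>s\<close> take these two classes to each
  other is derived from the constraints, not assumed.\<close>

locale ar_translations = ar_setting k Q C E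
  for k :: "'r ring" and Q :: "('r, 'q) module" and C :: "('r, 'o, 'm) lcat" and E :: "('m \<times> 'm) set" +
  fixes t s :: "'o \<Rightarrow> 'o" and \<phi> \<psi> :: "'o \<Rightarrow> 'o \<Rightarrow> 'm set \<Rightarrow> (('m \<times> 'm) set \<Rightarrow> 'q)"
  assumes rep_r: "Y \<in> Obj_r k Q C E \<Longrightarrow> represents_r k Q C E Y (t Y) (\<phi> Y)"
    and rep_l: "X \<in> Obj_l k Q C E \<Longrightarrow> represents_l k Q C E X (s X) (\<psi> X)"
begin

abbreviation "Or \<equiv> Obj_r k Q C E"
abbreviation "Ol \<equiv> Obj_l k Q C E"
abbreviation "\<tau> \<equiv> tau C E t \<phi>"
abbreviation "\<tau>' \<equiv> tau_minus C E s \<psi>"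

text \<open>The Yoneda elements of the chosen isomorphisms: \<open>\<theta> Y\<close> is a
  functional on \<open>Ext(Y, t Y)\<close>, and \<open>\<kappa> X\<close> is one on
  \<open>Ext(s X, X)\<close>.\<close>

definition \<theta> :: "'o \<Rightarrow> ('m \<times> 'm) set \<Rightarrow> 'q" where "\<theta> Y = \<phi> Y (t Y) (I.qc (Id (t Y)))"
definition \<kappa> :: "'o \<Rightarrow> ('m \<times> 'm) set \<Rightarrow> 'q" where "\<kappa> X = \<psi> X (s X) (P.qc (Id (s X)))"

lemma Or_Obj: "Y \<in> Or \<Longrightarrow> Y \<in> Obj C" and Ol_Obj: "X \<in> Ol \<Longrightarrow> X \<in> Obj C"
  by (auto simp: Obj_r_def Obj_l_def)

lemma t_Obj: "Y \<in> Or \<Longrightarrow> t Y \<in> Obj C" and s_Obj: "X \<in> Ol \<Longrightarrow> s X \<in> Obj C"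
  using rep_r rep_l by (auto simp: represents_r_def represents_l_def)

lemma
  assumes "Y \<in> Or"
  shows \<phi>_eq: "hom g M (t Y) \<Longrightarrow> \<phi> Y M (I.qc g) = (\<lambda>\<xi>\<in>carrier (Ex Y M). \<theta> Y (po g \<xi>))"
    and \<theta>_univ: "r_univ Y (t Y) (\<theta> Y)"
    and \<theta>_ext: "\<theta> Y \<in> extensional (carrier (Ex Y (t Y)))"
  using represents_r_universal[OF rep_r Or_Obj] assms unfolding \<theta>_def by blast+

text \<open>\<open>\<psi>\<close> yields left universality of \<open>\<kappa> X\<close>; it is
  restated as \<open>r_univ\<close>, so that both families satisfy the same predicate.\<close>

lemma
  assumes "X \<in> Ol"
  shows \<psi>_eq: "hom g (s X) M \<Longrightarrow> \<psi> X M (P.qc g) = (\<lambda>\<xi>\<in>carrier (Ex M X). \<kappa> X (pb g \<xi>))"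
    and \<kappa>_univ: "r_univ (s X) X (\<kappa> X)"
    and \<kappa>_ext: "\<kappa> X \<in> extensional (carrier (Ex (s X) X))"
  using represents_l_universal[OF rep_l Ol_Obj] l_univ_iff_r_univ[OF s_Obj Ol_Obj] assms
  unfolding \<kappa>_def by blast+

lemma t_closed:
  assumes "Y \<in> Or"
  shows "t Y \<in> Ol"
proof -
  note o = Or_Obj[OF assms] t_Obj[OF assms]
  have "\<exists>\<psi>. represents_l k Q C E (t Y) Y \<psi>"
    using universal_represents_l[OF o(2,1)] \<theta>_univ[OF assms] l_univ_iff_r_univ[OF o] by blast
  then show ?thesis using o by (auto simp: Obj_l_def)
qed

lemma s_closed:
  assumes "X \<in> Ol"
  shows "s X \<in> Or"
proof -
  note o = Ol_Obj[OF assms] s_Obj[OF assms]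
  have "\<exists>\<phi>. represents_r k Q C E (s X) X \<phi>"
    using universal_represents_r[OF o(2,1)] \<kappa>_univ[OF assms] by blast
  then show ?thesis using o by (auto simp: Obj_r_def)
qed

lemma P_eqI:
  assumes "r_univ Y T l" "hom f Y M" "hom g Y M" "T \<in> Obj C"
    "\<And>\<xi>. \<xi> \<in> carrier (Ex M T) \<Longrightarrow> l (pb f \<xi>) = l (pb g \<xi>)"
  shows "P.qc f = P.qc g"
proof -
  have "Y \<in> Obj C" using assms(2) by auto
  then have "l_univ Y T l" using l_univ_iff_r_univ assms by blast
  then show ?thesis using l_univ_eqI assms by blast
qed

lemma I_eqI:
  assumes "r_univ Y T l" "hom f M T" "hom g M T" "Y \<in> Obj C"
    "\<And>\<xi>. \<xi> \<in> carrier (Ex Y M) \<Longrightarrow> l (po f \<xi>) = l (po g \<xi>)"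
  shows "I.qc f = I.qc g"
  using r_univ_eqI assms by blast


subsection \<open>Functoriality\<close>

text \<open>The functional \<open>\<theta> Y \<circ> pb f\<close> on \<open>Ext(Y', t Y)\<close> is
  written through \<open>\<theta> Y'\<close> by universality. The equation for \<open>u\<close> is
  the defining condition of \<open>\<tau>\<close>, evaluated at the identity of
  \<open>t Y\<close>.\<close>

lemma tau_exists:
  assumes Y: "Y \<in> Or" "Y' \<in> Or" and f: "hom f Y Y'"
  obtains u where "hom u (t Y) (t Y')" "\<And>\<xi>. \<xi> \<in> carrier (Ex Y' (t Y)) \<Longrightarrow> \<theta> Y' (po u \<xi>) = \<theta> Y (pb f \<xi>)"
proof -
  have "linear_map k (Ex Y' (t Y)) Q (\<lambda>\<xi>. \<theta> Y (pb f \<xi>))"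
    by (rule linear_map_comp[OF ext_pb_linear[OF t_Obj[OF Y(1)] f] right_universalD(1)[OF \<theta>_univ[OF Y(1)]]])
  then show thesis
    using univ_right[OF \<theta>_univ[OF Y(2)] Or_Obj[OF Y(2)] t_Obj[OF Y(2)] t_Obj[OF Y(1)]] that by blast
qed

text \<open>Turns the definite description in \<open>tau\<close> into a usable rule. For uniqueness
  the defining condition is evaluated at the identity of \<open>t Y\<close>; that it holds for every
  \<open>U\<close> and every representative \<open>f'\<close> follows by moving \<open>pb\<close>
  past \<open>po\<close>.\<close>

lemma tau_mor:
  assumes Y: "Y \<in> Or" "Y' \<in> Or" and f: "hom f Y Y'" and u: "hom u (t Y) (t Y')"
    and eq: "\<And>\<xi>. \<xi> \<in> carrier (Ex Y' (t Y)) \<Longrightarrow> \<theta> Y' (po u \<xi>) = \<theta> Y (pb f \<xi>)"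
  shows "Fmor \<tau> Y Y' (P.qc f) = I.qc u"
proof -
  note o = t_Obj[OF Y(1)] t_Obj[OF Y(2)] Or_Obj[OF Y(1)] Or_Obj[OF Y(2)]
  let ?S = "inj_stable C E"
  have tf: "T = I.qc u"
    if T: "T \<in> Mor ?S (t Y) (t Y')" and TU: "\<forall>f\<in>P.qc f. \<forall>M\<in>Obj C. \<forall>U\<in>Mor ?S M (t Y).
           \<phi> Y' M (T \<cdot>\<^bsub>?S\<^esub> U) = dual_map (Ex Y' M) (pb f) (\<phi> Y M U)" for T
  proof -
    obtain v where v: "hom v (t Y) (t Y')" "T = I.qc v" using T Mor_inj_stable[OF o(1,2)] by blast
    have i: "hom (Id (t Y)) (t Y) (t Y)" using o by simp
    have "I.qc (Id (t Y)) \<in> Mor ?S (t Y) (t Y)" using i Mor_inj_stable[OF o(1,1)] by blast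
    then have "\<phi> Y' (t Y) (T \<cdot>\<^bsub>?S\<^esub> I.qc (Id (t Y))) = dual_map (Ex Y' (t Y)) (pb f) (\<theta> Y)"
      using TU P.self_in_qc[OF f] o(1) unfolding \<theta>_def by blast
    then have "\<phi> Y' (t Y) (I.qc v) = dual_map (Ex Y' (t Y)) (pb f) (\<theta> Y)"
      using inj_stable_comp[OF i v(1)] v by simp
    then have e: "(\<lambda>\<xi>\<in>carrier (Ex Y' (t Y)). \<theta> Y' (po v \<xi>)) = dual_map (Ex Y' (t Y)) (pb f) (\<theta> Y)"
      using \<phi>_eq[OF Y(2) v(1)] by simp
    have "\<theta> Y' (po v \<xi>) = \<theta> Y' (po u \<xi>)" if "\<xi> \<in> carrier (Ex Y' (t Y))" for \<xi>
      using fun_cong[OF e, of \<xi>] eq[OF that] that by (simp add: dual_map_def)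
    then show "T = I.qc u" unfolding v(2) by (rule I_eqI[OF \<theta>_univ[OF Y(2)] v(1) u o(4)])
  qed
  have "\<phi> Y' M (I.qc u \<cdot>\<^bsub>?S\<^esub> U) = dual_map (Ex Y' M) (pb f') (\<phi> Y M U)"
    if f': "f' \<in> P.qc f" and M: "M \<in> Obj C" and U: "U \<in> Mor ?S M (t Y)" for f' M U
  proof -
    obtain g where g: "hom g M (t Y)" "U = I.qc g" using U Mor_inj_stable[OF M o(1)] by blast
    note hf' = P.mem_qcD[OF f' f]
    have "\<theta> Y' (po (u \<bullet> g) \<xi>) = \<phi> Y M (I.qc g) (pb f' \<xi>)" if \<xi>: "\<xi> \<in> carrier (Ex Y' M)" for \<xi>
    proof -
      have g\<xi>: "po g \<xi> \<in> carrier (Ex Y' (t Y))" using ext_po_closed[OF \<xi> g(1)] .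
      have "\<theta> Y' (po (u \<bullet> g) \<xi>) = \<theta> Y (pb f (po g \<xi>))"
        using ext_po_comp[OF \<xi> g(1) u] eq[OF g\<xi>] by simp
      also have "pb f (po g \<xi>) = pb f' (po g \<xi>)"
        using P_eq_iff[OF hf'(1) f] hf'(2) o(1) g\<xi> by metis
      also have "\<dots> = po g (pb f' \<xi>)" using ext_pb_po[OF \<xi> hf'(1) g(1)] .
      finally show ?thesis using \<phi>_eq[OF Y(1) g(1)] ext_pb_closed[OF \<xi> hf'(1)] by simp
    qed
    moreover have "hom (u \<bullet> g) M (t Y')" using u g by simp
    ultimately show ?thesis
      using inj_stable_comp[OF g(1) u] \<phi>_eq[OF Y(2), of "u \<bullet> g" M] g(2)
      by (auto simp: dual_map_def intro!: restrict_ext)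
  qed
  moreover have "I.qc u \<in> Mor ?S (t Y) (t Y')" using u Mor_inj_stable[OF o(1,2)] by blast
  ultimately have "(THE T. T \<in> Mor ?S (t Y) (t Y') \<and> (\<forall>f\<in>P.qc f. \<forall>M\<in>Obj C. \<forall>U\<in>Mor ?S M (t Y).
           \<phi> Y' M (T \<cdot>\<^bsub>?S\<^esub> U) = dual_map (Ex Y' M) (pb f) (\<phi> Y M U))) = I.qc u"
    using tf by (intro the_equality) blast+
  then show ?thesis by (simp add: tau_def)
qed

text \<open>The functional \<open>\<kappa> X' \<circ> po g\<close> lives on
  \<open>Ext(s X', X)\<close> and is written through \<open>\<kappa> X\<close>, whose left
  universality yields morphisms out of \<open>s X\<close>; so \<open>v\<close> runs in the same
  direction as \<open>g\<close>.\<close>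

lemma tau_minus_exists:
  assumes X: "X \<in> Ol" "X' \<in> Ol" and g: "hom g X X'"
  obtains v where "hom v (s X) (s X')" "\<And>\<xi>. \<xi> \<in> carrier (Ex (s X') X) \<Longrightarrow> \<kappa> X (pb v \<xi>) = \<kappa> X' (po g \<xi>)"
proof -
  have "linear_map k (Ex (s X') X) Q (\<lambda>\<xi>. \<kappa> X' (po g \<xi>))"
    by (rule linear_map_comp[OF ext_po_linear[OF s_Obj[OF X(2)] g] right_universalD(1)[OF \<kappa>_univ[OF X(2)]]])
  then show thesis
    using univ_left[OF \<kappa>_univ[OF X(1)] s_Obj[OF X(1)] Ol_Obj[OF X(1)] s_Obj[OF X(2)]] that by blast
qed

lemma tau_minus_mor:
  assumes X: "X \<in> Ol" "X' \<in> Ol" and g: "hom g X X'" and v: "hom v (s X) (s X')"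
    and eq: "\<And>\<xi>. \<xi> \<in> carrier (Ex (s X') X) \<Longrightarrow> \<kappa> X (pb v \<xi>) = \<kappa> X' (po g \<xi>)"
  shows "Fmor \<tau>' X X' (I.qc g) = P.qc v"
proof -
  note o = s_Obj[OF X(1)] s_Obj[OF X(2)] Ol_Obj[OF X(1)] Ol_Obj[OF X(2)]
  let ?S = "proj_stable C E"
  have tf: "T = P.qc v"
    if T: "T \<in> Mor ?S (s X) (s X')" and TU: "\<forall>g\<in>I.qc g. \<forall>M\<in>Obj C. \<forall>U\<in>Mor ?S (s X') M.
           \<psi> X M (U \<cdot>\<^bsub>?S\<^esub> T) = dual_map (Ex M X) (po g) (\<psi> X' M U)" for T
  proof -
    obtain w where w: "hom w (s X) (s X')" "T = P.qc w" using T Mor_proj_stable[OF o(1,2)] by blast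
    have i: "hom (Id (s X')) (s X') (s X')" using o by simp
    have "P.qc (Id (s X')) \<in> Mor ?S (s X') (s X')" using i Mor_proj_stable[OF o(2,2)] by blast
    then have "\<psi> X (s X') (P.qc (Id (s X')) \<cdot>\<^bsub>?S\<^esub> T) = dual_map (Ex (s X') X) (po g) (\<kappa> X')"
      using TU I.self_in_qc[OF g] o(2) unfolding \<kappa>_def by blast
    then have "\<psi> X (s X') (P.qc w) = dual_map (Ex (s X') X) (po g) (\<kappa> X')"
      using proj_stable_comp[OF w(1) i] w by simp
    then have e: "(\<lambda>\<xi>\<in>carrier (Ex (s X') X). \<kappa> X (pb w \<xi>)) = dual_map (Ex (s X') X) (po g) (\<kappa> X')"
      using \<psi>_eq[OF X(1) w(1)] by simp
    have "\<kappa> X (pb w \<xi>) = \<kappa> X (pb v \<xi>)" if "\<xi> \<in> carrier (Ex (s X') X)" for \<xi>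
      using fun_cong[OF e, of \<xi>] eq[OF that] that by (simp add: dual_map_def)
    then show "T = P.qc v" unfolding w(2) by (rule P_eqI[OF \<kappa>_univ[OF X(1)] w(1) v o(3)])
  qed
  have "\<psi> X M (U \<cdot>\<^bsub>?S\<^esub> P.qc v) = dual_map (Ex M X) (po g') (\<psi> X' M U)"
    if g': "g' \<in> I.qc g" and M: "M \<in> Obj C" and U: "U \<in> Mor ?S (s X') M" for g' M U
  proof -
    obtain f where f: "hom f (s X') M" "U = P.qc f" using U Mor_proj_stable[OF o(2) M] by blast
    note hg' = I.mem_qcD[OF g' g]
    have "\<kappa> X (pb (f \<bullet> v) \<xi>) = \<psi> X' M (P.qc f) (po g' \<xi>)" if \<xi>: "\<xi> \<in> carrier (Ex M X)" for \<xi>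
    proof -
      have f\<xi>: "pb f \<xi> \<in> carrier (Ex (s X') X)" using ext_pb_closed[OF \<xi> f(1)] .
      have "\<kappa> X (pb (f \<bullet> v) \<xi>) = \<kappa> X' (po g (pb f \<xi>))"
        using ext_pb_comp[OF \<xi> f(1) v] eq[OF f\<xi>] by simp
      also have "po g (pb f \<xi>) = po g' (pb f \<xi>)"
        using I_eq_iff[OF hg'(1) g] hg'(2) o(2) f\<xi> by metis
      also have "\<dots> = pb f (po g' \<xi>)" using ext_pb_po[OF \<xi> f(1) hg'(1)] by simp
      finally show ?thesis using \<psi>_eq[OF X(2) f(1)] ext_po_closed[OF \<xi> hg'(1)] by simp
    qed
    moreover have "hom (f \<bullet> v) (s X) M" using v f by simp
    ultimately show ?thesis
      using proj_stable_comp[OF v f(1)] \<psi>_eq[OF X(1), of "f \<bullet> v" M] f(2)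
      by (auto simp: dual_map_def intro!: restrict_ext)
  qed
  moreover have "P.qc v \<in> Mor ?S (s X) (s X')" using v Mor_proj_stable[OF o(1,2)] by blast
  ultimately have "(THE T. T \<in> Mor ?S (s X) (s X') \<and> (\<forall>g\<in>I.qc g. \<forall>M\<in>Obj C. \<forall>U\<in>Mor ?S (s X') M.
           \<psi> X M (U \<cdot>\<^bsub>?S\<^esub> T) = dual_map (Ex M X) (po g) (\<psi> X' M U))) = P.qc v"
    using tf by (intro the_equality) blast+
  then show ?thesis by (simp add: tau_minus_def)
qed

lemma stable_r_sel [simp]:
  "Obj (stable_r k Q C E) = Or" "Comp (stable_r k Q C E) = Comp (proj_stable C E)"
  "Hom (stable_r k Q C E) = Hom (proj_stable C E)" "Idt (stable_r k Q C E) X = P.qc (Id X)"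
  by (simp_all add: stable_r_def full_subcat_def)

lemma stable_l_sel [simp]:
  "Obj (stable_l k Q C E) = Ol" "Comp (stable_l k Q C E) = Comp (inj_stable C E)"
  "Hom (stable_l k Q C E) = Hom (inj_stable C E)" "Idt (stable_l k Q C E) X = I.qc (Id X)"
  by (simp_all add: stable_l_def full_subcat_def)

lemma Fob_tau [simp]: "Fob \<tau> = t" "Fob \<tau>' = s"
  by (simp_all add: tau_def tau_minus_def)

lemma functor_tau: "is_functor (stable_r k Q C E) (stable_l k Q C E) \<tau>"
  unfolding is_functor_def stable_r_sel stable_l_sel Fob_tau
proof (intro conjI ballI)
  show "t Y \<in> Ol" if "Y \<in> Or" for Y using that by (rule t_closed)
  show "Fmor \<tau> Y Y' F \<in> Mor (inj_stable C E) (t Y) (t Y')"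
    if Y: "Y \<in> Or" "Y' \<in> Or" and F: "F \<in> Mor (proj_stable C E) Y Y'" for Y Y' F
  proof -
    obtain f where f: "hom f Y Y'" "F = P.qc f" using F Mor_proj_stable[OF Or_Obj Or_Obj] Y by blast
    obtain u where "hom u (t Y) (t Y')" "Fmor \<tau> Y Y' F = I.qc u"
      using tau_exists[OF Y f(1)] tau_mor[OF Y f(1)] f(2) by metis
    then show ?thesis using Mor_inj_stable[OF t_Obj t_Obj] Y by blast
  qed
  show "Fmor \<tau> Y Y (P.qc (Id Y)) = I.qc (Id (t Y))" if Y: "Y \<in> Or" for Y
    using tau_mor[OF Y Y, of "Id Y" "Id (t Y)"] Or_Obj[OF Y] t_Obj[OF Y] ext_po_Id ext_pb_Id by simp
  fix X Y Z F G assume o: "X \<in> Or" "Y \<in> Or" "Z \<in> Or"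
    and F: "F \<in> Mor (proj_stable C E) X Y" and G: "G \<in> Mor (proj_stable C E) Y Z"
  obtain f where f: "hom f X Y" "F = P.qc f" using F Mor_proj_stable[OF Or_Obj Or_Obj] o by blast
  obtain g where g: "hom g Y Z" "G = P.qc g" using G Mor_proj_stable[OF Or_Obj Or_Obj] o by blast
  obtain u where u: "hom u (t X) (t Y)" "\<And>\<xi>. \<xi> \<in> carrier (Ex Y (t X)) \<Longrightarrow> \<theta> Y (po u \<xi>) = \<theta> X (pb f \<xi>)"
    using tau_exists[OF o(1,2) f(1)] by blast
  obtain v where v: "hom v (t Y) (t Z)" "\<And>\<xi>. \<xi> \<in> carrier (Ex Z (t Y)) \<Longrightarrow> \<theta> Z (po v \<xi>) = \<theta> Y (pb g \<xi>)"
    using tau_exists[OF o(2,3) g(1)] by blast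
  \<comment> \<open>The equations characterizing \<open>u\<close> and \<open>v\<close> compose
    because \<open>pb g\<close> and \<open>po u\<close> commute.\<close>
  have "\<theta> Z (po (v \<bullet> u) \<xi>) = \<theta> X (pb (g \<bullet> f) \<xi>)" if \<xi>: "\<xi> \<in> carrier (Ex Z (t X))" for \<xi>
  proof -
    have "\<theta> Z (po (v \<bullet> u) \<xi>) = \<theta> Y (pb g (po u \<xi>))"
      using ext_po_comp[OF \<xi> u(1) v(1)] v(2)[OF ext_po_closed[OF \<xi> u(1)]] by simp
    also have "pb g (po u \<xi>) = po u (pb g \<xi>)" using ext_pb_po[OF \<xi> g(1) u(1)] .
    also have "\<theta> Y (po u (pb g \<xi>)) = \<theta> X (pb f (pb g \<xi>))" using u(2)[OF ext_pb_closed[OF \<xi> g(1)]] .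
    also have "\<dots> = \<theta> X (pb (g \<bullet> f) \<xi>)" using ext_pb_comp[OF \<xi> g(1) f(1)] by simp
    finally show ?thesis .
  qed
  moreover have "hom (g \<bullet> f) X Z" "hom (v \<bullet> u) (t X) (t Z)" using f g u v by simp_all
  ultimately have "Fmor \<tau> X Z (P.qc (g \<bullet> f)) = I.qc (v \<bullet> u)" by (intro tau_mor o) blast+
  then show "Fmor \<tau> X Z (G \<cdot>\<^bsub>proj_stable C E\<^esub> F) = Fmor \<tau> Y Z G \<cdot>\<^bsub>inj_stable C E\<^esub> Fmor \<tau> X Y F"
    using proj_stable_comp[OF f(1) g(1)] inj_stable_comp[OF u(1) v(1)]
      tau_mor[OF o(1,2) f(1) u] tau_mor[OF o(2,3) g(1) v] f(2) g(2) by simp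
qed

lemma functor_tau_minus: "is_functor (stable_l k Q C E) (stable_r k Q C E) \<tau>'"
  unfolding is_functor_def stable_r_sel stable_l_sel Fob_tau
proof (intro conjI ballI)
  show "s X \<in> Or" if "X \<in> Ol" for X using that by (rule s_closed)
  show "Fmor \<tau>' X X' F \<in> Mor (proj_stable C E) (s X) (s X')"
    if X: "X \<in> Ol" "X' \<in> Ol" and F: "F \<in> Mor (inj_stable C E) X X'" for X X' F
  proof -
    obtain f where f: "hom f X X'" "F = I.qc f" using F Mor_inj_stable[OF Ol_Obj Ol_Obj] X by blast
    obtain v where "hom v (s X) (s X')" "Fmor \<tau>' X X' F = P.qc v"
      using tau_minus_exists[OF X f(1)] tau_minus_mor[OF X f(1)] f(2) by metis
    then show ?thesis using Mor_proj_stable[OF s_Obj s_Obj] X by blast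
  qed
  show "Fmor \<tau>' X X (I.qc (Id X)) = P.qc (Id (s X))" if X: "X \<in> Ol" for X
    using tau_minus_mor[OF X X, of "Id X" "Id (s X)"] Ol_Obj[OF X] s_Obj[OF X] ext_po_Id ext_pb_Id by simp
  fix X Y Z F G assume o: "X \<in> Ol" "Y \<in> Ol" "Z \<in> Ol"
    and F: "F \<in> Mor (inj_stable C E) X Y" and G: "G \<in> Mor (inj_stable C E) Y Z"
  obtain f where f: "hom f X Y" "F = I.qc f" using F Mor_inj_stable[OF Ol_Obj Ol_Obj] o by blast
  obtain g where g: "hom g Y Z" "G = I.qc g" using G Mor_inj_stable[OF Ol_Obj Ol_Obj] o by blast
  obtain u where u: "hom u (s X) (s Y)" "\<And>\<xi>. \<xi> \<in> carrier (Ex (s Y) X) \<Longrightarrow> \<kappa> X (pb u \<xi>) = \<kappa> Y (po f \<xi>)"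
    using tau_minus_exists[OF o(1,2) f(1)] by blast
  obtain v where v: "hom v (s Y) (s Z)" "\<And>\<xi>. \<xi> \<in> carrier (Ex (s Z) Y) \<Longrightarrow> \<kappa> Y (pb v \<xi>) = \<kappa> Z (po g \<xi>)"
    using tau_minus_exists[OF o(2,3) g(1)] by blast
  have "\<kappa> X (pb (v \<bullet> u) \<xi>) = \<kappa> Z (po (g \<bullet> f) \<xi>)" if \<xi>: "\<xi> \<in> carrier (Ex (s Z) X)" for \<xi>
  proof -
    have "\<kappa> X (pb (v \<bullet> u) \<xi>) = \<kappa> Y (po f (pb v \<xi>))"
      using ext_pb_comp[OF \<xi> v(1) u(1)] u(2)[OF ext_pb_closed[OF \<xi> v(1)]] by simp
    also have "po f (pb v \<xi>) = pb v (po f \<xi>)" using ext_pb_po[OF \<xi> v(1) f(1)] by simp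
    also have "\<kappa> Y (pb v (po f \<xi>)) = \<kappa> Z (po g (po f \<xi>))" using v(2)[OF ext_po_closed[OF \<xi> f(1)]] .
    also have "\<dots> = \<kappa> Z (po (g \<bullet> f) \<xi>)" using ext_po_comp[OF \<xi> f(1) g(1)] by simp
    finally show ?thesis .
  qed
  moreover have "hom (g \<bullet> f) X Z" "hom (v \<bullet> u) (s X) (s Z)" using f g u v by simp_all
  ultimately have "Fmor \<tau>' X Z (I.qc (g \<bullet> f)) = P.qc (v \<bullet> u)" by (intro tau_minus_mor o) blast+
  then show "Fmor \<tau>' X Z (G \<cdot>\<^bsub>inj_stable C E\<^esub> F) = Fmor \<tau>' Y Z G \<cdot>\<^bsub>proj_stable C E\<^esub> Fmor \<tau>' X Y F"
    using inj_stable_comp[OF f(1) g(1)] proj_stable_comp[OF u(1) v(1)]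
      tau_minus_mor[OF o(1,2) f(1) u] tau_minus_mor[OF o(2,3) g(1) v] f(2) g(2) by simp
qed


subsection \<open>Counit and unit\<close>

text \<open>\<open>epsilon\<close> inverts \<open>\<psi>\<close> at the functional
  \<open>\<theta> Y\<close>; by the formula for \<open>\<psi>\<close> this means that
  \<open>\<kappa> (t Y)\<close> composed with \<open>pb e\<close> is \<open>\<theta> Y\<close>. From
  here on only this equation represents the counit.\<close>

lemma epsilon_spec:
  assumes Y: "Y \<in> Or"
  obtains e where "hom e (s (t Y)) Y" "epsilon C E t \<phi> s \<psi> Y = P.qc e"
    "\<And>\<xi>. \<xi> \<in> carrier (Ex Y (t Y)) \<Longrightarrow> \<kappa> (t Y) (pb e \<xi>) = \<theta> Y \<xi>"
proof -
  note tY = t_closed[OF Y]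
  note o = Or_Obj[OF Y] t_Obj[OF Y] s_Obj[OF tY]
  obtain e where e: "hom e (s (t Y)) Y" "\<And>\<xi>. \<xi> \<in> carrier (Ex Y (t Y)) \<Longrightarrow> \<kappa> (t Y) (pb e \<xi>) = \<theta> Y \<xi>"
    using univ_left[OF \<kappa>_univ[OF tY] o(3,2,1) right_universalD(1)[OF \<theta>_univ[OF Y]]] by blast
  have "\<psi> (t Y) Y (P.qc e) = \<theta> Y"
    unfolding \<psi>_eq[OF tY e(1)] by (rule extensionalityI[OF _ \<theta>_ext[OF Y]]) (use e(2) in simp_all)
  moreover have "inj_on (\<psi> (t Y) Y) (Mor (proj_stable C E) (s (t Y)) Y)"
    using rep_l[OF tY] o(1) by (simp add: represents_l_def linear_iso_def bij_betw_def)
  moreover have "P.qc e \<in> Mor (proj_stable C E) (s (t Y)) Y" using e(1) Mor_proj_stable[OF o(3,1)] by blast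
  ultimately have "inv_into (Mor (proj_stable C E) (s (t Y)) Y) (\<psi> (t Y) Y) (\<theta> Y) = P.qc e"
    using inv_into_f_f by metis
  then have "epsilon C E t \<phi> s \<psi> Y = P.qc e" by (simp add: epsilon_def \<theta>_def)
  then show thesis using that e by blast
qed

lemma eta_spec:
  assumes X: "X \<in> Ol"
  obtains h where "hom h X (t (s X))" "eta C E t \<phi> s \<psi> X = I.qc h"
    "\<And>\<xi>. \<xi> \<in> carrier (Ex (s X) X) \<Longrightarrow> \<theta> (s X) (po h \<xi>) = \<kappa> X \<xi>"
proof -
  note sX = s_closed[OF X]
  note o = Ol_Obj[OF X] s_Obj[OF X] t_Obj[OF sX]
  obtain h where h: "hom h X (t (s X))" "\<And>\<xi>. \<xi> \<in> carrier (Ex (s X) X) \<Longrightarrow> \<theta> (s X) (po h \<xi>) = \<kappa> X \<xi>"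
    using univ_right[OF \<theta>_univ[OF sX] o(2,3,1) right_universalD(1)[OF \<kappa>_univ[OF X]]] by blast
  have "\<phi> (s X) X (I.qc h) = \<kappa> X"
    unfolding \<phi>_eq[OF sX h(1)] by (rule extensionalityI[OF _ \<kappa>_ext[OF X]]) (use h(2) in simp_all)
  moreover have "inj_on (\<phi> (s X) X) (Mor (inj_stable C E) X (t (s X)))"
    using rep_r[OF sX] o(1) by (simp add: represents_r_def linear_iso_def bij_betw_def)
  moreover have "I.qc h \<in> Mor (inj_stable C E) X (t (s X))" using h(1) Mor_inj_stable[OF o(1,3)] by blast
  ultimately have "inv_into (Mor (inj_stable C E) X (t (s X))) (\<phi> (s X) X) (\<kappa> X) = I.qc h"
    using inv_into_f_f by metis
  then have "eta C E t \<phi> s \<psi> X = I.qc h" by (simp add: eta_def \<kappa>_def)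
  then show thesis using that h by blast
qed

text \<open>\<open>\<theta> Y\<close> and \<open>\<kappa> (t Y)\<close> are both universal for
  functionals on \<open>Ext(-, t Y)\<close>; expressing each through the other gives
  \<open>e\<close> and its inverse \<open>e'\<close>. Naturality is tested with
  \<open>\<kappa> (t Y)\<close>, the functional belonging to the source.\<close>

lemma epsilon_natural_iso:
  "natural_iso (stable_r k Q C E) (stable_r k Q C E) (comp_functor \<tau>' \<tau>) id_functor (epsilon C E t \<phi> s \<psi>)"
  unfolding natural_iso_def
proof (intro conjI ballI)
  show "is_functor (stable_r k Q C E) (stable_r k Q C E) (comp_functor \<tau>' \<tau>)"
    by (rule is_functor_comp[OF functor_tau functor_tau_minus])
  show "is_functor (stable_r k Q C E) (stable_r k Q C E) id_functor" by (rule is_functor_id)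
next
  fix Y assume "Y \<in> Obj (stable_r k Q C E)"
  then have Y: "Y \<in> Or" by simp
  note tY = t_closed[OF Y]
  note o = Or_Obj[OF Y] t_Obj[OF Y] s_Obj[OF tY]
  obtain e where e: "hom e (s (t Y)) Y" "epsilon C E t \<phi> s \<psi> Y = P.qc e"
    "\<And>\<xi>. \<xi> \<in> carrier (Ex Y (t Y)) \<Longrightarrow> \<kappa> (t Y) (pb e \<xi>) = \<theta> Y \<xi>"
    using epsilon_spec[OF Y] by blast
  obtain e' where e': "hom e' Y (s (t Y))" "\<And>\<xi>. \<xi> \<in> carrier (Ex (s (t Y)) (t Y)) \<Longrightarrow> \<theta> Y (pb e' \<xi>) = \<kappa> (t Y) \<xi>"
    using univ_left[OF \<theta>_univ[OF Y] o(1,2,3) right_universalD(1)[OF \<kappa>_univ[OF tY]]] by blast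
  have h: "hom (e' \<bullet> e) (s (t Y)) (s (t Y))" "hom (e \<bullet> e') Y Y" "hom (Id (s (t Y))) (s (t Y)) (s (t Y))" "hom (Id Y) Y Y"
    using e(1) e'(1) o by simp_all
  have "P.qc (e' \<bullet> e) = P.qc (Id (s (t Y)))"
  proof (rule P_eqI[OF \<kappa>_univ[OF tY] h(1,3) o(2)])
    fix \<xi> assume \<xi>: "\<xi> \<in> carrier (Ex (s (t Y)) (t Y))"
    show "\<kappa> (t Y) (pb (e' \<bullet> e) \<xi>) = \<kappa> (t Y) (pb (Id (s (t Y))) \<xi>)"
      using ext_pb_comp[OF \<xi> e'(1) e(1)] e(3)[OF ext_pb_closed[OF \<xi> e'(1)]] e'(2)[OF \<xi>] ext_pb_Id[OF \<xi>] by simp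
  qed
  moreover have "P.qc (e \<bullet> e') = P.qc (Id Y)"
  proof (rule P_eqI[OF \<theta>_univ[OF Y] h(2,4) o(2)])
    fix \<xi> assume \<xi>: "\<xi> \<in> carrier (Ex Y (t Y))"
    show "\<theta> Y (pb (e \<bullet> e') \<xi>) = \<theta> Y (pb (Id Y) \<xi>)"
      using ext_pb_comp[OF \<xi> e(1) e'(1)] e'(2)[OF ext_pb_closed[OF \<xi> e(1)]] e(3)[OF \<xi>] ext_pb_Id[OF \<xi>] by simp
  qed
  moreover have "P.qc e \<in> Mor (proj_stable C E) (s (t Y)) Y" "P.qc e' \<in> Mor (proj_stable C E) Y (s (t Y))"
    using e(1) e'(1) Mor_proj_stable[OF o(3,1)] Mor_proj_stable[OF o(1,3)] by blast+
  ultimately have "is_iso (stable_r k Q C E) (s (t Y)) Y (P.qc e)"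
    unfolding is_iso_def stable_r_sel
    using proj_stable_comp[OF e(1) e'(1)] proj_stable_comp[OF e'(1) e(1)] by (intro conjI bexI[of _ "P.qc e'"]) simp_all
  then show "is_iso (stable_r k Q C E) (Fob (comp_functor \<tau>' \<tau>) Y) (Fob id_functor Y) (epsilon C E t \<phi> s \<psi> Y)"
    by (simp add: comp_functor_def id_functor_def e(2))
next
  fix Y Y' F assume "Y \<in> Obj (stable_r k Q C E)" "Y' \<in> Obj (stable_r k Q C E)" "F \<in> Mor (stable_r k Q C E) Y Y'"
  then have Y: "Y \<in> Or" "Y' \<in> Or" and F: "F \<in> Mor (proj_stable C E) Y Y'" by simp_all
  note tY = t_closed[OF Y(1)] t_closed[OF Y(2)]
  obtain f where f: "hom f Y Y'" "F = P.qc f" using F Mor_proj_stable[OF Or_Obj Or_Obj] Y by blast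
  obtain u where u: "hom u (t Y) (t Y')" "\<And>\<xi>. \<xi> \<in> carrier (Ex Y' (t Y)) \<Longrightarrow> \<theta> Y' (po u \<xi>) = \<theta> Y (pb f \<xi>)"
    using tau_exists[OF Y f(1)] by blast
  obtain v where v: "hom v (s (t Y)) (s (t Y'))"
    "\<And>\<xi>. \<xi> \<in> carrier (Ex (s (t Y')) (t Y)) \<Longrightarrow> \<kappa> (t Y) (pb v \<xi>) = \<kappa> (t Y') (po u \<xi>)"
    using tau_minus_exists[OF tY u(1)] by blast
  obtain e where e: "hom e (s (t Y)) Y" "epsilon C E t \<phi> s \<psi> Y = P.qc e"
    "\<And>\<xi>. \<xi> \<in> carrier (Ex Y (t Y)) \<Longrightarrow> \<kappa> (t Y) (pb e \<xi>) = \<theta> Y \<xi>"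
    using epsilon_spec[OF Y(1)] by blast
  obtain e' where e': "hom e' (s (t Y')) Y'" "epsilon C E t \<phi> s \<psi> Y' = P.qc e'"
    "\<And>\<xi>. \<xi> \<in> carrier (Ex Y' (t Y')) \<Longrightarrow> \<kappa> (t Y') (pb e' \<xi>) = \<theta> Y' \<xi>"
    using epsilon_spec[OF Y(2)] by blast
  have h: "hom (e' \<bullet> v) (s (t Y)) Y'" "hom (f \<bullet> e) (s (t Y)) Y'" using e e' v f by simp_all
  have "P.qc (e' \<bullet> v) = P.qc (f \<bullet> e)"
  proof (rule P_eqI[OF \<kappa>_univ[OF tY(1)] h t_Obj[OF Y(1)]])
    fix \<xi> assume \<xi>: "\<xi> \<in> carrier (Ex Y' (t Y))"
    \<comment> \<open>Both sides equal \<open>\<theta> Y (pb f \<xi>)\<close>: the left by the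
      equations for \<open>v\<close>, \<open>e'\<close> and \<open>u\<close>, the right by that for
      \<open>e\<close>.\<close>
    have "\<kappa> (t Y) (pb (e' \<bullet> v) \<xi>) = \<kappa> (t Y') (po u (pb e' \<xi>))"
      using ext_pb_comp[OF \<xi> e'(1) v(1)] v(2)[OF ext_pb_closed[OF \<xi> e'(1)]] by simp
    also have "po u (pb e' \<xi>) = pb e' (po u \<xi>)" using ext_pb_po[OF \<xi> e'(1) u(1)] by simp
    also have "\<kappa> (t Y') (pb e' (po u \<xi>)) = \<theta> Y (pb f \<xi>)"
      using e'(3)[OF ext_po_closed[OF \<xi> u(1)]] u(2)[OF \<xi>] by simp
    also have "\<dots> = \<kappa> (t Y) (pb (f \<bullet> e) \<xi>)"
      using e(3)[OF ext_pb_closed[OF \<xi> f(1)]] ext_pb_comp[OF \<xi> f(1) e(1)] by simp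
    finally show "\<kappa> (t Y) (pb (e' \<bullet> v) \<xi>) = \<kappa> (t Y) (pb (f \<bullet> e) \<xi>)" .
  qed
  then show "epsilon C E t \<phi> s \<psi> Y' \<cdot>\<^bsub>stable_r k Q C E\<^esub> Fmor (comp_functor \<tau>' \<tau>) Y Y' F
      = Fmor id_functor Y Y' F \<cdot>\<^bsub>stable_r k Q C E\<^esub> epsilon C E t \<phi> s \<psi> Y"
    using tau_mor[OF Y f(1) u] tau_minus_mor[OF tY u(1) v] f(2) e(2) e'(2)
      proj_stable_comp[OF v(1) e'(1)] proj_stable_comp[OF e(1) f(1)]
    by (simp add: comp_functor_def id_functor_def)
qed

text \<open>Dual to the counit: \<open>\<kappa> X\<close> and \<open>\<theta> (s X)\<close> are both
  universal for functionals on \<open>Ext(s X, -)\<close>, and naturality is tested with the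
  functional belonging to the target.\<close>

lemma eta_natural_iso:
  "natural_iso (stable_l k Q C E) (stable_l k Q C E) id_functor (comp_functor \<tau> \<tau>') (eta C E t \<phi> s \<psi>)"
  unfolding natural_iso_def
proof (intro conjI ballI)
  show "is_functor (stable_l k Q C E) (stable_l k Q C E) (comp_functor \<tau> \<tau>')"
    by (rule is_functor_comp[OF functor_tau_minus functor_tau])
  show "is_functor (stable_l k Q C E) (stable_l k Q C E) id_functor" by (rule is_functor_id)
next
  fix X assume "X \<in> Obj (stable_l k Q C E)"
  then have X: "X \<in> Ol" by simp
  note sX = s_closed[OF X]
  note o = Ol_Obj[OF X] s_Obj[OF X] t_Obj[OF sX]
  obtain e where e: "hom e X (t (s X))" "eta C E t \<phi> s \<psi> X = I.qc e"
    "\<And>\<xi>. \<xi> \<in> carrier (Ex (s X) X) \<Longrightarrow> \<theta> (s X) (po e \<xi>) = \<kappa> X \<xi>"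
    using eta_spec[OF X] by blast
  obtain e' where e': "hom e' (t (s X)) X" "\<And>\<xi>. \<xi> \<in> carrier (Ex (s X) (t (s X))) \<Longrightarrow> \<kappa> X (po e' \<xi>) = \<theta> (s X) \<xi>"
    using univ_right[OF \<kappa>_univ[OF X] o(2,1,3) right_universalD(1)[OF \<theta>_univ[OF sX]]] by blast
  have h: "hom (e \<bullet> e') (t (s X)) (t (s X))" "hom (e' \<bullet> e) X X" "hom (Id (t (s X))) (t (s X)) (t (s X))" "hom (Id X) X X"
    using e(1) e'(1) o by simp_all
  have "I.qc (e \<bullet> e') = I.qc (Id (t (s X)))"
  proof (rule I_eqI[OF \<theta>_univ[OF sX] h(1,3) o(2)])
    fix \<xi> assume \<xi>: "\<xi> \<in> carrier (Ex (s X) (t (s X)))"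
    show "\<theta> (s X) (po (e \<bullet> e') \<xi>) = \<theta> (s X) (po (Id (t (s X))) \<xi>)"
      using ext_po_comp[OF \<xi> e'(1) e(1)] e(3)[OF ext_po_closed[OF \<xi> e'(1)]] e'(2)[OF \<xi>] ext_po_Id[OF \<xi>] by simp
  qed
  moreover have "I.qc (e' \<bullet> e) = I.qc (Id X)"
  proof (rule I_eqI[OF \<kappa>_univ[OF X] h(2,4) o(2)])
    fix \<xi> assume \<xi>: "\<xi> \<in> carrier (Ex (s X) X)"
    show "\<kappa> X (po (e' \<bullet> e) \<xi>) = \<kappa> X (po (Id X) \<xi>)"
      using ext_po_comp[OF \<xi> e(1) e'(1)] e'(2)[OF ext_po_closed[OF \<xi> e(1)]] e(3)[OF \<xi>] ext_po_Id[OF \<xi>] by simp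
  qed
  moreover have "I.qc e \<in> Mor (inj_stable C E) X (t (s X))" "I.qc e' \<in> Mor (inj_stable C E) (t (s X)) X"
    using e(1) e'(1) Mor_inj_stable[OF o(3,1)] Mor_inj_stable[OF o(1,3)] by blast+
  ultimately have "is_iso (stable_l k Q C E) X (t (s X)) (I.qc e)"
    unfolding is_iso_def stable_l_sel
    using inj_stable_comp[OF e(1) e'(1)] inj_stable_comp[OF e'(1) e(1)] by (intro conjI bexI[of _ "I.qc e'"]) simp_all
  then show "is_iso (stable_l k Q C E) (Fob id_functor X) (Fob (comp_functor \<tau> \<tau>') X) (eta C E t \<phi> s \<psi> X)"
    by (simp add: comp_functor_def id_functor_def e(2))
next
  fix X X' G assume "X \<in> Obj (stable_l k Q C E)" "X' \<in> Obj (stable_l k Q C E)" "G \<in> Mor (stable_l k Q C E) X X'"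
  then have X: "X \<in> Ol" "X' \<in> Ol" and G: "G \<in> Mor (inj_stable C E) X X'" by simp_all
  note sX = s_closed[OF X(1)] s_closed[OF X(2)]
  obtain g where g: "hom g X X'" "G = I.qc g" using G Mor_inj_stable[OF Ol_Obj Ol_Obj] X by blast
  obtain v where v: "hom v (s X) (s X')" "\<And>\<xi>. \<xi> \<in> carrier (Ex (s X') X) \<Longrightarrow> \<kappa> X (pb v \<xi>) = \<kappa> X' (po g \<xi>)"
    using tau_minus_exists[OF X g(1)] by blast
  obtain u where u: "hom u (t (s X)) (t (s X'))"
    "\<And>\<xi>. \<xi> \<in> carrier (Ex (s X') (t (s X))) \<Longrightarrow> \<theta> (s X') (po u \<xi>) = \<theta> (s X) (pb v \<xi>)"
    using tau_exists[OF sX v(1)] by blast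
  obtain e where e: "hom e X (t (s X))" "eta C E t \<phi> s \<psi> X = I.qc e"
    "\<And>\<xi>. \<xi> \<in> carrier (Ex (s X) X) \<Longrightarrow> \<theta> (s X) (po e \<xi>) = \<kappa> X \<xi>"
    using eta_spec[OF X(1)] by blast
  obtain e' where e': "hom e' X' (t (s X'))" "eta C E t \<phi> s \<psi> X' = I.qc e'"
    "\<And>\<xi>. \<xi> \<in> carrier (Ex (s X') X') \<Longrightarrow> \<theta> (s X') (po e' \<xi>) = \<kappa> X' \<xi>"
    using eta_spec[OF X(2)] by blast
  have h: "hom (e' \<bullet> g) X (t (s X'))" "hom (u \<bullet> e) X (t (s X'))" using e e' u g by simp_all
  have "I.qc (e' \<bullet> g) = I.qc (u \<bullet> e)"
  proof (rule I_eqI[OF \<theta>_univ[OF sX(2)] h s_Obj[OF X(2)]])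
    fix \<xi> assume \<xi>: "\<xi> \<in> carrier (Ex (s X') X)"
    \<comment> \<open>Both sides reduce to \<open>\<kappa> X' (po g \<xi>)\<close>, one by the
      equations for \<open>u\<close>, \<open>e\<close> and \<open>v\<close>, the other by that for
      \<open>e'\<close>.\<close>
    have "\<theta> (s X') (po (u \<bullet> e) \<xi>) = \<theta> (s X) (pb v (po e \<xi>))"
      using ext_po_comp[OF \<xi> e(1) u(1)] u(2)[OF ext_po_closed[OF \<xi> e(1)]] by simp
    also have "pb v (po e \<xi>) = po e (pb v \<xi>)" using ext_pb_po[OF \<xi> v(1) e(1)] .
    also have "\<theta> (s X) (po e (pb v \<xi>)) = \<kappa> X' (po g \<xi>)"
      using e(3)[OF ext_pb_closed[OF \<xi> v(1)]] v(2)[OF \<xi>] by simp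
    also have "\<dots> = \<theta> (s X') (po (e' \<bullet> g) \<xi>)"
      using e'(3)[OF ext_po_closed[OF \<xi> g(1)]] ext_po_comp[OF \<xi> g(1) e'(1)] by simp
    finally show "\<theta> (s X') (po (e' \<bullet> g) \<xi>) = \<theta> (s X') (po (u \<bullet> e) \<xi>)" by simp
  qed
  then show "eta C E t \<phi> s \<psi> X' \<cdot>\<^bsub>stable_l k Q C E\<^esub> Fmor id_functor X X' G
      = Fmor (comp_functor \<tau> \<tau>') X X' G \<cdot>\<^bsub>stable_l k Q C E\<^esub> eta C E t \<phi> s \<psi> X"
    using tau_minus_mor[OF X g(1) v] tau_mor[OF sX v(1) u] g(2) e(2) e'(2)
      inj_stable_comp[OF g(1) e'(1)] inj_stable_comp[OF e(1) u(1)]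
    by (simp add: comp_functor_def id_functor_def)
qed

end

theorem proposition3p4:
  fixes k :: "'r ring" and Q :: "('r, 'q) module"
    and C :: "('r, 'o, 'm) lcat" and E :: "('m \<times> 'm) set"
    and t s :: "'o \<Rightarrow> 'o"
    and \<phi> \<psi> :: "'o \<Rightarrow> 'o \<Rightarrow> 'm set \<Rightarrow> (('m \<times> 'm) set \<Rightarrow> 'q)"
  assumes "artinian_ring k"
    and "minimal_injective_cogenerator k Q"
    and "exact_category k C E"
    and "hom_finite k C"
    and "krull_schmidt C"
    and "\<And>Y. Y \<in> Obj_r k Q C E \<Longrightarrow> represents_r k Q C E Y (t Y) (\<phi> Y)"
    and "\<And>X. X \<in> Obj_l k Q C E \<Longrightarrow> represents_l k Q C E X (s X) (\<psi> X)"
  shows "natural_iso (stable_r k Q C E) (stable_r k Q C E)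
           (comp_functor (tau_minus C E s \<psi>) (tau C E t \<phi>)) id_functor (epsilon C E t \<phi> s \<psi>)
       \<and> natural_iso (stable_l k Q C E) (stable_l k Q C E)
           id_functor (comp_functor (tau C E t \<phi>) (tau_minus C E s \<psi>)) (eta C E t \<phi> s \<psi>)
       \<and> mutually_quasi_inverse (stable_r k Q C E) (stable_l k Q C E)
           (tau C E t \<phi>) (tau_minus C E s \<psi>)"
proof -
  interpret ar_translations k Q C E t s \<phi> \<psi>
    by (intro ar_translations.intro ar_translations_axioms.intro ar_setting.intro ar_setting_axioms.intro
        exact_cat.intro matlis.intro assms)
  show ?thesis
    using epsilon_natural_iso eta_natural_iso functor_tau functor_tau_minus
    unfolding mutually_quasi_inverse_def by blast
qed

end
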